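(* Let $\mathcal U\subset\mathbb C^n$ be a minimal bounded homogeneous domain on which the Forelli–Rudin estimates (FR) stated in the context hold. Let $m\ge1$ be an integer, $\alpha>\alpha_{\min}$, and $1<p_i,q_i<\infty$ for $i=1,\dots,m$, with $\sum_{i=1}^m\frac1{q_i}=1$. Then there is a fixed number $\alpha_0=\alpha_0(p_1,\dots,p_m,q_1,\dots,q_m,\alpha,m)$ such that for every $r>0$, every Bergman sampling sequence $\{z_k\}_{k\ge1}$ in $\mathcal U$ with parameter $r$, and every positive Borel measure $\mu$ on $\mathcal U$, the following are equivalent: (i) there is a constant $C>0$ such that for all $f_1,\dots,f_m\in H(\mathcal U)$ \[\int_{\mathcal U}\prod_{i=1}^{m}|f_i(z)|^{p_i}\,d\mu(z)\le C\prod_{i=1}^{m}\left[\sum_{k=1}^{\infty}\left(\int_{B(z_k,2r)}|f_i(z)|^{p_i}\,dV_\alpha(z)\right)^{q_i}\right]^{1/q_i};\] (ii) there is a constant $C>0$ such that \[\mu(B(z_k,r))\le C\,\bigl(\mathrm{Vol}(B(z_k,r))\bigr)^{\alpha_0}\qquad\text{for every } k=1,2,\dots\]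
   Context: A bounded domain $\mathcal U\subset\mathbb C^n$ is minimal with center $t\in\mathcal U$ if every biholomorphism $\psi:\mathcal U\to\mathcal U'$ onto a domain $\mathcal U'$ with $\det J(\psi,t)=1$ satisfies $\mathrm{Vol}(\mathcal U')\ge\mathrm{Vol}(\mathcal U)$, where $J(\psi,t)$ is the complex Jacobi matrix of $\psi$ at $t$. It is homogeneous if its group of biholomorphic automorphisms acts transitively. $\mathrm{Vol}$ and $dV$ denote Lebesgue measure, $H(\mathcal U)$ the space of analytic functions on $\mathcal U$, and $K_{\mathcal U}(z,\omega)$ the (unweighted) Bergman kernel of $\mathcal U$. For $\beta\in\mathbb R$, $dV_\beta(z)=K_{\mathcal U}(z,z)^{-\beta}dV(z)$. The number $\alpha_{\min}$ is the threshold such that the weighted Bergman spaces $L^p(\mathcal U,dV_\alpha)\cap H(\mathcal U)$ are non-trivial if and only if $\alpha>\alpha_{\min}$. $d_{\mathcal U}$ is the Bergman distance on $\mathcal U$, and $B(z,r)=\{\omega\in\mathcal U: d_{\mathcal U}(z,\omega)\le r\}$. A (Bergman) sampling sequence with parameter $\rho>0$ is a sequence $\{z_k\}_{k\ge 1}\subset\mathcal U$ such that $\mathcal U=\bigcup_{k}B(z_k,\rho)$, $B(z_i,\rho/4)\cap B(z_j,\rho/4)=\emptyset$ for $i\ne j$, and there is a positive integer $N$ such that each $z\in\mathcal U$ belongs to at most $N$ of the sets $B(z_k,2\rho)$. (FR): for every $\beta>\alpha_{\min}$ there is $\alpha_*(\beta)$ such that for every $\alpha'>\alpha_*(\beta)$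 there is a constant $c(\alpha',\beta)$ with $\int_{\mathcal U}|K_{\mathcal U}(z,w)|^{1+\alpha'}dV_\beta(w)\le c(\alpha',\beta)K_{\mathcal U}(z,z)^{\alpha'-\beta}$ for all $z\in\mathcal U$. Constants $C$ do not depend on $f_1,\dots,f_m$ or $k$. The right-hand side of the inequality in (i) may be $+\infty$, with the convention $0\cdot\infty=0$. *)

theory Defs
  imports "HOL-Analysis.Analysis"
begin

section \<open>Holomorphy in several complex variables\<close>

text \<open>On an open set, having a complex-linear Frechet derivative at every point is the same as
  being analytic.\<close>

definition holo_on :: "(complex^'n) set \<Rightarrow> (complex^'n \<Rightarrow> complex) \<Rightarrow> bool" where
  "holo_on U f \<longleftrightarrow>
     (\<forall>z\<in>U. \<exists>f'. (f has_derivative f') (at z) \<and> (\<forall>c v. f' (c *s v) = c * f' v))"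

definition holo_map_on :: "(complex^'n) set \<Rightarrow> (complex^'n \<Rightarrow> complex^'m) \<Rightarrow> bool" where
  "holo_map_on U \<psi> \<longleftrightarrow> (\<forall>i. holo_on U (\<lambda>z. \<psi> z $ i))"

definition complex_jacobi :: "(complex^'n \<Rightarrow> complex^'n) \<Rightarrow> complex^'n \<Rightarrow> complex^'n^'n" where
  "complex_jacobi \<psi> z = (\<chi> i j. frechet_derivative \<psi> (at z) (axis j 1) $ i)"

definition cdomain :: "(complex^'n) set \<Rightarrow> bool" where
  "cdomain U \<longleftrightarrow> open U \<and> connected U \<and> U \<noteq> {}"

definition biholomorphism ::
    "(complex^'n \<Rightarrow> complex^'n) \<Rightarrow> (complex^'n) set \<Rightarrow> (complex^'n) set \<Rightarrow> bool" where
  "biholomorphism \<psi> U V \<longleftrightarrow>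
     bij_betw \<psi> U V \<and> holo_map_on U \<psi> \<and> holo_map_on V (inv_into U \<psi>)"


section \<open>Minimal and homogeneous domains\<close>

text \<open>The image domain need not be bounded, so its volume is taken in the extended reals.\<close>

definition minimal_domain_center :: "(complex^'n) set \<Rightarrow> complex^'n \<Rightarrow> bool" where
  "minimal_domain_center U t \<longleftrightarrow>
     cdomain U \<and> bounded U \<and> t \<in> U \<and>
     (\<forall>\<psi> V. cdomain V \<and> biholomorphism \<psi> U V \<and> det (complex_jacobi \<psi> t) = 1 \<longrightarrow>
        emeasure lborel U \<le> emeasure lborel V)"

definition homogeneous_domain :: "(complex^'n) set \<Rightarrow> bool" where
  "homogeneous_domain U \<longleftrightarrow> (\<forall>z\<in>U. \<forall>w\<in>U. \<exists>\<phi>. biholomorphism \<phi> U U \<and> \<phi> z = w)"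


section \<open>The Bergman kernel and weighted Bergman spaces\<close>

definition bergman_L2 :: "(complex^'n) set \<Rightarrow> (complex^'n \<Rightarrow> complex) set" where
  "bergman_L2 U = {f. holo_on U f \<and> set_integrable lborel U (\<lambda>z. (norm (f z))\<^sup>2)}"

text \<open>The reproducing kernel of \<^const>\<open>bergman_L2\<close>, holomorphic in its first argument.
  Setting it to zero off \<open>U \<times> U\<close> makes it unique as a total function.\<close>

definition bergman_kernel :: "(complex^'n) set \<Rightarrow> complex^'n \<Rightarrow> complex^'n \<Rightarrow> complex" where
  "bergman_kernel U =
     (THE K. (\<forall>w\<in>U. (\<lambda>z. K z w) \<in> bergman_L2 U) \<and>
             (\<forall>f\<in>bergman_L2 U. \<forall>z\<in>U. f z = (LINT w:U|lborel. f w * cnj (K w z))) \<and>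
             (\<forall>z w. z \<notin> U \<or> w \<notin> U \<longrightarrow> K z w = 0))"

text \<open>The kernel is real on the diagonal.\<close>

definition bergman_diag :: "(complex^'n) set \<Rightarrow> complex^'n \<Rightarrow> real" where
  "bergman_diag U z = Re (bergman_kernel U z z)"

definition weighted_vol :: "(complex^'n) set \<Rightarrow> real \<Rightarrow> (complex^'n) measure" where
  "weighted_vol U \<beta> =
     density (restrict_space lborel U) (\<lambda>z. ennreal (bergman_diag U z powr (- \<beta>)))"

definition weighted_bergman ::
    "(complex^'n) set \<Rightarrow> real \<Rightarrow> real \<Rightarrow> (complex^'n \<Rightarrow> complex) set" where
  "weighted_bergman U p \<alpha> =
     {f. holo_on U f \<and> (\<integral>\<^sup>+ z. ennreal (norm (f z) powr p) \<partial>weighted_vol U \<alpha>) < \<infinity>}"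

text \<open>The threshold is the same for all exponents \<open>0 < p < \<infinity>\<close>.\<close>

definition alpha_min :: "(complex^'n) set \<Rightarrow> real" where
  "alpha_min U =
     (THE a. \<forall>p>0. \<forall>\<alpha>. (\<exists>f\<in>weighted_bergman U p \<alpha>. \<exists>z\<in>U. f z \<noteq> 0) \<longleftrightarrow> \<alpha> > a)"

definition forelli_rudin :: "(complex^'n) set \<Rightarrow> bool" where
  "forelli_rudin U \<longleftrightarrow>
     (\<forall>\<beta>>alpha_min U. \<exists>a::real. \<forall>\<alpha>'>a. \<exists>c::real. \<forall>z\<in>U.
        (\<integral>\<^sup>+ w. ennreal (norm (bergman_kernel U z w) powr (1 + \<alpha>')) \<partial>weighted_vol U \<beta>)
          \<le> ennreal (c * bergman_diag U z powr (\<alpha>' - \<beta>)))"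


section \<open>The Bergman distance\<close>

text \<open>The Wirtinger derivatives \<open>\<partial>/\<partial>z\<^sub>j\<close> and \<open>\<partial>/\<partial>cnj z\<^sub>j\<close>.\<close>

definition dz :: "'n \<Rightarrow> (complex^'n \<Rightarrow> complex) \<Rightarrow> complex^'n \<Rightarrow> complex" where
  "dz j f z =
     (vector_derivative (\<lambda>t::real. f (z + t *\<^sub>R axis j 1)) (at 0)
       - \<i> * vector_derivative (\<lambda>t::real. f (z + t *\<^sub>R axis j \<i>)) (at 0)) / 2"

definition dzbar :: "'n \<Rightarrow> (complex^'n \<Rightarrow> complex) \<Rightarrow> complex^'n \<Rightarrow> complex" where
  "dzbar j f z =
     (vector_derivative (\<lambda>t::real. f (z + t *\<^sub>R axis j 1)) (at 0)
       + \<i> * vector_derivative (\<lambda>t::real. f (z + t *\<^sub>R axis j \<i>)) (at 0)) / 2"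

definition bergman_metric ::
    "(complex^'n) set \<Rightarrow> complex^'n \<Rightarrow> complex^'n \<Rightarrow> real" where
  "bergman_metric U z v =
     Re (\<Sum>j\<in>UNIV. \<Sum>k\<in>UNIV.
           dz j (dzbar k (\<lambda>x. complex_of_real (ln (bergman_diag U x)))) z * v $ j * cnj (v $ k))"

text \<open>The derivative of a \<^const>\<open>valid_path\<close> may be unbounded near a break point, and such a
  path may have infinite length.  Hence lengths are extended reals: the
  Henstock-Kurzweil \<^const>\<open>integral\<close> would assign such a path the length zero.\<close>

definition bergman_length :: "(complex^'n) set \<Rightarrow> (real \<Rightarrow> complex^'n) \<Rightarrow> ennreal" where
  "bergman_length U \<gamma> =
     (\<integral>\<^sup>+ t\<in>{0..1}.
        ennreal (sqrt (bergman_metric U (\<gamma> t) (vector_derivative \<gamma> (at t)))) \<partial>lborel)"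

definition bergman_dist :: "(complex^'n) set \<Rightarrow> complex^'n \<Rightarrow> complex^'n \<Rightarrow> real" where
  "bergman_dist U z w =
     enn2real (INF \<gamma>\<in>{\<gamma>. valid_path \<gamma> \<and> path_image \<gamma> \<subseteq> U \<and> pathstart \<gamma> = z \<and> pathfinish \<gamma> = w}.
       bergman_length U \<gamma>)"

definition bergman_ball :: "(complex^'n) set \<Rightarrow> complex^'n \<Rightarrow> real \<Rightarrow> (complex^'n) set" where
  "bergman_ball U z r = {w\<in>U. bergman_dist U z w \<le> r}"

definition bergman_sampling ::
    "(complex^'n) set \<Rightarrow> real \<Rightarrow> (nat \<Rightarrow> complex^'n) \<Rightarrow> bool" where
  "bergman_sampling U \<rho> z \<longleftrightarrow>
     \<rho> > 0 \<and> range z \<subseteq> U \<and>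
     U = (\<Union>k. bergman_ball U (z k) \<rho>) \<and>
     (\<forall>i j. i \<noteq> j \<longrightarrow> bergman_ball U (z i) (\<rho>/4) \<inter> bergman_ball U (z j) (\<rho>/4) = {}) \<and>
     (\<exists>N::nat. N > 0 \<and> (\<forall>x\<in>U. finite {k. x \<in> bergman_ball U (z k) (2*\<rho>)} \<and>
                                card {k. x \<in> bergman_ball U (z k) (2*\<rho>)} \<le> N))"


section \<open>Real powers of extended nonnegative reals\<close>

text \<open>Only meant for positive exponents.\<close>

definition ennpowr :: "ennreal \<Rightarrow> real \<Rightarrow> ennreal" where
  "ennpowr x a = (if x = \<infinity> then \<infinity> else ennreal (enn2real x powr a))"

end

theory Submission
  imports Defs "HOL-Complex_Analysis.Cauchy_Integral_Formula" "HOL-Library.Numeral_Type"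
begin

text \<open>
  Write \<open>Jac \<psi>\<close> for the Jacobian determinant of an automorphism \<open>\<psi>\<close>. By homogeneity every point of the
  sampling sequence is \<open>\<psi> z0\<close> for a fixed base point \<open>z0\<close>, and since \<open>\<psi>\<close> is a Bergman isometry all
  estimates pull back to a fixed relatively compact Bergman ball around \<open>z0\<close>. The Forelli-Rudin
  estimate pulled back by \<open>\<psi>\<close> yields a Harnack inequality: \<open>|Jac \<psi>|\<close> is comparable to
  \<open>|Jac \<psi> z0|\<close> on compact sets, uniformly in \<open>\<psi>\<close>. Hence the ball around \<open>\<psi> z0\<close> has volume comparable to
  \<open>|Jac \<psi> z0|^2\<close>, and so is \<open>1 / K(w, w)\<close> for \<open>w\<close> in that ball. This leads to the exponent \<open>m (1 + \<alpha>)\<close>.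

  For (ii) implies (i), bound each \<open>|f i| powr p i\<close> on a ball by its weighted mean over the doubled ball,
  sum over the covering, and apply Hoelder's inequality for series. For (i) implies (ii), test with
  powers of the kernel \<open>K(-, \<psi> y)\<close>, whose norms are controlled by the Forelli-Rudin estimate, where
  \<open>y\<close> runs over a finite set such that every point \<open>x\<close> of the fixed ball has some \<open>y\<close> with \<open>K(x, y)\<close>
  bounded away from 0.
\<close>

section \<open>Holomorphic functions of several variables\<close>

text \<open>The kernel is a definite description and the distance an infimum of path lengths, so
  both must be built before use: the kernel from the element of least norm with value 1 at a point,
  the distance by comparing the metric with the Euclidean one. Bergman balls must be relatively
  compact for uniform constants to exist; homogeneity supplies one radius that works at every point,
  and finitely many enlargements reach any radius. The obstacle for the Jacobians is that
  \<open>K\<close> has a lower bound only near the diagonal. In the pulled-back Forelli-Rudin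
  integral the quotient \<open>Jac \<psi> x0 / Jac \<psi> x\<close> carries the exponent
  \<open>\<alpha>' - 1 - 2 * \<alpha>\<close>; a large \<alpha>' makes it exceed 1, so the sub-mean
  value property applies near \<open>x0\<close>, and chaining through the connected domain covers
  compact sets. The exponent comes from counting: the weighted volume of the ball at
  \<open>\<psi> z0\<close> behaves like \<open>norm (Jac \<psi> z0)\<close> to the power
  \<open>2 + 2 * \<alpha>\<close>, each of the \<open>m\<close> factors contributes one such volume,
  and Lebesgue volume behaves like the square.\<close>

lemma norm_vector_scalar_mult: "norm (c *s (v::complex^'n)) = norm c * norm v"
  by (simp add: norm_vec_def norm_mult L2_set_right_distrib)

lemma bounded_linear_vector_scalar_mult_left: "bounded_linear (\<lambda>c. c *s (v::complex^'n))"
  by (rule bounded_linear_intro[where K = "norm v"])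
     (auto simp: vec_eq_iff algebra_simps norm_vector_scalar_mult)

lemma bounded_linear_vector_scalar_mult_right: "bounded_linear (\<lambda>v. c *s (v::complex^'n))"
  by (rule bounded_linear_intro[where K = "norm c"])
     (auto simp: vec_eq_iff algebra_simps norm_vector_scalar_mult)

lemma scaleR_eq_vector_scalar_mult: "r *\<^sub>R (v::complex^'n) = complex_of_real r *s v"
  by (simp add: vec_eq_iff, simp add: scaleR_conv_of_real)

text \<open>A total function of \<open>v\<close> and \<open>z\<close>, so that directional
  derivatives can be iterated like ordinary functions. It is complex linear in \<open>v\<close>
  wherever \<open>f\<close> is holomorphic.\<close>

definition dird :: "(complex^'n \<Rightarrow> complex) \<Rightarrow> complex^'n \<Rightarrow> complex^'n \<Rightarrow> complex" where
  "dird f v z = frechet_derivative f (at z) v"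

lemma dird_eqI: "(f has_derivative f') (at z) \<Longrightarrow> dird f v z = f' v"
  by (simp add: dird_def frechet_derivative_at[symmetric])

lemma holo_on_dird:
  assumes "holo_on U f" "z \<in> U"
  shows "(f has_derivative (\<lambda>v. dird f v z)) (at z)" "dird f (c *s v) z = c * dird f v z"
proof -
  obtain f' where f': "(f has_derivative f') (at z)" "\<And>c v. f' (c *s v) = c * f' v"
    using assms by (auto simp: holo_on_def)
  have "dird f = (\<lambda>v. dird f v)" by simp
  have "\<And>v. dird f v z = f' v" using dird_eqI[OF f'(1)] by simp
  then show "(f has_derivative (\<lambda>v. dird f v z)) (at z)" "dird f (c *s v) z = c * dird f v z"
    using f' by simp_all
qed

lemma dird_add:
  assumes "holo_on U f" "z \<in> U"
  shows "dird f (v + w) z = dird f v z + dird f w z"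
  using linear_add[OF has_derivative_linear[OF holo_on_dird(1)[OF assms]]] .

lemma dird_sum:
  assumes "holo_on U f" "z \<in> U"
  shows "dird f (\<Sum>i\<in>I. v i) z = (\<Sum>i\<in>I. dird f (v i) z)"
  using linear_sum[OF has_derivative_linear[OF holo_on_dird(1)[OF assms]]] .

lemma holo_onI:
  assumes "\<And>z. z \<in> U \<Longrightarrow> \<exists>f'. (f has_derivative f') (at z) \<and> (\<forall>c v. f' (c *s v) = c * f' v)"
  shows "holo_on U f"
  using assms by (auto simp: holo_on_def)

lemma holo_on_subset: "holo_on U f \<Longrightarrow> V \<subseteq> U \<Longrightarrow> holo_on V f"
  by (auto simp: holo_on_def)

lemma holo_on_continuous: "holo_on U f \<Longrightarrow> continuous_on U f"
  by (meson continuous_at_imp_continuous_on has_derivative_continuous holo_on_dird(1))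

lemma holo_on_const [simp]: "holo_on U (\<lambda>z. c)"
  by (auto intro!: holo_onI exI[of _ "\<lambda>_. 0"])

lemma holo_on_nth: "holo_on U (\<lambda>z. z $ i)"
  by (auto intro!: holo_onI exI[of _ "\<lambda>v. v $ i"] bounded_linear_imp_has_derivative bounded_linear_vec_nth)

lemma holo_on_add: assumes "holo_on U f" "holo_on U g" shows "holo_on U (\<lambda>z. f z + g z)"
proof (rule holo_onI)
  fix z assume "z \<in> U"
  note f = holo_on_dird[OF assms(1) this] note g = holo_on_dird[OF assms(2) \<open>z \<in> U\<close>]
  show "\<exists>f'. ((\<lambda>z. f z + g z) has_derivative f') (at z) \<and> (\<forall>c v. f' (c *s v) = c * f' v)"
    by (rule exI, rule conjI, rule has_derivative_add[OF f(1) g(1)]) (simp add: f(2) g(2) algebra_simps)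
qed

lemma holo_on_mult: assumes "holo_on U f" "holo_on U g" shows "holo_on U (\<lambda>z. f z * g z)"
proof (rule holo_onI)
  fix z assume "z \<in> U"
  note f = holo_on_dird[OF assms(1) this] note g = holo_on_dird[OF assms(2) \<open>z \<in> U\<close>]
  show "\<exists>f'. ((\<lambda>z. f z * g z) has_derivative f') (at z) \<and> (\<forall>c v. f' (c *s v) = c * f' v)"
    by (rule exI, rule conjI, rule has_derivative_mult[OF f(1) g(1)]) (simp add: f(2) g(2) algebra_simps)
qed

lemma holo_on_cmult: "holo_on U f \<Longrightarrow> holo_on U (\<lambda>z. c * f z)"
  using holo_on_mult[OF holo_on_const] by blast

lemma holo_on_diff: "holo_on U f \<Longrightarrow> holo_on U g \<Longrightarrow> holo_on U (\<lambda>z. f z - g z)"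
  using holo_on_add[of U f "\<lambda>z. (-1) * g z"] holo_on_cmult[of U g "-1"] by simp

lemma holo_on_power: "holo_on U f \<Longrightarrow> holo_on U (\<lambda>z. f z ^ k)"
  by (induction k) (auto intro: holo_on_mult)

lemma holo_on_sum: "(\<And>i. i \<in> I \<Longrightarrow> holo_on U (f i)) \<Longrightarrow> holo_on U (\<lambda>z. \<Sum>i\<in>I. f i z)"
  by (induction I rule: infinite_finite_induct) (auto intro!: holo_on_add)

lemma holo_on_prod: "(\<And>i. i \<in> I \<Longrightarrow> holo_on U (f i)) \<Longrightarrow> holo_on U (\<lambda>z. \<Prod>i\<in>I. f i z)"
  by (induction I rule: infinite_finite_induct) (auto intro!: holo_on_mult)

lemma holo_on_compose_field:
  assumes "holo_on U f" "\<And>z. z \<in> U \<Longrightarrow> (g has_field_derivative g' (f z)) (at (f z))"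
  shows "holo_on U (\<lambda>z. g (f z))"
proof (rule holo_onI)
  fix z assume z: "z \<in> U"
  note f = holo_on_dird[OF assms(1) z]
  have "((\<lambda>z. g (f z)) has_derivative (\<lambda>v. g' (f z) * dird f v z)) (at z)"
    using has_derivative_compose[OF f(1) assms(2)[OF z, unfolded has_field_derivative_def]] by simp
  then show "\<exists>f'. ((\<lambda>z. g (f z)) has_derivative f') (at z) \<and> (\<forall>c v. f' (c *s v) = c * f' v)"
    using f(2) by (intro exI conjI) auto
qed

lemma holo_on_divide:
  assumes "holo_on U f" "holo_on U g" "\<And>z. z \<in> U \<Longrightarrow> g z \<noteq> 0"
  shows "holo_on U (\<lambda>z. f z / g z)"
proof -
  have "holo_on U (\<lambda>z. inverse (g z))"
    by (rule holo_on_compose_field[OF assms(2), where g' = "\<lambda>w. - inverse (w^2)"])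
       (auto intro!: derivative_eq_intros simp: assms(3) power2_eq_square)
  from holo_on_mult[OF assms(1) this] show ?thesis by (simp add: field_simps)
qed

text \<open>The derivative as a map on vectors suits the chain rule for Frechet derivatives;
  \<open>complex_jacobi_mult_vec\<close> identifies it with multiplication by the Jacobi
  matrix.\<close>

definition holo_derivative :: "(complex^'n \<Rightarrow> complex^'m) \<Rightarrow> complex^'n \<Rightarrow> complex^'n \<Rightarrow> complex^'m" where
  "holo_derivative \<psi> z v = (\<chi> i. dird (\<lambda>x. \<psi> x $ i) v z)"

lemma bounded_linear_axis: "bounded_linear (\<lambda>c. axis i c :: complex^'m)"
proof (rule bounded_linear_intro[where K=1])
  have *: "axis i c = c *s (axis i 1 :: complex^'m)" for c
    by (simp add: vec_eq_iff axis_def)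
  have "norm (axis i (1::complex)) = 1"
    by (simp add: norm_vec_def axis_def L2_set_def if_distrib[of norm] if_distrib[of "\<lambda>x. x^2"] cong: if_cong)
  then show "norm (axis i c :: complex^'m) \<le> norm c * 1" for c
    unfolding *[of c] norm_vector_scalar_mult by simp
qed (auto simp: vec_eq_iff axis_def)

lemma has_derivative_vec:
  fixes f :: "'a::real_normed_vector \<Rightarrow> complex^'m"
  assumes "\<And>i. ((\<lambda>x. f x $ i) has_derivative (\<lambda>v. f' v $ i)) (at z)"
  shows "(f has_derivative f') (at z)"
proof -
  have *: "f x = (\<Sum>i\<in>UNIV. axis i (f x $ i))" for x
    by (simp add: vec_eq_iff axis_def if_distrib cong: if_cong)
  have **: "f' x = (\<Sum>i\<in>UNIV. axis i (f' x $ i))" for x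
    by (simp add: vec_eq_iff axis_def if_distrib cong: if_cong)
  have ax: "bounded_linear (\<lambda>c. axis i c :: complex^'m)" for i
    by (rule bounded_linear_axis)
  have "((\<lambda>x. \<Sum>i\<in>UNIV. axis i (f x $ i)) has_derivative (\<lambda>v. \<Sum>i\<in>UNIV. axis i (f' v $ i))) (at z)"
    by (intro has_derivative_sum bounded_linear.has_derivative[OF ax] assms)
  then show ?thesis using * ** by simp
qed

lemma holo_map_on_has_derivative:
  assumes "holo_map_on U \<psi>" "z \<in> U"
  shows "(\<psi> has_derivative holo_derivative \<psi> z) (at z)"
    "holo_derivative \<psi> z (c *s v) = c *s holo_derivative \<psi> z v"
proof -
  have h: "holo_on U (\<lambda>z. \<psi> z $ i)" for i using assms by (auto simp: holo_map_on_def)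
  show "(\<psi> has_derivative holo_derivative \<psi> z) (at z)"
    by (rule has_derivative_vec) (simp add: holo_derivative_def holo_on_dird[OF h assms(2)])
  show "holo_derivative \<psi> z (c *s v) = c *s holo_derivative \<psi> z v"
    by (simp add: holo_derivative_def vec_eq_iff holo_on_dird[OF h assms(2)])
qed

lemma holo_map_on_continuous: "holo_map_on U \<psi> \<Longrightarrow> continuous_on U \<psi>"
  by (meson continuous_at_imp_continuous_on has_derivative_continuous holo_map_on_has_derivative(1))

lemma holo_on_compose:
  assumes "holo_map_on U \<psi>" "holo_on V f" "\<psi> ` U \<subseteq> V"
  shows "holo_on U (\<lambda>z. f (\<psi> z))"
proof (rule holo_onI)
  fix z assume z: "z \<in> U"
  then have V: "\<psi> z \<in> V" using assms by auto
  note f = holo_on_dird[OF assms(2) V] note p = holo_map_on_has_derivative[OF assms(1) z]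
  show "\<exists>f'. ((\<lambda>z. f (\<psi> z)) has_derivative f') (at z) \<and> (\<forall>c v. f' (c *s v) = c * f' v)"
    by (rule exI, rule conjI, rule has_derivative_compose[OF p(1) f(1)]) (simp add: p(2) f(2))
qed

lemma holo_map_on_compose:
  assumes "holo_map_on U \<psi>" "holo_map_on V \<phi>" "\<psi> ` U \<subseteq> V"
  shows "holo_map_on U (\<lambda>z. \<phi> (\<psi> z))"
  using holo_on_compose[OF assms(1) _ assms(3)] assms(2) by (auto simp: holo_map_on_def)

lemma holo_map_on_affine: "holo_map_on U (\<lambda>z. a + c *s (z::complex^'n))"
  by (auto simp: holo_map_on_def intro!: holo_on_add holo_on_cmult holo_on_nth)

lemma holo_on_line:
  assumes "holo_on U f" "z + c *s v \<in> U"
  shows "((\<lambda>c. f (z + c *s v)) has_field_derivative dird f v (z + c *s v)) (at c)"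
proof -
  have "((\<lambda>c. z + c *s v) has_derivative (\<lambda>c. c *s v)) (at c)"
    by (auto intro!: derivative_eq_intros bounded_linear_imp_has_derivative
        bounded_linear_vector_scalar_mult_left)
  from has_derivative_compose[OF this holo_on_dird(1)[OF assms]]
  have "((\<lambda>c. f (z + c *s v)) has_derivative (\<lambda>c'. dird f (c' *s v) (z + c *s v))) (at c)" .
  then show ?thesis
    by (simp add: has_field_derivative_def holo_on_dird(2)[OF assms] mult_commute_abs)
qed

text \<open>All estimates in several variables are reduced to one variable by restricting to complex lines.\<close>

lemma cauchy_taylor_1d:
  assumes g: "g holomorphic_on ball 0 R" and M: "\<And>c. c \<in> ball 0 R \<Longrightarrow> norm (g c) \<le> M" and c: "norm c \<le> R/2" "R > 0"
  shows "norm (g c - g 0) \<le> 3 * M / R * norm c"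
    "norm (g c - g 0 - deriv g 0 * c) \<le> 18 * M / R^2 * norm c ^ 2"
    "norm (deriv g 0) \<le> 3 * M / R"
proof -
  have op: "open (ball (0::complex) R)" by simp
  \<comment> \<open>Cauchy's inequality on discs of radius \<open>R/3\<close>: those centred in
    \<open>cball 0 (R/2)\<close> stay inside \<open>ball 0 R\<close>. Orders 1 and 2 give the
    constants 3 and 18, the latter as 2! times 9.\<close>
  have dn: "norm ((deriv ^^ k) g x) \<le> fact k * M / (R/3)^k" if "norm x \<le> R/2" for x k
  proof (rule Cauchy_inequality)
    have sub: "cball x (R/3) \<subseteq> ball 0 R"
    proof
      fix y assume "y \<in> cball x (R/3)"
      then have "norm (y - x) \<le> R/3" by (simp add: dist_norm norm_minus_commute)
      moreover have "norm y \<le> norm (y - x) + norm x" by norm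
      ultimately show "y \<in> ball 0 R" using that c by simp
    qed
    show "g holomorphic_on ball x (R/3)"
      using g by (rule holomorphic_on_subset) (use sub ball_subset_cball in blast)
    show "continuous_on (cball x (R/3)) g"
      using holomorphic_on_imp_continuous_on[OF g] sub continuous_on_subset by blast
    show "norm (g y) \<le> M" if "norm (x - y) = R/3" for y
      using that sub by (intro M) (auto simp: dist_norm subset_iff)
  qed (use c in auto)
  let ?S = "cball (0::complex) (R/2)"
  have sub: "?S \<subseteq> ball 0 R" using c by auto
  have hd: "((deriv ^^ i) g has_field_derivative (deriv ^^ Suc i) g x) (at x within ?S)" if "x \<in> ?S" for i x
  proof -
    have "(deriv ^^ i) g holomorphic_on ball 0 R" by (rule holomorphic_higher_deriv[OF g op])
    then have "((deriv ^^ i) g has_field_derivative deriv ((deriv ^^ i) g) x) (at x)"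
      using holomorphic_derivI[OF _ op] sub that by blast
    then show ?thesis by (auto intro: has_field_derivative_at_within)
  qed
  have 0: "0 \<in> ?S" and cS: "c \<in> ?S" using c by auto
  have "norm ((deriv ^^ 0) g c - (\<Sum>i\<le>0. (deriv ^^ i) g 0 * (c - 0) ^ i / fact i)) \<le> (3*M/R) * norm (c - 0) ^ Suc 0 / fact 0"
  proof (rule complex_Taylor[where S = ?S])
    show "norm ((deriv ^^ Suc 0) g x) \<le> 3*M/R" if "x \<in> ?S" for x
      using dn[of x 1] that by (simp add: field_simps)
  qed (rule convex_cball | rule hd, assumption | rule cS | rule 0)+
  then show "norm (g c - g 0) \<le> 3 * M / R * norm c" by simp
  have "norm ((deriv ^^ 0) g c - (\<Sum>i\<le>1. (deriv ^^ i) g 0 * (c - 0) ^ i / fact i)) \<le> (18*M/R^2) * norm (c - 0) ^ Suc 1 / fact 1"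
  proof (rule complex_Taylor[where S = ?S])
    show "norm ((deriv ^^ Suc 1) g x) \<le> 18*M/R^2" if "x \<in> ?S" for x
      using dn[of x 2] that by (simp add: field_simps eval_nat_numeral)
  qed (rule convex_cball | rule hd, assumption | rule cS | rule 0)+
  then show "norm (g c - g 0 - deriv g 0 * c) \<le> 18 * M / R^2 * norm c ^ 2"
    by (simp add: algebra_simps power2_eq_square)
  show "norm (deriv g 0) \<le> 3 * M / R" using dn[of 0 1] c by (simp add: field_simps)
qed

text \<open>The function sending \<open>c\<close> to \<open>f (a + c *s h)\<close> is holomorphic on
  the disc of radius \<open>R / norm h\<close>, and its values at 0 and 1 are the two values
  compared. The constants depend only on \<open>M\<close> and \<open>R\<close>, which is what
  passing to limits requires.\<close>

lemma holo_estimates: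
  assumes f: "holo_on (ball a R) f" and M: "\<And>x. x \<in> ball a R \<Longrightarrow> norm (f x) \<le> M" and R: "R > 0"
  shows "norm h \<le> R/2 \<Longrightarrow> norm (f (a + h) - f a) \<le> 3 * M / R * norm h"
    "norm h \<le> R/2 \<Longrightarrow> norm (f (a + h) - f a - dird f h a) \<le> 18 * M / R^2 * norm h ^ 2"
    "norm (dird f h a) \<le> 3 * M / R * norm h"
proof -
  have a: "a \<in> ball a R" using R by simp
  have M0: "M \<ge> 0" using M[OF a] norm_ge_zero order_trans by blast
  have "(norm h \<le> R/2 \<longrightarrow> norm (f (a + h) - f a) \<le> 3 * M / R * norm h \<and>
    norm (f (a + h) - f a - dird f h a) \<le> 18 * M / R^2 * norm h ^ 2) \<and>
    norm (dird f h a) \<le> 3 * M / R * norm h"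
  proof (cases "h = 0")
    case True
    have "dird f 0 a = 0" using holo_on_dird(2)[OF f a, of 0 0] by (simp add: vector_scalar_mult_def zero_vec_def)
    then show ?thesis using True by simp
  next
    case False
    then have hp: "norm h > 0" by simp
    define g where "g = (\<lambda>c. f (a + c *s h))"
    define S where "S = R / norm h"
    have S: "S > 0" using hp R by (simp add: S_def)
    have inb: "a + c *s h \<in> ball a R \<longleftrightarrow> norm c < S" for c
      using hp by (simp add: dist_norm norm_vector_scalar_mult S_def field_simps)
    have fd: "(g has_field_derivative dird f h (a + c *s h)) (at c)" if "norm c < S" for c
      unfolding g_def by (rule holo_on_line[OF f]) (use that inb in auto)
    have "g holomorphic_on ball 0 S"
      by (rule holomorphic_onI) (use fd in \<open>auto simp: field_differentiable_def intro: has_field_derivative_at_within\<close>)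
    moreover have "norm (g c) \<le> M" if "c \<in> ball 0 S" for c
      unfolding g_def by (rule M) (use that inb in auto)
    ultimately have est: "norm (c::complex) \<le> S/2 \<Longrightarrow> norm (g c - g 0) \<le> 3 * M / S * norm c"
        "norm c \<le> S/2 \<Longrightarrow> norm (g c - g 0 - deriv g 0 * c) \<le> 18 * M / S^2 * norm c ^ 2"
        "norm (0::complex) \<le> S/2 \<Longrightarrow> norm (deriv g 0) \<le> 3 * M / S" for c
      using cauchy_taylor_1d[of g S M c] cauchy_taylor_1d(3)[of g S M 0] S by blast+
    have g0: "g 0 = f a" "g 1 = f (a + h)" by (simp_all add: g_def)
    have "deriv g 0 = dird f h (a + 0 *s h)" by (rule DERIV_imp_deriv[OF fd]) (use S in auto)
    moreover have "a + 0 *s h = a" by (simp add: vec_eq_iff)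
    ultimately have d0: "deriv g 0 = dird f h a" by simp
    have q: "norm h \<le> R/2 \<Longrightarrow> norm (1::complex) \<le> S/2" using hp by (simp add: S_def field_simps)
    have e: "3 * M / S = 3 * M / R * norm h" "18 * M / S^2 = 18 * M / R^2 * norm h ^ 2"
      using hp R by (simp_all add: S_def field_simps)
    show ?thesis
      using est(1,2)[of 1] est(3) q g0 d0 e S by auto
  qed
  then show "norm h \<le> R/2 \<Longrightarrow> norm (f (a + h) - f a) \<le> 3 * M / R * norm h"
    "norm h \<le> R/2 \<Longrightarrow> norm (f (a + h) - f a - dird f h a) \<le> 18 * M / R^2 * norm h ^ 2"
    "norm (dird f h a) \<le> 3 * M / R * norm h" by auto
qed

section \<open>Locally uniform limits and derivatives of holomorphic functions\<close>

lemma has_derivativeI_quadratic: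
  fixes f :: "'a::real_normed_vector \<Rightarrow> 'b::real_normed_vector"
  assumes "bounded_linear A" "\<delta> > 0" "\<And>h. norm h \<le> \<delta> \<Longrightarrow> norm (f (a + h) - f a - A h) \<le> C * norm h ^ 2"
  shows "(f has_derivative A) (at a)"
  unfolding has_derivative_at
proof (intro conjI assms(1))
  show "(\<lambda>h. norm (f (a + h) - f a - A h) / norm h) \<midarrow>0\<rightarrow> 0"
  proof (rule Lim_null_comparison)
    show "\<forall>\<^sub>F h in at 0. norm (norm (f (a + h) - f a - A h) / norm h) \<le> C * norm h"
      unfolding eventually_at
    proof (intro exI[of _ \<delta>] conjI ballI impI assms(2))
      fix h :: 'a assume "h \<noteq> 0 \<and> dist h 0 < \<delta>"
      then show "norm (norm (f (a + h) - f a - A h) / norm h) \<le> C * norm h"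
        using assms(3)[of h] by (simp add: pos_divide_le_eq power2_eq_square)
    qed
    show "((\<lambda>h. C * norm h) \<longlongrightarrow> 0) (at (0::'a))"
      by (auto intro!: tendsto_eq_intros)
  qed
qed

text \<open>The directional derivatives at \<open>a\<close> form Cauchy sequences, by the derivative
  bound of \<open>holo_estimates\<close> applied to differences of the \<open>f n\<close>; their
  limit is the candidate derivative. The quadratic remainder bound has a constant independent of
  \<open>n\<close> and so survives the limit.\<close>

lemma holo_uniform_limit_at:
  fixes f :: "nat \<Rightarrow> complex^'n \<Rightarrow> complex"
  assumes f: "\<And>n. holo_on (ball a R) (f n)" and lim: "uniform_limit (ball a R) f g sequentially"
    and R: "R > 0"
  shows "\<exists>g'. (g has_derivative g') (at a) \<and> (\<forall>c v. g' (c *s v) = c * g' v)"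
proof -
  have a: "a \<in> ball a R" using R by simp
  define R' where "R' = R / 2"
  have R': "0 < R'" "cball a R' \<subseteq> ball a R" "ball a R' \<subseteq> cball a R'" using R by (auto simp: R'_def)
  have f': "holo_on (ball a R') (f n)" for n using f R' holo_on_subset by (metis order_trans)
  have cau: "Cauchy (\<lambda>n. dird (f n) v a)" for v
  proof (rule metric_CauchyI)
    fix e :: real assume e: "e > 0"
    define e' where "e' = e * R / (2 * (3 * norm v + 1))"
    have e': "e' > 0" using e R by (simp add: e'_def add_nonneg_pos)
    from uniform_limitD[OF lim, of "e'/2"] e' obtain N where N: "\<And>n x. n \<ge> N \<Longrightarrow> x \<in> ball a R \<Longrightarrow> dist (f n x) (g x) < e'/2"
      unfolding eventually_sequentially by (metis half_gt_zero)
    show "\<exists>M. \<forall>m\<ge>M. \<forall>n\<ge>M. dist (dird (f m) v a) (dird (f n) v a) < e"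
    proof (intro exI[of _ N] allI impI)
      fix m n assume mn: "N \<le> m" "N \<le> n"
      have h: "holo_on (ball a R) (\<lambda>x. f m x - f n x)" by (intro holo_on_diff f)
      have b: "norm (f m x - f n x) \<le> e'" if "x \<in> ball a R" for x
        using N[OF mn(1) that] N[OF mn(2) that]
        by (metis dist_norm dist_triangle_half_l less_imp_le)
      have "dird (\<lambda>x. f m x - f n x) v a = dird (f m) v a - dird (f n) v a"
        by (rule dird_eqI[OF has_derivative_diff[OF holo_on_dird(1)[OF f a] holo_on_dird(1)[OF f a]]])
      then have "dist (dird (f m) v a) (dird (f n) v a) \<le> 3 * e' / R * norm v"
        using holo_estimates(3)[OF h b R, of v] by (simp add: dist_norm)
      also have "\<dots> < e"
      proof -
        have "3 * norm v * e < 2 * (3 * norm v + 1) * e"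
          by (rule mult_strict_right_mono) (use e in \<open>auto intro: add_nonneg_pos\<close>)
        moreover have "2 * (3 * norm v + 1) > 0" by (simp add: add_nonneg_pos)
        ultimately have "3 * norm v * e / (2 * (3 * norm v + 1)) < e"
          by (simp only: pos_divide_less_eq mult.commute[of e])
        moreover have "3 * e' / R * norm v = 3 * norm v * e / (2 * (3 * norm v + 1))"
          using R by (simp add: e'_def)
        ultimately show ?thesis by simp
      qed
      finally show "dist (dird (f m) v a) (dird (f n) v a) < e" .
    qed
  qed
  define A where "A = (\<lambda>v. lim (\<lambda>n. dird (f n) v a))"
  have A: "(\<lambda>n. dird (f n) v a) \<longlonglongrightarrow> A v" for v
    using cau[of v] Cauchy_convergent_iff convergent_LIMSEQ_iff A_def by metis
  have pw: "(\<lambda>n. f n x) \<longlonglongrightarrow> g x" if "x \<in> ball a R" for x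
    using tendsto_uniform_limitI[OF lim that] .
  \<comment> \<open>One bound for all \<open>n\<close>: compactness handles the functions up to
    index \<open>N\<close>, and the later ones lie within 2 of \<open>f N\<close>.\<close>
  obtain M where M: "\<And>n x. x \<in> ball a R' \<Longrightarrow> norm (f n x) \<le> M"
  proof -
    from uniform_limitD[OF lim, of 1] obtain N where N: "\<And>n x. n \<ge> N \<Longrightarrow> x \<in> ball a R \<Longrightarrow> dist (f n x) (g x) < 1"
      unfolding eventually_sequentially by (metis zero_less_one)
    have "\<exists>B. \<forall>x\<in>cball a R'. norm (f n x) \<le> B" for n
    proof -
      have "compact (f n ` cball a R')"
        by (intro compact_continuous_image continuous_on_subset[OF holo_on_continuous[OF f]] R') auto
      then have "bounded (f n ` cball a R')" by (rule compact_imp_bounded)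
      then show ?thesis unfolding bounded_iff by auto
    qed
    then obtain B where B: "\<And>n x. x \<in> cball a R' \<Longrightarrow> norm (f n x) \<le> B n" by metis
    define C where "C = (\<Sum>n\<le>N. \<bar>B n\<bar>) + 2"
    have "norm (f n x) \<le> C" if "x \<in> ball a R'" for n x
    proof (cases "n \<le> N")
      case True
      then have "\<bar>B n\<bar> \<le> (\<Sum>n\<le>N. \<bar>B n\<bar>)" by (intro member_le_sum) auto
      then show ?thesis using B[of x n] that by (auto simp: C_def)
    next
      case False
      have x: "x \<in> cball a R'" "x \<in> ball a R" using that R'(2,3) by blast+
      have "\<bar>B N\<bar> \<le> (\<Sum>n\<le>N. \<bar>B n\<bar>)" by (intro member_le_sum) auto
      moreover have "norm (f N x) \<le> B N" using B x by auto
      moreover have "dist (f n x) (f N x) < 2"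
        using N[of n x] N[of N x] False x dist_triangle2[of "f n x" "f N x" "g x"] by simp
      moreover have "norm (f n x) \<le> dist (f n x) (f N x) + norm (f N x)" unfolding dist_norm by norm
      ultimately show ?thesis by (simp add: C_def)
    qed
    then show ?thesis using that by blast
  qed
  have lin: "A (c *s v) = c * A v" for c v
  proof -
    have "(\<lambda>n. dird (f n) (c *s v) a) \<longlonglongrightarrow> c * A v"
      using tendsto_mult_left[OF A[of v], of c] by (simp add: holo_on_dird(2)[OF f a])
    then show ?thesis using A LIMSEQ_unique by blast
  qed
  have bl: "bounded_linear A"
  proof (rule bounded_linear_intro[where K = "3 * M / R'"])
    show "A (x + y) = A x + A y" for x y
    proof -
      have "(\<lambda>n. dird (f n) (x + y) a) \<longlonglongrightarrow> A x + A y"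
        using tendsto_add[OF A[of x] A[of y]] by (simp add: dird_add[OF f a])
      then show ?thesis using A LIMSEQ_unique by blast
    qed
    show "A (r *\<^sub>R x) = r *\<^sub>R A x" for r x
      by (simp add: scaleR_eq_vector_scalar_mult lin scaleR_conv_of_real)
    show "norm (A x) \<le> norm x * (3 * M / R')" for x
    proof (rule LIMSEQ_le_const2[OF tendsto_norm[OF A]])
      have "\<And>n. norm (dird (f n) x a) \<le> norm x * (3 * M / R')"
        using holo_estimates(3)[OF f' M R'(1)] by (simp add: mult.commute)
      then show "\<exists>N. \<forall>n\<ge>N. norm (dird (f n) x a) \<le> norm x * (3 * M / R')" by blast
    qed
  qed
  have "(g has_derivative A) (at a)"
  proof (rule has_derivativeI_quadratic[OF bl])
    show "R' / 2 > 0" using R' by simp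
    fix h :: "complex^'n" assume h: "norm h \<le> R'/2"
    then have "a + h \<in> ball a R" using R' R by (auto simp: dist_norm R'_def)
    then have "(\<lambda>n. norm (f n (a + h) - f n a - dird (f n) h a)) \<longlonglongrightarrow> norm (g (a + h) - g a - A h)"
      by (intro tendsto_intros pw A a)
    then show "norm (g (a + h) - g a - A h) \<le> 18 * M / R'^2 * norm h ^ 2"
      by (rule LIMSEQ_le_const2) (use holo_estimates(2)[OF f' M R'(1) h] in blast)
  qed
  with lin show ?thesis by blast
qed

lemma holo_on_locally_bounded:
  assumes "holo_on U f" "open U" "a \<in> U"
  obtains R M where "R > 0" "cball a R \<subseteq> U" "M > 0" "\<And>x. x \<in> cball a R \<Longrightarrow> norm (f x) \<le> M"
proof -
  obtain R where R: "R > 0" "cball a R \<subseteq> U" using assms open_contains_cball by blast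
  have "compact (f ` cball a R)"
    by (intro compact_continuous_image continuous_on_subset[OF holo_on_continuous[OF assms(1)]] R) auto
  then have "bounded (f ` cball a R)" by (rule compact_imp_bounded)
  then obtain M where "M > 0" "\<forall>x\<in>f ` cball a R. norm x \<le> M" unfolding bounded_pos by auto
  with R that show ?thesis by auto
qed

text \<open>Difference quotients in the direction \<open>v\<close> are holomorphic and converge
  uniformly near \<open>a\<close>, since the second-order estimate leaves an error proportional to
  the step. The limit is then holomorphic.\<close>

lemma holo_on_directional_derivative:
  assumes f: "holo_on U f" and U: "open U"
  shows "holo_on U (dird f v)"
proof (rule holo_onI)
  fix a assume a: "a \<in> U"
  obtain R M where R: "R > 0" "cball a R \<subseteq> U" "M > 0" and M: "\<And>x. x \<in> cball a R \<Longrightarrow> norm (f x) \<le> M"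
    using holo_on_locally_bounded[OF f U a] by metis
  define r where "r = R / 2"
  \<comment> \<open>The scaling by \<open>1 + norm v\<close> keeps the step
    \<open>c n *\<^sub>R v\<close> of length at most \<open>r/2\<close>, also for
    \<open>v = 0\<close>.\<close>
  define c where "c = (\<lambda>n::nat. r / (2 * (1 + norm v)) * inverse (real (Suc n)))"
  have r: "r > 0" using R by (simp add: r_def)
  have c: "c n > 0" for n using r by (simp add: c_def add_pos_nonneg)
  have cv: "norm (c n *\<^sub>R v) \<le> r/2" for n
  proof -
    have "c n \<le> r / (2 * (1 + norm v))" unfolding c_def
      using r by (intro mult_left_le) (auto simp: add_nonneg_nonneg inverse_le_1_iff)
    then have "c n * norm v \<le> r / (2 * (1 + norm v)) * norm v" by (rule mult_right_mono) simp
    also have "\<dots> \<le> r / 2" using r by (simp add: divide_simps add_pos_nonneg)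
    finally show ?thesis using c[of n] by (simp add: less_imp_le)
  qed
  have c0: "c \<longlonglongrightarrow> 0" unfolding c_def
    by (rule tendsto_mult_right_zero[OF LIMSEQ_inverse_real_of_nat])
  define F where "F = (\<lambda>n z. (f (z + c n *\<^sub>R v) - f z) / complex_of_real (c n))"
  have sub: "ball z r \<subseteq> cball a R" if "z \<in> ball a r" for z
  proof
    fix y assume "y \<in> ball z r" then show "y \<in> cball a R" using that dist_triangle[of a y z] by (simp add: r_def)
  qed
  have "uniform_limit (ball a r) F (dird f v) sequentially"
  proof (rule uniform_limitI)
    fix e :: real assume e: "e > 0"
    define B where "B = 18 * M / r^2 * norm v ^ 2"
    have "(\<lambda>n. B * c n) \<longlonglongrightarrow> B * 0" by (intro tendsto_intros c0)
    then have ev: "\<forall>\<^sub>F n in sequentially. B * c n < e" using e by (auto dest: order_tendstoD)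
    show "\<forall>\<^sub>F n in sequentially. \<forall>x\<in>ball a r. dist (F n x) (dird f v x) < e"
      using ev
    proof eventually_elim
      case (elim n)
      show ?case
      proof
        fix x assume x: "x \<in> ball a r"
        have xU: "x \<in> U" using sub[OF x] R(2) r by (metis centre_in_ball subsetD)
        have h: "holo_on (ball x r) f" using f sub[OF x] R(2) by (meson holo_on_subset order_trans)
        have "norm (f (x + c n *\<^sub>R v) - f x - dird f (c n *\<^sub>R v) x) \<le> 18 * M / r^2 * norm (c n *\<^sub>R v) ^ 2"
          using holo_estimates(2)[OF h M r cv[of n]] sub[OF x] by blast
        moreover have "dird f (c n *\<^sub>R v) x = complex_of_real (c n) * dird f v x"
          by (simp add: scaleR_eq_vector_scalar_mult holo_on_dird(2)[OF f xU])
        ultimately have *: "norm (f (x + c n *\<^sub>R v) - f x - complex_of_real (c n) * dird f v x) \<le> B * (c n)^2"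
          by (simp add: B_def power_mult_distrib mult.commute mult.left_commute)
        have "F n x - dird f v x = (f (x + c n *\<^sub>R v) - f x - complex_of_real (c n) * dird f v x) / complex_of_real (c n)"
          using c[of n] by (simp add: F_def field_simps)
        then have "norm (F n x - dird f v x) = norm (f (x + c n *\<^sub>R v) - f x - complex_of_real (c n) * dird f v x) / c n"
          using c[of n] by (simp add: norm_divide)
        also have "\<dots> \<le> B * (c n)^2 / c n" by (rule divide_right_mono[OF *]) (use c[of n] in simp)
        also have "\<dots> = B * c n" using c[of n] by (simp add: power2_eq_square)
        finally show "dist (F n x) (dird f v x) < e" using elim by (simp add: dist_norm)
      qed
    qed
  qed
  moreover have "holo_on (ball a r) (F n)" for n
  proof -
    have "holo_on (ball a r) (\<lambda>z. f (c n *\<^sub>R v + 1 *s z))"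
    proof (rule holo_on_compose[OF holo_map_on_affine f])
      show "(\<lambda>z. c n *\<^sub>R v + 1 *s z) ` ball a r \<subseteq> U"
      proof safe
        fix x assume x: "x \<in> ball a r"
        have "x + c n *\<^sub>R v \<in> ball x r" using cv[of n] r by (simp add: dist_norm)
        then have "x + c n *\<^sub>R v \<in> U" using sub[OF x] R by blast
        then show "c n *\<^sub>R v + 1 *s x \<in> U" by (simp add: add.commute)
      qed
    qed
    moreover have "c n *\<^sub>R v + 1 *s z = z + c n *\<^sub>R v" for z by (simp add: vec_eq_iff)
    ultimately have h1: "holo_on (ball a r) (\<lambda>z. f (z + c n *\<^sub>R v))" by (simp only:)
    have h2: "holo_on (ball a r) f" using f sub[of a] R(2) r by (meson centre_in_ball holo_on_subset order_trans)
    show ?thesis unfolding F_def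
      by (intro holo_on_divide holo_on_diff h1 h2 holo_on_const) (use c[of n] in auto)
  qed
  ultimately show "\<exists>f'. (dird f v has_derivative f') (at a) \<and> (\<forall>c v. f' (c *s v) = c * f' v)"
    using holo_uniform_limit_at[of a r F "dird f v"] r by blast
qed

text \<open>Pairs are encoded over the sum of the index types, so that a function of two vector
  variables is again a function of one vector and \<open>holo_on\<close> applies to it.\<close>

definition vpair :: "complex^'n \<Rightarrow> complex^'m \<Rightarrow> complex^('n+'m)" where
  "vpair z w = (\<chi> i. case i of Inl a \<Rightarrow> z $ a | Inr b \<Rightarrow> w $ b)"
definition vfst :: "complex^('n+'m::finite) \<Rightarrow> complex^'n" where "vfst x = (\<chi> a. x $ Inl a)"
definition vsnd :: "complex^('n::finite+'m) \<Rightarrow> complex^'m" where "vsnd x = (\<chi> a. x $ Inr a)"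

lemma vpair_simps [simp]: "vfst (vpair z w) = z" "vsnd (vpair z w) = w" "vpair (vfst x) (vsnd x) = x"
  "vpair z w $ Inl a = z $ a" "vpair z w $ Inr b = w $ b"
  by (auto simp: vpair_def vfst_def vsnd_def vec_eq_iff split: sum.splits)

lemma vpair_add: "vpair (z + z') (w + w') = vpair z w + vpair z' w'"
  by (auto simp: vpair_def vec_eq_iff split: sum.splits)

lemma vpair_diff: "vpair (z - z') (w - w') = vpair z w - vpair z' w'"
  by (auto simp: vpair_def vec_eq_iff split: sum.splits)

lemma vfst_linear: "vfst (x + y) = vfst x + vfst y" "vfst (c *s x) = c *s vfst x" "vfst (r *\<^sub>R x) = r *\<^sub>R vfst x"
  and vsnd_linear: "vsnd (x + y) = vsnd x + vsnd y" "vsnd (c *s x) = c *s vsnd x" "vsnd (r *\<^sub>R x) = r *\<^sub>R vsnd x"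
  by (auto simp: vfst_def vsnd_def vec_eq_iff)

lemma norm_vpair_sq: "norm (vpair z w)^2 = norm z^2 + norm w^2"
proof -
  have "(\<Sum>i\<in>UNIV. norm (vpair z w $ i)^2) = (\<Sum>a\<in>UNIV. norm (z $ a)^2) + (\<Sum>b\<in>UNIV. norm (w $ b)^2)"
    unfolding UNIV_Plus_UNIV[symmetric] by (subst sum.Plus) auto
  then show ?thesis by (simp add: norm_vec_def L2_set_def sum_nonneg)
qed

lemma norm_vpair_le: "norm (vpair z w) \<le> norm z + norm w"
  by (rule power2_le_imp_le) (auto simp: norm_vpair_sq power2_sum)

lemma norm_vfst_le: "norm (vfst x) \<le> norm x" and norm_vsnd_le: "norm (vsnd x) \<le> norm x"
  using norm_vpair_sq[of "vfst x" "vsnd x"]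
  by (simp_all add: power2_le_imp_le[of "norm (vfst x)" "norm x"] power2_le_imp_le[of "norm (vsnd x)" "norm x"])

lemma bounded_linear_vfst: "bounded_linear vfst"
  by (rule bounded_linear_intro[where K = 1]) (auto simp: vfst_linear norm_vfst_le)

lemma bounded_linear_vsnd: "bounded_linear vsnd"
  by (rule bounded_linear_intro[where K = 1]) (auto simp: vsnd_linear norm_vsnd_le)

text \<open>Local boundedness takes the place of continuity in passing from separate to joint
  holomorphy. The increment splits into one in each block plus a mixed difference, and all three
  errors are quadratic in \<open>norm h\<close>.\<close>

lemma osgood:
  fixes G :: "complex^('n::finite+'m::finite) \<Rightarrow> complex"
  assumes lb: "\<And>p. p \<in> W \<Longrightarrow> \<exists>R>0. \<exists>M. ball p R \<subseteq> W \<and> (\<forall>x\<in>ball p R. norm (G x) \<le> M)"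
    and s1: "\<And>w. holo_on {z. vpair z w \<in> W} (\<lambda>z. G (vpair z w))"
    and s2: "\<And>z. holo_on {w. vpair z w \<in> W} (\<lambda>w. G (vpair z w))"
  shows "holo_on W G"
proof (rule holo_onI)
  fix p assume p: "p \<in> W"
  define z0 where "z0 = vfst p"
  define w0 where "w0 = vsnd p"
  have p_eq: "p = vpair z0 w0" by (simp add: z0_def w0_def)
  obtain R M where R: "R > 0" "ball p R \<subseteq> W" and M: "\<And>x. x \<in> ball p R \<Longrightarrow> norm (G x) \<le> M"
    using lb[OF p] by metis
  define r where "r = R / 2"
  have r: "r > 0" using R by (simp add: r_def)
  have M0: "M \<ge> 0" using M[of p] R norm_ge_zero order_trans by (metis centre_in_ball)
  have inb: "vpair z w \<in> ball p R" if "z \<in> ball z0 r" "w \<in> ball w0 r" for z w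
  proof -
    have "norm (p - vpair z w) \<le> norm (z0 - z) + norm (w0 - w)"
      unfolding p_eq vpair_diff[symmetric] by (rule norm_vpair_le)
    then show ?thesis using that by (simp add: dist_norm r_def)
  qed
  have z0b: "z0 \<in> ball z0 r" and w0b: "w0 \<in> ball w0 r" using r by auto
  have h1: "holo_on (ball z0 r) (\<lambda>z. G (vpair z w))" if "w \<in> ball w0 r" for w
    by (rule holo_on_subset[OF s1]) (use inb that R in auto)
  have h2: "holo_on (ball w0 r) (\<lambda>w. G (vpair z w))" if "z \<in> ball z0 r" for z
    by (rule holo_on_subset[OF s2]) (use inb that R in auto)
  define A1 where "A1 = (\<lambda>v. dird (\<lambda>z. G (vpair z w0)) v z0)"
  define A2 where "A2 = (\<lambda>v. dird (\<lambda>w. G (vpair z0 w)) v w0)"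
  note d1 = holo_on_dird[OF h1[OF w0b] z0b] note d2 = holo_on_dird[OF h2[OF z0b] w0b]
  have bl: "bounded_linear (\<lambda>h. A1 (vfst h) + A2 (vsnd h))"
    unfolding A1_def A2_def
    by (intro bounded_linear_add bounded_linear_compose[OF has_derivative_bounded_linear[OF d1(1)] bounded_linear_vfst]
        bounded_linear_compose[OF has_derivative_bounded_linear[OF d2(1)] bounded_linear_vsnd])
  have "(G has_derivative (\<lambda>h. A1 (vfst h) + A2 (vsnd h))) (at p)"
  proof (rule has_derivativeI_quadratic[OF bl])
    show "r/2 > 0" using r by simp
    fix h :: "complex^('n+'m)" assume h: "norm h \<le> r/2"
    define a where "a = vfst h"
    define b where "b = vsnd h"
    have h_eq: "h = vpair a b" by (simp add: a_def b_def)
    have a: "norm a \<le> norm h" and b: "norm b \<le> norm h" by (auto simp: a_def b_def norm_vfst_le norm_vsnd_le)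
    then have a2: "norm a \<le> r/2" and b2: "norm b \<le> r/2" using h by auto
    have wb: "w0 + b \<in> ball w0 r" and za: "z0 + a \<in> ball z0 r" using a2 b2 r by (auto simp: dist_norm)
    \<comment> \<open>The mixed difference: the first-order bound in the second block makes
      \<open>F\<close> of size \<open>norm b\<close>, and the first-order bound for \<open>F\<close>
      in the first block gains the factor \<open>norm a\<close>.\<close>
    define F where "F = (\<lambda>z. G (vpair z (w0 + b)) - G (vpair z w0))"
    have Fh: "holo_on (ball z0 r) F" unfolding F_def by (intro holo_on_diff h1 wb w0b)
    have Fb: "norm (F z) \<le> 3 * M / r * norm b" if "z \<in> ball z0 r" for z
      unfolding F_def by (rule holo_estimates(1)[OF h2[OF that] _ r b2]) (use M inb that in auto)
    have e1: "norm (F (z0 + a) - F z0) \<le> 3 * (3 * M / r * norm b) / r * norm a"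
      by (rule holo_estimates(1)[OF Fh Fb r a2])
    have e2: "norm (G (vpair (z0 + a) w0) - G (vpair z0 w0) - A1 a) \<le> 18 * M / r^2 * norm a ^ 2"
      unfolding A1_def by (rule holo_estimates(2)[OF h1[OF w0b] _ r a2]) (use M inb w0b in auto)
    have e3: "norm (G (vpair z0 (w0 + b)) - G (vpair z0 w0) - A2 b) \<le> 18 * M / r^2 * norm b ^ 2"
      unfolding A2_def by (rule holo_estimates(2)[OF h2[OF z0b] _ r b2]) (use M inb z0b in auto)
    have ab: "norm a * norm b \<le> norm h ^ 2" "norm a ^ 2 \<le> norm h ^2" "norm b ^ 2 \<le> norm h ^2"
      using a b by (auto simp: power2_eq_square intro!: mult_mono)
    have K: "0 \<le> M / r^2" using M0 by simp
    have "G (p + h) - G p - (A1 (vfst h) + A2 (vsnd h)) = (F (z0 + a) - F z0)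
      + (G (vpair (z0 + a) w0) - G (vpair z0 w0) - A1 a) + (G (vpair z0 (w0 + b)) - G (vpair z0 w0) - A2 b)"
      unfolding p_eq h_eq vpair_add[symmetric] F_def by simp
    then have "norm (G (p + h) - G p - (A1 (vfst h) + A2 (vsnd h))) \<le>
       3 * (3 * M / r * norm b) / r * norm a + 18 * M / r^2 * norm a ^ 2 + 18 * M / r^2 * norm b ^ 2"
      using norm_triangle_mono[OF norm_triangle_mono[OF e1 e2] e3] by simp
    also have "\<dots> = 9 * (M / r^2) * (norm a * norm b) + 18 * (M / r^2) * norm a ^ 2 + 18 * (M / r^2) * norm b ^ 2"
      by (simp add: power2_eq_square field_simps)
    also have "\<dots> \<le> 9 * (M / r^2) * norm h ^ 2 + 18 * (M / r^2) * norm h ^ 2 + 18 * (M / r^2) * norm h ^ 2"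
      by (intro add_mono mult_left_mono ab) (use K in auto)
    also have "\<dots> = 45 * (M / r^2) * norm h ^ 2" by (simp add: algebra_simps)
    finally show "norm (G (p + h) - G p - (A1 (vfst h) + A2 (vsnd h))) \<le> 45 * (M / r^2) * norm h ^ 2" .
  qed
  then show "\<exists>f'. (G has_derivative f') (at p) \<and> (\<forall>c v. f' (c *s v) = c * f' v)"
    using d1(2) d2(2) by (intro exI conjI) (auto simp: A1_def A2_def vfst_linear vsnd_linear algebra_simps)
qed

section \<open>Jacobi matrices of holomorphic maps\<close>

lemma dird_basis:
  assumes "holo_on U f" "z \<in> U"
  shows "dird f v z = (\<Sum>j\<in>UNIV. dird f (axis j 1) z * v $ j)"
proof -
  have "v = (\<Sum>j\<in>UNIV. v $ j *s axis j 1)" by (simp add: basis_expansion)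
  then have "dird f v z = dird f (\<Sum>j\<in>UNIV. v $ j *s axis j 1) z" by simp
  then show ?thesis by (simp only: dird_sum[OF assms] holo_on_dird(2)[OF assms] mult.commute)
qed

lemma complex_jacobi_nth:
  assumes "holo_map_on U \<psi>" "z \<in> U"
  shows "complex_jacobi \<psi> z $ i $ j = dird (\<lambda>x. \<psi> x $ i) (axis j 1) z"
  unfolding complex_jacobi_def frechet_derivative_at[OF holo_map_on_has_derivative(1)[OF assms], symmetric]
  by (simp add: holo_derivative_def)

lemma complex_jacobi_mult_vec:
  assumes "holo_map_on U \<psi>" "z \<in> U"
  shows "complex_jacobi \<psi> z *v v = holo_derivative \<psi> z v"
proof -
  have "holo_on U (\<lambda>x. \<psi> x $ i)" for i using assms(1) by (auto simp: holo_map_on_def)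
  note e = dird_basis[OF this assms(2), of _ v]
  show ?thesis
    by (simp add: vec_eq_iff matrix_vector_mult_def complex_jacobi_nth[OF assms] holo_derivative_def e[symmetric])
qed

lemma holo_on_det_jacobi:
  assumes "holo_map_on U \<psi>" "open U"
  shows "holo_on U (\<lambda>z. det (complex_jacobi \<psi> z))"
proof -
  have *: "holo_on U (dird (\<lambda>x. \<psi> x $ i) v)" for i v
    using assms by (intro holo_on_directional_derivative) (auto simp: holo_map_on_def)
  have **: "holo_on U (\<lambda>z. complex_jacobi \<psi> z $ i $ j)" for i j
    unfolding holo_on_def
  proof
    fix z assume z: "z \<in> U"
    show "\<exists>f'. ((\<lambda>z. complex_jacobi \<psi> z $ i $ j) has_derivative f') (at z) \<and> (\<forall>c v. f' (c *s v) = c * f' v)"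
      using holo_on_dird[OF *[of i "axis j 1"] z] complex_jacobi_nth[OF assms(1), of _ i j] assms(2) z
      by (metis (no_types, lifting) has_derivative_transform_within_open)
  qed
  show ?thesis unfolding det_def by (intro holo_on_sum holo_on_mult holo_on_prod ** holo_on_const)
qed

section \<open>Biholomorphic change of variables\<close>

text \<open>Lebesgue measure and determinants on \<open>complex^'n\<close> are compared with those on
  \<open>real^('n bit0)\<close>, the library's change of variables being stated for well-ordered index types.\<close>

lemma euclidean_basis_iso:
  assumes "DIM('a) = DIM('b)"
  obtains T :: "'a::euclidean_space \<Rightarrow> 'b::euclidean_space" and S where "linear T" "linear S" "\<And>x. S (T x) = x" "\<And>y. T (S y) = y"
    "\<And>b. b \<in> Basis \<Longrightarrow> T b \<in> Basis" "\<And>b. b \<in> Basis \<Longrightarrow> S b \<in> Basis" "\<And>x. norm (T x) = norm x"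
    "distr lborel borel T = lborel"
proof -
  obtain \<pi> :: "'a \<Rightarrow> 'b" where \<pi>: "bij_betw \<pi> Basis Basis"
    using finite_same_card_bij[OF finite_Basis finite_Basis assms] by blast
  define T where "T = (\<lambda>x. \<Sum>b\<in>Basis. (x \<bullet> b) *\<^sub>R \<pi> b)"
  define S where "S = (\<lambda>y. \<Sum>b\<in>Basis. (y \<bullet> \<pi> b) *\<^sub>R b)"
  have lT: "linear T" unfolding T_def
    by (rule linearI) (auto simp: inner_add_left scaleR_add_left sum.distrib scaleR_sum_right)
  have lS: "linear S" unfolding S_def
    by (rule linearI) (auto simp: inner_add_left scaleR_add_left sum.distrib scaleR_sum_right)
  have ip: "\<pi> b \<bullet> \<pi> c = (if b = c then 1 else 0)" if "b \<in> Basis" "c \<in> Basis" for b c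
  proof -
    have "\<pi> b \<in> Basis" "\<pi> c \<in> Basis" "\<pi> b = \<pi> c \<longleftrightarrow> b = c"
      using \<pi> that by (auto simp: bij_betw_def inj_on_def)
    then show ?thesis by (simp add: inner_Basis)
  qed
  have T1: "T x \<bullet> \<pi> c = x \<bullet> c" if "c \<in> Basis" for x c
    using that by (simp add: T_def inner_sum_left ip if_distrib cong: if_cong)
  have S1: "S y \<bullet> c = y \<bullet> \<pi> c" if "c \<in> Basis" for y c
    using that by (simp add: S_def inner_sum_left inner_Basis if_distrib cong: if_cong)
  have ST: "S (T x) = x" for x
    by (rule euclidean_eqI) (simp add: S1 T1)
  have TS: "T (S y) = y" for y
  proof (rule euclidean_eqI)
    fix c :: 'b assume "c \<in> Basis"
    then obtain b where "b \<in> Basis" "c = \<pi> b" using \<pi> by (auto simp: bij_betw_def)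
    then show "T (S y) \<bullet> c = y \<bullet> c" by (simp add: S1 T1)
  qed
  have Tb: "T b = \<pi> b" if "b \<in> Basis" for b
    using that by (simp add: T_def inner_Basis if_distrib[of "\<lambda>r. r *\<^sub>R _"] cong: if_cong)
  then have Tb': "T b \<in> Basis" if "b \<in> Basis" for b using \<pi> that by (auto simp: bij_betw_def)
  have Sb: "S b \<in> Basis" if "b \<in> Basis" for b
  proof -
    from \<pi> that have "b \<in> \<pi> ` Basis" by (simp add: bij_betw_def)
    then obtain b' where "b' \<in> Basis" "b = \<pi> b'" by blast
    then show ?thesis using Tb[of b'] ST[of b'] by simp
  qed
  have nT: "norm (T x) = norm x" for x
  proof -
    have "T x \<bullet> T x = (\<Sum>b\<in>Basis. (x \<bullet> b) * (T x \<bullet> \<pi> b))"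
      by (subst (2) T_def) (simp add: inner_sum_right)
    also have "\<dots> = (\<Sum>b\<in>Basis. (x \<bullet> b) * (x \<bullet> b))" by (simp add: T1)
    also have "\<dots> = x \<bullet> x" by (simp add: euclidean_inner[of x x])
    finally show ?thesis by (simp add: norm_eq_sqrt_inner)
  qed
  have [measurable]: "T \<in> borel_measurable borel"
    using lT by (intro borel_measurable_continuous_onI linear_continuous_on linear_conv_bounded_linear[THEN iffD1])
  \<comment> \<open>Boxes pull back to boxes whose corners are the images under \<open>S\<close>,
    with the side lengths only permuted; this characterises Lebesgue measure.\<close>
  have "lborel = distr lborel borel T"
  proof (rule lborel_eqI)
    fix l u :: 'b assume lu: "\<And>b. b \<in> Basis \<Longrightarrow> l \<bullet> b \<le> u \<bullet> b"
    have "T -` box l u = box (S l) (S u)"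
    proof (intro set_eqI)
      fix x
      have "T x \<in> box l u \<longleftrightarrow> (\<forall>b\<in>Basis. l \<bullet> \<pi> b < T x \<bullet> \<pi> b \<and> T x \<bullet> \<pi> b < u \<bullet> \<pi> b)"
        using \<pi> unfolding mem_box bij_betw_def by (metis imageE imageI)
      also have "\<dots> \<longleftrightarrow> x \<in> box (S l) (S u)" by (simp add: mem_box S1 T1)
      finally show "x \<in> T -` box l u \<longleftrightarrow> x \<in> box (S l) (S u)" by simp
    qed
    then have "emeasure (distr lborel borel T) (box l u) = emeasure lborel (box (S l) (S u))"
      by (simp add: emeasure_distr)
    also have "\<dots> = (\<Prod>b\<in>Basis. (S u - S l) \<bullet> b)"
    proof (rule emeasure_lborel_box)
      show "S l \<bullet> b \<le> S u \<bullet> b" if "b \<in> Basis" for b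
      proof -
        have "\<pi> b \<in> Basis" using that \<pi> by (auto simp: bij_betw_def)
        then show ?thesis using lu[of "\<pi> b"] by (simp add: S1[OF that])
      qed
    qed
    also have "(\<Prod>b\<in>Basis. (S u - S l) \<bullet> b) = (\<Prod>b\<in>Basis. (u - l) \<bullet> \<pi> b)"
      by (intro prod.cong) (auto simp: inner_diff_left S1)
    also have "\<dots> = (\<Prod>b\<in>Basis. (u - l) \<bullet> b)"
      using \<pi> by (rule prod.reindex_bij_betw)
    finally show "emeasure (distr lborel borel T) (box l u) = (\<Prod>b\<in>Basis. (u - l) \<bullet> b)" .
  qed simp
  then show ?thesis using that[OF lT lS ST TS Tb' Sb nT] by simp
qed

text \<open>The elementary matrices of Gauss-Jordan elimination. Shears, scalings of one coordinate
  and whole pivot steps are all of this form.\<close>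

definition colmat :: "'n \<Rightarrow> complex^'n \<Rightarrow> complex^'n^'n" where
  "colmat k u = (\<chi> i j. if j = k then u $ i else mat 1 $ i $ j)"

lemma colmat_vec: "colmat k u *v x = x + x $ k *s (u - axis k 1)"
  unfolding vec_eq_iff
proof
  fix i
  have "(\<Sum>j\<in>UNIV. (if j = k then u $ i else mat 1 $ i $ j) * x $ j)
     = (\<Sum>j\<in>UNIV. (mat 1 $ i $ j * x $ j) + (if j = k then (u $ i - mat 1 $ i $ k) * x $ k else 0))"
    by (intro sum.cong) (auto simp: algebra_simps)
  also have "\<dots> = x $ i + x $ k * (u $ i - axis k 1 $ i)"
    by (simp add: sum.distrib mat_def axis_def if_distrib[of "\<lambda>z. z * _"] cong: if_cong)
  finally show "(colmat k u *v x) $ i = (x + x $ k *s (u - axis k 1)) $ i"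
    by (simp only: colmat_def matrix_vector_mult_def vec_lambda_beta vector_add_component
        vector_smult_component vector_minus_component)
qed

lemma det_colmat:
  fixes u :: "complex^'n"
  shows "det (colmat k u) = u $ k"
  using cramer_lemma[of k "mat 1 :: complex^'n^'n" u]
  by (simp only: colmat_def det_I mult_1_right matrix_vector_mul_lid)

lemma colmat_mult: "colmat k u ** colmat k v = colmat k (colmat k u *v v)"
  unfolding matrix_eq matrix_vector_mul_assoc[symmetric]
  by (simp add: colmat_vec vec_eq_iff algebra_simps axis_def)

lemma colmat_one: "colmat k (axis k 1) = mat 1"
  unfolding matrix_eq by (simp add: colmat_vec)

text \<open>Both sides are multiplicative in \<open>A\<close>, so generators suffice: phases of one
  coordinate are isometries, positive scalings of one coordinate are diagonal in the real basis, and
  shears are conjugate to their inverses. Elimination reduces \<open>A\<close> to the identity by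
  such factors unless a kernel vector appears, and then both sides are 0.\<close>

lemma real_det_eq_norm_det_sq:
  fixes T :: "complex^'n \<Rightarrow> real^('n bit0)" and A :: "complex^'n^'n"
  assumes T: "linear T" "linear S" "\<And>x. S (T x) = x" "\<And>y. T (S y) = y"
    "\<And>b. b \<in> Basis \<Longrightarrow> T b \<in> Basis" "\<And>b. b \<in> Basis \<Longrightarrow> S b \<in> Basis" "\<And>x. norm (T x) = norm x"
  shows "\<bar>det (matrix (\<lambda>y. T (A *v S y)))\<bar> = (norm (det A))^2"
proof -
  define D where "D = (\<lambda>A::complex^'n^'n. \<bar>det (matrix (\<lambda>y. T (A *v S y)))\<bar>)"
  have lin: "linear (\<lambda>y. T (A *v S y))" for A
  proof -
    have "linear (\<lambda>x::complex^'n. A *v x)"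
      by (rule linearI) (auto simp: matrix_vector_right_distrib scaleR_eq_vector_scalar_mult vector_scalar_commute)
    from linear_compose[OF linear_compose[OF T(2) this] T(1)] show ?thesis by (simp add: o_def)
  qed
  have D_mult: "D (A ** B) = D A * D B" for A B
  proof -
    have "matrix (\<lambda>y. T ((A ** B) *v S y)) = matrix ((\<lambda>y. T (A *v S y)) \<circ> (\<lambda>y. T (B *v S y)))"
      by (simp add: o_def T(3) matrix_vector_mul_assoc)
    also have "\<dots> = matrix (\<lambda>y. T (A *v S y)) ** matrix (\<lambda>y. T (B *v S y))"
      by (rule matrix_compose[OF lin lin])
    finally show ?thesis by (simp add: D_def det_mul abs_mult)
  qed
  have nS: "norm (S y) = norm y" for y using T(7)[of "S y"] T(4) by simp
  have D_iso: "D A = 1" if "\<And>x. norm (A *v x) = norm x" for A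
  proof -
    have "orthogonal_transformation (\<lambda>y. T (A *v S y))"
      unfolding orthogonal_transformation using lin by (simp add: T(7) that nS)
    then show ?thesis unfolding D_def by (rule orthogonal_transformation_det)
  qed
  have D_one: "D (mat 1) = 1" by (rule D_iso) simp
  have iso_col: "norm (colmat k (axis k c) *v x) = norm x" if "norm c = 1" for k c and x :: "complex^'n"
  proof -
    have "norm ((colmat k (axis k c) *v x) $ i) = norm (x $ i)" for i
      using that by (auto simp: colmat_vec axis_def algebra_simps norm_mult)
    then show ?thesis by (simp add: norm_vec_def)
  qed
  have D_shear: "D (colmat k u) = 1" if "u $ k = 1" for k u
  proof -
    let ?R = "colmat k (axis k (-1))"
    have R: "D ?R = 1" by (rule D_iso, rule iso_col) simp
    \<comment> \<open>Conjugation by the reflection \<open>?R\<close> inverts the shear, so the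
      square of its \<open>D\<close> is 1.\<close>
    have "?R ** colmat k u ** ?R ** colmat k u = mat 1"
      unfolding matrix_eq matrix_vector_mul_assoc[symmetric]
      using that by (auto simp: colmat_vec vec_eq_iff axis_def algebra_simps)
    then have "D ?R * D (colmat k u) * D ?R * D (colmat k u) = 1" using D_one by (simp add: D_mult[symmetric])
    then have "D (colmat k u) ^ 2 = 1" using R by (simp add: power2_eq_square)
    moreover have "D (colmat k u) \<ge> 0" by (simp add: D_def)
    ultimately show ?thesis by (simp add: power2_eq_1_iff)
  qed
  have D_real: "D (colmat k (axis k (complex_of_real r))) = r^2" if "r > 0" for k r
  proof -
    let ?E = "colmat k (axis k (complex_of_real r))"
    \<comment> \<open>Only the two real basis vectors of coordinate \<open>k\<close> are stretched;
      this is where the square comes from.\<close>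
    define d where "d = (\<lambda>b::complex^'n. if b = axis k 1 \<or> b = axis k \<i> then r else 1)"
    have Eb: "?E *v b = d b *\<^sub>R b" if "b \<in> Basis" for b
    proof -
      obtain i c where b: "b = axis i c" "c = 1 \<or> c = \<i>"
        using \<open>b \<in> Basis\<close> by (auto simp: Basis_vec_def Basis_complex_def)
      show ?thesis
      proof (cases "i = k")
        case True
        then have db: "d b = r" using b by (auto simp: d_def)
        show ?thesis unfolding db unfolding b(1) True
          by (simp add: colmat_vec vec_eq_iff axis_def scaleR_eq_vector_scalar_mult ring_distribs mult.commute)
      next
        case False
        have "c \<noteq> 0" using b by auto
        then have "d b = 1" using b False by (auto simp: d_def axis_eq_axis)
        then show ?thesis using False b by (simp add: colmat_vec axis_def)
      qed
    qed
    have M: "matrix (\<lambda>y. T (?E *v S y)) $ i $ j = (if i = j then d (S (axis j 1)) else 0)" for i j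
    proof -
      have B: "S (axis j 1) \<in> Basis" by (rule T(6)) simp
      have "T (?E *v S (axis j 1)) = d (S (axis j 1)) *\<^sub>R axis j 1"
        by (simp add: Eb[OF B] linear_cmul[OF T(1)] T(4))
      then show ?thesis by (simp add: matrix_def axis_def)
    qed
    have "det (matrix (\<lambda>y. T (?E *v S y))) = (\<Prod>j\<in>UNIV. d (S (axis j 1)))"
      by (subst det_diagonal) (auto simp: M)
    also have "\<dots> = (\<Prod>b\<in>(Basis :: (real^('n bit0)) set). d (S b))"
    proof -
      have 1: "(Basis :: (real^('n bit0)) set) = range (\<lambda>j. axis j (1::real))" by (auto simp: Basis_vec_def)
      have 2: "inj (\<lambda>j. axis j (1::real) :: real^('n bit0))" by (auto simp: inj_on_def axis_eq_axis)
      show ?thesis using prod.reindex[OF 2, of "\<lambda>b. d (S b)"] by (simp add: 1)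
    qed
    also have "\<dots> = (\<Prod>b\<in>Basis. d b)"
      by (rule prod.reindex_bij_witness[where j = S and i = T]) (use T in auto)
    also have "\<dots> = (\<Prod>b\<in>{axis k 1, axis k \<i>}. d b)"
      by (rule prod.mono_neutral_right) (auto simp: d_def Basis_vec_def Basis_complex_def)
    also have "\<dots> = r^2" by (simp add: d_def axis_eq_axis power2_eq_square complex_eq_iff)
    finally show ?thesis by (simp add: D_def)
  qed
  define P where "P = (\<lambda>A. D A = (norm (det A))^2)"
  have P_mult: "P (A ** B)" if "P A" "P B" for A B
    using that by (simp add: P_def D_mult det_mul norm_mult power_mult_distrib)
  have P_shear: "P (colmat k u)" if "u $ k = 1" for k u using that by (simp add: P_def D_shear det_colmat)
  have P_col: "P (colmat k u)" if u: "u $ k \<noteq> 0" for k u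
  proof -
    let ?c = "u $ k"
    have 1: "P (colmat k (axis k (complex_of_real (norm ?c))))" using u by (simp add: P_def D_real det_colmat)
    have 2: "P (colmat k (axis k (sgn ?c)))" using u D_iso[OF iso_col[of "sgn ?c" k]] by (simp add: P_def det_colmat norm_sgn)
    have 3: "P (colmat k (inverse ?c *s u))" by (rule P_shear) (use u in simp)
    have "complex_of_real (norm ?c) * sgn ?c = ?c" using u by (simp add: sgn_eq)
    \<comment> \<open>The column \<open>u\<close> is factored into a shear with pivot 1, a scaling
      by the modulus of the pivot, and a phase.\<close>
    then have "colmat k (inverse ?c *s u) ** (colmat k (axis k (complex_of_real (norm ?c))) ** colmat k (axis k (sgn ?c))) = colmat k u"
      using u unfolding colmat_mult
      by (intro arg_cong[where f = "colmat k"]) (auto simp: colmat_vec vec_eq_iff axis_def field_simps)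
    then show ?thesis using P_mult[OF 3 P_mult[OF 1 2]] by simp
  qed
  have col_axis: "column j (colmat k u ** A) = colmat k u *v column j A" for j k u A
    by (simp add: vec_eq_iff column_def matrix_matrix_mult_def matrix_vector_mult_def)
  \<comment> \<open>Induction on the set \<open>K\<close> of columns that may still differ from unit
    vectors.\<close>
  have "\<forall>j. j \<notin> K \<longrightarrow> column j A = axis j 1 \<Longrightarrow> P A" if "finite K" for K A
    using that
  proof (induction K arbitrary: A rule: finite_induct)
    case empty
    then have "A = mat 1" by (auto simp: vec_eq_iff column_def mat_def axis_def)
    then show ?case by (simp add: P_def D_one)
  next
    case (insert k K)
    have case1: "P A" if "\<forall>j. j \<notin> insert k K \<longrightarrow> column j A = axis j 1" "column k A $ k \<noteq> 0" for A
    proof -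
      let ?u = "column k A"
      \<comment> \<open>Chosen so that \<open>colmat k ?v\<close> inverts
        \<open>colmat k ?u\<close>; multiplying by it from the left turns column \<open>k\<close>
        into a unit vector and leaves the other unit columns alone.\<close>
      let ?v = "axis k 1 + inverse (?u $ k) *s (axis k 1 - ?u)"
      have uv: "colmat k ?u ** colmat k ?v = mat 1"
        unfolding colmat_mult colmat_one[of k, symmetric] using that(2)
        by (intro arg_cong[where f = "colmat k"]) (auto simp: colmat_vec vec_eq_iff axis_def field_simps)
      have "P (colmat k ?v ** A)"
      proof (rule insert.IH, intro allI impI)
        fix j assume j: "j \<notin> K"
        show "column j (colmat k ?v ** A) = axis j 1"
        proof (cases "j = k")
          case True
          then show ?thesis unfolding col_axis using that(2)
            by (auto simp: colmat_vec vec_eq_iff axis_def field_simps)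
        next
          case False
          then show ?thesis unfolding col_axis using that(1) j by (auto simp: colmat_vec vec_eq_iff axis_def)
        qed
      qed
      from P_mult[OF P_col[OF that(2)] this] show ?thesis by (simp only: matrix_mul_assoc uv matrix_mul_lid)
    qed
    show ?case
    proof (cases "\<exists>l\<in>insert k K. column k A $ l \<noteq> 0")
      case True
      then obtain l where l: "l \<in> insert k K" "column k A $ l \<noteq> 0" by blast
      show ?thesis
      proof (cases "column k A $ k = 0")
        case False then show ?thesis using case1 insert.prems by blast
      next
        case True
        then have kl: "l \<noteq> k" using l by auto
        \<comment> \<open>The pivot vanishes but row \<open>l\<close> has a usable entry: left
          multiplication by \<open>?S\<close> adds row \<open>l\<close> to row \<open>k\<close>, and
          \<open>?S'\<close> undoes it.\<close>
        let ?S = "colmat l (axis l 1 + axis k 1)" and ?S' = "colmat l (axis l 1 - axis k 1)"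
        have "?S' ** ?S = mat 1"
          unfolding colmat_mult colmat_one[of l, symmetric] using kl
          by (intro arg_cong[where f = "colmat l"]) (auto simp: colmat_vec vec_eq_iff axis_def)
        moreover have "P (?S ** A)"
        proof (rule case1)
          show "\<forall>j. j \<notin> insert k K \<longrightarrow> column j (?S ** A) = axis j 1"
            unfolding col_axis using insert.prems l by (auto simp: colmat_vec vec_eq_iff axis_def)
          show "column k (?S ** A) $ k \<noteq> 0"
            unfolding col_axis using True kl l by (auto simp: colmat_vec axis_def)
        qed
        moreover have "P ?S'" by (rule P_shear) (use kl in \<open>auto simp: axis_def\<close>)
        ultimately show ?thesis using P_mult[of ?S' "?S ** A"] by (simp only: matrix_mul_assoc matrix_mul_lid)
      qed
    next
      case False
      let ?u = "column k A"
      \<comment> \<open>Column \<open>k\<close> is supported where the columns of \<open>A\<close>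
        are already unit vectors, so \<open>A\<close> fixes it. Since \<open>A\<close> also maps
        \<open>axis k 1\<close> to it, \<open>?x\<close> lies in the kernel.\<close>
      let ?x = "axis k 1 - ?u"
      have Ae: "A *v axis j 1 = column j A" for j
        by (simp add: vec_eq_iff column_def matrix_vector_mult_def axis_def if_distrib cong: if_cong)
      have "A *v ?u = (\<Sum>j\<in>UNIV. ?u $ j *s column j A)" by (rule matrix_mult_sum)
      also have "\<dots> = (\<Sum>j\<in>UNIV. ?u $ j *s axis j 1)"
        using False insert.prems by (intro sum.cong refl) (metis vector_smult_lzero)
      also have "\<dots> = ?u" by (simp add: basis_expansion)
      finally have Ax: "A *v ?x = 0" by (simp add: matrix_vector_mult_diff_distrib Ae)
      have x0: "?x \<noteq> 0"
      proof
        assume "?x = 0" then have "?x $ k = 0" by simp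
        then show False using False by (simp add: axis_def)
      qed
      have "det A = 0"
      proof (rule ccontr)
        assume "det A \<noteq> 0"
        then obtain B where "B ** A = mat 1" by (auto simp: invertible_det_nz[symmetric] invertible_def)
        then have "?x = B *v (A *v ?x)" by (simp add: matrix_vector_mul_assoc)
        then show False using Ax x0 by simp
      qed
      moreover have "D A = 0"
      proof (rule ccontr)
        let ?M = "matrix (\<lambda>y. T (A *v S y))"
        assume "D A \<noteq> 0"
        then obtain B where "B ** ?M = mat 1" by (auto simp: D_def invertible_det_nz[symmetric] invertible_def)
        then have "T ?x = B *v (?M *v T ?x)" by (simp add: matrix_vector_mul_assoc)
        also have "?M *v T ?x = 0" by (simp add: matrix_works[OF lin[folded linear_matrix_vector_mul_eq]] T(3) Ax linear_0[OF T(1)])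
        finally have "T ?x = 0" by simp
        then have "S (T ?x) = 0" using linear_0[OF T(2)] by simp
        then show False using x0 T(3) by simp
      qed
      ultimately show ?thesis by (simp add: P_def)
    qed
  qed
  from this[of UNIV A] show ?thesis by (simp add: P_def D_def)
qed

section \<open>Integrals under biholomorphic maps and sub-mean value inequalities\<close>

lemma biholomorphismD:
  assumes "biholomorphism \<psi> U V"
  shows "holo_map_on U \<psi>" "holo_map_on V (inv_into U \<psi>)" "inj_on \<psi> U" "\<psi> ` U = V"
    "\<And>x. x \<in> U \<Longrightarrow> \<psi> x \<in> V" "\<And>y. y \<in> V \<Longrightarrow> inv_into U \<psi> y \<in> U"
    "\<And>x. x \<in> U \<Longrightarrow> inv_into U \<psi> (\<psi> x) = x" "\<And>y. y \<in> V \<Longrightarrow> \<psi> (inv_into U \<psi> y) = y"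
  using assms by (auto simp: biholomorphism_def bij_betw_def f_inv_into_f inv_into_into)

lemma borel_vimage_open:
  assumes "continuous_on U \<psi>" "open U" "B \<in> sets borel"
  shows "{x\<in>U. \<psi> x \<in> B} \<in> sets borel"
proof -
  have "\<psi> \<in> borel_measurable (restrict_space borel U)" by (rule borel_measurable_continuous_on_restrict[OF assms(1)])
  from measurable_sets[OF this assms(3)] have "\<psi> -` B \<inter> U \<in> sets (restrict_space borel U)"
    by (simp add: space_restrict_space)
  moreover have "\<psi> -` B \<inter> U = {x\<in>U. \<psi> x \<in> B}" by auto
  ultimately show ?thesis using assms(2) by (simp add: sets_restrict_space_iff)
qed

lemma borel_measurable_ennreal_indicator:
  fixes f :: "'a::topological_space \<Rightarrow> real"
  assumes "continuous_on U f" "A \<in> sets borel" "A \<subseteq> U"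
  shows "(\<lambda>x. ennreal (f x) * indicator A x) \<in> borel_measurable borel"
proof -
  have "(\<lambda>x. indicator A x *\<^sub>R f x) \<in> borel_measurable borel"
    by (rule borel_measurable_continuous_on_indicator[OF assms(2) continuous_on_subset[OF assms(1,3)]])
  then have "(\<lambda>x. ennreal (indicator A x *\<^sub>R f x)) \<in> borel_measurable borel" by measurable
  moreover have "ennreal (indicator A x *\<^sub>R f x) = ennreal (f x) * indicator A x" for x
    by (simp add: indicator_def)
  ultimately show ?thesis by simp
qed

text \<open>The real change of variables is carried over along the isometry \<open>T\<close>, and
  \<open>real_det_eq_norm_det_sq\<close> converts the Jacobian. Boundedness of \<open>V\<close>
  makes the image a set of finite measure.\<close>

lemma emeasure_biholo_image:
  fixes \<psi> :: "complex^'n \<Rightarrow> complex^'n"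
  assumes bih: "biholomorphism \<psi> U V" and U: "open U" and V: "bounded V" and B: "B \<in> sets borel" "B \<subseteq> V"
  shows "(\<integral>\<^sup>+x. ennreal ((norm (det (complex_jacobi \<psi> x)))^2) * indicator {x\<in>U. \<psi> x \<in> B} x \<partial>lborel) = emeasure lborel B"
proof -
  note bh = biholomorphismD[OF bih]
  have dim: "DIM(complex^'n) = DIM(real^('n bit0))" by simp
  obtain T :: "complex^'n \<Rightarrow> real^('n bit0)" and S where T: "linear T" "linear S" "\<And>x. S (T x) = x" "\<And>y. T (S y) = y"
    "\<And>b. b \<in> Basis \<Longrightarrow> T b \<in> Basis" "\<And>b. b \<in> Basis \<Longrightarrow> S b \<in> Basis" "\<And>x. norm (T x) = norm x"
    "distr lborel borel T = lborel"
    by (rule euclidean_basis_iso[OF dim]) blast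
  have Tm[measurable]: "T \<in> borel_measurable borel" and Sm[measurable]: "S \<in> borel_measurable borel"
    using T(1,2) by (auto intro!: borel_measurable_continuous_onI linear_continuous_on simp: linear_conv_bounded_linear)
  define A where "A = {x\<in>U. \<psi> x \<in> B}"
  define J where "J = (\<lambda>x. (norm (det (complex_jacobi \<psi> x)))^2)"
  have A: "A \<in> sets borel" unfolding A_def by (rule borel_vimage_open[OF holo_map_on_continuous[OF bh(1)] U B(1)])
  have AU: "A \<subseteq> U" by (auto simp: A_def)
  have \<psi>A: "\<psi> ` A = B" using bh(4) B(2) by (auto simp: A_def)
  have im: "T ` X = S -` X" for X
  proof -
    have "y \<in> T ` X" if "S y \<in> X" for y using imageI[OF that, of T] by (simp add: T(4))
    then show ?thesis by (auto simp: T(3))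
  qed
  have im_borel: "T ` X \<in> sets borel" if "X \<in> sets borel" for X
    unfolding im using measurable_sets[OF Sm that] by simp
  define g where "g = (\<lambda>y. T (\<psi> (S y)))"
  define g' where "g' = (\<lambda>y h. T (complex_jacobi \<psi> (S y) *v S h))"
  have bT: "bounded_linear T" and bS: "bounded_linear S" using T(1,2) by (auto simp: linear_conv_bounded_linear)
  have der: "(g has_derivative g' y) (at y within T ` A)" if y: "y \<in> T ` A" for y
  proof -
    have SU: "S y \<in> U" using y AU by (auto simp: im)
    have 1: "(S has_derivative S) (at y)" by (rule bounded_linear_imp_has_derivative[OF bS])
    have 2: "(\<psi> has_derivative (\<lambda>h. complex_jacobi \<psi> (S y) *v h)) (at (S y))"
      using holo_map_on_has_derivative(1)[OF bh(1) SU] by (simp add: complex_jacobi_mult_vec[OF bh(1) SU])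
    have "(g has_derivative g' y) (at y)" unfolding g_def g'_def
      by (rule bounded_linear.has_derivative[OF bT has_derivative_compose[OF 1 2]])
    then show ?thesis by (rule has_derivative_at_withinI)
  qed
  have inj: "inj_on g (T ` A)"
  proof (rule inj_onI)
    fix x y assume *: "x \<in> T ` A" "y \<in> T ` A" "g x = g y"
    then have "\<psi> (S x) = \<psi> (S y)" using T(3) unfolding g_def by metis
    then have "S x = S y" using *(1,2) AU bh(3) by (auto simp: im inj_on_def subset_iff)
    then show "x = y" using T(4) by metis
  qed
  have gim: "g ` (T ` A) = T ` B" by (auto simp: g_def image_image T(3) \<psi>A[symmetric])
  have "bounded (T ` B)" using bounded_linear_image[OF bounded_subset[OF V B(2)] bT] .
  moreover have TB: "T ` B \<in> sets borel" by (rule im_borel[OF B(1)])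
  ultimately have "T ` B \<in> lmeasurable" by (intro bounded_set_imp_lmeasurable) auto
  then have "((\<lambda>y. \<bar>det (matrix (g' y))\<bar>) has_integral measure lebesgue (T ` B)) (T ` A)"
    using has_measure_differentiable_image[OF _ der inj, of "measure lebesgue (T ` B)"] im_borel[OF A] gim by auto
  moreover have "\<bar>det (matrix (g' y))\<bar> = J (S y)" for y
    unfolding g'_def J_def using T by (intro real_det_eq_norm_det_sq) auto
  ultimately have "((\<lambda>y. J (S y)) has_integral measure lebesgue (T ` B)) (T ` A)" by simp
  from nn_integral_has_integral_lebesgue'[OF _ this]
  have "(\<integral>\<^sup>+y. ennreal (J (S y)) * indicator (T ` A) y \<partial>lborel) = ennreal (measure lebesgue (T ` B))"
    by (simp add: J_def)
  also have "measure lebesgue (T ` B) = measure lborel (T ` B)" using TB by (simp add: measure_completion)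
  also have "ennreal \<dots> = emeasure lborel (T ` B)"
    using emeasure_bounded_finite[OF \<open>bounded (T ` B)\<close>] by (intro emeasure_eq_ennreal_measure[symmetric]) auto
  also have "\<dots> = emeasure (distr lborel borel T) (T ` B)" by (simp add: T(8))
  also have "\<dots> = emeasure lborel (T -` T ` B)" using TB by (subst emeasure_distr) auto
  also have "T -` T ` B = B" using T(3) by (auto simp: image_iff) (metis T(3))
  finally have 1: "(\<integral>\<^sup>+y. ennreal (J (S y)) * indicator (T ` A) y \<partial>lborel) = emeasure lborel B" .
  have "continuous_on U J" unfolding J_def
    by (intro continuous_intros holo_on_continuous[OF holo_on_det_jacobi[OF bh(1) U]])
  from borel_measurable_ennreal_indicator[OF this A AU]
  have m[measurable]: "(\<lambda>x. ennreal (J x) * indicator A x) \<in> borel_measurable borel" .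
  have ind: "indicator (T ` A) y = (indicator A (S y) :: ennreal)" for y by (auto simp: im indicator_def)
  have "(\<integral>\<^sup>+y. ennreal (J (S y)) * indicator (T ` A) y \<partial>lborel) = (\<integral>\<^sup>+y. (\<lambda>x. ennreal (J x) * indicator A x) (S y) \<partial>distr lborel borel T)"
    by (simp add: T(8) ind)
  also have "\<dots> = (\<integral>\<^sup>+x. ennreal (J x) * indicator A x \<partial>lborel)"
    by (subst nn_integral_distr) (auto simp: T(3))
  finally show ?thesis using 1 by (simp add: J_def A_def)
qed

text \<open>Stated for measures so that both the nonnegative and the Bochner integral can be
  transformed from it. Setting \<psi> to 0 off \<open>U\<close> makes it a Borel function on the
  whole space; the density \<open>J\<close> discards that part.\<close>

lemma distr_biholo:
  fixes \<psi> :: "complex^'n \<Rightarrow> complex^'n"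
  assumes bih: "biholomorphism \<psi> U V" and U: "open U" and V: "bounded V" "open V"
  defines "J \<equiv> (\<lambda>x. ennreal ((norm (det (complex_jacobi \<psi> x)))^2) * indicator U x)"
    and "\<psi>' \<equiv> (\<lambda>x. if x \<in> U then \<psi> x else 0)"
  shows "distr (density lborel J) borel \<psi>' = density lborel (indicator V)"
    "J \<in> borel_measurable borel" "\<psi>' \<in> borel_measurable borel"
proof -
  note bh = biholomorphismD[OF bih]
  have U': "U \<in> sets borel" and V': "V \<in> sets borel" using U V by auto
  have "continuous_on U (\<lambda>x. (norm (det (complex_jacobi \<psi> x)))^2)"
    by (intro continuous_intros holo_on_continuous[OF holo_on_det_jacobi[OF bh(1) U]])
  from borel_measurable_ennreal_indicator[OF this U']
  show J[measurable]: "J \<in> borel_measurable borel" by (simp add: J_def)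
  show \<psi>'[measurable]: "\<psi>' \<in> borel_measurable borel"
    unfolding \<psi>'_def by (rule borel_measurable_continuous_on_if[OF U' holo_map_on_continuous[OF bh(1)]]) simp
  show "distr (density lborel J) borel \<psi>' = density lborel (indicator V)"
  proof (rule measure_eqI)
    fix B assume "B \<in> sets (distr (density lborel J) borel \<psi>')"
    then have B[measurable]: "B \<in> sets borel" by simp
    have "emeasure (distr (density lborel J) borel \<psi>') B = (\<integral>\<^sup>+x. J x * indicator (\<psi>' -` B) x \<partial>lborel)"
      using measurable_sets[OF \<psi>' B] by (simp add: emeasure_distr emeasure_density)
    also have "\<dots> = (\<integral>\<^sup>+x. ennreal ((norm (det (complex_jacobi \<psi> x)))^2) * indicator {x\<in>U. \<psi> x \<in> B \<inter> V} x \<partial>lborel)"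
      by (intro nn_integral_cong) (auto simp: J_def \<psi>'_def indicator_def bh(5))
    also have "\<dots> = emeasure lborel (B \<inter> V)"
      by (rule emeasure_biholo_image[OF bih U V(1)]) (use B V' in auto)
    also have "\<dots> = emeasure (density lborel (indicator V)) B"
    proof -
      have "emeasure (density lborel (indicator V)) B = (\<integral>\<^sup>+x. indicator V x * indicator B x \<partial>lborel)"
        using V' by (intro emeasure_density) auto
      also have "\<dots> = (\<integral>\<^sup>+x. indicator (B \<inter> V) x \<partial>lborel)"
        by (intro nn_integral_cong) (auto simp: indicator_def)
      also have "\<dots> = emeasure lborel (B \<inter> V)" using V' by (intro nn_integral_indicator) auto
      finally show ?thesis by simp
    qed
    finally show "emeasure (distr (density lborel J) borel \<psi>') B = emeasure (density lborel (indicator V)) B" .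
  qed simp
qed

lemma nn_integral_biholo:
  fixes \<psi> :: "complex^'n \<Rightarrow> complex^'n"
  assumes bih: "biholomorphism \<psi> U V" and U: "open U" and V: "bounded V" "open V"
    and f: "(\<lambda>y. f y * indicator V y) \<in> borel_measurable borel"
  shows "(\<integral>\<^sup>+y. f y * indicator V y \<partial>lborel) =
    (\<integral>\<^sup>+x. f (\<psi> x) * ennreal ((norm (det (complex_jacobi \<psi> x)))^2) * indicator U x \<partial>lborel)"
proof -
  define J where "J = (\<lambda>x. ennreal ((norm (det (complex_jacobi \<psi> x)))^2) * indicator U x)"
  define \<psi>' where "\<psi>' = (\<lambda>x. if x \<in> U then \<psi> x else 0)"
  note d = distr_biholo[OF bih U V, folded J_def \<psi>'_def]
  note eq = d(1) note J[measurable] = d(2) note \<psi>'[measurable] = d(3)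
  note bh = biholomorphismD[OF bih]
  have V': "V \<in> sets borel" using V by auto
  have "(\<integral>\<^sup>+y. f y * indicator V y \<partial>lborel) = (\<integral>\<^sup>+y. f y * indicator V y \<partial>density lborel (indicator V))"
    using V' f by (subst nn_integral_density) (auto intro!: nn_integral_cong simp: indicator_def)
  also have "\<dots> = (\<integral>\<^sup>+y. f y * indicator V y \<partial>distr (density lborel J) borel \<psi>')" by (simp only: eq)
  also have "\<dots> = (\<integral>\<^sup>+x. f (\<psi>' x) * indicator V (\<psi>' x) \<partial>density lborel J)"
    using f by (subst nn_integral_distr) auto
  also have "\<dots> = (\<integral>\<^sup>+x. J x * (f (\<psi>' x) * indicator V (\<psi>' x)) \<partial>lborel)"
    using measurable_compose[OF \<psi>' f] by (subst nn_integral_density) auto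
  also have "\<dots> = (\<integral>\<^sup>+x. f (\<psi> x) * ennreal ((norm (det (complex_jacobi \<psi> x)))^2) * indicator U x \<partial>lborel)"
    by (intro nn_integral_cong) (auto simp: J_def \<psi>'_def indicator_def bh(5) mult.commute)
  finally show ?thesis .
qed

lemma integral_biholo:
  fixes \<psi> :: "complex^'n \<Rightarrow> complex^'n" and f :: "complex^'n \<Rightarrow> complex"
  assumes bih: "biholomorphism \<psi> U V" and U: "open U" and V: "bounded V" "open V"
    and f: "continuous_on V f"
  shows "(LINT y:V|lborel. f y) = (LINT x:U|lborel. (norm (det (complex_jacobi \<psi> x)))^2 *\<^sub>R f (\<psi> x))"
proof -
  define J where "J = (\<lambda>x. ennreal ((norm (det (complex_jacobi \<psi> x)))^2) * indicator U x)"
  define \<psi>' where "\<psi>' = (\<lambda>x. if x \<in> U then \<psi> x else 0)"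
  note d = distr_biholo[OF bih U V, folded J_def \<psi>'_def]
  note eq = d(1) note J[measurable] = d(2) note \<psi>'[measurable] = d(3)
  note bh = biholomorphismD[OF bih]
  define J' where "J' = (\<lambda>x. indicator U x * (norm (det (complex_jacobi \<psi> x)))^2)"
  have JJ: "J = (\<lambda>x. ennreal (J' x))" by (auto simp: J_def J'_def indicator_def)
  have J'm: "J' \<in> borel_measurable borel"
  proof -
    have "(\<lambda>x. indicator U x *\<^sub>R ((norm (det (complex_jacobi \<psi> x)))^2)) \<in> borel_measurable borel"
      using U by (intro borel_measurable_continuous_on_indicator continuous_intros
          holo_on_continuous[OF holo_on_det_jacobi[OF bh(1) U]]) auto
    then show ?thesis by (simp add: J'_def)
  qed
  define g where "g = (\<lambda>y. indicator V y *\<^sub>R f y)"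
  have gm[measurable]: "g \<in> borel_measurable borel"
    unfolding g_def using V by (intro borel_measurable_continuous_on_indicator f) auto
  have V': "(\<lambda>x. ennreal (indicator V x)) = indicator V" by (auto simp: indicator_def)
  have "(LINT y:V|lborel. f y) = (LINT y|lborel. indicator V y *\<^sub>R g y)"
    unfolding set_lebesgue_integral_def by (intro Bochner_Integration.integral_cong) (auto simp: g_def indicator_def)
  also have "\<dots> = integral\<^sup>L (density lborel (\<lambda>x. ennreal (indicator V x))) g"
    using V by (subst integral_density) auto
  also have "\<dots> = integral\<^sup>L (distr (density lborel J) borel \<psi>') g" by (simp only: V' eq)
  also have "\<dots> = integral\<^sup>L (density lborel J) (\<lambda>x. g (\<psi>' x))"
    by (subst integral_distr) auto
  also have "\<dots> = (LINT x|lborel. J' x *\<^sub>R g (\<psi>' x))"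
    unfolding JJ using J'm measurable_compose[OF \<psi>' gm] by (subst integral_density) (auto simp: J'_def)
  also have "\<dots> = (LINT x:U|lborel. (norm (det (complex_jacobi \<psi> x)))^2 *\<^sub>R f (\<psi> x))"
    unfolding set_lebesgue_integral_def
    by (intro Bochner_Integration.integral_cong) (auto simp: J'_def \<psi>'_def g_def indicator_def bh(5))
  finally show ?thesis .
qed

text \<open>Multiplication by a unit scalar is a biholomorphism of the ball onto itself with
  Jacobian of modulus 1. The support condition on \<open>H\<close> confines the integral to such a
  ball.\<close>

lemma nn_integral_rotation:
  fixes H :: "complex^'n \<Rightarrow> ennreal"
  assumes c: "norm c = 1" and H: "H \<in> borel_measurable borel" and z: "\<And>w. w \<notin> ball 0 R \<Longrightarrow> H w = 0"
  shows "(\<integral>\<^sup>+v. H (c *s v) \<partial>lborel) = (\<integral>\<^sup>+v. H v \<partial>lborel)"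
proof -
  let ?\<psi> = "\<lambda>v::complex^'n. c *s v"
  have c0: "c \<noteq> 0" using c by auto
  have inj: "inj_on ?\<psi> (ball 0 R)" using c0 by (auto simp: inj_on_def vec_eq_iff)
  have inv: "inv_into (ball 0 R) ?\<psi> w = inverse c *s w" if "w \<in> ball 0 R" for w
    by (rule inv_into_f_eq[OF inj]) (use that c0 c in \<open>auto simp: norm_vector_scalar_mult norm_inverse\<close>)
  have im: "?\<psi> ` ball 0 R = ball 0 R"
  proof
    show "ball 0 R \<subseteq> ?\<psi> ` ball 0 R"
    proof
      fix w :: "complex^'n" assume "w \<in> ball 0 R"
      then have "inverse c *s w \<in> ball 0 R" "w = c *s (inverse c *s w)"
        using c c0 by (auto simp: norm_vector_scalar_mult norm_inverse)
      then show "w \<in> ?\<psi> ` ball 0 R" by blast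
    qed
  qed (use c in \<open>auto simp: norm_vector_scalar_mult\<close>)
  have h: "holo_map_on S (\<lambda>v::complex^'n. d *s v)" for S d
    using holo_map_on_affine[of S 0 d] by simp
  have "holo_map_on (ball 0 R) (inv_into (ball 0 R) ?\<psi>)"
    unfolding holo_map_on_def holo_on_def
  proof (intro allI ballI)
    fix i and w :: "complex^'n" assume w: "w \<in> ball 0 R"
    obtain f' where f': "((\<lambda>z. (inverse c *s z) $ i) has_derivative f') (at w)" "\<forall>c v. f' (c *s v) = c * f' v"
      using h[of "ball 0 R" "inverse c"] w unfolding holo_map_on_def holo_on_def by blast
    have "((\<lambda>z. inv_into (ball 0 R) ?\<psi> z $ i) has_derivative f') (at w)"
      by (rule has_derivative_transform_within_open[OF f'(1) _ w]) (auto simp: inv simp del: vector_smult_component)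
    then show "\<exists>f'. ((\<lambda>z. inv_into (ball 0 R) ?\<psi> z $ i) has_derivative f') (at w) \<and> (\<forall>c v. f' (c *s v) = c * f' v)"
      using f' by blast
  qed
  then have bih: "biholomorphism ?\<psi> (ball 0 R) (ball 0 R)"
    using h inj im by (auto simp: biholomorphism_def bij_betw_def)
  have det1: "norm (det (complex_jacobi ?\<psi> x)) = 1" for x
  proof -
    have n: "complex_jacobi ?\<psi> x $ i $ j = c * axis j 1 $ i" for i j
    proof -
      have "((\<lambda>x. (c *s x) $ i) has_derivative (\<lambda>v. c * v $ i)) (at x)"
        by (simp, intro has_derivative_mult_right bounded_linear_imp_has_derivative bounded_linear_vec_nth)
      from dird_eqI[OF this] show ?thesis using complex_jacobi_nth[OF h[of UNIV c]] by simp
    qed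
    have "det (complex_jacobi ?\<psi> x) = (\<Prod>i\<in>UNIV. complex_jacobi ?\<psi> x $ i $ i)"
      by (rule det_diagonal) (simp add: n axis_def)
    then show ?thesis using c by (simp add: n norm_power)
  qed
  have Hi: "H v * indicator (ball 0 R) v = H v" for v using z[of v] by (auto simp: indicator_def)
  have Hc: "H (c *s v) * indicator (ball 0 R) v = H (c *s v)" for v
    using z[of "c *s v"] c by (auto simp: indicator_def norm_vector_scalar_mult)
  show ?thesis
    using nn_integral_biholo[OF bih open_ball bounded_ball open_ball, of H] H Hi Hc by (simp add: det1)
qed

text \<open>Cauchy's formula bounds \<open>norm (g 0)\<close> by the mean of
  \<open>norm (g (e x))\<close> over the circle; the passage to the mean of powers is Jensen's
  inequality, derived here from Young's.\<close>

lemma circle_mean_powr: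
  assumes g: "g holomorphic_on cball 0 1" and s: "s > 1"
  shows "ennreal (norm (g 0) powr s) \<le>
    (\<integral>\<^sup>+\<theta>. ennreal (norm (g (exp (2 * of_real pi * \<i> * of_real \<theta>))) powr s) * indicator {0..1} \<theta> \<partial>lborel)"
proof -
  define e where "e = (\<lambda>\<theta>::real. exp (2 * of_real pi * \<i> * of_real \<theta>))"
  have ne: "norm (e \<theta>) = 1" for \<theta> by (simp add: e_def)
  have ce: "continuous_on S e" for S unfolding e_def by (intro continuous_intros)
  have cg: "continuous_on {0..1} (\<lambda>\<theta>. g (e \<theta>))"
    by (rule continuous_on_compose2[OF holomorphic_on_imp_continuous_on[OF g] ce]) (auto simp: ne)
  have "((\<lambda>u. g u / (u - 0)) has_contour_integral (2 * of_real pi * \<i> * g 0)) (circlepath 0 1)"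
    by (rule Cauchy_integral_circlepath_simple[OF g]) simp
  then have "((\<lambda>x. g (e x) / e x * (2 * pi * \<i> * e x)) has_integral (2 * of_real pi * \<i> * g 0)) {0..1}"
    unfolding has_contour_integral_def
    by (rule has_integral_eq[rotated]) (simp add: vector_derivative_circlepath01, simp add: circlepath e_def)
  from has_integral_mult_right[OF this, of "inverse (2 * of_real pi * \<i>)"]
  have hi: "((\<lambda>x. g (e x)) has_integral g 0) {0..1}"
    by (auto simp: field_simps e_def)
  define h where "h = (\<lambda>x. norm (g (e x)))"
  have ch: "continuous_on {0..1} h" unfolding h_def by (intro continuous_intros cg)
  have h0: "h x \<ge> 0" for x by (simp add: h_def)
  define m where "m = integral {0..1} h"
  have m0: "m \<ge> 0" unfolding m_def by (rule integral_nonneg[OF integrable_continuous_interval[OF ch]]) (auto simp: h0)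
  have "norm (g 0) \<le> m"
    unfolding m_def integral_unique[OF hi, symmetric]
    by (rule integral_norm_bound_integral[OF has_integral_integrable[OF hi] integrable_continuous_interval[OF ch]]) (simp add: h_def)
  then have le1: "norm (g 0) powr s \<le> m powr s" using s by (intro powr_mono2) auto
  have chs: "continuous_on {0..1} (\<lambda>x. h x powr s)"
    using s by (intro continuous_on_powr' ch continuous_intros) (auto simp: h0)
  define q where "q = s / (s - 1)"
  have q: "q > 1" "1 / s + 1 / q = 1" "(s - 1) * q = s" using s by (auto simp: q_def field_simps)
  \<comment> \<open>Young's inequality against the constant \<open>m powr (s - 1)\<close>, whose
    \<open>q\<close>-th power is \<open>m powr s\<close>. Integrated, the left side becomes
    \<open>m powr s\<close>, and the term \<open>m powr s / q\<close> can be absorbed.\<close>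
  have Y: "h x * m powr (s - 1) \<le> h x powr s / s + m powr s / q" for x
    using Youngs_inequality[OF s q(1,2) h0[of x] powr_ge_zero[of m "s - 1"]] by (simp add: powr_powr q(3))
  have i1: "((\<lambda>x. h x * m powr (s - 1)) has_integral m * m powr (s - 1)) {0..1}"
    unfolding m_def by (intro has_integral_mult_left integrable_integral integrable_continuous_interval ch)
  define I where "I = integral {0..1} (\<lambda>x. h x powr s)"
  have I: "((\<lambda>x. h x powr s) has_integral I) {0..1}"
    unfolding I_def by (intro integrable_integral integrable_continuous_interval chs)
  have i2: "((\<lambda>x. h x powr s / s + m powr s / q) has_integral (I / s + m powr s / q)) {0..1}"
    using has_integral_add[OF has_integral_divide[OF I, of s] has_integral_const_real[of "m powr s / q" 0 1]] by simp
  have "m * m powr (s - 1) \<le> I / s + m powr s / q"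
    by (rule has_integral_le[OF i1 i2]) (rule Y)
  moreover have "m * m powr (s - 1) = m powr s"
    using m0 powr_mult_base[of m "s - 1"] by simp
  moreover have "m powr s / q = m powr s - m powr s / s" using q(2) s by (simp add: q_def field_simps)
  ultimately have "m powr s / s \<le> I / s" by linarith
  then have "m powr s \<le> I" using s by (simp add: divide_le_cancel)
  then have "norm (g 0) powr s \<le> I" using le1 by linarith
  then have "ennreal (norm (g 0) powr s) \<le> ennreal I" by (rule ennreal_leI)
  also have "ennreal I = (\<integral>\<^sup>+\<theta>. ennreal (h \<theta> powr s) * indicator {0..1} \<theta> \<partial>lborel)"
    by (rule nn_integral_has_integral_lebesgue'[OF _ I, symmetric]) simp
  finally show ?thesis by (simp add: h_def e_def)
qed

text \<open>The circle inequality holds on each complex line through \<open>a\<close>. After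
  integrating over all \<open>v\<close> in the ball and exchanging the integrals,
  \<open>nn_integral_rotation\<close> makes the inner integral independent of the angle.\<close>

lemma holo_mean_value_powr:
  fixes f :: "complex^'n \<Rightarrow> complex"
  assumes f: "holo_on (ball a R) f" and s: "s > 1"
  shows "ennreal (norm (f a) powr s) * emeasure lborel (ball a R) \<le>
    (\<integral>\<^sup>+x. ennreal (norm (f x) powr s) * indicator (ball a R) x \<partial>lborel)"
proof -
  define e where "e = (\<lambda>\<theta>::real. exp (2 * of_real pi * \<i> * of_real \<theta>))"
  have ne: "norm (e \<theta>) = 1" for \<theta> by (simp add: e_def)
  define H where "H = (\<lambda>w. ennreal (norm (f (a + w)) powr s) * indicator (ball 0 R) w)"
  have cf: "continuous_on (ball 0 R) (\<lambda>w. norm (f (a + w)) powr s)"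
    using s by (intro continuous_on_powr' continuous_on_norm continuous_on_compose2[OF holo_on_continuous[OF f]] continuous_intros)
       (auto simp: dist_norm)
  have H[measurable]: "H \<in> borel_measurable borel"
    unfolding H_def by (rule borel_measurable_ennreal_indicator[OF cf]) auto
  have circ: "ennreal (norm (f a) powr s) * indicator (ball 0 R) v \<le> (\<integral>\<^sup>+\<theta>. H (e \<theta> *s v) * indicator {0..1} \<theta> \<partial>lborel)" for v
  proof (cases "v \<in> ball 0 R")
    case True
    then have v: "norm v < R" by simp
    define g where "g = (\<lambda>c. f (a + c *s v))"
    have inb: "a + c *s v \<in> ball a R" if "norm c \<le> 1" for c
    proof -
      have "norm c * norm v \<le> 1 * norm v" by (rule mult_right_mono[OF that]) simp
      then show ?thesis using v by (simp add: dist_norm norm_vector_scalar_mult)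
    qed
    have "g holomorphic_on cball 0 1"
    proof (rule holomorphic_onI)
      fix c :: complex assume "c \<in> cball 0 1"
      then have "(g has_field_derivative dird f v (a + c *s v)) (at c)"
        unfolding g_def by (intro holo_on_line[OF f] inb) simp
      then show "g field_differentiable at c within cball 0 1"
        by (meson field_differentiable_def has_field_derivative_at_within)
    qed
    from circle_mean_powr[OF this s]
    have "ennreal (norm (f a) powr s) \<le> (\<integral>\<^sup>+\<theta>. ennreal (norm (f (a + e \<theta> *s v)) powr s) * indicator {0..1} \<theta> \<partial>lborel)"
      by (simp add: g_def e_def)
    also have "\<dots> = (\<integral>\<^sup>+\<theta>. H (e \<theta> *s v) * indicator {0..1} \<theta> \<partial>lborel)"
      using v by (intro nn_integral_cong) (simp add: H_def norm_vector_scalar_mult ne)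
    finally show ?thesis using True by simp
  qed simp
  have "(\<lambda>x. e (fst x) *s snd x) \<in> borel_measurable (borel \<Otimes>\<^sub>M (borel :: (complex^'n) measure))"
  proof -
    have "continuous_on UNIV (\<lambda>x::real \<times> (complex^'n). e (fst x) *s snd x)"
      unfolding vector_scalar_mult_def e_def by (intro continuous_intros)
    from borel_measurable_continuous_onI[OF this] show ?thesis by (simp add: borel_prod)
  qed
  then have [measurable]: "(\<lambda>x. e (fst x) *s snd x) \<in> borel_measurable (lborel \<Otimes>\<^sub>M (lborel :: (complex^'n) measure))"
    by (simp cong: measurable_cong_sets)
  have "ennreal (norm (f a) powr s) * emeasure lborel (ball a R) = ennreal (norm (f a) powr s) * emeasure lborel (ball (0::complex^'n) R)"
    by (cases "R \<ge> 0") (simp_all add: emeasure_ball ball_empty)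
  also have "\<dots> = (\<integral>\<^sup>+v. ennreal (norm (f a) powr s) * indicator (ball (0::complex^'n) R) v \<partial>lborel)"
    by (simp add: nn_integral_cmult_indicator)
  also have "\<dots> \<le> (\<integral>\<^sup>+v. (\<integral>\<^sup>+\<theta>. H (e \<theta> *s v) * indicator {0..1} \<theta> \<partial>lborel) \<partial>lborel)"
    by (intro nn_integral_mono circ)
  also have "\<dots> = (\<integral>\<^sup>+\<theta>. (\<integral>\<^sup>+v. H (e \<theta> *s v) * indicator {0..1} \<theta> \<partial>lborel) \<partial>lborel)"
  proof -
    have "(\<lambda>(\<theta>, v). H (e \<theta> *s v) * indicator {0..1} \<theta>) \<in> borel_measurable (lborel \<Otimes>\<^sub>M (lborel :: (complex^'n) measure))"
      unfolding case_prod_beta by measurable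
    from lborel_pair.Fubini'[OF this] show ?thesis by simp
  qed
  also have "\<dots> = (\<integral>\<^sup>+\<theta>. (\<integral>\<^sup>+v. H v \<partial>lborel) * indicator {0..1} \<theta> \<partial>(lborel::real measure))"
  proof (intro nn_integral_cong)
    fix \<theta> :: real
    have [measurable]: "(\<lambda>v::complex^'n. e \<theta> *s v) \<in> borel_measurable borel"
      by (intro borel_measurable_continuous_onI bounded_linear.continuous_on[OF bounded_linear_vector_scalar_mult_right] continuous_intros)
    have "(\<integral>\<^sup>+v. H (e \<theta> *s v) * indicator {0..1} \<theta> \<partial>lborel) = (\<integral>\<^sup>+v. H (e \<theta> *s v) \<partial>lborel) * indicator {0..1} \<theta>"
      by (rule nn_integral_multc) measurable
    also have "(\<integral>\<^sup>+v. H (e \<theta> *s v) \<partial>lborel) = (\<integral>\<^sup>+v. H v \<partial>lborel)"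
      by (rule nn_integral_rotation[OF ne H, of R]) (simp add: H_def)
    finally show "(\<integral>\<^sup>+v. H (e \<theta> *s v) * indicator {0..1} \<theta> \<partial>lborel) = (\<integral>\<^sup>+v. H v \<partial>lborel) * indicator {0..1} \<theta>" .
  qed
  also have "\<dots> = (\<integral>\<^sup>+v. H v \<partial>lborel)"
    by (simp add: nn_integral_cmult_indicator)
  also have "\<dots> = (\<integral>\<^sup>+x. ennreal (norm (f x) powr s) * indicator (ball a R) x \<partial>lborel)"
  proof -
    have "continuous_on (ball a R) (\<lambda>w. norm (f w) powr s)"
      using s by (intro continuous_on_powr' continuous_on_norm holo_on_continuous[OF f] continuous_intros) auto
    then have [measurable]: "(\<lambda>x. ennreal (norm (f x) powr s) * indicator (ball a R) x) \<in> borel_measurable borel"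
      by (rule borel_measurable_ennreal_indicator) auto
    have "(\<integral>\<^sup>+x. ennreal (norm (f x) powr s) * indicator (ball a R) x \<partial>lborel) =
       (\<integral>\<^sup>+x. ennreal (norm (f x) powr s) * indicator (ball a R) x \<partial>distr lborel borel ((+) a))"
      by (simp add: lborel_distr_plus)
    also have "\<dots> = (\<integral>\<^sup>+v. ennreal (norm (f (a + v)) powr s) * indicator (ball a R) (a + v) \<partial>lborel)"
      by (subst nn_integral_distr) auto
    also have "\<dots> = (\<integral>\<^sup>+v. H v \<partial>lborel)"
      by (intro nn_integral_cong) (auto simp: H_def indicator_def dist_norm)
    finally show ?thesis by simp
  qed
  finally show ?thesis .
qed

section \<open>The Bergman kernel\<close>

lemma holo_on_cong_open:
  assumes "holo_on U f" "open U" "\<And>z. z \<in> U \<Longrightarrow> g z = f z"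
  shows "holo_on U g"
  unfolding holo_on_def
proof
  fix z assume z: "z \<in> U"
  obtain f' where f': "(f has_derivative f') (at z)" "\<forall>c v. f' (c *s v) = c * f' v"
    using assms(1) z by (auto simp: holo_on_def)
  have "(g has_derivative f') (at z)"
    by (rule has_derivative_transform_within_open[OF f'(1) assms(2) z]) (simp add: assms(3))
  with f'(2) show "\<exists>f'. (g has_derivative f') (at z) \<and> (\<forall>c v. f' (c *s v) = c * f' v)" by blast
qed

section \<open>The space of square integrable holomorphic functions and its reproducing
  kernel\<close>

locale bounded_domain =
  fixes U :: "(complex^'n) set"
  assumes open_U: "open U" and bounded_U: "bounded U" and nonempty_U: "U \<noteq> {}" and connected_U: "connected U"
begin

definition ip :: "(complex^'n \<Rightarrow> complex) \<Rightarrow> (complex^'n \<Rightarrow> complex) \<Rightarrow> complex" where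
  "ip f g = (LINT z:U|lborel. f z * cnj (g z))"

definition sqnorm :: "(complex^'n \<Rightarrow> complex) \<Rightarrow> real" where
  "sqnorm f = (LINT z:U|lborel. (norm (f z))^2)"

abbreviation "A2 \<equiv> bergman_L2 U"

lemma A2_holo: "f \<in> A2 \<Longrightarrow> holo_on U f" by (simp add: bergman_L2_def)

lemma U_borel [measurable, simp]: "U \<in> sets borel" using open_U by simp

lemma emeasure_U_finite: "emeasure lborel U < \<infinity>"
  using emeasure_bounded_finite[OF bounded_U] by simp

lemma set_measurable_continuous:
  fixes f :: "complex^'n \<Rightarrow> 'b::{banach, second_countable_topology}"
  shows "continuous_on U f \<Longrightarrow> set_borel_measurable lborel U f"
  unfolding set_borel_measurable_def using borel_measurable_continuous_on_indicator[OF U_borel] by simp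

lemma A2_const: "(\<lambda>z. c) \<in> A2"
  unfolding bergman_L2_def using emeasure_U_finite by (auto simp: set_integrable_def)

lemma set_integrable_ip:
  assumes f: "f \<in> A2" and g: "g \<in> A2"
  shows "set_integrable lborel U (\<lambda>z. f z * cnj (g z))"
proof -
  have cf: "continuous_on U f" "continuous_on U g" using f g A2_holo holo_on_continuous by auto
  have "set_integrable lborel U (\<lambda>z. (norm (f z))^2 + (norm (g z))^2)"
    using f g by (intro set_integral_add) (auto simp: bergman_L2_def)
  then show ?thesis
  proof (rule set_integrable_bound)
    show "set_borel_measurable lborel U (\<lambda>z. f z * cnj (g z))"
      by (intro set_measurable_continuous continuous_intros cf)
    show "AE x in lborel. x \<in> U \<longrightarrow> norm (f x * cnj (g x)) \<le> norm ((norm (f x))^2 + (norm (g x))^2)"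
    proof (intro AE_I2 impI)
      fix x
      have "0 \<le> (norm (f x) - norm (g x))^2" by simp
      then have "2 * (norm (f x) * norm (g x)) \<le> norm (f x)^2 + norm (g x)^2"
        by (simp add: power2_diff)
      moreover have "0 \<le> norm (f x) * norm (g x)" by simp
      ultimately have "norm (f x) * norm (g x) \<le> norm (f x)^2 + norm (g x)^2" by linarith
      then show "norm (f x * cnj (g x)) \<le> norm ((norm (f x))^2 + (norm (g x))^2)"
        by (simp add: norm_mult)
    qed
  qed
qed

lemma A2_cmult: assumes "f \<in> A2" shows "(\<lambda>z. c * f z) \<in> A2"
proof -
  have "set_integrable lborel U (\<lambda>z. (norm c)^2 * (norm (f z))^2)"
    using assms by (intro set_integrable_mult_right) (auto simp: bergman_L2_def)
  then show ?thesis using assms by (auto simp: bergman_L2_def norm_mult power_mult_distrib intro: holo_on_cmult)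
qed

lemma A2_add: assumes f: "f \<in> A2" and g: "g \<in> A2" shows "(\<lambda>z. f z + g z) \<in> A2"
proof -
  have cf: "continuous_on U f" "continuous_on U g" using f g A2_holo holo_on_continuous by auto
  have "set_integrable lborel U (\<lambda>z. 2 * ((norm (f z))^2 + (norm (g z))^2))"
    using f g by (intro set_integrable_mult_right set_integral_add) (auto simp: bergman_L2_def)
  then have "set_integrable lborel U (\<lambda>z. (norm (f z + g z))^2)"
  proof (rule set_integrable_bound)
    show "set_borel_measurable lborel U (\<lambda>z. (norm (f z + g z))^2)"
      by (intro set_measurable_continuous continuous_intros cf)
    show "AE x in lborel. x \<in> U \<longrightarrow> norm ((norm (f x + g x))^2) \<le> norm (2 * ((norm (f x))^2 + (norm (g x))^2))"
    proof (intro AE_I2 impI)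
      fix x
      have "(norm (f x + g x))^2 \<le> (norm (f x) + norm (g x))^2" by (intro power_mono norm_triangle_ineq) auto
      moreover have "0 \<le> (norm (f x) - norm (g x))^2" by simp
      ultimately show "norm ((norm (f x + g x))^2) \<le> norm (2 * ((norm (f x))^2 + (norm (g x))^2))"
        by (simp add: power2_diff power2_sum)
    qed
  qed
  then show ?thesis using f g by (auto simp: bergman_L2_def intro: holo_on_add)
qed

lemma A2_diff: "f \<in> A2 \<Longrightarrow> g \<in> A2 \<Longrightarrow> (\<lambda>z. f z - g z) \<in> A2"
  using A2_add[of f "\<lambda>z. (-1) * g z"] A2_cmult[of g "-1"] by simp

lemma ip_add_left: assumes "f \<in> A2" "g \<in> A2" "h \<in> A2" shows "ip (\<lambda>z. f z + g z) h = ip f h + ip g h"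
  using set_integral_add(2)[OF set_integrable_ip[OF assms(1,3)] set_integrable_ip[OF assms(2,3)]]
  by (simp add: ip_def algebra_simps)

lemma ip_cmult_left: "ip (\<lambda>z. c * f z) h = c * ip f h"
  by (simp add: ip_def mult.assoc)

lemma ip_cnj: "ip g f = cnj (ip f g)"
proof -
  have "ip g f = (LINT z:U|lborel. cnj (f z * cnj (g z)))" by (simp add: ip_def mult.commute)
  also have "\<dots> = cnj (ip f g)"
    unfolding ip_def set_lebesgue_integral_def
    using Bochner_Integration.integral_cnj[of lborel "\<lambda>x. indicator U x *\<^sub>R (f x * cnj (g x))"] by simp
  finally show ?thesis .
qed

lemma ip_add_right: "f \<in> A2 \<Longrightarrow> g \<in> A2 \<Longrightarrow> h \<in> A2 \<Longrightarrow> ip h (\<lambda>z. f z + g z) = ip h f + ip h g"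
  using ip_add_left[of f g h] ip_cnj[of h "\<lambda>z. f z + g z"] ip_cnj[of h f] ip_cnj[of h g] by simp

lemma ip_cmult_right: "ip h (\<lambda>z. c * f z) = cnj c * ip h f"
  using ip_cmult_left[of c f h] ip_cnj[of h "\<lambda>z. c * f z"] ip_cnj[of h f] by simp

lemma ip_self: "ip f f = complex_of_real (sqnorm f)"
proof -
  have "ip f f = (LINT z:U|lborel. complex_of_real ((norm (f z))^2))"
    by (simp only: ip_def complex_norm_square)
  also have "\<dots> = complex_of_real (sqnorm f)"
    unfolding sqnorm_def set_lebesgue_integral_def by (subst integral_complex_of_real[symmetric]) (simp add: scaleR_conv_of_real)
  finally show ?thesis .
qed

lemma sqnorm_nonneg: "sqnorm f \<ge> 0"
  unfolding sqnorm_def set_lebesgue_integral_def by (intro integral_nonneg_AE) auto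

lemma sqnorm_add_cmult:
  assumes "f \<in> A2" "g \<in> A2"
  shows "sqnorm (\<lambda>z. f z + c * g z) = sqnorm f + 2 * Re (c * ip g f) + (norm c)^2 * sqnorm g"
proof -
  have cg: "(\<lambda>z. c * g z) \<in> A2" by (rule A2_cmult[OF assms(2)])
  have "complex_of_real (sqnorm (\<lambda>z. f z + c * g z)) = ip f f + cnj c * ip f g + (c * ip g f + c * (cnj c * ip g g))"
    unfolding ip_self[symmetric]
    by (simp add: ip_add_left ip_add_right A2_add assms cg ip_cmult_left ip_cmult_right algebra_simps)
  also have "\<dots> = complex_of_real (sqnorm f) + (c * ip g f + cnj (c * ip g f)) + complex_of_real ((norm c)^2 * sqnorm g)"
    by (simp add: ip_self ip_cnj[of f g] complex_norm_square algebra_simps del: of_real_power)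
  also have "\<dots> = complex_of_real (sqnorm f + 2 * Re (c * ip g f) + (norm c)^2 * sqnorm g)"
    by (simp only: complex_add_cnj of_real_add)
  finally show ?thesis by (simp only: of_real_eq_iff)
qed

text \<open>On total functions \<open>sqnorm\<close> is only a seminorm, so its vanishing at
  \<open>g\<close> is a case of its own: there the quadratic inequality is linear in
  \<open>t\<close>, and a large \<open>t\<close> refutes a nonzero product.\<close>

lemma ip_cauchy_schwarz:
  assumes "f \<in> A2" "g \<in> A2"
  shows "(norm (ip f g))^2 \<le> sqnorm f * sqnorm g"
proof -
  have key: "0 \<le> sqnorm f - 2 * t * (norm (ip f g))^2 + t^2 * (norm (ip f g))^2 * sqnorm g" for t :: real
  proof -
    define c where "c = - complex_of_real t * ip f g"
    have "c * ip g f = - complex_of_real (t * (norm (ip f g))^2)"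
      by (simp add: c_def ip_cnj[of g f] complex_norm_square del: of_real_power)
    moreover have "(norm c)^2 = t^2 * (norm (ip f g))^2" by (simp add: c_def norm_mult power_mult_distrib)
    ultimately have "sqnorm (\<lambda>z. f z + c * g z) = sqnorm f - 2 * t * (norm (ip f g))^2 + t^2 * (norm (ip f g))^2 * sqnorm g"
      by (simp add: sqnorm_add_cmult[OF assms])
    then show ?thesis using sqnorm_nonneg by metis
  qed
  show ?thesis
  proof (cases "sqnorm g = 0")
    case True
    have "norm (ip f g) = 0"
    proof (rule ccontr)
      assume n: "norm (ip f g) \<noteq> 0"
      define t where "t = (sqnorm f + 1) / (norm (ip f g))^2"
      have "2 * t * (norm (ip f g))^2 = 2 * (sqnorm f + 1)" using n by (simp add: t_def)
      with key[of t] True sqnorm_nonneg[of f] show False by simp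
    qed
    then show ?thesis using True by simp
  next
    case False
    then have pos: "sqnorm g > 0" using sqnorm_nonneg[of g] by simp
    have "0 \<le> sqnorm f - (norm (ip f g))^2 / sqnorm g"
      using key[of "1 / sqnorm g"] pos by (simp add: power2_eq_square)
    then show ?thesis using pos by (simp add: field_simps)
  qed
qed

lemma sqnorm_nn_integral:
  assumes "f \<in> A2"
  shows "(\<integral>\<^sup>+z. ennreal ((norm (f z))^2) * indicator U z \<partial>lborel) = ennreal (sqnorm f)"
proof -
  have "integrable lborel (\<lambda>z. indicator U z *\<^sub>R (norm (f z))^2)"
    using assms by (simp add: bergman_L2_def set_integrable_def)
  from nn_integral_eq_integral[OF this] have "(\<integral>\<^sup>+z. ennreal (indicator U z *\<^sub>R (norm (f z))^2) \<partial>lborel) = ennreal (sqnorm f)"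
    by (auto simp: sqnorm_def set_lebesgue_integral_def)
  moreover have "ennreal (indicator U z *\<^sub>R (norm (f z))^2) = ennreal ((norm (f z))^2) * indicator U z" for z
    by (simp add: indicator_def)
  ultimately show ?thesis by simp
qed

lemma A2I:
  assumes "holo_on U f" "(\<integral>\<^sup>+z. ennreal ((norm (f z))^2) * indicator U z \<partial>lborel) \<le> ennreal C"
  shows "f \<in> A2" "C \<ge> 0 \<Longrightarrow> sqnorm f \<le> C"
proof -
  have c: "continuous_on U (\<lambda>z. (norm (f z))^2)" by (intro continuous_intros holo_on_continuous[OF assms(1)])
  have eq: "ennreal (norm (indicator U z *\<^sub>R (norm (f z))^2)) = ennreal ((norm (f z))^2) * indicator U z" for z
    by (simp add: indicator_def)
  have "integrable lborel (\<lambda>z. indicator U z *\<^sub>R (norm (f z))^2)"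
  proof (rule integrableI_bounded)
    show "(\<lambda>z. indicator U z *\<^sub>R (norm (f z))^2) \<in> borel_measurable lborel"
      using borel_measurable_continuous_on_indicator[OF U_borel c] by simp
    show "(\<integral>\<^sup>+z. ennreal (norm (indicator U z *\<^sub>R (norm (f z))^2)) \<partial>lborel) < \<infinity>"
      unfolding eq using assms(2) by (simp add: order_le_less_trans)
  qed
  then show A: "f \<in> A2" using assms(1) by (simp add: bergman_L2_def set_integrable_def)
  show "C \<ge> 0 \<Longrightarrow> sqnorm f \<le> C"
    using assms(2) unfolding sqnorm_nn_integral[OF A] by simp
qed

text \<open>The sub-mean value property with exponent 2. It bounds point evaluations, so that
  convergence in norm is locally uniform.\<close>

lemma A2_eval_bound:
  assumes "f \<in> A2" "ball a R \<subseteq> U" "R > 0"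
  shows "(norm (f a))^2 * measure lborel (ball a R) \<le> sqnorm f"
proof -
  have b: "emeasure lborel (ball a R) = ennreal (measure lborel (ball a R))"
    by (intro emeasure_eq_ennreal_measure emeasure_bounded_finite[THEN less_imp_neq, simplified]) auto
  have "ennreal ((norm (f a))^2 * measure lborel (ball a R)) = ennreal (norm (f a) powr 2) * emeasure lborel (ball a R)"
    by (simp add: b ennreal_mult powr_numeral)
  also have "\<dots> \<le> (\<integral>\<^sup>+x. ennreal (norm (f x) powr 2) * indicator (ball a R) x \<partial>lborel)"
    by (rule holo_mean_value_powr[OF holo_on_subset[OF A2_holo[OF assms(1)] assms(2)]]) simp
  also have "\<dots> \<le> (\<integral>\<^sup>+x. ennreal ((norm (f x))^2) * indicator U x \<partial>lborel)"
    using assms(2) by (intro nn_integral_mono) (auto simp: indicator_def powr_numeral)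
  also have "\<dots> = ennreal (sqnorm f)" by (rule sqnorm_nn_integral[OF assms(1)])
  finally show ?thesis using sqnorm_nonneg by (simp add: ennreal_le_iff)
qed

lemma measure_ball_pos: "R > 0 \<Longrightarrow> measure lborel (ball (a::complex^'n) R) > 0"
  using content_ball_pos[of R a] by simp

lemma measure_ball_eq: "measure lborel (ball (a::complex^'n) R) = measure lborel (ball (0::complex^'n) R)"
  by (cases "R \<ge> 0") (simp_all add: content_ball ball_empty)

text \<open>Completeness of the Bergman space: a sequence that is Cauchy in norm is locally
  uniformly Cauchy by \<open>A2_eval_bound\<close>, its limit is holomorphic, and Fatou's lemma
  bounds the norm. The bounds \<open>B\<close> are there because the extremal problem needs the
  limit to attain the infimum.\<close>

lemma A2_Cauchy_limit:
  assumes f: "\<And>k. f k \<in> A2" and C: "\<And>e. e > 0 \<Longrightarrow> \<exists>N. \<forall>j\<ge>N. \<forall>k\<ge>N. sqnorm (\<lambda>z. f j z - f k z) < e"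
    and b: "\<And>k. sqnorm (f k) \<le> B k" and B: "B \<longlonglongrightarrow> d"
  obtains g where "g \<in> A2" "\<And>z. z \<in> U \<Longrightarrow> (\<lambda>k. f k z) \<longlonglongrightarrow> g z" "sqnorm g \<le> d"
proof -
  have uc: "\<exists>N. \<forall>j\<ge>N. \<forall>k\<ge>N. \<forall>x\<in>ball a R. dist (f j x) (f k x) < e"
    if aR: "ball a (2 * R) \<subseteq> U" "R > 0" and e: "e > 0" for a R e
  proof -
    let ?v = "measure lborel (ball (0::complex^'n) R)"
    have v: "?v > 0" using measure_ball_pos[OF aR(2)] .
    then have "e^2 * ?v > 0" using e by simp
    from C[OF this] obtain N where N: "\<And>j k. j \<ge> N \<Longrightarrow> k \<ge> N \<Longrightarrow> sqnorm (\<lambda>z. f j z - f k z) < e^2 * ?v" by blast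
    have "dist (f j x) (f k x) < e" if "j \<ge> N" "k \<ge> N" "x \<in> ball a R" for j k x
    proof -
      have "ball x R \<subseteq> ball a (2 * R)"
      proof
        fix y assume "y \<in> ball x R" then show "y \<in> ball a (2 * R)" using that dist_triangle[of a y x] by simp
      qed
      then have "ball x R \<subseteq> U" using aR by blast
      from A2_eval_bound[OF A2_diff[OF f[of j] f[of k]] this aR(2)]
      have "(norm (f j x - f k x))^2 * ?v < e^2 * ?v" using N[OF that(1,2)] by (simp add: measure_ball_eq[of x])
      then have "(norm (f j x - f k x))^2 < e^2" using v by simp
      then show ?thesis using e by (simp add: dist_norm power2_less_imp_less less_imp_le)
    qed
    then show ?thesis by blast
  qed
  have nb: "\<exists>R>0. ball a (2 * R) \<subseteq> U" if "a \<in> U" for a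
  proof -
    obtain r where "r > 0" "ball a r \<subseteq> U" using open_U \<open>a \<in> U\<close> open_contains_ball by blast
    then show ?thesis by (intro exI[of _ "r/2"]) auto
  qed
  define g where "g = (\<lambda>z. lim (\<lambda>k. f k z))"
  have conv: "(\<lambda>k. f k z) \<longlonglongrightarrow> g z" if "z \<in> U" for z
  proof -
    obtain R where R: "R > 0" "ball z (2 * R) \<subseteq> U" using nb \<open>z \<in> U\<close> by blast
    have "Cauchy (\<lambda>k. f k z)"
    proof (rule metric_CauchyI)
      fix e :: real assume "e > 0"
      from uc[OF R(2,1) this] obtain N where "\<forall>j\<ge>N. \<forall>k\<ge>N. \<forall>x\<in>ball z R. dist (f j x) (f k x) < e" by blast
      moreover have "z \<in> ball z R" using R by simp
      ultimately show "\<exists>M. \<forall>m\<ge>M. \<forall>n\<ge>M. dist (f m z) (f n z) < e" by blast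
    qed
    then show ?thesis using Cauchy_convergent_iff convergent_LIMSEQ_iff g_def by metis
  qed
  have holo: "holo_on U g"
  proof (rule holo_onI)
    fix a assume a: "a \<in> U"
    obtain R where R: "R > 0" "ball a (2 * R) \<subseteq> U" using nb a by blast
    have sub: "ball a R \<subseteq> U" using R subset_ball[of R "2 * R" a] by auto
    have "uniform_limit (ball a R) f g sequentially"
    proof (rule uniform_limitI)
      fix e :: real assume e: "e > 0"
      from uc[OF R(2,1), of "e/2"] e obtain N where N: "\<And>j k x. j \<ge> N \<Longrightarrow> k \<ge> N \<Longrightarrow> x \<in> ball a R \<Longrightarrow> dist (f j x) (f k x) < e/2"
        by (metis half_gt_zero)
      have "dist (f j x) (g x) < e" if "j \<ge> N" "x \<in> ball a R" for j x
      proof -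
        have "(\<lambda>k. dist (f j x) (f k x)) \<longlonglongrightarrow> dist (f j x) (g x)"
          using that sub by (intro tendsto_intros conv) auto
        then have "dist (f j x) (g x) \<le> e/2"
          by (rule LIMSEQ_le_const2) (use N that in \<open>auto intro!: exI[of _ N] less_imp_le\<close>)
        then show ?thesis using e by simp
      qed
      then show "\<forall>\<^sub>F n in sequentially. \<forall>x\<in>ball a R. dist (f n x) (g x) < e"
        unfolding eventually_sequentially by blast
    qed
    from holo_uniform_limit_at[OF _ this R(1)]
    show "\<exists>f'. (g has_derivative f') (at a) \<and> (\<forall>c v. f' (c *s v) = c * f' v)"
      using holo_on_subset[OF A2_holo[OF f] sub] by blast
  qed
  have "(\<integral>\<^sup>+z. ennreal ((norm (g z))^2) * indicator U z \<partial>lborel) =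
     (\<integral>\<^sup>+z. liminf (\<lambda>k. ennreal ((norm (f k z))^2) * indicator U z) \<partial>lborel)"
  proof (intro nn_integral_cong)
    fix z
    have "(\<lambda>k. ennreal ((norm (f k z))^2) * indicator U z) \<longlonglongrightarrow> ennreal ((norm (g z))^2) * indicator U z"
    proof (cases "z \<in> U")
      case True
      then show ?thesis using conv[OF True] by (auto intro!: tendsto_intros)
    qed simp
    from lim_imp_Liminf[OF _ this] show "ennreal ((norm (g z))^2) * indicator U z = liminf (\<lambda>k. ennreal ((norm (f k z))^2) * indicator U z)" by simp
  qed
  also have "\<dots> \<le> liminf (\<lambda>k. \<integral>\<^sup>+z. ennreal ((norm (f k z))^2) * indicator U z \<partial>lborel)"
  proof (rule nn_integral_liminf)
    fix k
    show "(\<lambda>z. ennreal ((norm (f k z))^2) * indicator U z) \<in> borel_measurable lborel"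
    proof -
      have "continuous_on U (\<lambda>z. (norm (f k z))^2)" by (intro continuous_intros holo_on_continuous[OF A2_holo[OF f]])
      from borel_measurable_ennreal_indicator[OF this U_borel] show ?thesis by simp
    qed
  qed
  also have "\<dots> = liminf (\<lambda>k. ennreal (sqnorm (f k)))" by (simp add: sqnorm_nn_integral[OF f])
  also have "\<dots> \<le> liminf (\<lambda>k. ennreal (B k))" by (intro Liminf_mono always_eventually allI ennreal_leI b)
  also have "\<dots> = ennreal d" using B by (intro lim_imp_Liminf tendsto_ennrealI) auto
  finally have le: "(\<integral>\<^sup>+z. ennreal ((norm (g z))^2) * indicator U z \<partial>lborel) \<le> ennreal d" .
  have "d \<ge> 0" using B by (rule LIMSEQ_le_const) (use b sqnorm_nonneg order_trans in blast)
  with A2I[OF holo le] conv that show ?thesis by blast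
qed

text \<open>The element of least norm among those with value 1 at \<open>w\<close>; up to a factor
  it is the kernel function at \<open>w\<close>. The parallelogram law makes a minimising sequence
  Cauchy, and minimality gives orthogonality to everything that vanishes at
  \<open>w\<close>.\<close>

lemma exists_minimal:
  assumes w: "w \<in> U"
  obtains f where "f \<in> A2" "f w = 1" "sqnorm f > 0" "\<And>g. g \<in> A2 \<Longrightarrow> g w = 0 \<Longrightarrow> ip g f = 0"
proof -
  define E where "E = {f\<in>A2. f w = 1}"
  define d where "d = Inf (sqnorm ` E)"
  have E1: "(\<lambda>z. 1) \<in> E" using A2_const by (simp add: E_def)
  have bdd: "bdd_below (sqnorm ` E)" by (rule bdd_belowI[of _ 0]) (auto simp: sqnorm_nonneg)
  have d_le: "d \<le> sqnorm f" if "f \<in> E" for f unfolding d_def using that by (intro cInf_lower bdd) auto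
  have "\<exists>f\<in>E. sqnorm f < d + e" if "e > 0" for e
  proof -
    have "\<exists>x\<in>sqnorm ` E. x < d + e" unfolding d_def by (rule cInf_lessD) (use E1 that in \<open>auto simp: d_def\<close>)
    then show ?thesis by blast
  qed
  then have "\<forall>k. \<exists>f\<in>E. sqnorm f < d + inverse (real (Suc k))" by simp
  then obtain f where f: "\<And>k. f k \<in> E" "\<And>k. sqnorm (f k) < d + inverse (real (Suc k))" by metis
  have fA: "f k \<in> A2" for k using f by (simp add: E_def)
  \<comment> \<open>The midpoint of two competitors is again a competitor, so its squared norm is at
    least \<open>d\<close>.\<close>
  have par: "sqnorm (\<lambda>z. f j z - f k z) \<le> 2 * (sqnorm (f j) - d) + 2 * (sqnorm (f k) - d)" for j k
  proof -
    have "(\<lambda>z. 1/2 * (f j z + f k z)) \<in> E"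
      using f A2_cmult[OF A2_add[OF fA fA], of "1/2" j k] by (simp add: E_def)
    then have "4 * d \<le> 4 * sqnorm (\<lambda>z. 1/2 * (f j z + f k z))" using d_le by simp
    also have "sqnorm (\<lambda>z. 1/2 * (f j z + f k z)) = (1/4) * sqnorm (\<lambda>z. f j z + f k z)"
      unfolding sqnorm_def set_integral_mult_right[symmetric] by (simp add: norm_mult norm_divide power_divide)
    finally have 1: "4 * d \<le> sqnorm (\<lambda>z. f j z + f k z)" by simp
    have "sqnorm (\<lambda>z. f j z + 1 * f k z) + sqnorm (\<lambda>z. f j z + (-1) * f k z) = 2 * sqnorm (f j) + 2 * sqnorm (f k)"
      by (simp only: sqnorm_add_cmult[OF fA fA]) simp
    with 1 show ?thesis by (simp add: algebra_simps)
  qed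
  obtain g where g: "g \<in> A2" "\<And>z. z \<in> U \<Longrightarrow> (\<lambda>k. f k z) \<longlonglongrightarrow> g z" "sqnorm g \<le> d"
  proof (rule A2_Cauchy_limit[of f "\<lambda>k. d + inverse (real (Suc k))" d])
    show "f k \<in> A2" for k by (rule fA)
    show "sqnorm (f k) \<le> d + inverse (real (Suc k))" for k using f(2)[of k] by simp
    show "(\<lambda>k. d + inverse (real (Suc k))) \<longlonglongrightarrow> d"
      using tendsto_add[OF tendsto_const LIMSEQ_inverse_real_of_nat, of d] by simp
    fix e :: real assume "e > 0"
    then obtain N where N: "inverse (real (Suc N)) < e / 4" by (metis reals_Archimedean zero_less_divide_iff zero_less_numeral)
    have s: "sqnorm (f k) - d < e/4" if "k \<ge> N" for k
    proof -
      have "inverse (real (Suc k)) \<le> inverse (real (Suc N))" using that by (intro le_imp_inverse_le) auto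
      then show ?thesis using f(2)[of k] N by linarith
    qed
    have "sqnorm (\<lambda>z. f j z - f k z) < e" if "j \<ge> N" "k \<ge> N" for j k
      using par[of j k] s[OF that(1)] s[OF that(2)] by simp
    then show "\<exists>N. \<forall>j\<ge>N. \<forall>k\<ge>N. sqnorm (\<lambda>z. f j z - f k z) < e" by blast
  qed blast
  have gw: "g w = 1"
  proof -
    have "(\<lambda>k. f k w) = (\<lambda>k. 1)" using f(1) by (auto simp: E_def)
    then have "(\<lambda>k. 1) \<longlonglongrightarrow> g w" using g(2)[OF w] by simp
    then show ?thesis using LIMSEQ_unique[OF tendsto_const] by metis
  qed
  then have gE: "g \<in> E" using g by (simp add: E_def)
  have gd: "sqnorm g = d" using d_le[OF gE] g(3) by simp
  have pos: "sqnorm g > 0"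
  proof -
    obtain R where R: "R > 0" "ball w R \<subseteq> U" using w open_U open_contains_ball by blast
    have "measure lborel (ball w R) \<le> sqnorm g" using A2_eval_bound[OF g(1) R(2,1)] gw by simp
    with measure_ball_pos[OF R(1)] show ?thesis by (rule less_le_trans)
  qed
  have orth: "ip h g = 0" if h: "h \<in> A2" "h w = 0" for h
  proof (rule ccontr)
    assume n: "ip h g \<noteq> 0"
    define t where "t = 1 / (sqnorm h + 1)"
    have t: "t > 0" "t * sqnorm h < 1" using sqnorm_nonneg[of h] by (auto simp: t_def divide_simps)
    \<comment> \<open>Moves the minimiser along \<open>h\<close> in the direction that lowers the
      norm; \<open>t * sqnorm h < 1\<close> makes the linear term win over the quadratic
      one.\<close>
    define c where "c = - complex_of_real t * cnj (ip h g)"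
    have "(\<lambda>z. g z + c * h z) \<in> E" using gE h by (auto simp: E_def intro!: A2_add A2_cmult)
    then have "sqnorm g \<le> sqnorm (\<lambda>z. g z + c * h z)" using d_le gd by simp
    moreover have "c * ip h g = - complex_of_real (t * (norm (ip h g))^2)"
      by (simp add: c_def complex_norm_square mult.commute del: of_real_power)
    moreover have "(norm c)^2 = t^2 * (norm (ip h g))^2" by (simp add: c_def norm_mult power_mult_distrib)
    ultimately have "0 \<le> - 2 * t * (norm (ip h g))^2 + t^2 * (norm (ip h g))^2 * sqnorm h"
      by (simp add: sqnorm_add_cmult[OF g(1) h(1)])
    also have "\<dots> = t * (norm (ip h g))^2 * (t * sqnorm h - 2)" by (simp add: power2_eq_square algebra_simps)
    also have "\<dots> < 0" using t n by (intro mult_pos_neg) auto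
    finally show False by simp
  qed
  show ?thesis using that[OF g(1) gw pos orth] by blast
qed

text \<open>The predicate under the definite description of \<open>bergman_kernel\<close>, named so
  that existence and uniqueness can be treated separately.\<close>

definition is_kernel where
  "is_kernel K \<longleftrightarrow> (\<forall>w\<in>U. (\<lambda>z. K z w) \<in> bergman_L2 U) \<and>
     (\<forall>f\<in>bergman_L2 U. \<forall>z\<in>U. f z = (LINT w:U|lborel. f w * cnj (K w z))) \<and>
     (\<forall>z w. z \<notin> U \<or> w \<notin> U \<longrightarrow> K z w = 0)"

text \<open>Reproducing one kernel by another shows that they are conjugate transposes of each
  other. This holds for \<open>K\<close> with itself as well as with \<open>K'\<close>, so both
  equal the same conjugate transpose.\<close>

lemma is_kernel_unique:
  assumes "is_kernel K" "is_kernel K'"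
  shows "K = K'"
proof -
  have *: "K' z w = cnj (K w z)" if "is_kernel K" "is_kernel K'" "z \<in> U" "w \<in> U" for K K' z w
  proof -
    have 1: "(\<lambda>z. K z w) \<in> A2" "(\<lambda>z. K' z w) \<in> A2" if "w \<in> U" for w using \<open>is_kernel K\<close> \<open>is_kernel K'\<close> that by (auto simp: is_kernel_def)
    have rep: "f z = ip f (\<lambda>w. K w z)" "f z = ip f (\<lambda>w. K' w z)" if "f \<in> A2" "z \<in> U" for f z
      using \<open>is_kernel K\<close> \<open>is_kernel K'\<close> that unfolding is_kernel_def ip_def by blast+
    have "K' z w = ip (\<lambda>z. K' z w) (\<lambda>w. K w z)" using rep(1)[OF 1(2)] that by blast
    also have "\<dots> = cnj (ip (\<lambda>w. K w z) (\<lambda>z. K' z w))" by (rule ip_cnj)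
    also have "ip (\<lambda>w. K w z) (\<lambda>z. K' z w) = K w z" using rep(2)[OF 1(1)] that by simp
    finally show ?thesis .
  qed
  show ?thesis
  proof (intro ext)
    fix z w
    show "K z w = K' z w"
    proof (cases "z \<in> U \<and> w \<in> U")
      case True
      then show ?thesis using *[OF assms(1,1), of z w] *[OF assms, of z w] by simp
    qed (use assms in \<open>auto simp: is_kernel_def\<close>)
  qed
qed

text \<open>The minimiser at \<open>w\<close> is divided by its squared norm. Subtracting from
  \<open>f\<close> the multiple of the minimiser with the same value at \<open>w\<close> leaves a
  function vanishing there, hence orthogonal to the minimiser; this is the reproducing
  property.\<close>

lemma is_kernel_exists: "\<exists>K. is_kernel K"
proof -
  have "\<forall>w\<in>U. \<exists>f. f \<in> A2 \<and> f w = 1 \<and> sqnorm f > 0 \<and> (\<forall>g\<in>A2. g w = 0 \<longrightarrow> ip g f = 0)"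
    using exists_minimal by metis
  then obtain F where F: "\<And>w. w \<in> U \<Longrightarrow> F w \<in> A2" "\<And>w. w \<in> U \<Longrightarrow> F w w = 1" "\<And>w. w \<in> U \<Longrightarrow> sqnorm (F w) > 0"
    "\<And>w g. w \<in> U \<Longrightarrow> g \<in> A2 \<Longrightarrow> g w = 0 \<Longrightarrow> ip g (F w) = 0" by metis
  define K where "K = (\<lambda>z w. if z \<in> U \<and> w \<in> U then complex_of_real (1 / sqnorm (F w)) * F w z else 0)"
  have "is_kernel K"
    unfolding is_kernel_def
  proof (intro conjI ballI allI impI)
    fix w assume w: "w \<in> U"
    have A: "(\<lambda>z. complex_of_real (1 / sqnorm (F w)) * F w z) \<in> A2" (is "?g \<in> _") by (rule A2_cmult[OF F(1)[OF w]])
    have eq: "K z w = ?g z" if "z \<in> U" for z using that w by (simp add: K_def)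
    have "holo_on U (\<lambda>z. K z w)" by (rule holo_on_cong_open[OF A2_holo[OF A] open_U eq])
    moreover have "set_integrable lborel U (\<lambda>z. (norm (K z w))^2) \<longleftrightarrow> set_integrable lborel U (\<lambda>z. (norm (?g z))^2)"
      by (rule set_integrable_cong) (use eq in auto)
    ultimately show "(\<lambda>z. K z w) \<in> A2" using A by (simp add: bergman_L2_def)
  next
    fix f z assume f: "f \<in> A2" and z: "z \<in> U"
    have "ip (\<lambda>x. f x + (- f z) * F z x) (F z) = 0"
      using A2_add[OF f A2_cmult[OF F(1)[OF z], of "- f z"]] F(2)[OF z] by (intro F(4)[OF z]) auto
    then have "ip f (F z) = f z * complex_of_real (sqnorm (F z))"
      unfolding ip_add_left[OF f A2_cmult[OF F(1)[OF z]] F(1)[OF z]] ip_cmult_left ip_self by simp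
    then have "ip f (\<lambda>w. complex_of_real (1 / sqnorm (F z)) * F z w) = f z"
      using F(3)[OF z] by (simp only: ip_cmult_right) simp
    also have "ip f (\<lambda>w. complex_of_real (1 / sqnorm (F z)) * F z w) = (LINT w:U|lborel. f w * cnj (K w z))"
      unfolding ip_def by (rule set_lebesgue_integral_cong) (use z in \<open>auto simp: K_def\<close>)
    finally show "f z = (LINT w:U|lborel. f w * cnj (K w z))" by simp
  qed (auto simp: K_def)
  then show ?thesis by blast
qed

abbreviation "K \<equiv> bergman_kernel U"
abbreviation "k \<equiv> bergman_diag U"

lemma is_kernel_bergman: "is_kernel K"
proof -
  have "\<exists>!K. is_kernel K" using is_kernel_exists is_kernel_unique by blast
  from theI'[OF this] show ?thesis unfolding bergman_kernel_def is_kernel_def .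
qed

lemma kernel_unique: "is_kernel K' \<Longrightarrow> K' = K"
  using is_kernel_unique is_kernel_bergman by blast

lemma kernel_A2: "w \<in> U \<Longrightarrow> (\<lambda>z. K z w) \<in> A2"
  using is_kernel_bergman by (simp add: is_kernel_def)

lemma kernel_reproducing: "f \<in> A2 \<Longrightarrow> z \<in> U \<Longrightarrow> f z = ip f (\<lambda>w. K w z)"
  using is_kernel_bergman by (simp add: is_kernel_def ip_def)

lemma kernel_zero: "z \<notin> U \<or> w \<notin> U \<Longrightarrow> K z w = 0"
  using is_kernel_bergman by (auto simp: is_kernel_def)

lemma kernel_cnj: "K z w = cnj (K w z)"
proof (cases "z \<in> U \<and> w \<in> U")
  case True
  then have "K z w = ip (\<lambda>x. K x w) (\<lambda>x. K x z)" using kernel_reproducing[OF kernel_A2] by blast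
  also have "\<dots> = cnj (ip (\<lambda>x. K x z) (\<lambda>x. K x w))" by (rule ip_cnj)
  also have "ip (\<lambda>x. K x z) (\<lambda>x. K x w) = K w z" using kernel_reproducing[OF kernel_A2] True by metis
  finally show ?thesis .
qed (auto simp: kernel_zero)

lemma kernel_diag: "K z z = complex_of_real (k z)"
proof -
  have "K z z \<in> \<real>" using kernel_cnj[of z z] Reals_cnj_iff by metis
  then show ?thesis by (simp add: bergman_diag_def)
qed

lemma sqnorm_kernel: "w \<in> U \<Longrightarrow> sqnorm (\<lambda>z. K z w) = k w"
  using kernel_reproducing[OF kernel_A2, of w w] by (simp add: ip_self kernel_diag)

lemma A2_kernel_bound: "f \<in> A2 \<Longrightarrow> z \<in> U \<Longrightarrow> (norm (f z))^2 \<le> sqnorm f * k z"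
  using ip_cauchy_schwarz[OF _ kernel_A2] kernel_reproducing by (metis sqnorm_kernel)

text \<open>The kernel bound applied to the constant function 1, which lies in \<open>A2\<close>
  because \<open>U\<close> is bounded.\<close>

lemma kernel_diag_lower: "z \<in> U \<Longrightarrow> 1 \<le> measure lborel U * k z"
proof -
  have "sqnorm (\<lambda>z. 1) = measure lborel U"
    unfolding sqnorm_def by (simp add: set_lebesgue_integral_def)
  then show "z \<in> U \<Longrightarrow> 1 \<le> measure lborel U * k z" using A2_kernel_bound[OF A2_const, of z 1] by simp
qed

lemma measure_U_pos: "measure lborel U > 0"
proof -
  obtain z where "z \<in> U" using nonempty_U by blast
  from kernel_diag_lower[OF this] have "measure lborel U \<noteq> 0" by auto
  then show ?thesis by (simp add: zero_less_measure_iff)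
qed

lemma kernel_diag_pos: assumes "z \<in> U" shows "k z > 0"
  using kernel_diag_lower[OF assms] measure_U_pos by (metis less_le_trans mult_less_cancel_left_pos mult_zero_right zero_less_one)

lemma kernel_bound: "z \<in> U \<Longrightarrow> w \<in> U \<Longrightarrow> (norm (K z w))^2 \<le> k z * k w"
  using A2_kernel_bound[OF kernel_A2, of w z] by (simp add: sqnorm_kernel mult.commute)

text \<open>The evaluation bound applied to the kernel function at its own base point: the square of
  \<open>k x\<close> times the volume of the ball is at most \<open>k x\<close>.\<close>

lemma kernel_diag_upper:
  assumes "ball x R \<subseteq> U" "R > 0"
  shows "k x * measure lborel (ball (0::complex^'n) R) \<le> 1"
proof -
  have x: "x \<in> U" using assms by auto
  have "(norm (K x x))^2 * measure lborel (ball x R) \<le> k x"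
    using A2_eval_bound[OF kernel_A2[OF x] assms] by (simp add: sqnorm_kernel x)
  then have "k x * (k x * measure lborel (ball (0::complex^'n) R)) \<le> k x * 1"
    by (simp add: kernel_diag power2_eq_square measure_ball_eq[of x])
  then show ?thesis using kernel_diag_pos[OF x] by simp
qed

end

lemma dird_cong_open:
  assumes "open W" "z \<in> W" "\<And>x. x \<in> W \<Longrightarrow> f x = g x" "holo_on W g"
  shows "dird f v z = dird g v z"
  by (rule dird_eqI, rule has_derivative_transform_within_open[OF holo_on_dird(1)[OF assms(4,2)] assms(1,2)])
     (simp add: assms(3))

lemma holo_map_on_cong_open:
  assumes "holo_map_on U f" "open U" "\<And>z. z \<in> U \<Longrightarrow> g z = f z"
  shows "holo_map_on U g"
  unfolding holo_map_on_def
proof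
  fix i
  show "holo_on U (\<lambda>z. g z $ i)"
    by (rule holo_on_cong_open[of U "\<lambda>z. f z $ i"]) (use assms in \<open>auto simp: holo_map_on_def\<close>)
qed

lemma biholomorphism_inv:
  assumes bih: "biholomorphism \<psi> U V" and "open U"
  shows "biholomorphism (inv_into U \<psi>) V U"
proof -
  note bh = biholomorphismD[OF bih]
  have bij: "bij_betw \<psi> U V" using bih by (simp add: biholomorphism_def)
  have eq: "inv_into V (inv_into U \<psi>) x = \<psi> x" if "x \<in> U" for x
    by (rule inv_into_inv_into_eq[OF bij that])
  show ?thesis
    unfolding biholomorphism_def
    using bij_betw_inv_into[OF bij] bh(2) holo_map_on_cong_open[OF bh(1) assms(2) eq] by blast
qed

definition Jac :: "(complex^'n \<Rightarrow> complex^'n) \<Rightarrow> complex^'n \<Rightarrow> complex" where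
  "Jac \<psi> x = det (complex_jacobi \<psi> x)"

lemma holo_derivative_eqI:
  assumes "holo_map_on U \<psi>" "x \<in> U" "(\<psi> has_derivative f') (at x)"
  shows "holo_derivative \<psi> x = f'"
  using has_derivative_unique[OF holo_map_on_has_derivative(1)[OF assms(1,2)] assms(3)] .

lemma holo_derivative_compose:
  assumes "holo_map_on U \<psi>" "holo_map_on V \<phi>" "\<psi> ` U \<subseteq> V" "x \<in> U"
  shows "holo_derivative (\<lambda>z. \<phi> (\<psi> z)) x v = holo_derivative \<phi> (\<psi> x) (holo_derivative \<psi> x v)"
proof -
  have V: "\<psi> x \<in> V" using assms by auto
  have "holo_derivative (\<lambda>z. \<phi> (\<psi> z)) x = (\<lambda>v. holo_derivative \<phi> (\<psi> x) (holo_derivative \<psi> x v))"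
    by (rule holo_derivative_eqI[OF holo_map_on_compose[OF assms(1,2,3)] assms(4)])
       (rule has_derivative_compose[OF holo_map_on_has_derivative(1)[OF assms(1,4)] holo_map_on_has_derivative(1)[OF assms(2) V]])
  then show ?thesis by simp
qed

lemma Jac_compose:
  assumes "holo_map_on U \<psi>" "holo_map_on V \<phi>" "\<psi> ` U \<subseteq> V" "x \<in> U"
  shows "Jac (\<lambda>z. \<phi> (\<psi> z)) x = Jac \<phi> (\<psi> x) * Jac \<psi> x"
proof -
  have V: "\<psi> x \<in> V" using assms by auto
  have "complex_jacobi (\<lambda>z. \<phi> (\<psi> z)) x = complex_jacobi \<phi> (\<psi> x) ** complex_jacobi \<psi> x"
    unfolding matrix_eq matrix_vector_mul_assoc[symmetric]
    by (simp add: complex_jacobi_mult_vec[OF holo_map_on_compose[OF assms(1,2,3)] assms(4)]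
        complex_jacobi_mult_vec[OF assms(1,4)] complex_jacobi_mult_vec[OF assms(2) V] holo_derivative_compose[OF assms])
  then show ?thesis by (simp add: Jac_def det_mul)
qed

lemma Jac_local_id:
  assumes "open U" "x \<in> U" "\<And>y. y \<in> U \<Longrightarrow> \<psi> y = y"
  shows "Jac \<psi> x = 1"
proof -
  have h: "holo_map_on U \<psi>"
    by (rule holo_map_on_cong_open[of U "\<lambda>y. y"]) (use assms in \<open>auto simp: holo_map_on_def holo_on_nth\<close>)
  have "(\<psi> has_derivative (\<lambda>v. v)) (at x)"
    by (rule has_derivative_transform_within_open[OF has_derivative_ident assms(1,2)]) (simp add: assms(3))
  from holo_derivative_eqI[OF h assms(2) this]
  have "complex_jacobi \<psi> x = mat 1"
    unfolding matrix_eq by (simp add: complex_jacobi_mult_vec[OF h assms(2)])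
  then show ?thesis by (simp add: Jac_def)
qed

lemma Jac_inv:
  assumes bih: "biholomorphism \<psi> U V" and U: "open U" "x \<in> U"
  shows "Jac (inv_into U \<psi>) (\<psi> x) * Jac \<psi> x = 1"
proof -
  note bh = biholomorphismD[OF bih]
  have "Jac (\<lambda>z. inv_into U \<psi> (\<psi> z)) x = 1" by (rule Jac_local_id[OF U]) (use bh in auto)
  then show ?thesis using Jac_compose[OF bh(1,2) _ U(2)] bh by auto
qed

lemma Jac_nonzero: "biholomorphism \<psi> U V \<Longrightarrow> open U \<Longrightarrow> x \<in> U \<Longrightarrow> Jac \<psi> x \<noteq> 0"
  using Jac_inv by fastforce

lemma holo_on_Jac: "holo_map_on U \<psi> \<Longrightarrow> open U \<Longrightarrow> holo_on U (Jac \<psi>)"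
  using holo_on_det_jacobi by (simp add: Jac_def[abs_def])

definition cnjv :: "complex^'n \<Rightarrow> complex^'n" where "cnjv w = (\<chi> i. cnj (w $ i))"

lemma cnjv_simps [simp]: "cnjv (cnjv w) = w" "cnjv w $ i = cnj (w $ i)" "norm (cnjv w) = norm w"
  by (auto simp: cnjv_def vec_eq_iff norm_vec_def)

lemma cnjv_linear: "cnjv (x + y) = cnjv x + cnjv y" "cnjv (x - y) = cnjv x - cnjv y" "cnjv (c *s x) = cnj c *s cnjv x" "cnjv (r *\<^sub>R x) = r *\<^sub>R cnjv x"
  by (auto simp: vec_eq_iff)

lemma bounded_linear_cnjv: "bounded_linear cnjv"
  by (rule bounded_linear_intro[where K = 1]) (auto simp: cnjv_linear)

lemma holo_on_cnj:
  assumes "holo_on U f"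
  shows "holo_on {w. cnjv w \<in> U} (\<lambda>w. cnj (f (cnjv w)))"
proof (rule holo_onI)
  fix z assume "z \<in> {w. cnjv w \<in> U}"
  then have z: "cnjv z \<in> U" by simp
  note d = holo_on_dird[OF assms z]
  have "((\<lambda>w. cnj (f (cnjv w))) has_derivative (\<lambda>v. cnj (dird f (cnjv v) (cnjv z)))) (at z)"
    by (intro bounded_linear.has_derivative[OF bounded_linear_cnj]
        has_derivative_compose[OF bounded_linear_imp_has_derivative[OF bounded_linear_cnjv] d(1)])
  then show "\<exists>f'. ((\<lambda>w. cnj (f (cnjv w))) has_derivative f') (at z) \<and> (\<forall>c v. f' (c *s v) = c * f' v)"
    by (intro exI conjI) (auto simp: cnjv_linear d(2))
qed

text \<open>The conjugate diagonal. A real-analytic function of \<open>z\<close> such as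
  \<open>k\<close> is the restriction to it of a holomorphic function of twice as many
  variables.\<close>

definition ddiag :: "complex^'n \<Rightarrow> complex^('n+'n)" where "ddiag z = vpair z (cnjv z)"

lemma ddiag_add: "ddiag (z + t *\<^sub>R v) = ddiag z + t *\<^sub>R vpair v (cnjv v)"
  by (auto simp: ddiag_def vec_eq_iff vpair_def split: sum.splits)

lemma bounded_linear_ddiag: "bounded_linear ddiag"
proof (rule bounded_linear_intro[where K = 2])
  show "norm (ddiag x) \<le> norm x * 2" for x :: "complex^'n"
    unfolding ddiag_def using norm_vpair_le[of x "cnjv x"] by simp
qed (auto simp: ddiag_def vec_eq_iff vpair_def split: sum.splits)

text \<open>Along \<open>axis j c\<close> the derivative of \<open>f\<close> is
  \<open>c * A + cnj c * B\<close>, where \<open>A\<close> and \<open>B\<close> are the partial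
  derivatives of \<open>H\<close> in the two blocks; the Wirtinger combinations pick out
  \<open>A\<close> and \<open>B\<close>. These are again restrictions of holomorphic functions, so
  the lemma can be applied a second time.\<close>

lemma wirtinger_ddiag:
  assumes H: "holo_on W H" and U: "open U" "z \<in> U" and W: "\<And>x. x \<in> U \<Longrightarrow> ddiag x \<in> W"
    and f: "\<And>x. x \<in> U \<Longrightarrow> f x = H (ddiag x)"
  shows "dz j f z = dird H (vpair (axis j 1) 0) (ddiag z)"
    "dzbar j f z = dird H (vpair 0 (axis j 1)) (ddiag z)"
proof -
  have zW: "ddiag z \<in> W" using W U by simp
  have vd: "vector_derivative (\<lambda>t::real. f (z + t *\<^sub>R v)) (at 0) = dird H (vpair v (cnjv v)) (ddiag z)" for v
  proof (rule vector_derivative_at)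
    have hd: "((\<lambda>t::real. H (ddiag z + t *\<^sub>R vpair v (cnjv v))) has_derivative (\<lambda>t. dird H (t *\<^sub>R vpair v (cnjv v)) (ddiag z))) (at 0)"
    proof -
      have 1: "((\<lambda>t::real. ddiag z + t *\<^sub>R vpair v (cnjv v)) has_derivative (\<lambda>t. t *\<^sub>R vpair v (cnjv v))) (at 0)"
        by (auto intro!: derivative_eq_intros)
      have 2: "(H has_derivative (\<lambda>u. dird H u (ddiag z))) (at (ddiag z + (0::real) *\<^sub>R vpair v (cnjv v)))"
        using holo_on_dird(1)[OF H zW] by simp
      show ?thesis by (rule has_derivative_compose[OF 1 2])
    qed
    have hv: "((\<lambda>t::real. H (ddiag (z + t *\<^sub>R v))) has_vector_derivative dird H (vpair v (cnjv v)) (ddiag z)) (at 0)"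
      if "((\<lambda>t::real. H (ddiag z + t *\<^sub>R vpair v (cnjv v))) has_derivative (\<lambda>t. dird H (t *\<^sub>R vpair v (cnjv v)) (ddiag z))) (at 0)"
    proof -
      have "dird H (t *\<^sub>R X) (ddiag z) = t *\<^sub>R dird H X (ddiag z)" for t X
        by (simp add: scaleR_eq_vector_scalar_mult holo_on_dird(2)[OF H zW], simp add: scaleR_conv_of_real)
      with that show ?thesis by (simp add: has_vector_derivative_def ddiag_add)
    qed
    have "open ((\<lambda>t::real. z + t *\<^sub>R v) -` U)"
      by (intro open_vimage U continuous_intros)
    then show "((\<lambda>t::real. f (z + t *\<^sub>R v)) has_vector_derivative dird H (vpair v (cnjv v)) (ddiag z)) (at 0)"
      by (rule has_vector_derivative_transform_within_open[OF hv[OF hd]]) (use U f in auto)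
  qed
  define A where "A = dird H (vpair (axis j 1) 0) (ddiag z)"
  define B where "B = dird H (vpair 0 (axis j 1)) (ddiag z)"
  have e: "vpair (axis j c) (cnjv (axis j c)) = c *s vpair (axis j 1) 0 + cnj c *s vpair 0 (axis j 1)" for c
    by (auto simp: vec_eq_iff vpair_def axis_def split: sum.splits)
  have AB: "dird H (vpair (axis j c) (cnjv (axis j c))) (ddiag z) = c * A + cnj c * B" for c
    unfolding e dird_add[OF H zW] holo_on_dird(2)[OF H zW] A_def B_def ..
  show "dz j f z = A" "dzbar j f z = B"
    unfolding dz_def dzbar_def vd AB by (simp_all add: algebra_simps)
qed

text \<open>The mixed second difference is a difference of first differences. The second-order
  estimate is used twice: for the difference \<open>f\<close> in direction \<open>v\<close>, and for
  \<open>dird L v\<close> in direction \<open>u\<close>.\<close>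

lemma holo_mixed_estimate:
  fixes p :: "complex^'m"
  assumes L: "holo_on (ball p (2*r)) L" and B: "\<And>x. x \<in> ball p (2*r) \<Longrightarrow> norm (L x) \<le> B" and r: "r > 0"
    and u: "norm u \<le> r/2" and v: "norm v \<le> r/2"
  shows "norm (L (p + u + v) - L (p + u) - L (p + v) + L p - dird (dird L v) u p) \<le> 54 * B / r^3 * norm u * norm v * (norm u + norm v)"
proof -
  have sub: "ball q r \<subseteq> ball p (2*r)" if "q \<in> ball p r" for q
  proof
    fix y assume "y \<in> ball q r" then show "y \<in> ball p (2*r)" using that dist_triangle[of p y q] by simp
  qed
  have sub': "ball p r \<subseteq> ball p (2*r)" using r by (intro subset_ball) simp
  have pb: "p \<in> ball p r" and pb2: "p \<in> ball p (2*r)" using r by auto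
  define f where "f = (\<lambda>q. L (u + 1 *s q) - L q)"
  have f_eq: "f q = L (q + u) - L q" for q by (simp add: f_def add.commute)
  have ub: "u + 1 *s q \<in> ball p (2*r)" if "q \<in> ball p r" for q
  proof -
    have "dist q (u + 1 *s q) = norm u" by (simp add: dist_norm)
    then have "u + 1 *s q \<in> ball q r" using u r by simp
    then show ?thesis using sub[OF that] by blast
  qed
  have im: "(\<lambda>q. u + 1 *s q) ` ball p r \<subseteq> ball p (2*r)" using ub by blast
  have fh: "holo_on (ball p r) f" unfolding f_def
    by (intro holo_on_diff holo_on_compose[OF holo_map_on_affine L im] holo_on_subset[OF L sub'])
  have fb: "norm (f q) \<le> 3 * B / r * norm u" if "q \<in> ball p r" for q
    unfolding f_eq by (rule holo_estimates(1)[OF holo_on_subset[OF L sub[OF that]] _ r u]) (use B sub[OF that] in blast)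
  have 1: "norm (f (p + v) - f p - dird f v p) \<le> 18 * (3 * B / r * norm u) / r^2 * norm v ^ 2"
    by (rule holo_estimates(2)[OF fh fb r v])
  have pu: "p + u \<in> ball p (2*r)" using ub[OF pb] by (simp add: add.commute)
  have df: "dird f v p = dird L v (p + u) - dird L v p"
  proof (rule dird_eqI)
    have a: "((\<lambda>q. u + 1 *s q) has_derivative (\<lambda>x. x)) (at p)"
      by simp (auto intro!: derivative_eq_intros)
    have b: "(L has_derivative (\<lambda>x. dird L x (p + u))) (at (u + 1 *s p))"
      using holo_on_dird(1)[OF L pu] by (simp add: add.commute)
    show "(f has_derivative (\<lambda>x. dird L x (p + u) - dird L x p)) (at p)"
      unfolding f_def by (intro has_derivative_diff has_derivative_compose[OF a b] holo_on_dird(1)[OF L pb2])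
  qed
  have gh: "holo_on (ball p r) (dird L v)"
    by (rule holo_on_subset[OF holo_on_directional_derivative[OF L open_ball] sub'])
  have gb: "norm (dird L v q) \<le> 3 * B / r * norm v" if "q \<in> ball p r" for q
    by (rule holo_estimates(3)[OF holo_on_subset[OF L sub[OF that]] _ r]) (use B sub[OF that] in blast)
  have 2: "norm (dird L v (p + u) - dird L v p - dird (dird L v) u p) \<le> 18 * (3 * B / r * norm v) / r^2 * norm u ^ 2"
    by (rule holo_estimates(2)[OF gh gb r u])
  have "L (p + u + v) - L (p + u) - L (p + v) + L p - dird (dird L v) u p =
     (f (p + v) - f p - dird f v p) + (dird L v (p + u) - dird L v p - dird (dird L v) u p)"
    unfolding df f_eq by (simp add: algebra_simps)
  then have "norm (L (p + u + v) - L (p + u) - L (p + v) + L p - dird (dird L v) u p) \<le>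
     18 * (3 * B / r * norm u) / r^2 * norm v ^ 2 + 18 * (3 * B / r * norm v) / r^2 * norm u ^ 2"
    by (simp only: norm_triangle_mono[OF 1 2])
  also have "\<dots> = 54 * B / r^3 * norm u * norm v * (norm u + norm v)"
    using r by (simp add: power2_eq_square power3_eq_cube field_simps)
  finally show ?thesis .
qed

section \<open>Transformation of the kernel under automorphisms, and the polarised kernel\<close>

context bounded_domain
begin

abbreviation "aut \<psi> \<equiv> biholomorphism \<psi> U U"

lemma aut_inv: "aut \<psi> \<Longrightarrow> aut (inv_into U \<psi>)"
  using biholomorphism_inv open_U by blast

text \<open>The change of variables turns the squared norm of the pullback into that of
  \<open>f\<close>.\<close>

lemma A2_pullback:
  assumes \<psi>: "aut \<psi>" and f: "f \<in> A2"
  shows "(\<lambda>x. f (\<psi> x) * Jac \<psi> x) \<in> A2"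
proof (rule A2I(1)[where C = "sqnorm f"])
  note bh = biholomorphismD[OF \<psi>]
  show "holo_on U (\<lambda>x. f (\<psi> x) * Jac \<psi> x)"
    by (intro holo_on_mult holo_on_compose[OF bh(1) A2_holo[OF f]] holo_on_Jac[OF bh(1) open_U]) (use bh in auto)
  have "continuous_on U (\<lambda>z. (norm (f z))^2)" by (intro continuous_intros holo_on_continuous[OF A2_holo[OF f]])
  from borel_measurable_ennreal_indicator[OF this U_borel]
  have "(\<lambda>z. ennreal ((norm (f z))^2) * indicator U z) \<in> borel_measurable borel" by simp
  from nn_integral_biholo[OF \<psi> open_U bounded_U open_U this]
  show "(\<integral>\<^sup>+z. ennreal ((norm (f (\<psi> z) * Jac \<psi> z))^2) * indicator U z \<partial>lborel) \<le> ennreal (sqnorm f)"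
    by (simp add: sqnorm_nn_integral[OF f] Jac_def norm_mult power_mult_distrib ennreal_mult)
qed

text \<open>The right-hand side has the defining properties of the kernel, so uniqueness gives the
  identity. Pulling \<open>f\<close> back by the inverse automorphism transports the reproducing
  formula from \<open>\<psi> z\<close> to \<open>z\<close>.\<close>

lemma kernel_transform:
  assumes \<psi>: "aut \<psi>" and x: "x \<in> U" and y: "y \<in> U"
  shows "K x y = Jac \<psi> x * K (\<psi> x) (\<psi> y) * cnj (Jac \<psi> y)"
proof -
  note bh = biholomorphismD[OF \<psi>]
  define K' where "K' = (\<lambda>x y. if x \<in> U \<and> y \<in> U then Jac \<psi> x * K (\<psi> x) (\<psi> y) * cnj (Jac \<psi> y) else 0)"
  have "is_kernel K'"
    unfolding is_kernel_def
  proof (intro conjI ballI allI impI)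
    fix w assume w: "w \<in> U"
    have A: "(\<lambda>z. cnj (Jac \<psi> w) * (K (\<psi> z) (\<psi> w) * Jac \<psi> z)) \<in> A2" (is "?g \<in> _")
      by (intro A2_cmult A2_pullback[OF \<psi>] kernel_A2) (use w bh in auto)
    have eq: "K' z w = ?g z" if "z \<in> U" for z using that w by (simp add: K'_def)
    have "holo_on U (\<lambda>z. K' z w)" by (rule holo_on_cong_open[OF A2_holo[OF A] open_U eq])
    moreover have "set_integrable lborel U (\<lambda>z. (norm (K' z w))^2) \<longleftrightarrow> set_integrable lborel U (\<lambda>z. (norm (?g z))^2)"
      by (rule set_integrable_cong) (use eq in auto)
    ultimately show "(\<lambda>z. K' z w) \<in> A2" using A by (simp add: bergman_L2_def)
  next
    fix f z assume f: "f \<in> A2" and z: "z \<in> U"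
    define \<phi> where "\<phi> = inv_into U \<psi>"
    define g where "g = (\<lambda>y. f (\<phi> y) * Jac \<phi> y)"
    have g: "g \<in> A2" unfolding g_def \<phi>_def by (rule A2_pullback[OF aut_inv[OF \<psi>] f])
    have gJ: "g (\<psi> x) * Jac \<psi> x = f x" if "x \<in> U" for x
      using Jac_inv[OF \<psi> open_U that] bh(7)[OF that] by (simp add: g_def \<phi>_def mult.assoc)
    have z': "\<psi> z \<in> U" using bh z by auto
    have cont: "continuous_on U (\<lambda>y. g y * cnj (K y (\<psi> z)))"
      by (intro continuous_intros holo_on_continuous[OF A2_holo[OF g]] holo_on_continuous[OF A2_holo[OF kernel_A2[OF z']]])
    have "g (\<psi> z) = (LINT y:U|lborel. g y * cnj (K y (\<psi> z)))"
      using kernel_reproducing[OF g z'] by (simp add: ip_def)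
    also have "\<dots> = (LINT x:U|lborel. (norm (Jac \<psi> x))^2 *\<^sub>R (g (\<psi> x) * cnj (K (\<psi> x) (\<psi> z))))"
      using integral_biholo[OF \<psi> open_U bounded_U open_U cont] by (simp add: Jac_def)
    also have "\<dots> = (LINT x:U|lborel. f x * cnj (Jac \<psi> x * K (\<psi> x) (\<psi> z)))"
    proof (rule set_lebesgue_integral_cong)
      show "\<forall>x. x \<in> U \<longrightarrow> (norm (Jac \<psi> x))^2 *\<^sub>R (g (\<psi> x) * cnj (K (\<psi> x) (\<psi> z))) = f x * cnj (Jac \<psi> x * K (\<psi> x) (\<psi> z))"
      proof (intro allI impI)
        fix x assume "x \<in> U"
        from gJ[OF this] show "(norm (Jac \<psi> x))^2 *\<^sub>R (g (\<psi> x) * cnj (K (\<psi> x) (\<psi> z))) = f x * cnj (Jac \<psi> x * K (\<psi> x) (\<psi> z))"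
          by (simp add: scaleR_conv_of_real complex_norm_square algebra_simps del: of_real_power)
      qed
    qed simp
    finally have "g (\<psi> z) * Jac \<psi> z = (LINT x:U|lborel. f x * cnj (Jac \<psi> x * K (\<psi> x) (\<psi> z))) * Jac \<psi> z" by simp
    also have "\<dots> = (LINT x:U|lborel. f x * cnj (Jac \<psi> x * K (\<psi> x) (\<psi> z)) * Jac \<psi> z)"
      by (rule set_integral_mult_left[symmetric])
    also have "\<dots> = (LINT w:U|lborel. f w * cnj (K' w z))"
      by (rule set_lebesgue_integral_cong) (use z in \<open>auto simp: K'_def algebra_simps\<close>)
    finally show "f z = (LINT w:U|lborel. f w * cnj (K' w z))" using gJ[OF z] by simp
  qed (auto simp: K'_def)
  from kernel_unique[OF this] have "K x y = K' x y" by simp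
  then show ?thesis using x y by (simp add: K'_def)
qed

lemma kernel_diag_transform:
  assumes "aut \<psi>" "x \<in> U"
  shows "k x = (norm (Jac \<psi> x))^2 * k (\<psi> x)"
proof -
  have "complex_of_real (k x) = Jac \<psi> x * cnj (Jac \<psi> x) * complex_of_real (k (\<psi> x))"
    using kernel_transform[OF assms(1,2,2)] by (simp add: kernel_diag mult.commute mult.left_commute)
  also have "\<dots> = complex_of_real ((norm (Jac \<psi> x))^2 * k (\<psi> x))" by (simp add: complex_norm_square del: of_real_power)
  finally show ?thesis by (simp only: of_real_eq_iff)
qed

lemma norm_kernel_transform:
  assumes "aut \<psi>" "x \<in> U" "y \<in> U"
  shows "norm (K x y) = norm (Jac \<psi> x) * norm (K (\<psi> x) (\<psi> y)) * norm (Jac \<psi> y)"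
  by (simp add: kernel_transform[OF assms] norm_mult)

text \<open>The polarised kernel: with the second argument conjugated, the kernel becomes
  holomorphic in all variables jointly.\<close>

definition G :: "complex^('n+'n) \<Rightarrow> complex" where "G p = K (vfst p) (cnjv (vsnd p))"
definition W where "W = {p. vfst p \<in> U \<and> cnjv (vsnd p) \<in> U}"

lemma kernel_eq_G: "K z w = G (vpair z (cnjv w))" by (simp add: G_def)
lemma ddiag_W: "z \<in> U \<Longrightarrow> ddiag z \<in> W" by (simp add: ddiag_def W_def)
lemma G_ddiag: "G (ddiag z) = complex_of_real (k z)" by (simp add: G_def ddiag_def kernel_diag)

lemma open_W: "open W"
proof -
  have "W = vfst -` U \<inter> (\<lambda>p. cnjv (vsnd p)) -` U" by (auto simp: W_def)
  moreover have "open (vfst -` U)"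
    by (intro open_vimage open_U linear_continuous_on bounded_linear_vfst)
  moreover have "open ((\<lambda>p. cnjv (vsnd p)) -` U)"
    using bounded_linear_compose[OF bounded_linear_cnjv bounded_linear_vsnd]
    by (intro open_vimage open_U linear_continuous_on) (simp add: o_def)
  ultimately show ?thesis by auto
qed

text \<open>The Cauchy-Schwarz inequality reduces to the diagonal, where
  \<open>kernel_diag_upper\<close> applies.\<close>

lemma norm_kernel_bound:
  assumes "ball z R \<subseteq> U" "ball w R \<subseteq> U" "R > 0"
  shows "norm (K z w) \<le> 1 / measure lborel (ball (0::complex^'n) R)"
proof -
  let ?v = "measure lborel (ball (0::complex^'n) R)"
  have v: "?v > 0" by (rule measure_ball_pos[OF assms(3)])
  have zw: "z \<in> U" "w \<in> U" using assms by auto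
  have "(norm (K z w))^2 \<le> k z * k w" by (rule kernel_bound[OF zw])
  also have "\<dots> \<le> (1 / ?v) * (1 / ?v)"
    using kernel_diag_upper[OF assms(1,3)] kernel_diag_upper[OF assms(2,3)] v kernel_diag_pos zw
    by (intro mult_mono) (auto simp: pos_le_divide_eq less_imp_le)
  finally have "(norm (K z w))^2 \<le> (1 / ?v)^2" by (simp add: power2_eq_square)
  then show ?thesis by (rule power2_le_imp_le) (use v in simp)
qed

text \<open>Hermitian symmetry gives holomorphy in the second block, and
  \<open>norm_kernel_bound\<close> supplies the local bound that \<open>osgood\<close> asks
  for.\<close>

lemma holo_on_G: "holo_on W G"
proof (rule osgood)
  fix p assume p: "p \<in> W"
  have "vfst p \<in> U" "cnjv (vsnd p) \<in> U" using p by (auto simp: W_def)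
  then obtain R1 R2 where R1: "R1 > 0" "ball (vfst p) R1 \<subseteq> U" and R2: "R2 > 0" "ball (cnjv (vsnd p)) R2 \<subseteq> U"
    using open_U unfolding open_contains_ball by blast
  define R where "R = min R1 R2 / 2"
  have R: "R > 0" using R1 R2 by (simp add: R_def)
  have *: "ball (vfst q) R \<subseteq> U" "ball (cnjv (vsnd q)) R \<subseteq> U" if q: "q \<in> ball p R" for q
  proof -
    have "norm (vfst (p - q)) < R" using norm_vfst_le[of "p - q"] q by (simp add: dist_norm)
    then have 1: "dist (vfst p) (vfst q) < R" by (simp add: dist_norm vfst_def vec_eq_iff minus_vec_def)
    have "norm (vsnd (p - q)) < R" using norm_vsnd_le[of "p - q"] q by (simp add: dist_norm)
    moreover have "vsnd (p - q) = vsnd p - vsnd q" by (simp add: vsnd_def vec_eq_iff)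
    ultimately have 2: "dist (cnjv (vsnd p)) (cnjv (vsnd q)) < R" by (simp add: dist_norm cnjv_linear(2)[symmetric])
    show "ball (vfst q) R \<subseteq> U"
    proof
      fix y assume "y \<in> ball (vfst q) R"
      then have "y \<in> ball (vfst p) R1" using 1 dist_triangle[of "vfst p" y "vfst q"] by (simp add: R_def)
      then show "y \<in> U" using R1 by blast
    qed
    show "ball (cnjv (vsnd q)) R \<subseteq> U"
    proof
      fix y assume "y \<in> ball (cnjv (vsnd q)) R"
      then have "y \<in> ball (cnjv (vsnd p)) R2" using 2 dist_triangle[of "cnjv (vsnd p)" y "cnjv (vsnd q)"] by (simp add: R_def)
      then show "y \<in> U" using R2 by blast
    qed
  qed
  have "ball p R \<subseteq> W" using * R by (auto simp: W_def) (metis centre_in_ball subsetD mem_ball)+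
  moreover have "norm (G q) \<le> 1 / measure lborel (ball (0::complex^'n) R)" if "q \<in> ball p R" for q
    unfolding G_def by (rule norm_kernel_bound[OF *[OF that] R])
  ultimately show "\<exists>R>0. \<exists>M. ball p R \<subseteq> W \<and> (\<forall>x\<in>ball p R. norm (G x) \<le> M)" using R by blast
next
  fix w
  show "holo_on {z. vpair z w \<in> W} (\<lambda>z. G (vpair z w))"
  proof (cases "cnjv w \<in> U")
    case True
    then show ?thesis using A2_holo[OF kernel_A2[OF True]] by (simp add: G_def W_def)
  qed (simp add: W_def holo_on_def)
next
  fix z
  show "holo_on {w. vpair z w \<in> W} (\<lambda>w. G (vpair z w))"
  proof (cases "z \<in> U")
    case True
    have "G (vpair z w) = cnj (K (cnjv w) z)" for w using kernel_cnj[of z "cnjv w"] by (simp add: G_def)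
    then show ?thesis using holo_on_cnj[OF A2_holo[OF kernel_A2[OF True]]] True by (simp add: W_def)
  qed (simp add: W_def holo_on_def)
qed

lemma continuous_kernel: "continuous_on (U \<times> U) (\<lambda>(z, w). K z w)"
proof -
  have "bounded_linear (\<lambda>p::(complex^'n) \<times> (complex^'n). vpair (fst p) (cnjv (snd p)))"
  proof (rule bounded_linear_intro[where K = 2])
    fix p :: "(complex^'n) \<times> (complex^'n)"
    have "norm (fst p) \<le> norm p" "norm (snd p) \<le> norm p" using norm_fst_le[of "fst p" "snd p"] norm_snd_le[of "snd p" "fst p"] by simp_all
    then show "norm (vpair (fst p) (cnjv (snd p))) \<le> norm p * 2"
      using norm_vpair_le[of "fst p" "cnjv (snd p)"] by simp
  qed (auto simp: vec_eq_iff vpair_def split: sum.splits)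
  then have "continuous_on (U \<times> U) (\<lambda>p. G (vpair (fst p) (cnjv (snd p))))"
    by (intro continuous_on_compose2[OF holo_on_continuous[OF holo_on_G]] linear_continuous_on)
       (auto simp: W_def)
  then show ?thesis by (simp add: G_def case_prod_beta)
qed

lemma continuous_kernel_diag: "continuous_on U k"
proof -
  have "continuous_on U (\<lambda>z. Re (G (ddiag z)))"
    by (intro continuous_intros continuous_on_compose2[OF holo_on_continuous[OF holo_on_G]] linear_continuous_on bounded_linear_ddiag)
       (use ddiag_W in auto)
  then show ?thesis by (simp add: G_ddiag)
qed

text \<open>A neighbourhood of the conjugate diagonal on which the principal logarithm of
  \<open>G\<close> is holomorphic; positivity of \<open>k\<close> puts the diagonal inside.\<close>

definition W1 where "W1 = {p\<in>W. Re (G p) > 0}"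
definition L where "L p = Ln (G p)"

lemma open_W1: "open W1"
proof -
  have "W1 = W \<inter> (\<lambda>p. Re (G p)) -` {0<..}" by (auto simp: W1_def)
  then show ?thesis
    using continuous_open_preimage[OF _ open_W, of "\<lambda>p. Re (G p)" "{0<..}"] holo_on_continuous[OF holo_on_G]
    by (auto intro!: continuous_intros)
qed

lemma holo_on_L: "holo_on W1 L"
  unfolding L_def[abs_def]
proof (rule holo_on_compose_field[where f = G and g = Ln and g' = inverse])
  show "holo_on W1 G" by (rule holo_on_subset[OF holo_on_G]) (auto simp: W1_def)
  fix z assume "z \<in> W1"
  then have "G z \<notin> \<real>\<^sub>\<le>\<^sub>0" by (auto simp: W1_def complex_nonpos_Reals_iff)
  from has_field_derivative_Ln[OF this] show "(Ln has_field_derivative inverse (G z)) (at (G z))" .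
qed

lemma ddiag_W1: "z \<in> U \<Longrightarrow> ddiag z \<in> W1"
  by (simp add: W1_def ddiag_W G_ddiag kernel_diag_pos)

text \<open>The coefficients of the Bergman metric, extended holomorphically off the conjugate
  diagonal.\<close>

definition Mjk where "Mjk j l = dird (dird L (vpair 0 (axis l 1))) (vpair (axis j 1) 0)"

lemma holo_on_dL: "holo_on W1 (dird L v)" "holo_on W1 (dird (dird L v) u)"
  by (intro holo_on_directional_derivative holo_on_L open_W1)+

lemma bergman_metric_eq_sum:
  assumes z: "z \<in> U"
  shows "bergman_metric U z v = Re (\<Sum>j\<in>UNIV. \<Sum>l\<in>UNIV. Mjk j l (ddiag z) * v $ j * cnj (v $ l))"
proof -
  have 1: "dzbar l (\<lambda>x. complex_of_real (ln (k x))) x = dird L (vpair 0 (axis l 1)) (ddiag x)" if "x \<in> U" for l x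
    by (rule wirtinger_ddiag(2)[OF holo_on_L open_U that ddiag_W1])
       (auto simp: L_def G_ddiag Ln_of_real kernel_diag_pos)
  have 2: "dz j (dzbar l (\<lambda>x. complex_of_real (ln (k x)))) z = Mjk j l (ddiag z)" for j l
    unfolding Mjk_def by (rule wirtinger_ddiag(1)[OF holo_on_dL(1) open_U z ddiag_W1 1])
  show ?thesis unfolding bergman_metric_def 2 ..
qed

text \<open>Collects the double sum into one mixed derivative of \<open>L\<close>, the form to which
  \<open>holo_mixed_estimate\<close> applies.\<close>

lemma bergman_metric_eq_dird:
  assumes z: "z \<in> U"
  shows "bergman_metric U z v = Re (dird (dird L (vpair 0 (cnjv v))) (vpair v 0) (ddiag z))"
proof -
  have e1: "vpair v 0 = (\<Sum>j\<in>UNIV. v $ j *s vpair (axis j 1) (0::complex^'n))" for v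
  proof -
    have "(\<Sum>j\<in>UNIV. v $ j *s vpair (axis j 1) (0::complex^'n)) $ i = vpair v 0 $ i" for i
      by (cases i) (auto simp: axis_def if_distrib cong: if_cong)
    then show ?thesis by (simp add: vec_eq_iff)
  qed
  have e2: "vpair 0 v = (\<Sum>j\<in>UNIV. v $ j *s vpair (0::complex^'n) (axis j 1))" for v
  proof -
    have "(\<Sum>j\<in>UNIV. v $ j *s vpair (0::complex^'n) (axis j 1)) $ i = vpair 0 v $ i" for i
      by (cases i) (auto simp: axis_def if_distrib cong: if_cong)
    then show ?thesis by (simp add: vec_eq_iff)
  qed
  note zW = ddiag_W1[OF z]
  have s: "dird L (vpair 0 (cnjv v)) p = (\<Sum>l\<in>UNIV. cnj (v $ l) * dird L (vpair 0 (axis l 1)) p)" if "p \<in> W1" for p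
    by (subst e2) (simp add: dird_sum[OF holo_on_L that] holo_on_dird(2)[OF holo_on_L that])
  have h: "holo_on W1 (\<lambda>p. (\<Sum>l\<in>UNIV. cnj (v $ l) * dird L (vpair 0 (axis l 1)) p))"
    by (intro holo_on_sum holo_on_cmult holo_on_dL)
  have "dird (dird L (vpair 0 (cnjv v))) (vpair v 0) (ddiag z) =
     dird (\<lambda>p. (\<Sum>l\<in>UNIV. cnj (v $ l) * dird L (vpair 0 (axis l 1)) p)) (vpair v 0) (ddiag z)"
    by (rule dird_cong_open[OF open_W1 zW s h])
  also have "\<dots> = (\<Sum>l\<in>UNIV. cnj (v $ l) * dird (dird L (vpair 0 (axis l 1))) (vpair v 0) (ddiag z))"
    by (rule dird_eqI) (intro has_derivative_sum has_derivative_mult_right holo_on_dird(1)[OF holo_on_dL(1) zW])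
  also have "\<dots> = (\<Sum>l\<in>UNIV. cnj (v $ l) * (\<Sum>j\<in>UNIV. v $ j * Mjk j l (ddiag z)))"
  proof -
    have "dird (dird L X) (vpair v 0) (ddiag z) = (\<Sum>j\<in>UNIV. v $ j * dird (dird L X) (vpair (axis j 1) 0) (ddiag z))" for X
      by (subst e1) (simp only: dird_sum[OF holo_on_dL(1) zW] holo_on_dird(2)[OF holo_on_dL(1) zW])
    then show ?thesis by (simp add: Mjk_def)
  qed
  also have "\<dots> = (\<Sum>j\<in>UNIV. \<Sum>l\<in>UNIV. Mjk j l (ddiag z) * v $ j * cnj (v $ l))"
    unfolding sum_distrib_left by (subst sum.swap) (simp add: mult.commute mult.left_commute)
  finally show ?thesis using bergman_metric_eq_sum[OF z] by simp
qed

lemma continuous_bergman_metric: "continuous_on (U \<times> UNIV) (\<lambda>(z, v). bergman_metric U z v)"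
proof -
  have c: "continuous_on (U \<times> UNIV) (\<lambda>p. Mjk j l (ddiag (fst p)))" for j l
    unfolding Mjk_def
    by (rule continuous_on_compose2[OF holo_on_continuous[OF holo_on_dL(2)]])
       (auto intro!: continuous_on_compose2[OF linear_continuous_on[OF bounded_linear_ddiag, of UNIV]] continuous_intros ddiag_W1)
  have "continuous_on (U \<times> UNIV) (\<lambda>p. Re (\<Sum>j\<in>UNIV. \<Sum>l\<in>UNIV. Mjk j l (ddiag (fst p)) * snd p $ j * cnj (snd p $ l)))"
    by (intro continuous_intros c)
  then show ?thesis
    by (rule continuous_on_eq) (auto simp: bergman_metric_eq_sum)
qed

lemma bergman_metric_scaleR: "z \<in> U \<Longrightarrow> bergman_metric U z (t *\<^sub>R v) = t^2 * bergman_metric U z v"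
proof -
  assume z: "z \<in> U"
  have "(\<Sum>j\<in>UNIV. \<Sum>l\<in>UNIV. Mjk j l (ddiag z) * (t *\<^sub>R v) $ j * cnj ((t *\<^sub>R v) $ l)) =
    complex_of_real (t^2) * (\<Sum>j\<in>UNIV. \<Sum>l\<in>UNIV. Mjk j l (ddiag z) * v $ j * cnj (v $ l))"
    unfolding sum_distrib_left by (intro sum.cong) (simp_all only: vector_scaleR_component complex_cnj_scaleR, simp_all add: scaleR_conv_of_real power2_eq_square)
  then show ?thesis unfolding bergman_metric_eq_sum[OF z] by (simp only: scaleR_conv_of_real[symmetric] scaleR_complex.sel real_scaleR_def)
qed

section \<open>The Bergman metric\<close>

text \<open>Calabi's diastasis. It is invariant under automorphisms and agrees with the Bergman metric to
  second order, which transfers the invariance to the metric.\<close>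

definition diast :: "complex^'n \<Rightarrow> complex^'n \<Rightarrow> real" where
  "diast z w = ln (k z) + ln (k w) - 2 * ln (norm (K z w))"

text \<open>The Jacobian factors at \<open>x\<close> and \<open>y\<close> enter
  \<open>ln (k x) + ln (k y)\<close> and \<open>2 * ln (norm (K x y))\<close> with the same
  multiplicity and cancel. Nonvanishing of \<open>K x y\<close> makes the logarithm of the product
  split.\<close>

lemma diast_invariant:
  assumes \<psi>: "aut \<psi>" and x: "x \<in> U" and y: "y \<in> U" and n: "K x y \<noteq> 0"
  shows "diast (\<psi> x) (\<psi> y) = diast x y"
proof -
  note bh = biholomorphismD[OF \<psi>]
  have J: "norm (Jac \<psi> x) > 0" "norm (Jac \<psi> y) > 0" using Jac_nonzero[OF \<psi> open_U] x y by auto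
  have kp: "k (\<psi> x) > 0" "k (\<psi> y) > 0" using bh(5) x y by (auto intro: kernel_diag_pos)
  have Kp: "norm (K (\<psi> x) (\<psi> y)) > 0" using n kernel_transform[OF \<psi> x y] by auto
  have "ln (k x) = 2 * ln (norm (Jac \<psi> x)) + ln (k (\<psi> x))" "ln (k y) = 2 * ln (norm (Jac \<psi> y)) + ln (k (\<psi> y))"
    using J kp by (simp_all add: kernel_diag_transform[OF \<psi>] x y ln_mult ln_realpow)
  moreover have "ln (norm (K x y)) = ln (norm (Jac \<psi> x)) + ln (norm (K (\<psi> x) (\<psi> y))) + ln (norm (Jac \<psi> y))"
    using J Kp by (simp add: norm_kernel_transform[OF \<psi> x y] ln_mult)
  ultimately show ?thesis by (simp add: diast_def)
qed

lemma norm_kernel_sym: "norm (K z w) = norm (K w z)"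
  using kernel_cnj[of z w] by simp

text \<open>The diastasis is the real part of the mixed second difference of \<open>L\<close> at
  \<open>ddiag z\<close>, with increments \<open>vpair h 0\<close> and
  \<open>vpair 0 (cnjv h)\<close>. Hence \<open>holo_mixed_estimate\<close> compares it with the
  metric up to a cubic error.\<close>

lemma diast_expansion:
  assumes z: "z \<in> U"
  obtains C \<delta> where "\<delta> > 0" "C \<ge> 0"
    "\<And>h. norm h \<le> \<delta> \<Longrightarrow> z + h \<in> U \<and> K z (z + h) \<noteq> 0 \<and> \<bar>diast z (z + h) - bergman_metric U z h\<bar> \<le> C * norm h ^ 3"
proof -
  define p where "p = ddiag z"
  have p: "p \<in> W1" using ddiag_W1[OF z] by (simp add: p_def)
  obtain R B where R: "R > 0" "cball p R \<subseteq> W1" "B > 0" and B: "\<And>x. x \<in> cball p R \<Longrightarrow> norm (L x) \<le> B"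
    using holo_on_locally_bounded[OF holo_on_L open_W1 p] by metis
  define r where "r = R / 2"
  have r: "r > 0" "2 * r = R" using R by (auto simp: r_def)
  have sub: "ball p (2*r) \<subseteq> W1" using R(2) r(2) ball_subset_cball by blast
  have Lh: "holo_on (ball p (2*r)) L" by (rule holo_on_subset[OF holo_on_L sub])
  have Lb: "norm (L x) \<le> B" if "x \<in> ball p (2*r)" for x using B that r by auto
  have n0: "norm (vpair h 0) = norm h" "norm (vpair 0 h) = norm h" for h
    using norm_vpair_sq[of h 0] norm_vpair_sq[of 0 h] by auto
  have ReL: "Re (L q) = ln (norm (G q))" "G q \<noteq> 0" if "q \<in> W1" for q
    using that by (auto simp: L_def W1_def) (metis Re_Ln zero_complex.simps(1) less_irrefl)+
  have main: "z + h \<in> U \<and> K z (z + h) \<noteq> 0 \<and> \<bar>diast z (z + h) - bergman_metric U z h\<bar> \<le> (108 * B / r^3) * norm h ^ 3"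
    if h: "norm h \<le> r / 2" for h
  proof -
    define u where "u = vpair h (0::complex^'n)"
    define v where "v = vpair (0::complex^'n) (cnjv h)"
    have nu: "norm u = norm h" "norm v = norm h" by (simp_all add: u_def v_def n0)
    have e: "p + u + v = ddiag (z + h)" "p + u = vpair (z + h) (cnjv z)" "p + v = vpair z (cnjv (z + h))"
      unfolding p_def u_def v_def ddiag_def cnjv_linear by (simp_all add: vpair_add[symmetric])
    have nuv: "norm (u + v) \<le> r" using norm_triangle_ineq[of u v] nu h by simp
    have inb: "p + u + v \<in> ball p (2*r)" "p + u \<in> ball p (2*r)" "p + v \<in> ball p (2*r)"
    proof -
      have "p + x \<in> ball p (2*r)" if "norm x \<le> r" for x using that r by (simp add: dist_norm)
      from this[of "u + v"] this[of u] this[of v] nuv nu h r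
      show "p + u + v \<in> ball p (2*r)" "p + u \<in> ball p (2*r)" "p + v \<in> ball p (2*r)" by (simp_all add: add.assoc)
    qed
    then have inW: "p + u + v \<in> W1" "p + u \<in> W1" "p + v \<in> W1" using sub by auto
    have zh: "z + h \<in> U" using inW(1) unfolding e(1) by (simp add: W1_def W_def ddiag_def)
    have Kn: "K z (z + h) \<noteq> 0" using ReL(2)[OF inW(3)] unfolding e kernel_eq_G[symmetric] .
    have "Re (L (p + u + v)) = ln (k (z + h))"
      using ReL(1)[OF inW(1)] kernel_diag_pos[OF zh] unfolding e(1) by (simp add: G_ddiag)
    moreover have "Re (L (p + u)) = ln (norm (K z (z + h)))"
      using ReL(1)[OF inW(2)] unfolding e kernel_eq_G[symmetric] by (simp add: norm_kernel_sym)
    moreover have "Re (L (p + v)) = ln (norm (K z (z + h)))"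
      using ReL(1)[OF inW(3)] unfolding e kernel_eq_G[symmetric] .
    moreover have "Re (L p) = ln (k z)"
      using ReL(1)[OF p] kernel_diag_pos[OF z] unfolding p_def by (simp add: G_ddiag)
    ultimately have "diast z (z + h) = Re (L (p + u + v) - L (p + u) - L (p + v) + L p)"
      by (simp add: diast_def)
    moreover have "bergman_metric U z h = Re (dird (dird L v) u p)"
      unfolding u_def v_def p_def by (rule bergman_metric_eq_dird[OF z])
    ultimately have "\<bar>diast z (z + h) - bergman_metric U z h\<bar> = \<bar>Re (L (p + u + v) - L (p + u) - L (p + v) + L p - dird (dird L v) u p)\<bar>"
      by simp
    also have "\<dots> \<le> norm (L (p + u + v) - L (p + u) - L (p + v) + L p - dird (dird L v) u p)" by (rule abs_Re_le_cmod)
    also have "\<dots> \<le> 54 * B / r^3 * norm u * norm v * (norm u + norm v)"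
      by (rule holo_mixed_estimate[OF Lh Lb r(1)]) (use nu h in auto)
    also have "\<dots> = (108 * B / r^3) * norm h ^ 3" unfolding nu by (simp add: power3_eq_cube)
    finally show ?thesis using zh Kn by blast
  qed
  show ?thesis by (rule that[of "r/2" "108 * B / r^3"]) (use r R main in auto)
qed

lemma continuous_bergman_metric_vec:
  assumes "z \<in> U" shows "continuous_on UNIV (\<lambda>v. bergman_metric U z v)"
proof -
  have "continuous_on UNIV (\<lambda>v::complex^'n. (z, v))" by (intro continuous_intros)
  from continuous_on_compose2[OF continuous_bergman_metric this] assms show ?thesis by auto
qed

text \<open>The direction \<open>u n\<close> may vary with \<open>n\<close> because an automorphism
  need not map segments to segments.\<close>

lemma diast_limit:
  assumes z: "z \<in> U" and t: "\<And>n. t n > 0" "t \<longlonglongrightarrow> 0" and u: "u \<longlonglongrightarrow> v"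
  shows "(\<lambda>n. diast z (z + t n *\<^sub>R u n) / (t n)^2) \<longlonglongrightarrow> bergman_metric U z v"
    "\<forall>\<^sub>F n in sequentially. z + t n *\<^sub>R u n \<in> U \<and> K z (z + t n *\<^sub>R u n) \<noteq> 0"
proof -
  obtain C \<delta> where C: "\<delta> > 0" "C \<ge> 0" and
    est: "\<And>h. norm h \<le> \<delta> \<Longrightarrow> z + h \<in> U \<and> K z (z + h) \<noteq> 0 \<and> \<bar>diast z (z + h) - bergman_metric U z h\<bar> \<le> C * norm h ^ 3"
    using diast_expansion[OF z] by metis
  have "(\<lambda>n. t n *\<^sub>R u n) \<longlonglongrightarrow> 0 *\<^sub>R v" by (intro tendsto_intros t u)
  then have "(\<lambda>n. norm (t n *\<^sub>R u n)) \<longlonglongrightarrow> 0" using tendsto_norm by fastforce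
  then have ev: "\<forall>\<^sub>F n in sequentially. norm (t n *\<^sub>R u n) < \<delta>" by (rule order_tendstoD) (rule C(1))
  then show "\<forall>\<^sub>F n in sequentially. z + t n *\<^sub>R u n \<in> U \<and> K z (z + t n *\<^sub>R u n) \<noteq> 0"
    by eventually_elim (use est in auto)
  have m: "(\<lambda>n. bergman_metric U z (u n)) \<longlonglongrightarrow> bergman_metric U z v"
    using continuous_bergman_metric_vec[OF z] u by (metis continuous_on_tendsto_compose UNIV_I eventually_sequentiallyI)
  have "(\<lambda>n. diast z (z + t n *\<^sub>R u n) / (t n)^2 - bergman_metric U z (u n)) \<longlonglongrightarrow> 0"
  proof (rule Lim_null_comparison)
    show "\<forall>\<^sub>F n in sequentially. norm (diast z (z + t n *\<^sub>R u n) / (t n)^2 - bergman_metric U z (u n)) \<le> C * t n * norm (u n)^3"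
      using ev
    proof eventually_elim
      case (elim n)
      have "\<bar>diast z (z + t n *\<^sub>R u n) - bergman_metric U z (t n *\<^sub>R u n)\<bar> \<le> C * norm (t n *\<^sub>R u n) ^ 3"
        using est[of "t n *\<^sub>R u n"] elim by simp
      then have *: "\<bar>diast z (z + t n *\<^sub>R u n) - (t n)^2 * bergman_metric U z (u n)\<bar> \<le> (C * t n * norm (u n)^3) * (t n)^2"
        using t(1)[of n] by (simp add: bergman_metric_scaleR[OF z] power_mult_distrib power3_eq_cube power2_eq_square algebra_simps)
      have "diast z (z + t n *\<^sub>R u n) / (t n)^2 - bergman_metric U z (u n) =
          (diast z (z + t n *\<^sub>R u n) - (t n)^2 * bergman_metric U z (u n)) / (t n)^2"
        using t(1)[of n] by (simp add: field_simps)
      then have "norm (diast z (z + t n *\<^sub>R u n) / (t n)^2 - bergman_metric U z (u n)) =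
          \<bar>diast z (z + t n *\<^sub>R u n) - (t n)^2 * bergman_metric U z (u n)\<bar> / (t n)^2" by simp
      also have "\<dots> \<le> C * t n * norm (u n)^3"
        using * t(1)[of n] by (subst pos_divide_le_eq) auto
      finally show ?case .
    qed
    show "(\<lambda>n. C * t n * norm (u n)^3) \<longlonglongrightarrow> 0"
      by (auto intro!: tendsto_eq_intros t u)
  qed
  from tendsto_add[OF this m] show "(\<lambda>n. diast z (z + t n *\<^sub>R u n) / (t n)^2) \<longlonglongrightarrow> bergman_metric U z v" by simp
qed

text \<open>The diastasis along a segment at \<open>z\<close> and along its image have equal values,
  and the two sides are the limits of these values divided by the squared step.\<close>

lemma bergman_metric_invariant:
  assumes \<psi>: "aut \<psi>" and z: "z \<in> U"
  shows "bergman_metric U (\<psi> z) (holo_derivative \<psi> z v) = bergman_metric U z v"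
proof -
  note bh = biholomorphismD[OF \<psi>]
  define t where "t = (\<lambda>n. inverse (real (Suc n)))"
  have t: "\<And>n. t n > 0" "t \<longlonglongrightarrow> 0" unfolding t_def using LIMSEQ_inverse_real_of_nat by auto
  \<comment> \<open>Difference quotients of \<psi>, which converge to its derivative and put the
    image points into the form treated by \<open>diast_limit\<close>.\<close>
  define u where "u = (\<lambda>n. (1 / t n) *\<^sub>R (\<psi> (z + t n *\<^sub>R v) - \<psi> z))"
  have tu: "\<psi> z + t n *\<^sub>R u n = \<psi> (z + t n *\<^sub>R v)" for n using t(1)[of n] by (simp add: u_def)
  have D: "((\<lambda>s::real. \<psi> (z + s *\<^sub>R v)) has_derivative (\<lambda>s. s *\<^sub>R holo_derivative \<psi> z v)) (at 0)"
  proof -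
    have 1: "((\<lambda>s::real. z + s *\<^sub>R v) has_derivative (\<lambda>s. s *\<^sub>R v)) (at 0)" by (auto intro!: derivative_eq_intros)
    have 2: "(\<psi> has_derivative holo_derivative \<psi> z) (at (z + (0::real) *\<^sub>R v))"
      using holo_map_on_has_derivative(1)[OF bh(1) z] by simp
    have "((\<lambda>s::real. \<psi> (z + s *\<^sub>R v)) has_derivative (\<lambda>s. holo_derivative \<psi> z (s *\<^sub>R v))) (at 0)"
      by (rule has_derivative_compose[OF 1 2])
    then show ?thesis
      by (simp add: linear_cmul[OF has_derivative_linear[OF holo_map_on_has_derivative(1)[OF bh(1) z]]])
  qed
  then have "(\<lambda>h. norm (\<psi> (z + (0 + h) *\<^sub>R v) - \<psi> (z + (0::real) *\<^sub>R v) - h *\<^sub>R holo_derivative \<psi> z v) / norm h) \<midarrow>0\<rightarrow> 0"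
    unfolding has_derivative_at by blast
  then have "(\<lambda>n. norm (\<psi> (z + (0 + t n) *\<^sub>R v) - \<psi> (z + (0::real) *\<^sub>R v) - t n *\<^sub>R holo_derivative \<psi> z v) / norm (t n)) \<longlonglongrightarrow> 0"
  proof (rule filterlim_compose)
    show "filterlim t (at 0) sequentially"
      unfolding filterlim_at using t by (auto simp: less_imp_neq[symmetric])
  qed
  moreover have "norm (\<psi> (z + (0 + t n) *\<^sub>R v) - \<psi> (z + (0::real) *\<^sub>R v) - t n *\<^sub>R holo_derivative \<psi> z v) / norm (t n) = norm (u n - holo_derivative \<psi> z v)" for n
  proof -
    have "u n - holo_derivative \<psi> z v = (1 / t n) *\<^sub>R (\<psi> (z + t n *\<^sub>R v) - \<psi> z - t n *\<^sub>R holo_derivative \<psi> z v)"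
      using t(1)[of n] by (simp add: u_def scaleR_diff_right)
    then show ?thesis using t(1)[of n] by simp
  qed
  ultimately have "(\<lambda>n. u n - holo_derivative \<psi> z v) \<longlonglongrightarrow> 0" using tendsto_norm_zero_iff by fastforce
  then have u: "u \<longlonglongrightarrow> holo_derivative \<psi> z v" by (simp add: LIM_zero_iff)
  have z': "\<psi> z \<in> U" using bh(5) z by simp
  have l1: "(\<lambda>n. diast (\<psi> z) (\<psi> (z + t n *\<^sub>R v)) / (t n)^2) \<longlonglongrightarrow> bergman_metric U (\<psi> z) (holo_derivative \<psi> z v)"
    using diast_limit(1)[OF z' t u] by (simp add: tu)
  have l2: "(\<lambda>n. diast z (z + t n *\<^sub>R v) / (t n)^2) \<longlonglongrightarrow> bergman_metric U z v"
    using diast_limit(1)[OF z t tendsto_const] .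
  have "\<forall>\<^sub>F n in sequentially. diast z (z + t n *\<^sub>R v) / (t n)^2 = diast (\<psi> z) (\<psi> (z + t n *\<^sub>R v)) / (t n)^2"
    using diast_limit(2)[OF z t tendsto_const[of v]]
    by eventually_elim (simp add: diast_invariant[OF \<psi> z])
  from Lim_transform_eventually[OF l2 this] l1 show ?thesis using LIMSEQ_unique by blast
qed

text \<open>A function vanishing at \<open>z\<close> sees only the component \<open>g\<close> of the
  kernel function at \<open>w\<close> that is orthogonal to the one at \<open>z\<close>. The squared
  norm of that component is \<open>k w * (1 - exp (- diast z w))\<close>, at most
  \<open>k w * diast z w\<close>.\<close>

lemma A2_vanishing_bound:
  assumes f: "f \<in> A2" "f z = 0" and z: "z \<in> U" and w: "w \<in> U" and n: "K z w \<noteq> 0"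
  shows "(norm (f w))^2 \<le> sqnorm f * (k w * diast z w)"
proof -
  define c where "c = - K z w / complex_of_real (k z)"
  define g where "g = (\<lambda>x. K x w + c * K x z)"
  have kz: "k z > 0" and kw: "k w > 0" using kernel_diag_pos z w by auto
  have A: "(\<lambda>x. K x w) \<in> A2" "(\<lambda>x. K x z) \<in> A2" using kernel_A2 z w by auto
  have g: "g \<in> A2" unfolding g_def by (intro A2_add A2_cmult A)
  have "ip f g = ip f (\<lambda>x. K x w) + cnj c * ip f (\<lambda>x. K x z)"
    unfolding g_def by (simp add: ip_add_right A A2_cmult f ip_cmult_right)
  also have "\<dots> = f w" using kernel_reproducing[OF f(1) z] kernel_reproducing[OF f(1) w] f(2) by simp
  finally have 1: "(norm (f w))^2 \<le> sqnorm f * sqnorm g" using ip_cauchy_schwarz[OF f(1) g] by simp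
  have "ip (\<lambda>x. K x z) (\<lambda>x. K x w) = K w z" using kernel_reproducing[OF A(2) w] by simp
  moreover have "K z w * K w z = complex_of_real ((norm (K z w))^2)"
    using kernel_cnj[of w z] by (simp add: complex_norm_square del: of_real_power)
  ultimately have "c * ip (\<lambda>x. K x z) (\<lambda>x. K x w) = complex_of_real (- ((norm (K z w))^2 / k z))"
    by (simp add: c_def)
  then have "Re (c * ip (\<lambda>x. K x z) (\<lambda>x. K x w)) = - ((norm (K z w))^2 / k z)" by (simp only: Re_complex_of_real)
  moreover have "(norm c)^2 * k z = (norm (K z w))^2 / k z" using kz by (simp add: c_def norm_divide power_divide power2_eq_square)
  ultimately have "sqnorm g = k w - (norm (K z w))^2 / k z"
    unfolding g_def by (simp add: sqnorm_add_cmult[OF A] sqnorm_kernel z w)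
  also have "(norm (K z w))^2 / k z = k w * exp (- diast z w)"
  proof -
    have "exp (- diast z w) = exp (2 * ln (norm (K z w))) / (exp (ln (k z)) * exp (ln (k w)))"
      by (simp add: diast_def exp_diff exp_add exp_minus field_simps)
    also have "exp (2 * ln (norm (K z w))) = (norm (K z w))^2" using n by (simp add: exp_double)
    finally show ?thesis using kz kw by simp
  qed
  also have "k w - k w * exp (- diast z w) \<le> k w * diast z w"
  proof -
    have "1 - diast z w \<le> exp (- diast z w)" using exp_ge_add_one_self[of "- diast z w"] by simp
    from mult_left_mono[OF this, of "k w"] kw show ?thesis by (simp add: algebra_simps)
  qed
  finally show ?thesis using 1 sqnorm_nonneg[of f] by (meson mult_left_mono order_trans)
qed

text \<open>Quantitative nondegeneracy. The affine function \<open>f\<close> vanishes at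
  \<open>z\<close>, has modulus \<open>t * (norm v)^2\<close> at \<open>z + t *\<^sub>R v\<close>,
  and its norm is controlled by the diameter and the volume of \<open>U\<close>. Dividing
  \<open>A2_vanishing_bound\<close> at that point by \<open>t^2\<close> and letting \<open>t\<close>
  tend to 0 gives the bound, with \<open>B\<close> independent of \<open>z\<close>.\<close>

lemma bergman_metric_lower:
  obtains B where "B > 0" "\<And>z v. z \<in> U \<Longrightarrow> (norm v)^2 \<le> B * k z * bergman_metric U z v"
proof -
  obtain D where D: "D > 0" "\<And>x y. x \<in> U \<Longrightarrow> y \<in> U \<Longrightarrow> norm (x - y) \<le> D"
  proof -
    obtain a where a: "a > 0" "\<And>x. x \<in> U \<Longrightarrow> norm x \<le> a" using bounded_U unfolding bounded_pos by blast
    have "norm (x - y) \<le> 2 * a" if "x \<in> U" "y \<in> U" for x y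
      using norm_triangle_ineq4[of x y] a(2)[OF that(1)] a(2)[OF that(2)] by simp
    with a(1) show ?thesis by (intro that[of "2 * a"]) auto
  qed
  define B where "B = D^2 * measure lborel U"
  have B: "B > 0" using D(1) measure_U_pos by (simp add: B_def)
  have main: "(norm v)^2 \<le> B * k z * bergman_metric U z v" if z: "z \<in> U" for z v
  proof (cases "v = 0")
    case True
    have "bergman_metric U z v = 0" using bergman_metric_scaleR[OF z, of 0 0] True by simp
    then show ?thesis using True by simp
  next
    case False
    then have nv: "norm v > 0" by simp
    define f where "f = (\<lambda>x. \<Sum>j\<in>UNIV. cnj (v $ j) * (x $ j - z $ j))"
    have fh: "holo_on U f" unfolding f_def by (intro holo_on_sum holo_on_cmult holo_on_diff holo_on_nth holo_on_const)
    have CS: "norm (\<Sum>j\<in>UNIV. cnj (v $ j) * y $ j) \<le> norm v * norm y" for y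
    proof -
      have "norm (\<Sum>j\<in>UNIV. cnj (v $ j) * y $ j) \<le> (\<Sum>j\<in>UNIV. \<bar>norm (v $ j)\<bar> * \<bar>norm (y $ j)\<bar>)"
        by (rule order_trans[OF norm_sum]) (simp add: norm_mult)
      also have "\<dots> \<le> L2_set (\<lambda>j. norm (v $ j)) UNIV * L2_set (\<lambda>j. norm (y $ j)) UNIV" by (rule L2_set_mult_ineq)
      finally show ?thesis by (simp add: norm_vec_def)
    qed
    have fb: "norm (f x) \<le> norm v * D" if "x \<in> U" for x
    proof -
      have "norm (f x) \<le> norm v * norm (x - z)" using CS[of "x - z"] by (simp add: f_def)
      also have "\<dots> \<le> norm v * D" using D(2)[OF that z] by (intro mult_left_mono) auto
      finally show ?thesis .
    qed
    have C0: "0 \<le> (norm v * D)^2 * measure lborel U" by simp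
    have le: "(\<integral>\<^sup>+x. ennreal ((norm (f x))^2) * indicator U x \<partial>lborel) \<le> ennreal ((norm v * D)^2 * measure lborel U)"
    proof -
      have "(\<integral>\<^sup>+x. ennreal ((norm (f x))^2) * indicator U x \<partial>lborel) \<le> (\<integral>\<^sup>+x. ennreal ((norm v * D)^2) * indicator U x \<partial>lborel)"
        using fb by (intro nn_integral_mono) (auto simp: indicator_def intro!: ennreal_leI power_mono)
      also have "\<dots> = ennreal ((norm v * D)^2) * emeasure lborel U" by (rule nn_integral_cmult_indicator) simp
      also have "emeasure lborel U = ennreal (measure lborel U)"
        using emeasure_U_finite by (intro emeasure_eq_ennreal_measure) auto
      finally show ?thesis by (simp add: ennreal_mult)
    qed
    note fA = A2I(1)[OF fh le] and fs = A2I(2)[OF fh le C0]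
    have fz: "f z = 0" by (simp add: f_def)
    have ft: "norm (f (z + t *\<^sub>R v)) = t * (norm v)^2" if "t > 0" for t
    proof -
      have "f (z + t *\<^sub>R v) = (\<Sum>j\<in>UNIV. complex_of_real t * complex_of_real ((norm (v $ j))^2))"
        unfolding f_def by (intro sum.cong refl)
          (simp only: vector_add_component vector_scaleR_component, simp add: scaleR_conv_of_real complex_norm_square del: of_real_power)
      also have "\<dots> = complex_of_real (t * (norm v)^2)"
        by (simp add: sum_distrib_left[symmetric] norm_vec_def L2_set_def sum_nonneg)
      finally show ?thesis using that by (simp del: of_real_mult)
    qed
    define t where "t = (\<lambda>n. inverse (real (Suc n)))"
    have t: "\<And>n. t n > 0" "t \<longlonglongrightarrow> 0" unfolding t_def using LIMSEQ_inverse_real_of_nat by auto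
    have l: "(\<lambda>n. sqnorm f * (k (z + t n *\<^sub>R v) * (diast z (z + t n *\<^sub>R v) / (t n)^2))) \<longlonglongrightarrow> sqnorm f * (k z * bergman_metric U z v)"
    proof (intro tendsto_intros diast_limit(1)[OF z t tendsto_const])
      have "(\<lambda>n. z + t n *\<^sub>R v) \<longlonglongrightarrow> z + 0 *\<^sub>R v" by (intro tendsto_intros t)
      moreover have "isCont k z" using continuous_kernel_diag z open_U continuous_on_eq_continuous_at by blast
      ultimately show "(\<lambda>n. k (z + t n *\<^sub>R v)) \<longlonglongrightarrow> k z" using isCont_tendsto_compose by fastforce
    qed
    have "\<forall>\<^sub>F n in sequentially. norm v ^ 4 \<le> sqnorm f * (k (z + t n *\<^sub>R v) * (diast z (z + t n *\<^sub>R v) / (t n)^2))"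
      using diast_limit(2)[OF z t tendsto_const[of v]]
    proof eventually_elim
      case (elim n)
      have "(t n * (norm v)^2)^2 \<le> sqnorm f * (k (z + t n *\<^sub>R v) * diast z (z + t n *\<^sub>R v))"
        using A2_vanishing_bound[OF fA fz z, of "z + t n *\<^sub>R v"] elim ft[OF t(1)] by simp
      then have "norm v ^ 4 * (t n)^2 \<le> sqnorm f * (k (z + t n *\<^sub>R v) * diast z (z + t n *\<^sub>R v))"
        by (simp add: power_mult_distrib power_mult[symmetric] mult.commute)
      then have "norm v ^ 4 \<le> sqnorm f * (k (z + t n *\<^sub>R v) * diast z (z + t n *\<^sub>R v)) / (t n)^2"
        using t(1)[of n] by (subst pos_le_divide_eq) auto
      then show ?case by simp
    qed
    then have *: "norm v ^ 4 \<le> sqnorm f * (k z * bergman_metric U z v)"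
      by (intro tendsto_lowerbound[OF l]) auto
    have kz: "k z > 0" using kernel_diag_pos z by simp
    have M: "k z * bergman_metric U z v \<ge> 0"
    proof (rule ccontr)
      assume "\<not> ?thesis"
      then have "sqnorm f * (k z * bergman_metric U z v) \<le> 0" using sqnorm_nonneg[of f] by (simp add: mult_nonneg_nonpos)
      moreover have "norm v ^ 4 > 0" using nv by simp
      ultimately show False using * by linarith
    qed
    have "norm v ^ 4 \<le> (norm v * D)^2 * measure lborel U * (k z * bergman_metric U z v)"
      using * mult_right_mono[OF fs M] by linarith
    also have "\<dots> = norm v ^ 2 * (B * k z * bergman_metric U z v)" by (simp add: B_def power_mult_distrib)
    finally have "norm v ^ 2 * norm v ^ 2 \<le> norm v ^ 2 * (B * k z * bergman_metric U z v)"
      by (simp add: power_add[symmetric])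
    then show ?thesis by (rule mult_left_le_imp_le) (use nv in simp)
  qed
  show ?thesis by (rule that[OF B main])
qed

lemma bergman_metric_nonneg: "z \<in> U \<Longrightarrow> bergman_metric U z v \<ge> 0"
proof -
  assume z: "z \<in> U"
  obtain B where B: "B > 0" "\<And>z v. z \<in> U \<Longrightarrow> (norm v)^2 \<le> B * k z * bergman_metric U z v" using bergman_metric_lower by metis
  have "0 \<le> B * k z * bergman_metric U z v" using B(2)[OF z, of v] zero_le_power2 order_trans by blast
  moreover have "B * k z > 0" using B(1) kernel_diag_pos[OF z] by simp
  ultimately show ?thesis by (simp add: zero_le_mult_iff)
qed

end

section \<open>The Bergman distance\<close>

lemma vector_derivative_cong_open:
  fixes f g :: "real \<Rightarrow> 'a::real_normed_vector"
  assumes "open S" "t \<in> S" "\<And>s. s \<in> S \<Longrightarrow> f s = g s"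
  shows "vector_derivative f (at t) = vector_derivative g (at t)"
proof -
  have "(f has_vector_derivative D) (at t) \<longleftrightarrow> (g has_vector_derivative D) (at t)" for D
    using has_vector_derivative_transform_within_open[OF _ assms(1,2)] assms(3) by metis
  then show ?thesis by (simp add: vector_derivative_def)
qed

context bounded_domain
begin

definition bpaths where
  "bpaths z w = {\<gamma>. valid_path \<gamma> \<and> path_image \<gamma> \<subseteq> U \<and> pathstart \<gamma> = z \<and> pathfinish \<gamma> = w}"

text \<open>Extended real, so that infima over paths can be compared before finiteness is known;
  \<open>edist_eq_d\<close> returns to the real distance.\<close>

definition edist where "edist z w = (INF \<gamma>\<in>bpaths z w. bergman_length U \<gamma>)"

abbreviation "d \<equiv> bergman_dist U"

lemma bergman_dist_eq: "d z w = enn2real (edist z w)"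
  by (simp add: bergman_dist_def edist_def bpaths_def)

definition speed where "speed \<gamma> t = sqrt (bergman_metric U (\<gamma> t) (vector_derivative \<gamma> (at t)))"

lemma bergman_length_eq: "bergman_length U \<gamma> = (\<integral>\<^sup>+t. ennreal (speed \<gamma> t) * indicator {0..1} t \<partial>lborel)"
  by (simp add: bergman_length_def speed_def)

lemma AE_not_finite: "finite S \<Longrightarrow> AE t in lborel. t \<notin> (S :: real set)"
  by (intro AE_I'[of S]) (auto intro: finite_imp_null_set_lborel)

text \<open>An explicit derivative \<open>D\<close>, continuous off a finite set. Whatever value
  \<open>vector_derivative\<close> takes at break points, replacing it by \<open>D\<close> changes
  the integrand only on a null set and makes it measurable.\<close>

definition path_data where
  "path_data \<gamma> S D \<longleftrightarrow> finite S \<and> (\<forall>t\<in>{0..1} - S. (\<gamma> has_vector_derivative D t) (at t)) \<and>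
     continuous_on ({0..1} - S) D \<and> continuous_on {0..1} \<gamma> \<and> (\<forall>t\<in>{0..1}. \<gamma> t \<in> U)"

lemma path_dataD:
  assumes "path_data \<gamma> S D"
  shows "finite S" "\<And>t. t \<in> {0..1} - S \<Longrightarrow> (\<gamma> has_vector_derivative D t) (at t)"
    "continuous_on ({0..1} - S) D" "continuous_on {0..1} \<gamma>" "\<And>t. t \<in> {0..1} \<Longrightarrow> \<gamma> t \<in> U"
  using assms by (auto simp: path_data_def)

lemma bpaths_data:
  assumes "\<gamma> \<in> bpaths z w"
  obtains S D where "path_data \<gamma> S D"
proof -
  from assms have v: "valid_path \<gamma>" "path_image \<gamma> \<subseteq> U" by (auto simp: bpaths_def)
  from v(1) obtain S where S: "finite S" "\<gamma> C1_differentiable_on ({0..1} - S)" "continuous_on {0..1} \<gamma>"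
    unfolding valid_path_def piecewise_C1_differentiable_on_def by blast
  then obtain D where D: "\<forall>t\<in>{0..1} - S. (\<gamma> has_vector_derivative D t) (at t)" "continuous_on ({0..1} - S) D"
    unfolding C1_differentiable_on_def by blast
  have "\<forall>t\<in>{0..1}. \<gamma> t \<in> U" using v(2) by (auto simp: path_image_def)
  with S D have "path_data \<gamma> S D" by (simp add: path_data_def)
  then show ?thesis by (rule that)
qed

lemma path_data_measurable:
  assumes pd: "path_data \<gamma> S D" and A: "A \<in> sets borel" "A \<subseteq> {0..1}"
  shows "(\<lambda>t. ennreal (sqrt (bergman_metric U (\<gamma> t) (D t))) * indicator (A - S) t) \<in> borel_measurable borel"
proof (rule borel_measurable_ennreal_indicator)
  note pd = path_dataD[OF pd]
  have "continuous_on ({0..1} - S) (\<lambda>t. (\<gamma> t, D t))"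
    by (intro continuous_intros pd(3) continuous_on_subset[OF pd(4)]) auto
  from continuous_on_compose2[OF continuous_bergman_metric this] pd(5)
  have "continuous_on ({0..1} - S) (\<lambda>t. bergman_metric U (\<gamma> t) (D t))" by (auto simp: image_subset_iff)
  then show "continuous_on ({0..1} - S) (\<lambda>t. sqrt (bergman_metric U (\<gamma> t) (D t)))" by (intro continuous_intros)
  have "S \<in> sets borel" using finite_imp_closed[OF pd(1)] by auto
  then show "A - S \<in> sets borel" using A(1) by (rule sets.Diff[rotated])
qed (use A in auto)

lemma path_data_nn_integral:
  assumes pd: "path_data \<gamma> S D" and A: "A \<subseteq> {0..1}"
  shows "(\<integral>\<^sup>+t. ennreal (speed \<gamma> t) * indicator A t \<partial>lborel) =
      (\<integral>\<^sup>+t. ennreal (sqrt (bergman_metric U (\<gamma> t) (D t))) * indicator (A - S) t \<partial>lborel)"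
proof (rule nn_integral_cong_AE)
  note pd = path_dataD[OF pd]
  show "AE t in lborel. ennreal (speed \<gamma> t) * indicator A t = ennreal (sqrt (bergman_metric U (\<gamma> t) (D t))) * indicator (A - S) t"
    using AE_not_finite[OF pd(1)]
  proof eventually_elim
    case (elim t)
    show ?case
    proof (cases "t \<in> A")
      case True
      then have "vector_derivative \<gamma> (at t) = D t" using pd(2)[of t] elim A by (intro vector_derivative_at) auto
      then show ?thesis using True elim by (simp add: speed_def)
    qed simp
  qed
qed

lemma length_split:
  assumes g: "\<gamma> \<in> bpaths z w" and abc: "0 \<le> a" "a \<le> b" "b \<le> c" "c \<le> 1"
  shows "(\<integral>\<^sup>+t. ennreal (speed \<gamma> t) * indicator {a..c} t \<partial>lborel) =
    (\<integral>\<^sup>+t. ennreal (speed \<gamma> t) * indicator {a..b} t \<partial>lborel) + (\<integral>\<^sup>+t. ennreal (speed \<gamma> t) * indicator {b..c} t \<partial>lborel)"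
proof -
  obtain S D where pd: "path_data \<gamma> S D" by (rule bpaths_data[OF g])
  note S = path_dataD(1)[OF pd] and D = path_dataD(2,3)[OF pd] and c\<gamma> = path_dataD(4)[OF pd] and gU = path_dataD(5)[OF pd]
    and m = path_data_measurable[OF pd] and e = path_data_nn_integral[OF pd]
  let ?h = "\<lambda>t. ennreal (sqrt (bergman_metric U (\<gamma> t) (D t)))"
  have "(\<integral>\<^sup>+t. ?h t * indicator ({a..c} - S) t \<partial>lborel) =
     (\<integral>\<^sup>+t. ?h t * indicator ({a..b} - S) t + ?h t * indicator ({b..c} - S) t \<partial>lborel)"
  proof (rule nn_integral_cong_AE)
    have "AE t in lborel. t \<notin> {b}" by (rule AE_not_finite) simp
    then show "AE t in lborel. ?h t * indicator ({a..c} - S) t = ?h t * indicator ({a..b} - S) t + ?h t * indicator ({b..c} - S) t"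
      by eventually_elim (use abc in \<open>auto simp: indicator_def\<close>)
  qed
  also have "\<dots> = (\<integral>\<^sup>+t. ?h t * indicator ({a..b} - S) t \<partial>lborel) + (\<integral>\<^sup>+t. ?h t * indicator ({b..c} - S) t \<partial>lborel)"
    by (rule nn_integral_add) (use m[of "{a..b}"] m[of "{b..c}"] abc in auto)
  finally show ?thesis using e[of "{a..c}"] e[of "{a..b}"] e[of "{b..c}"] abc by auto
qed

text \<open>The affine substitution \<open>t = u + c * s\<close>. Allowing \<open>c < 0\<close>
  makes the reversal of a path a special case.\<close>

lemma length_subpath:
  assumes g: "\<gamma> \<in> bpaths z w" and uv: "u \<in> {0..1}" "v \<in> {0..1}" "u \<noteq> v"
  shows "bergman_length U (subpath u v \<gamma>) = (\<integral>\<^sup>+t. ennreal (speed \<gamma> t) * indicator {min u v..max u v} t \<partial>lborel)"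
proof -
  obtain S D where pd: "path_data \<gamma> S D" by (rule bpaths_data[OF g])
  note S = path_dataD(1)[OF pd] and D = path_dataD(2,3)[OF pd] and c\<gamma> = path_dataD(4)[OF pd] and gU = path_dataD(5)[OF pd]
    and m = path_data_measurable[OF pd] and e = path_data_nn_integral[OF pd]
  define A where "A = {min u v..max u v}"
  define c where "c = v - u"
  have c: "c \<noteq> 0" using uv by (simp add: c_def)
  have A: "A \<in> sets borel" "A \<subseteq> {0..1}" using uv by (auto simp: A_def)
  let ?h = "\<lambda>t. ennreal (sqrt (bergman_metric U (\<gamma> t) (D t))) * indicator (A - S) t"
  have mem: "u + c * s \<in> A \<longleftrightarrow> s \<in> {0..1}" for s
  proof (cases "u < v")
    case True
    then have 1: "u \<le> u + c * s \<longleftrightarrow> 0 \<le> s" by (simp add: c_def zero_le_mult_iff)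
    have "u + c * s \<le> v \<longleftrightarrow> (v - u) * s \<le> (v - u) * 1" by (simp add: c_def algebra_simps)
    also have "\<dots> \<longleftrightarrow> s \<le> 1" using True by (subst mult_le_cancel_left_pos) auto
    finally show ?thesis using 1 True by (auto simp: A_def)
  next
    case False
    then have "v < u" using uv by simp
    then have 1: "u + c * s \<le> u \<longleftrightarrow> 0 \<le> s" by (simp add: c_def mult_le_0_iff)
    have "v \<le> u + c * s \<longleftrightarrow> (u - v) * s \<le> (u - v) * 1" by (simp add: c_def algebra_simps)
    also have "\<dots> \<longleftrightarrow> s \<le> 1" using \<open>v < u\<close> by (subst mult_le_cancel_left_pos) auto
    finally show ?thesis using 1 \<open>v < u\<close> by (auto simp: A_def)
  qed
  have "(\<integral>\<^sup>+t. ennreal (speed \<gamma> t) * indicator A t \<partial>lborel) = (\<integral>\<^sup>+t. ?h t \<partial>lborel)" by (rule e[OF A(2)])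
  also have "\<dots> = ennreal \<bar>c\<bar> * (\<integral>\<^sup>+s. ?h (u + c * s) \<partial>lborel)"
    by (rule nn_integral_real_affine[OF m[OF A] c])
  also have "\<dots> = (\<integral>\<^sup>+s. ennreal \<bar>c\<bar> * ?h (u + c * s) \<partial>lborel)"
  proof (rule nn_integral_cmult[symmetric])
    have "(\<lambda>s. u + c * s) \<in> borel_measurable borel" by measurable
    from measurable_compose[OF this m[OF A]] show "(\<lambda>s. ?h (u + c * s)) \<in> borel_measurable lborel" by simp
  qed
  also have "\<dots> = (\<integral>\<^sup>+s. ennreal (speed (subpath u v \<gamma>) s) * indicator {0..1} s \<partial>lborel)"
  proof (rule nn_integral_cong_AE)
    have "inj (\<lambda>s. u + c * s)" using c by (auto simp: inj_on_def)
    then have "finite ((\<lambda>s. u + c * s) -` S)" by (rule finite_vimageI[OF S])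
    from AE_not_finite[OF this]
    show "AE s in lborel. ennreal \<bar>c\<bar> * ?h (u + c * s) = ennreal (speed (subpath u v \<gamma>) s) * indicator {0..1} s"
    proof eventually_elim
      case (elim s)
      show ?case
      proof (cases "s \<in> {0..1}")
        case True
        then have inA: "u + c * s \<in> A" by (simp add: mem)
        then have ts: "u + c * s \<in> {0..1} - S" using A elim by auto
        have "((\<lambda>s. u + c * s) has_vector_derivative c) (at s)"
          by (auto intro!: derivative_eq_intros simp: has_real_derivative_iff_has_vector_derivative[symmetric])
        from vector_diff_chain_at[OF this D(1)[OF ts]]
        have "((\<lambda>s. \<gamma> (u + c * s)) has_vector_derivative c *\<^sub>R D (u + c * s)) (at s)" by (simp add: o_def)
        moreover have sp: "subpath u v \<gamma> = (\<lambda>s. \<gamma> (u + c * s))" by (auto simp: subpath_def c_def add.commute)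
        ultimately have "vector_derivative (subpath u v \<gamma>) (at s) = c *\<^sub>R D (u + c * s)" by (simp add: vector_derivative_at)
        then have "speed (subpath u v \<gamma>) s = \<bar>c\<bar> * sqrt (bergman_metric U (\<gamma> (u + c * s)) (D (u + c * s)))"
          unfolding speed_def sp using gU[of "u + c * s"] ts by (simp add: bergman_metric_scaleR real_sqrt_mult)
        then show ?thesis using True inA ts by (simp add: ennreal_mult')
      next
        case False
        then have "u + c * s \<notin> A" using mem[of s] by blast
        then show ?thesis using False by simp
      qed
    qed
  qed
  finally show ?thesis by (simp add: bergman_length_eq A_def)
qed

text \<open>The derivatives at 0 and 1 also depend on values outside the unit interval, but two
  points are negligible.\<close>

lemma length_cong:
  assumes "\<And>t. t \<in> {0..1} \<Longrightarrow> \<gamma> t = \<sigma> t"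
  shows "bergman_length U \<gamma> = bergman_length U \<sigma>"
  unfolding bergman_length_eq
proof (rule nn_integral_cong_AE)
  have "AE t in lborel. t \<notin> {0, 1::real}" by (rule AE_not_finite) simp
  then show "AE t in lborel. ennreal (speed \<gamma> t) * indicator {0..1} t = ennreal (speed \<sigma> t) * indicator {0..1} t"
  proof eventually_elim
    case (elim t)
    show ?case
    proof (cases "t \<in> {0..1}")
      case True
      then have t: "t \<in> {0<..<1}" using elim by auto
      have "vector_derivative \<gamma> (at t) = vector_derivative \<sigma> (at t)"
        by (rule vector_derivative_cong_open[OF _ t]) (use assms in auto)
      then show ?thesis using assms[OF True] by (simp add: speed_def)
    qed simp
  qed
qed

lemma bpaths_subpath: "\<gamma> \<in> bpaths z w \<Longrightarrow> u \<in> {0..1} \<Longrightarrow> v \<in> {0..1} \<Longrightarrow> subpath u v \<gamma> \<in> bpaths (\<gamma> u) (\<gamma> v)"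
  using path_image_subpath_subset[of u v \<gamma>] by (auto simp: bpaths_def valid_path_subpath)

lemma bpaths_join: "\<gamma> \<in> bpaths z y \<Longrightarrow> \<sigma> \<in> bpaths y w \<Longrightarrow> \<gamma> +++ \<sigma> \<in> bpaths z w"
  by (auto simp: bpaths_def path_image_join intro!: valid_path_join)

lemma length_join:
  assumes g: "\<gamma> \<in> bpaths z y" and s: "\<sigma> \<in> bpaths y w"
  shows "bergman_length U (\<gamma> +++ \<sigma>) = bergman_length U \<gamma> + bergman_length U \<sigma>"
proof -
  let ?j = "\<gamma> +++ \<sigma>"
  note j = bpaths_join[OF g s]
  have ys: "\<gamma> 1 = \<sigma> 0" using g s by (auto simp: bpaths_def pathstart_def pathfinish_def)
  have 1: "bergman_length U \<gamma> = bergman_length U (subpath 0 (1/2) ?j)"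
    by (rule length_cong) (auto simp: subpath_def joinpaths_def)
  have 2: "bergman_length U \<sigma> = bergman_length U (subpath (1/2) 1 ?j)"
    by (rule length_cong) (auto simp: subpath_def joinpaths_def ys)
  show ?thesis
    unfolding 1 2 using length_split[OF j, of 0 "1/2" 1] length_subpath[OF j, of 0 "1/2"] length_subpath[OF j, of "1/2" 1]
    by (simp add: bergman_length_eq)
qed

lemma bpaths_reverse: "\<gamma> \<in> bpaths z w \<Longrightarrow> reversepath \<gamma> \<in> bpaths w z"
  by (auto simp: bpaths_def valid_path_imp_reverse)

lemma length_reverse: "\<gamma> \<in> bpaths z w \<Longrightarrow> bergman_length U (reversepath \<gamma>) = bergman_length U \<gamma>"
proof -
  assume g: "\<gamma> \<in> bpaths z w"
  have "bergman_length U (reversepath \<gamma>) = bergman_length U (subpath 1 0 \<gamma>)"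
    by (rule length_cong) (simp add: reversepath_def subpath_def)
  then show ?thesis using length_subpath[OF g, of 1 0] by (simp add: bergman_length_eq)
qed

lemma edist_le: "\<gamma> \<in> bpaths z w \<Longrightarrow> edist z w \<le> bergman_length U \<gamma>"
  unfolding edist_def by (rule INF_lower)

lemma edist_lessE:
  assumes "edist z w < r" obtains \<gamma> where "\<gamma> \<in> bpaths z w" "bergman_length U \<gamma> < r"
  using assms unfolding edist_def by (auto simp: INF_less_iff)

text \<open>A polynomial path has a continuous derivative and so bounded speed, whereas an arbitrary
  \<open>valid_path\<close> could have infinite length.\<close>

lemma edist_finite:
  assumes "z \<in> U" "w \<in> U" shows "edist z w < \<infinity>"
proof -
  obtain g where g: "polynomial_function g" "path_image g \<subseteq> U" "pathstart g = z" "pathfinish g = w"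
    using connected_open_polynomial_connected[OF open_U connected_U assms] by metis
  obtain g' where g': "polynomial_function g'" "\<And>x. (g has_vector_derivative g' x) (at x)"
    using has_vector_derivative_polynomial_function[OF g(1)] by metis
  have gb: "g \<in> bpaths z w" using g by (simp add: bpaths_def valid_path_polynomial_function)
  have gU: "g t \<in> U" if "t \<in> {0..1}" for t using g(2) that by (auto simp: path_image_def)
  have sp: "speed g t = sqrt (bergman_metric U (g t) (g' t))" for t
    using vector_derivative_at[OF g'(2)] by (simp add: speed_def)
  have "continuous_on {0..1} (\<lambda>t. (g t, g' t))"
    using continuous_on_polymonial_function[OF g(1)] continuous_on_polymonial_function[OF g'(1)] by (intro continuous_intros)
  from continuous_on_compose2[OF continuous_bergman_metric this] gU
  have "continuous_on {0..1} (\<lambda>t. bergman_metric U (g t) (g' t))" by (auto simp: image_subset_iff)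
  then have "continuous_on {0..1} (speed g)" unfolding sp[abs_def] by (intro continuous_intros)
  then have "bounded (speed g ` {0..1})" by (intro compact_imp_bounded compact_continuous_image compact_Icc)
  then obtain M where M: "\<And>t. t \<in> {0..1} \<Longrightarrow> norm (speed g t) \<le> M"
    unfolding bounded_iff by blast
  have "bergman_length U g \<le> (\<integral>\<^sup>+t. ennreal M * indicator {0..1::real} t \<partial>lborel)"
    unfolding bergman_length_eq
  proof (rule nn_integral_mono)
    fix t :: real
    show "ennreal (speed g t) * indicator {0..1} t \<le> ennreal M * indicator {0..1} t"
      using M[of t] by (cases "t \<in> {0..1}") (auto intro!: ennreal_leI)
  qed
  also have "\<dots> = ennreal M" by (simp add: nn_integral_cmult_indicator)
  finally show ?thesis using edist_le[OF gb] by (simp add: order_le_less_trans)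
qed

text \<open>The metric is bounded on the product of a compact ball with the unit sphere, and its
  quadratic scaling extends the bound to all vectors. Straight segments then give the
  estimate.\<close>

lemma edist_local:
  assumes z: "z \<in> U"
  obtains \<delta> M where "\<delta> > 0" "M > 0" "cball z \<delta> \<subseteq> U"
    "\<And>x y. x \<in> cball z \<delta> \<Longrightarrow> y \<in> cball z \<delta> \<Longrightarrow> edist x y \<le> ennreal (M * norm (y - x))"
proof -
  obtain \<delta> where \<delta>: "\<delta> > 0" "cball z \<delta> \<subseteq> U" using open_U z open_contains_cball by blast
  have "continuous_on (cball z \<delta> \<times> sphere (0::complex^'n) 1) (\<lambda>(z, v). bergman_metric U z v)"
    by (rule continuous_on_subset[OF continuous_bergman_metric]) (use \<delta> in auto)
  then have "bounded ((\<lambda>(z, v). bergman_metric U z v) ` (cball z \<delta> \<times> sphere (0::complex^'n) 1))"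
    by (intro compact_imp_bounded compact_continuous_image compact_Times compact_cball compact_sphere)
  then obtain B where B: "B > 0" "\<And>p. p \<in> cball z \<delta> \<times> sphere (0::complex^'n) 1 \<Longrightarrow> norm ((\<lambda>(z, v). bergman_metric U z v) p) \<le> B"
    unfolding bounded_pos by blast
  have B: "B > 0" "\<And>x v. x \<in> cball z \<delta> \<Longrightarrow> norm v = 1 \<Longrightarrow> \<bar>bergman_metric U x v\<bar> \<le> B"
    using B(1) B(2)[of "(_, _)"] by auto
  have le: "sqrt (bergman_metric U x v) \<le> sqrt B * norm v" if x: "x \<in> cball z \<delta>" for x v
  proof (cases "v = 0")
    case True
    then show ?thesis using bergman_metric_scaleR[of x 0 0] x \<delta>(2) by auto
  next
    case False
    have xU: "x \<in> U" using x \<delta> by auto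
    have "bergman_metric U x v = bergman_metric U x (norm v *\<^sub>R (v /\<^sub>R norm v))" using False by simp
    also have "\<dots> = (norm v)^2 * bergman_metric U x (v /\<^sub>R norm v)" by (rule bergman_metric_scaleR[OF xU])
    also have "\<dots> \<le> (norm v)^2 * B"
      using B(2)[OF x, of "v /\<^sub>R norm v"] False by (intro mult_left_mono) auto
    finally have "sqrt (bergman_metric U x v) \<le> sqrt ((norm v)^2 * B)" by simp
    then show ?thesis by (simp add: real_sqrt_mult mult.commute)
  qed
  have "edist x y \<le> ennreal (sqrt B * norm (y - x))" if xy: "x \<in> cball z \<delta>" "y \<in> cball z \<delta>" for x y
  proof -
    have seg: "closed_segment x y \<subseteq> cball z \<delta>" using xy by (simp add: closed_segment_subset)
    then have lb: "linepath x y \<in> bpaths x y" using \<delta> by (auto simp: bpaths_def)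
    have "bergman_length U (linepath x y) \<le> (\<integral>\<^sup>+t. ennreal (sqrt B * norm (y - x)) * indicator {0..1::real} t \<partial>lborel)"
      unfolding bergman_length_eq
    proof (intro nn_integral_mono)
      fix t :: real
      show "ennreal (speed (linepath x y) t) * indicator {0..1} t \<le> ennreal (sqrt B * norm (y - x)) * indicator {0..1} t"
      proof (cases "t \<in> {0..1}")
        case True
        then have "linepath x y t \<in> cball z \<delta>" using seg linepath_in_path[of t x y] by auto
        from le[OF this, of "y - x"] show ?thesis
          using vector_derivative_at[OF has_vector_derivative_linepath_within[of x y t UNIV]] True
            by (auto simp: speed_def intro!: ennreal_leI)
      qed simp
    qed
    also have "\<dots> = ennreal (sqrt B * norm (y - x))" by (simp add: nn_integral_cmult_indicator)
    finally show ?thesis using edist_le[OF lb] by simp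
  qed
  then show ?thesis using that[OF \<delta>(1) _ \<delta>(2), of "sqrt B"] B by simp
qed

lemma d_nonneg: "d z w \<ge> 0" by (simp add: bergman_dist_eq)

lemma edist_eq_d: "z \<in> U \<Longrightarrow> w \<in> U \<Longrightarrow> edist z w = ennreal (d z w)"
  using edist_finite[of z w] by (simp add: bergman_dist_eq)

lemma d_le_length:
  assumes "\<gamma> \<in> bpaths z w" "bergman_length U \<gamma> \<le> ennreal r" "r \<ge> 0"
  shows "d z w \<le> r"
proof -
  have "edist z w \<le> ennreal r" using edist_le[OF assms(1)] assms(2) by simp
  then show ?thesis unfolding bergman_dist_eq using assms(3) by (simp add: enn2real_leI)
qed

lemma d_lessE:
  assumes "z \<in> U" "w \<in> U" "d z w < r" obtains \<gamma> where "\<gamma> \<in> bpaths z w" "bergman_length U \<gamma> < ennreal r"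
proof -
  have "edist z w < ennreal r" using assms d_nonneg[of z w] by (simp add: edist_eq_d ennreal_less_iff)
  then show ?thesis using edist_lessE that by blast
qed

lemma d_triangle:
  assumes "z \<in> U" "y \<in> U" "w \<in> U" shows "d z w \<le> d z y + d y w"
proof (rule field_le_epsilon)
  fix e :: real assume e: "e > 0"
  obtain \<gamma> where \<gamma>: "\<gamma> \<in> bpaths z y" "bergman_length U \<gamma> < ennreal (d z y + e/2)" using d_lessE[OF assms(1,2), of "d z y + e/2"] e by auto
  obtain \<sigma> where \<sigma>: "\<sigma> \<in> bpaths y w" "bergman_length U \<sigma> < ennreal (d y w + e/2)" using d_lessE[OF assms(2,3), of "d y w + e/2"] e by auto
  have "bergman_length U (\<gamma> +++ \<sigma>) \<le> ennreal (d z y + e/2) + ennreal (d y w + e/2)"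
    unfolding length_join[OF \<gamma>(1) \<sigma>(1)] using \<gamma>(2) \<sigma>(2) by (intro add_mono) auto
  also have "\<dots> = ennreal (d z y + d y w + e)"
    using d_nonneg e by (subst ennreal_plus[symmetric]) (auto simp: algebra_simps intro!: add_nonneg_nonneg)
  finally show "d z w \<le> d z y + d y w + e"
    using bpaths_join[OF \<gamma>(1) \<sigma>(1)] d_nonneg e by (intro d_le_length) (auto intro!: add_nonneg_nonneg)
qed

lemma edist_sym: "edist z w = edist w z"
proof -
  have "edist z w \<le> edist w z" for z w
    unfolding edist_def[of w z]
    by (rule INF_greatest) (metis bpaths_reverse length_reverse edist_le)
  then show ?thesis by (simp add: order_antisym)
qed

lemma d_sym: "d z w = d w z" by (simp add: bergman_dist_eq edist_sym)

lemma d_local: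
  assumes z: "z \<in> U"
  obtains \<delta> M where "\<delta> > 0" "M > 0" "cball z \<delta> \<subseteq> U"
    "\<And>x y. x \<in> cball z \<delta> \<Longrightarrow> y \<in> cball z \<delta> \<Longrightarrow> d x y \<le> M * norm (y - x)"
proof -
  obtain \<delta> M where *: "\<delta> > 0" "M > 0" "cball z \<delta> \<subseteq> U"
    "\<And>x y. x \<in> cball z \<delta> \<Longrightarrow> y \<in> cball z \<delta> \<Longrightarrow> edist x y \<le> ennreal (M * norm (y - x))"
    using edist_local[OF z] by metis
  have "d x y \<le> M * norm (y - x)" if "x \<in> cball z \<delta>" "y \<in> cball z \<delta>" for x y
    unfolding bergman_dist_eq using *(4)[OF that] *(2) by (simp add: enn2real_leI)
  with * that show ?thesis by blast
qed

lemma d_self: "z \<in> U \<Longrightarrow> d z z = 0"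
proof -
  assume z: "z \<in> U"
  obtain \<delta> M where *: "\<delta> > 0" "\<And>x y. x \<in> cball z \<delta> \<Longrightarrow> y \<in> cball z \<delta> \<Longrightarrow> d x y \<le> M * norm (y - x)"
    using d_local[OF z] by metis
  show ?thesis using *(2)[of z z] *(1) d_nonneg[of z z] by simp
qed

lemma continuous_d: assumes "z \<in> U" shows "continuous_on U (d z)"
proof (rule continuous_at_imp_continuous_on, rule ballI)
  fix x assume x: "x \<in> U"
  obtain \<delta> M where *: "\<delta> > 0" "M > 0" "cball x \<delta> \<subseteq> U"
    "\<And>x' y. x' \<in> cball x \<delta> \<Longrightarrow> y \<in> cball x \<delta> \<Longrightarrow> d x' y \<le> M * norm (y - x')"
    using d_local[OF x] by metis
  show "isCont (d z) x"
    unfolding continuous_at_eps_delta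
  proof (intro allI impI)
    fix e :: real assume e: "e > 0"
    show "\<exists>r>0. \<forall>x'. dist x' x < r \<longrightarrow> dist (d z x') (d z x) < e"
    proof (intro exI[of _ "min \<delta> (e / M)"] conjI allI impI)
      show "min \<delta> (e / M) > 0" using * e by simp
      fix y assume y: "dist y x < min \<delta> (e / M)"
      then have yb: "y \<in> cball x \<delta>" "x \<in> cball x \<delta>" using *(1) by (auto simp: dist_commute)
      have yU: "y \<in> U" using yb * by blast
      have "d x y \<le> M * norm (y - x)" by (rule *(4)[OF yb(2,1)])
      also have "\<dots> < e" using y *(2) by (simp add: dist_norm field_simps)
      finally have "d x y < e" .
      moreover have "d z y \<le> d z x + d x y" "d z x \<le> d z y + d x y"
        using d_triangle[OF assms x yU] d_triangle[OF assms yU x] d_sym[of x y] by auto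
      ultimately show "dist (d z y) (d z x) < e" by (simp add: dist_real_def abs_less_iff)
    qed
  qed
qed

text \<open>Speeds agree off the exceptional set by \<open>bergman_metric_invariant\<close>; the
  work lies in showing that the image is again piecewise continuously differentiable.\<close>

lemma bpaths_image:
  assumes \<psi>: "aut \<psi>" and g: "\<gamma> \<in> bpaths z w"
  shows "(\<lambda>t. \<psi> (\<gamma> t)) \<in> bpaths (\<psi> z) (\<psi> w)" "bergman_length U (\<lambda>t. \<psi> (\<gamma> t)) = bergman_length U \<gamma>"
proof -
  note bh = biholomorphismD[OF \<psi>]
  obtain S D where pd: "path_data \<gamma> S D" by (rule bpaths_data[OF g])
  note S = path_dataD(1)[OF pd] and D = path_dataD(2,3)[OF pd] and c\<gamma> = path_dataD(4)[OF pd] and gU = path_dataD(5)[OF pd]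
    and m = path_data_measurable[OF pd] and e = path_data_nn_integral[OF pd]
  have D': "((\<lambda>t. \<psi> (\<gamma> t)) has_vector_derivative holo_derivative \<psi> (\<gamma> t) (D t)) (at t)" if "t \<in> {0..1} - S" for t
  proof -
    have t: "\<gamma> t \<in> U" using gU that by auto
    note p = holo_map_on_has_derivative(1)[OF bh(1) t]
    have "((\<lambda>t. \<psi> (\<gamma> t)) has_derivative (\<lambda>s. holo_derivative \<psi> (\<gamma> t) (s *\<^sub>R D t))) (at t)"
      using has_derivative_compose[OF D(1)[OF that, unfolded has_vector_derivative_def] p] .
    then show ?thesis by (simp add: has_vector_derivative_def linear_cmul[OF has_derivative_linear[OF p]])
  qed
  have cD: "continuous_on ({0..1} - S) (\<lambda>t. holo_derivative \<psi> (\<gamma> t) (D t))"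
  proof -
    have eq: "holo_derivative \<psi> (\<gamma> t) (D t) = (\<chi> i. \<Sum>j\<in>UNIV. dird (\<lambda>x. \<psi> x $ i) (axis j 1) (\<gamma> t) * D t $ j)"
      if "t \<in> {0..1} - S" for t
    proof -
      have t: "\<gamma> t \<in> U" using gU that by auto
      have h: "holo_on U (\<lambda>x. \<psi> x $ i)" for i using bh(1) by (simp add: holo_map_on_def)
      have "dird (\<lambda>x. \<psi> x $ i) (D t) (\<gamma> t) = (\<Sum>j\<in>UNIV. dird (\<lambda>x. \<psi> x $ i) (axis j 1) (\<gamma> t) * D t $ j)" for i
        by (rule dird_basis[OF h t])
      then show ?thesis unfolding holo_derivative_def by (simp only:)
    qed
    have "continuous_on ({0..1} - S) (\<lambda>t. dird (\<lambda>x. \<psi> x $ i) (axis j 1) (\<gamma> t))" for i j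
    proof -
      have "holo_on U (\<lambda>x. \<psi> x $ i)" using bh(1) by (simp add: holo_map_on_def)
      then have 1: "continuous_on U (dird (\<lambda>x. \<psi> x $ i) (axis j 1))"
        by (intro holo_on_continuous holo_on_directional_derivative open_U)
      have 2: "continuous_on ({0..1} - S) \<gamma>" using c\<gamma> by (rule continuous_on_subset) auto
      show ?thesis by (rule continuous_on_compose2[OF 1 2]) (use gU in auto)
    qed
    then have "continuous_on ({0..1} - S) (\<lambda>t. (\<chi> i. \<Sum>j\<in>UNIV. dird (\<lambda>x. \<psi> x $ i) (axis j 1) (\<gamma> t) * D t $ j))"
      by (intro continuous_intros D(2))
    then show ?thesis by (rule continuous_on_eq) (rule eq[symmetric])
  qed
  have c: "continuous_on {0..1} (\<lambda>t. \<psi> (\<gamma> t))"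
    by (rule continuous_on_compose2[OF holo_map_on_continuous[OF bh(1)] c\<gamma>]) (use gU in auto)
  have "(\<lambda>t. \<psi> (\<gamma> t)) C1_differentiable_on ({0..1} - S)"
    unfolding C1_differentiable_on_def
    by (rule exI[of _ "\<lambda>t. holo_derivative \<psi> (\<gamma> t) (D t)"]) (intro conjI ballI D' cD)
  then have "valid_path (\<lambda>t. \<psi> (\<gamma> t))"
    unfolding valid_path_def piecewise_C1_differentiable_on_def using S c by blast
  then show "(\<lambda>t. \<psi> (\<gamma> t)) \<in> bpaths (\<psi> z) (\<psi> w)"
    using g gU bh(5) by (auto simp: bpaths_def path_image_def pathstart_def pathfinish_def)
  show "bergman_length U (\<lambda>t. \<psi> (\<gamma> t)) = bergman_length U \<gamma>"
    unfolding bergman_length_eq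
  proof (rule nn_integral_cong_AE)
    show "AE t in lborel. ennreal (speed (\<lambda>t. \<psi> (\<gamma> t)) t) * indicator {0..1} t = ennreal (speed \<gamma> t) * indicator {0..1} t"
      using AE_not_finite[OF S]
    proof eventually_elim
      case (elim t)
      show ?case
      proof (cases "t \<in> {0..1}")
        case True
        then have t: "t \<in> {0..1} - S" using elim by simp
        show ?thesis using vector_derivative_at[OF D(1)[OF t]] vector_derivative_at[OF D'[OF t]]
          by (simp add: speed_def bergman_metric_invariant[OF \<psi> gU[OF True]])
      qed simp
    qed
  qed
qed

text \<open>Automorphisms cannot increase the distance, and the inverse of an automorphism is one
  too.\<close>

lemma d_invariant:
  assumes \<psi>: "aut \<psi>" and z: "z \<in> U" and w: "w \<in> U" shows "d (\<psi> z) (\<psi> w) = d z w"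
proof -
  have le: "edist (\<psi> z) (\<psi> w) \<le> edist z w" if "aut \<psi>" for \<psi> z w
    unfolding edist_def[of z w]
    by (rule INF_greatest) (metis bpaths_image[OF that] edist_le)
  note bh = biholomorphismD[OF \<psi>]
  have "edist z w \<le> edist (\<psi> z) (\<psi> w)" using le[OF aut_inv[OF \<psi>], of "\<psi> z" "\<psi> w"] bh z w by simp
  with le[OF \<psi>, of z w] show ?thesis by (simp add: bergman_dist_eq order_antisym)
qed

text \<open>The path leaves \<open>ball z \<delta>\<close>, and up to its first exit its Euclidean
  length is at least \<delta> because its displacement is. Up to that time the lower bound
  \<open>c\<close> on the metric is available.\<close>

lemma path_length_lower:
  assumes g: "\<gamma> \<in> bpaths z w" and \<delta>: "cball z \<delta> \<subseteq> U" "\<delta> > 0" and w: "w \<notin> ball z \<delta>"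
    and c: "c \<ge> 0" "\<And>x v. x \<in> cball z \<delta> \<Longrightarrow> c * norm v \<le> sqrt (bergman_metric U x v)"
  shows "ennreal (c * \<delta>) \<le> bergman_length U \<gamma>"
proof -
  obtain S D where pd: "path_data \<gamma> S D" by (rule bpaths_data[OF g])
  note S = path_dataD(1)[OF pd] and D = path_dataD(2,3)[OF pd] and c\<gamma> = path_dataD(4)[OF pd] and gU = path_dataD(5)[OF pd]
    and m = path_data_measurable[OF pd] and e = path_data_nn_integral[OF pd]
  have ends: "\<gamma> 0 = z" "\<gamma> 1 = w" using g by (auto simp: bpaths_def pathstart_def pathfinish_def)
  \<comment> \<open>The times spent outside the ball; this set is compact and its least element
    \<open>s0\<close> is the first exit.\<close>
  define C where "C = {s\<in>{0..1}. \<gamma> s \<in> - ball z \<delta>}"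
  have "C = {0..1} \<inter> \<gamma> -` (- ball z \<delta>)" by (auto simp: C_def)
  then have "closed C" using continuous_closed_preimage[OF c\<gamma> closed_atLeastAtMost, of "- ball z \<delta>"]
    by (simp add: closed_Compl)
  moreover have "bounded C" by (rule bounded_subset[of "{0..1}"]) (auto simp: C_def)
  ultimately have "compact C" by (simp add: compact_eq_bounded_closed)
  moreover have "1 \<in> C" using ends w by (simp add: C_def)
  ultimately obtain s0 where s0: "s0 \<in> C" "\<And>s. s \<in> C \<Longrightarrow> s0 \<le> s"
    using compact_attains_inf[of C] by blast
  have s01: "s0 \<in> {0..1}" and far: "norm (\<gamma> s0 - z) \<ge> \<delta>" using s0(1) by (auto simp: C_def dist_norm norm_minus_commute)
  have inb: "\<gamma> s \<in> ball z \<delta>" if "s \<in> {0..<s0}" for s using s0(2)[of s] that s01 by (force simp: C_def)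
  define T where "T = insert s0 S"
  have T: "finite T" using S by (simp add: T_def)
  define A where "A = {0..s0} - T"
  have "T \<in> sets borel" using finite_imp_closed[OF T] by auto
  then have "A \<in> sets borel" unfolding A_def by (intro sets.Diff) auto
  moreover have "A \<subseteq> {0..1} - S" using s01 by (auto simp: A_def T_def)
  ultimately have A: "A \<in> sets borel" "A \<subseteq> {0..1} - S" by auto
  define D' where "D' = (\<lambda>t. indicator A t *\<^sub>R D t)"
  have D'm: "D' \<in> borel_measurable lborel" unfolding D'_def
    using borel_measurable_continuous_on_indicator[OF A(1) continuous_on_subset[OF D(2) A(2)]] by simp
  have hi: "(D has_integral (\<gamma> s0 - \<gamma> 0)) {0..s0}"
    by (rule fundamental_theorem_of_calculus_interior_strong[OF T])
       (use s01 D(1) in \<open>auto simp: T_def intro: continuous_on_subset[OF c\<gamma>]\<close>)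
  have hi': "(D' has_integral (\<gamma> s0 - \<gamma> 0)) UNIV"
  proof -
    have "((\<lambda>t. if t \<in> {0..s0} then D t else 0) has_integral (\<gamma> s0 - \<gamma> 0)) UNIV" using hi by (simp only: has_integral_restrict_UNIV)
    then show ?thesis
      by (rule has_integral_spike_finite[OF T, rotated]) (auto simp: D'_def A_def indicator_def)
  qed
  \<comment> \<open>The Euclidean length up to the first exit. If it is infinite nothing is to be
    shown; otherwise \<open>D'\<close> is Lebesgue integrable and its integral is the displacement
    given by the fundamental theorem of calculus.\<close>
  define N where "N = (\<integral>\<^sup>+t. ennreal (norm (D' t)) \<partial>lborel)"
  have N: "ennreal \<delta> \<le> N"
  proof (cases "N = \<infinity>")
    case False
    then have int: "integrable lborel D'" using D'm by (intro integrableI_bounded) (auto simp: N_def top.not_eq_extremum)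
    have "integral\<^sup>L lborel D' = \<gamma> s0 - \<gamma> 0" using has_integral_unique[OF has_integral_integral_lborel[OF int] hi'] .
    then have "ennreal (norm (\<gamma> s0 - z)) \<le> N" using integral_norm_bound_ennreal[OF int] ends by (simp add: N_def)
    then show ?thesis using far by (meson ennreal_leI order_trans)
  qed simp
  have "ennreal (c * \<delta>) = ennreal c * ennreal \<delta>" using c(1) by (simp add: ennreal_mult')
  also have "\<dots> \<le> ennreal c * N" using N by (rule mult_left_mono) simp
  also have "\<dots> = (\<integral>\<^sup>+t. ennreal c * ennreal (norm (D' t)) \<partial>lborel)"
    unfolding N_def using D'm by (intro nn_integral_cmult[symmetric]) auto
  also have "\<dots> \<le> (\<integral>\<^sup>+t. ennreal (sqrt (bergman_metric U (\<gamma> t) (D t))) * indicator ({0..1} - S) t \<partial>lborel)"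
  proof (intro nn_integral_mono)
    fix t
    show "ennreal c * ennreal (norm (D' t)) \<le> ennreal (sqrt (bergman_metric U (\<gamma> t) (D t))) * indicator ({0..1} - S) t"
    proof (cases "t \<in> A")
      case True
      then have "\<gamma> t \<in> cball z \<delta>" using inb[of t] by (auto simp: A_def T_def)
      from c(2)[OF this, of "D t"] show ?thesis using True A c(1)
        by (auto simp: D'_def ennreal_mult'[symmetric] indicator_def intro!: ennreal_leI)
    qed (simp add: D'_def)
  qed
  also have "\<dots> = bergman_length U \<gamma>" using e[of "{0..1}"] by (simp add: bergman_length_eq)
  finally show ?thesis .
qed

text \<open>On the compact Euclidean ball \<open>k\<close> is bounded, so
  \<open>bergman_metric_lower\<close> yields a uniform constant \<open>c\<close> there; any point
  outside is at Bergman distance at least \<open>c * \<delta>\<close>.\<close>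

lemma small_balls:
  assumes z: "z \<in> U" and \<delta>: "cball z \<delta> \<subseteq> U" "\<delta> > 0"
  obtains \<epsilon> where "\<epsilon> > 0" "\<And>w. w \<in> U \<Longrightarrow> d z w \<le> \<epsilon> \<Longrightarrow> w \<in> ball z \<delta>"
proof -
  obtain B where B: "B > 0" "\<And>z v. z \<in> U \<Longrightarrow> (norm v)^2 \<le> B * k z * bergman_metric U z v" using bergman_metric_lower by metis
  have "bounded (k ` cball z \<delta>)"
    by (intro compact_imp_bounded compact_continuous_image continuous_on_subset[OF continuous_kernel_diag \<delta>(1)]) simp
  then obtain m where m: "m > 0" "\<And>x. x \<in> cball z \<delta> \<Longrightarrow> norm (k x) \<le> m"
    unfolding bounded_pos by blast
  then have m: "m > 0" "\<And>x. x \<in> cball z \<delta> \<Longrightarrow> k x \<le> m" by (auto simp: abs_le_iff)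
  define c where "c = 1 / sqrt (B * m)"
  have c: "c > 0" using B m by (simp add: c_def)
  have cle: "c * norm v \<le> sqrt (bergman_metric U x v)" if x: "x \<in> cball z \<delta>" for x v
  proof -
    have xU: "x \<in> U" using x \<delta> by auto
    have "(norm v)^2 \<le> B * k x * bergman_metric U x v" by (rule B(2)[OF xU])
    also have "\<dots> \<le> B * m * bergman_metric U x v"
      using m(2)[OF x] B(1) bergman_metric_nonneg[OF xU] by (intro mult_right_mono mult_left_mono) auto
    finally have "(norm v)^2 / (B * m) \<le> bergman_metric U x v" using B m by (simp add: pos_divide_le_eq mult.commute)
    then have "sqrt ((norm v)^2 / (B * m)) \<le> sqrt (bergman_metric U x v)" by simp
    then show ?thesis by (simp add: c_def real_sqrt_divide)
  qed
  have "w \<in> ball z \<delta>" if w: "w \<in> U" "d z w \<le> c * \<delta> / 2" for w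
  proof (rule ccontr)
    assume nw: "w \<notin> ball z \<delta>"
    have "d z w < c * \<delta>" using w(2) c \<delta>(2) by (simp add: less_le_trans) (smt (verit) field_sum_of_halves mult_pos_pos)
    then obtain \<gamma> where \<gamma>: "\<gamma> \<in> bpaths z w" "bergman_length U \<gamma> < ennreal (c * \<delta>)" using d_lessE[OF z w(1)] by blast
    show False using path_length_lower[OF \<gamma>(1) \<delta> nw less_imp_le[OF c] cle] \<gamma>(2) by simp
  qed
  then show ?thesis by (intro that[of "c * \<delta> / 2"]) (use c \<delta> in auto)
qed

text \<open>A substitute for minimising geodesics: a path of length below \<open>\<rho> + e\<close>
  is cut where its arc length reaches \<rho>.\<close>

lemma intermediate_point:
  assumes z: "z \<in> U" and w: "w \<in> U" and \<rho>: "\<rho> \<ge> 0" and e: "e > 0" and less: "d z w < \<rho> + e"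
  obtains y where "y \<in> U" "d z y \<le> \<rho>" "d y w \<le> e"
proof -
  obtain \<gamma> where \<gamma>: "\<gamma> \<in> bpaths z w" "bergman_length U \<gamma> < ennreal (\<rho> + e)" using d_lessE[OF z w less] by blast
  obtain S D where pd: "path_data \<gamma> S D" by (rule bpaths_data[OF \<gamma>(1)])
  note S = path_dataD(1)[OF pd] and D = path_dataD(2,3)[OF pd] and c\<gamma> = path_dataD(4)[OF pd] and gU = path_dataD(5)[OF pd]
    and m = path_data_measurable[OF pd] and ee = path_data_nn_integral[OF pd]
  \<comment> \<open>The arc length density as an integrable real function; its primitive
    \<open>F\<close> is continuous and so attains \<rho>.\<close>
  define h where "h = (\<lambda>t. sqrt (bergman_metric U (\<gamma> t) (D t)) * indicator ({0..1} - S) t)"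
  have h0: "h t \<ge> 0" for t unfolding h_def using gU[of t] by (cases "t \<in> {0..1} - S") (auto simp: bergman_metric_nonneg)
  have he: "ennreal (h t) = ennreal (sqrt (bergman_metric U (\<gamma> t) (D t))) * indicator ({0..1} - S) t" for t
    by (simp add: h_def indicator_def)
  have hm: "h \<in> borel_measurable borel"
  proof -
    have "(\<lambda>t. enn2real (ennreal (h t))) \<in> borel_measurable borel"
      unfolding he using m[of "{0..1}"] by (intro borel_measurable_enn2real) auto
    then show ?thesis using h0 by simp
  qed
  have "(\<integral>\<^sup>+t. ennreal (h t) \<partial>lborel) = bergman_length U \<gamma>" unfolding he using ee[of "{0..1}"] by (simp add: bergman_length_eq)
  then have hint: "integrable lborel h" using \<gamma>(2) hm h0
    by (intro integrableI_nonneg) (auto simp: less_top order_less_le_trans[OF _ top_greatest])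
  then have "h integrable_on UNIV" by (meson has_integral_integrable has_integral_integral_lborel)
  then have hI: "h integrable_on {a..b}" for a b by (rule integrable_on_subinterval) auto
  define F where "F = (\<lambda>s. integral {0..s} h)"
  have F: "(\<integral>\<^sup>+t. ennreal (speed \<gamma> t) * indicator {a..b} t \<partial>lborel) = ennreal (integral {a..b} h)" if "0 \<le> a" "b \<le> 1" for a b
  proof -
    have "(\<integral>\<^sup>+t. ennreal (speed \<gamma> t) * indicator {a..b} t \<partial>lborel) = (\<integral>\<^sup>+t. ennreal (h t) * indicator {a..b} t \<partial>lborel)"
      using that by (subst ee) (auto intro!: nn_integral_cong simp: he indicator_def)
    also have "\<dots> = ennreal (integral {a..b} h)"
      by (rule nn_integral_has_integral_lebesgue'[OF h0 integrable_integral[OF hI]])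
    finally show ?thesis .
  qed
  have F1: "F 1 < \<rho> + e"
  proof -
    have "ennreal (F 1) < ennreal (\<rho> + e)" using \<gamma>(2) F[of 0 1] by (simp add: F_def bergman_length_eq)
    then show ?thesis using integral_nonneg[OF hI[of 0 1]] h0 by (simp add: ennreal_less_iff F_def)
  qed
  show ?thesis
  proof (cases "F 1 \<le> \<rho>")
    \<comment> \<open>The whole path is no longer than \<rho>, and \<open>w\<close> itself serves as
      the intermediate point.\<close>
    case True
    have "d z w \<le> \<rho>" using F[of 0 1] True by (intro d_le_length[OF \<gamma>(1) _ \<rho>]) (simp add: bergman_length_eq F_def ennreal_leI)
    then show ?thesis using that[OF w] d_self[OF w] e by simp
  next
    case False
    have "continuous_on {0..1} F" unfolding F_def by (rule indefinite_integral_continuous_1[OF hI])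
    then obtain s where s: "0 \<le> s" "s \<le> 1" "F s = \<rho>" using IVT'[of F 0 \<rho> 1] False \<rho> by (auto simp: F_def)
    have s1: "s \<noteq> 1" using s False by auto
    have ends: "\<gamma> 0 = z" "\<gamma> 1 = w" using \<gamma>(1) by (auto simp: bpaths_def pathstart_def pathfinish_def)
    have 1: "d z (\<gamma> s) \<le> \<rho>"
    proof (cases "s = 0")
      case True then show ?thesis using ends d_self[OF z] \<rho> by simp
    next
      case False
      have "bergman_length U (subpath 0 s \<gamma>) = ennreal \<rho>"
        using length_subpath[OF \<gamma>(1), of 0 s] F[of 0 s] s False by (simp add: F_def)
      then show ?thesis using bpaths_subpath[OF \<gamma>(1), of 0 s] s \<rho> ends by (intro d_le_length[of "subpath 0 s \<gamma>"]) auto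
    qed
    have "integral {0..s} h + integral {s..1} h = integral {0..1} h"
      by (rule Henstock_Kurzweil_Integration.integral_combine[OF s(1,2) hI])
    then have le: "integral {s..1} h \<le> e" using F1 s(3) by (simp add: F_def)
    have "bergman_length U (subpath s 1 \<gamma>) = ennreal (integral {s..1} h)"
      using length_subpath[OF \<gamma>(1), of s 1] F[of s 1] s s1 by simp
    then have "d (\<gamma> s) w \<le> e" using bpaths_subpath[OF \<gamma>(1), of s 1] s e ends le
      by (intro d_le_length[of "subpath s 1 \<gamma>"]) (auto intro!: ennreal_leI)
    then show ?thesis using that[OF gU 1] s by simp
  qed
qed

lemma bergman_ball_borel: assumes "z \<in> U" shows "bergman_ball U z r \<in> sets borel"
proof -
  have "bergman_ball U z r = {w\<in>U. d z w \<in> {..r}}" by (auto simp: bergman_ball_def)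
  then show ?thesis using borel_vimage_open[OF continuous_d[OF assms] open_U, of "{..r}"] by simp
qed

end

locale homogeneous_bounded_domain = bounded_domain U for U :: "(complex^'n) set" +
  assumes homogeneous: "homogeneous_domain U"
begin

lemma obtain_aut: assumes "z \<in> U" "w \<in> U" obtains \<psi> where "aut \<psi>" "\<psi> z = w"
  using homogeneous assms unfolding homogeneous_domain_def by metis

text \<open>The radius \<epsilon> found at \<open>z0\<close> works everywhere by transport along
  automorphisms, so every ball of radius \<epsilon> lies in a compact subset of \<open>U\<close>.
  The radius about \<open>z0\<close> is then enlarged in steps of
  \<open>\<epsilon>/4\<close>.\<close>

lemma bergman_ball_relatively_compact:
  assumes z0: "z0 \<in> U"
  obtains Q where "compact Q" "Q \<subseteq> U" "bergman_ball U z0 \<rho> \<subseteq> Q"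
proof -
  obtain \<delta> where \<delta>: "\<delta> > 0" "cball z0 \<delta> \<subseteq> U" using open_U z0 open_contains_cball by blast
  obtain \<epsilon> where \<epsilon>: "\<epsilon> > 0" "\<And>w. w \<in> U \<Longrightarrow> d z0 w \<le> \<epsilon> \<Longrightarrow> w \<in> ball z0 \<delta>" using small_balls[OF z0 \<delta>(2,1)] by metis
  have small: "\<exists>Q. compact Q \<and> Q \<subseteq> U \<and> bergman_ball U x \<epsilon> \<subseteq> Q" if x: "x \<in> U" for x
  proof -
    obtain \<psi> where \<psi>: "aut \<psi>" "\<psi> z0 = x" using obtain_aut[OF z0 x] by blast
    note bh = biholomorphismD[OF \<psi>(1)]
    have "compact (\<psi> ` cball z0 \<delta>)"
      by (intro compact_continuous_image continuous_on_subset[OF holo_map_on_continuous[OF bh(1)] \<delta>(2)]) simp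
    moreover have "\<psi> ` cball z0 \<delta> \<subseteq> U" using bh(5) \<delta>(2) by blast
    moreover have "bergman_ball U x \<epsilon> \<subseteq> \<psi> ` cball z0 \<delta>"
    proof
      fix y assume y: "y \<in> bergman_ball U x \<epsilon>"
      then have yU: "y \<in> U" "d x y \<le> \<epsilon>" by (auto simp: bergman_ball_def)
      define y' where "y' = inv_into U \<psi> y"
      have y': "y' \<in> U" "\<psi> y' = y" using bh yU by (auto simp: y'_def)
      have "d z0 y' \<le> \<epsilon>" using d_invariant[OF \<psi>(1) z0 y'(1)] \<psi>(2) y' yU by simp
      then have "y' \<in> ball z0 \<delta>" using \<epsilon>(2)[OF y'(1)] by simp
      then show "y \<in> \<psi> ` cball z0 \<delta>" using y'(2) by force
    qed
    ultimately show ?thesis by blast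
  qed
  define P where "P = (\<lambda>\<rho>. \<exists>Q. compact Q \<and> Q \<subseteq> U \<and> bergman_ball U z0 \<rho> \<subseteq> Q)"
  have step: "P (real n * (\<epsilon>/4))" for n
  proof (induction n)
    case 0
    have "bergman_ball U z0 0 \<subseteq> bergman_ball U z0 \<epsilon>" using \<epsilon>(1) by (auto simp: bergman_ball_def)
    then show ?case using small[OF z0] unfolding P_def by (metis mult_zero_left of_nat_0 order_trans)
  next
    case (Suc n)
    define \<rho>' where "\<rho>' = real n * (\<epsilon>/4)"
    have \<rho>': "\<rho>' \<ge> 0" using \<epsilon>(1) by (simp add: \<rho>'_def)
    obtain Q where Q: "compact Q" "Q \<subseteq> U" "bergman_ball U z0 \<rho>' \<subseteq> Q" using Suc by (auto simp: P_def \<rho>'_def)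
    \<comment> \<open>A point of the enlarged ball is within \<open>\<epsilon>/2\<close> of some
      point of \<open>Q\<close>, which in turn is within \<open>\<epsilon>/2\<close> of one of
      finitely many centres. Compact sets containing the balls of radius \<epsilon> about these
      centres therefore suffice.\<close>
    define N where "N = (\<lambda>x. {y\<in>U. d x y < \<epsilon>/2})"
    have No: "open (N x)" if "x \<in> Q" for x
    proof -
      have "N x = U \<inter> d x -` {..<\<epsilon>/2}" by (auto simp: N_def)
      then show ?thesis using continuous_open_preimage[OF continuous_d open_U, of x "{..<\<epsilon>/2}"] that Q(2) by auto
    qed
    have "Q \<subseteq> (\<Union>x\<in>Q. N x)" using Q(2) d_self \<epsilon>(1) by (force simp: N_def)
    then obtain Q' where Q': "Q' \<subseteq> Q" "finite Q'" "Q \<subseteq> (\<Union>x\<in>Q'. N x)"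
      using compactE_image[OF Q(1), of Q N] No by metis
    obtain R where R: "\<And>x. x \<in> U \<Longrightarrow> compact (R x) \<and> R x \<subseteq> U \<and> bergman_ball U x \<epsilon> \<subseteq> R x" using small by metis
    have "bergman_ball U z0 (\<rho>' + \<epsilon>/4) \<subseteq> (\<Union>x\<in>Q'. R x)"
    proof
      fix w assume "w \<in> bergman_ball U z0 (\<rho>' + \<epsilon>/4)"
      then have w: "w \<in> U" "d z0 w < \<rho>' + \<epsilon>/2" using \<epsilon>(1) by (auto simp: bergman_ball_def)
      obtain y where y: "y \<in> U" "d z0 y \<le> \<rho>'" "d y w \<le> \<epsilon>/2"
        using intermediate_point[OF z0 w(1) \<rho>' _ w(2)] \<epsilon>(1) by auto
      then have "y \<in> Q" using Q(3) by (auto simp: bergman_ball_def)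
      then obtain x where x: "x \<in> Q'" "d x y < \<epsilon>/2" using Q'(3) by (auto simp: N_def)
      have xU: "x \<in> U" using x Q' Q by auto
      have "d x w \<le> \<epsilon>" using d_triangle[OF xU y(1) w(1)] x y by simp
      then show "w \<in> (\<Union>x\<in>Q'. R x)" using R[OF xU] x w by (auto simp: bergman_ball_def)
    qed
    moreover have "compact (\<Union>x\<in>Q'. R x)" using Q' Q R by (intro compact_UN) auto
    moreover have "(\<Union>x\<in>Q'. R x) \<subseteq> U" using Q' Q R by blast
    moreover have "real (Suc n) * (\<epsilon>/4) = \<rho>' + \<epsilon>/4" by (simp add: \<rho>'_def field_simps)
    ultimately show ?case unfolding P_def by (metis (no_types, lifting))
  qed
  obtain n where n: "\<rho> / (\<epsilon>/4) \<le> real n" using real_arch_simple by blast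
  then have "\<rho> \<le> real n * (\<epsilon>/4)" using \<epsilon>(1) by (simp add: field_simps)
  then have "bergman_ball U z0 \<rho> \<subseteq> bergman_ball U z0 (real n * (\<epsilon>/4))" by (auto simp: bergman_ball_def)
  with step[of n] show ?thesis using that unfolding P_def by (meson order_trans)
qed

end

section \<open>A Harnack inequality for Jacobians of automorphisms\<close>

text \<open>Comparability in both directions survives real powers of either sign, so exponents such
  as \<open>2 * \<alpha> + 2\<close> need no case distinction later.\<close>

lemma powr_compare:
  fixes a b C e :: real
  assumes "a > 0" "b > 0" "C > 0" "a \<le> C * b" "b \<le> C * a"
  shows "a powr e \<le> C powr \<bar>e\<bar> * b powr e"
proof (cases "e \<ge> 0")
  case True
  have "a powr e \<le> (C * b) powr e" using assms True by (intro powr_mono2) auto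
  then show ?thesis using True assms by (simp add: powr_mult)
next
  case False
  have "b powr (- e) \<le> (C * a) powr (- e)" using assms False by (intro powr_mono2) auto
  then have "b powr (- e) \<le> C powr (- e) * a powr (- e)" using assms by (simp add: powr_mult)
  then have "b powr (- e) * (a powr e * b powr e) \<le> C powr (- e) * a powr (- e) * (a powr e * b powr e)"
    by (rule mult_right_mono) simp
  moreover have "b powr (- e) * (a powr e * b powr e) = a powr e" using assms by (simp add: powr_minus field_simps)
  moreover have "C powr (- e) * a powr (- e) * (a powr e * b powr e) = C powr (- e) * b powr e"
    using assms by (simp add: powr_minus[of a] field_simps)
  ultimately show ?thesis using False by simp
qed

context bounded_domain
begin

lemma measurable_restrict_U: "continuous_on U f \<Longrightarrow> f \<in> borel_measurable (restrict_space lborel U)"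
  using borel_measurable_continuous_on_restrict measurable_cong_sets[OF sets_restrict_space_cong[OF sets_lborel] refl] by blast

lemma nn_integral_weighted_vol:
  assumes f: "continuous_on U f" "\<And>x. x \<in> U \<Longrightarrow> f x \<ge> (0::real)" and A: "A \<in> sets borel" "A \<subseteq> U"
  shows "(\<integral>\<^sup>+x\<in>A. ennreal (f x) \<partial>weighted_vol U \<alpha>) = (\<integral>\<^sup>+x. ennreal (f x * k x powr (- \<alpha>)) * indicator A x \<partial>lborel)"
proof -
  have kc: "continuous_on U (\<lambda>z. k z powr (- \<alpha>))"
    by (intro continuous_intros continuous_kernel_diag) (use kernel_diag_pos in fastforce)
  have km: "(\<lambda>z. ennreal (k z powr (- \<alpha>))) \<in> borel_measurable (restrict_space lborel U)"
    using measurable_restrict_U[OF kc] by measurable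
  have Ar: "A \<in> sets (restrict_space lborel U)" using A by (auto simp: sets_restrict_space_iff)
  have fm: "(\<lambda>x. ennreal (f x) * indicator A x) \<in> borel_measurable (restrict_space lborel U)"
    using measurable_restrict_U[OF f(1)] Ar by measurable
  have "(\<integral>\<^sup>+x\<in>A. ennreal (f x) \<partial>weighted_vol U \<alpha>) =
     (\<integral>\<^sup>+x. ennreal (k x powr (- \<alpha>)) * (ennreal (f x) * indicator A x) \<partial>restrict_space lborel U)"
    unfolding weighted_vol_def by (rule nn_integral_density[OF km fm])
  also have "\<dots> = (\<integral>\<^sup>+x. ennreal (k x powr (- \<alpha>)) * (ennreal (f x) * indicator A x) * indicator U x \<partial>lborel)"
    by (rule nn_integral_restrict_space) simp
  also have "\<dots> = (\<integral>\<^sup>+x. ennreal (f x * k x powr (- \<alpha>)) * indicator A x \<partial>lborel)"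
    using A(2) f(2) by (intro nn_integral_cong) (auto simp: indicator_def ennreal_mult' mult.commute)
  finally show ?thesis .
qed

lemma space_weighted_vol: "space (weighted_vol U \<alpha>) = U"
  by (simp add: weighted_vol_def space_restrict_space)

text \<open>Since \<open>k (\<psi> x) powr (- \<alpha>)\<close> equals \<open>k x powr (- \<alpha>)
  * norm (Jac \<psi> x) powr (2 * \<alpha>)\<close> and the volume contributes another square, the
  exponent is \<open>2 * \<alpha> + 2\<close>.\<close>

lemma nn_integral_weighted_vol_pullback:
  assumes \<psi>: "aut \<psi>" and f: "continuous_on U f" "\<And>x. x \<in> U \<Longrightarrow> f x \<ge> (0::real)" and A: "A \<in> sets borel" "A \<subseteq> U"
  shows "(\<integral>\<^sup>+x\<in>A. ennreal (f x) \<partial>weighted_vol U \<alpha>) =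
    (\<integral>\<^sup>+x. ennreal (f (\<psi> x) * k x powr (- \<alpha>) * norm (Jac \<psi> x) powr (2 * \<alpha> + 2)) * indicator {x\<in>U. \<psi> x \<in> A} x \<partial>lborel)"
proof -
  note bh = biholomorphismD[OF \<psi>]
  have kc: "continuous_on U (\<lambda>z. f z * k z powr (- \<alpha>))"
    by (intro continuous_intros continuous_kernel_diag f) (use kernel_diag_pos in fastforce)
  define F where "F = (\<lambda>y. ennreal (f y * k y powr (- \<alpha>)) * indicator A y)"
  have FU: "F y * indicator U y = F y" for y using A(2) by (auto simp: F_def indicator_def)
  have Fm: "(\<lambda>y. F y * indicator U y) \<in> borel_measurable borel"
    unfolding FU unfolding F_def by (rule borel_measurable_ennreal_indicator[OF kc A])
  have "(\<integral>\<^sup>+x\<in>A. ennreal (f x) \<partial>weighted_vol U \<alpha>) = (\<integral>\<^sup>+y. F y * indicator U y \<partial>lborel)"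
    unfolding FU unfolding F_def by (rule nn_integral_weighted_vol[OF f A])
  also have "\<dots> = (\<integral>\<^sup>+x. F (\<psi> x) * ennreal ((norm (det (complex_jacobi \<psi> x)))^2) * indicator U x \<partial>lborel)"
    by (rule nn_integral_biholo[OF \<psi> open_U bounded_U open_U Fm])
  also have "\<dots> = (\<integral>\<^sup>+x. ennreal (f (\<psi> x) * k x powr (- \<alpha>) * norm (Jac \<psi> x) powr (2 * \<alpha> + 2)) * indicator {x\<in>U. \<psi> x \<in> A} x \<partial>lborel)"
  proof (intro nn_integral_cong)
    fix x
    show "F (\<psi> x) * ennreal ((norm (det (complex_jacobi \<psi> x)))^2) * indicator U x =
      ennreal (f (\<psi> x) * k x powr (- \<alpha>) * norm (Jac \<psi> x) powr (2 * \<alpha> + 2)) * indicator {x\<in>U. \<psi> x \<in> A} x"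
    proof (cases "x \<in> U \<and> \<psi> x \<in> A")
      case True
      then have x: "x \<in> U" and y: "\<psi> x \<in> U" using bh(5) by auto
      define j where "j = norm (Jac \<psi> x)"
      have j: "j > 0" using Jac_nonzero[OF \<psi> open_U x] by (simp add: j_def)
      have ky: "k (\<psi> x) > 0" by (rule kernel_diag_pos[OF y])
      have "k x powr (- \<alpha>) * j powr (2 * \<alpha> + 2) = k (\<psi> x) powr (- \<alpha>) * ((j^2) powr (- \<alpha>) * j powr (2 * \<alpha> + 2))"
        using j ky by (simp add: kernel_diag_transform[OF \<psi> x] j_def[symmetric] powr_mult)
      also have "(j^2) powr (- \<alpha>) * j powr (2 * \<alpha> + 2) = j powr 2"
        using j by (simp add: powr_powr powr_add[symmetric] flip: powr_numeral)
      also have "j powr 2 = j^2" using j by (simp add: powr_numeral)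
      finally have e: "k x powr (- \<alpha>) * j powr (2 * \<alpha> + 2) = k (\<psi> x) powr (- \<alpha>) * j^2" .
      have "F (\<psi> x) * ennreal ((norm (det (complex_jacobi \<psi> x)))^2) * indicator U x = ennreal (f (\<psi> x) * k (\<psi> x) powr (- \<alpha>)) * ennreal (j^2)"
        using True by (simp add: F_def j_def Jac_def)
      also have "\<dots> = ennreal (f (\<psi> x) * k (\<psi> x) powr (- \<alpha>) * j^2)" using f(2)[OF y] by (simp add: ennreal_mult)
      also have "f (\<psi> x) * k (\<psi> x) powr (- \<alpha>) * j^2 = f (\<psi> x) * k x powr (- \<alpha>) * j powr (2 * \<alpha> + 2)"
        using e by (simp add: mult.assoc)
      finally show ?thesis using True by (simp add: j_def)
    qed (auto simp: F_def)
  qed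
  finally show ?thesis .
qed

lemma continuous_holo_powr:
  assumes "holo_on U f" "p > 0" shows "continuous_on U (\<lambda>x. norm (f x) powr p)"
  using assms by (intro continuous_on_powr' continuous_on_norm holo_on_continuous continuous_intros) auto

end

text \<open>The estimate (FR) for the single weight \<open>\<beta> = \<alpha>\<close> of the
  theorem; \<open>a\<close> is the threshold beyond which \<alpha>' is admissible.\<close>

locale forelli_rudin_domain = homogeneous_bounded_domain U for U :: "(complex^'n) set" +
  fixes \<alpha> a :: real
  assumes FR: "\<And>\<alpha>'. \<alpha>' > a \<Longrightarrow> \<exists>c. \<forall>z\<in>U. (\<integral>\<^sup>+ w. ennreal (norm (K z w) powr (1 + \<alpha>')) \<partial>weighted_vol U \<alpha>)
      \<le> ennreal (c * k z powr (\<alpha>' - \<alpha>))"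
begin

text \<open>The Forelli-Rudin estimate at the point \<open>\<psi> x0\<close>, pulled back by the automorphism \<open>\<psi>\<close>, bounds
  a weighted norm of the holomorphic function \<open>Jac \<psi> x0 / Jac \<psi>\<close> independently of \<open>\<psi>\<close>.
  The mean value property turns this into a Harnack inequality for Jacobians.\<close>

lemma FR_pullback:
  assumes c: "\<forall>z\<in>U. (\<integral>\<^sup>+ w. ennreal (norm (K z w) powr (1 + \<alpha>')) \<partial>weighted_vol U \<alpha>) \<le> ennreal (c * k z powr (\<alpha>' - \<alpha>))"
    and \<alpha>': "1 + \<alpha>' > 0" and \<psi>: "aut \<psi>" and x0: "x0 \<in> U"
  shows "(\<integral>\<^sup>+ x. ennreal (norm (K x0 x) powr (1 + \<alpha>') * k x powr (- \<alpha>) * norm (Jac \<psi> x0 / Jac \<psi> x) powr (\<alpha>' - 1 - 2 * \<alpha>)) * indicator U x \<partial>lborel)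
    \<le> ennreal (c * k x0 powr (\<alpha>' - \<alpha>))"
proof -
  note bh = biholomorphismD[OF \<psi>]
  define J where "J = (\<lambda>x. norm (Jac \<psi> x))"
  have J: "J x > 0" if "x \<in> U" for x using Jac_nonzero[OF \<psi> open_U that] by (simp add: J_def)
  have y0: "\<psi> x0 \<in> U" using bh(5) x0 by simp
  \<comment> \<open>The factor by which \<open>k x0 powr (\<alpha>' - \<alpha>)\<close> differs from
    \<open>k (\<psi> x0) powr (\<alpha>' - \<alpha>)\<close>; multiplying by it removes \<psi> from
    the bound.\<close>
  define C where "C = J x0 powr (2 * (\<alpha>' - \<alpha>))"
  have C: "C > 0" using J[OF x0] by (simp add: C_def)
  have cf: "continuous_on U (\<lambda>w. norm (K (\<psi> x0) w) powr (1 + \<alpha>'))"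
  proof -
    have "continuous_on U (\<lambda>w. K w (\<psi> x0))" by (rule holo_on_continuous[OF A2_holo[OF kernel_A2[OF y0]]])
    then show ?thesis using \<alpha>' by (subst norm_kernel_sym) (intro continuous_on_powr' continuous_intros, auto)
  qed
  have set_eq: "{x\<in>U. \<psi> x \<in> U} = U" using bh(5) by auto
  have "(\<integral>\<^sup>+ w. ennreal (norm (K (\<psi> x0) w) powr (1 + \<alpha>')) \<partial>weighted_vol U \<alpha>) =
     (\<integral>\<^sup>+ w\<in>U. ennreal (norm (K (\<psi> x0) w) powr (1 + \<alpha>')) \<partial>weighted_vol U \<alpha>)"
    by (intro nn_integral_cong) (simp add: space_weighted_vol)
  also have "\<dots> = (\<integral>\<^sup>+x. ennreal (norm (K (\<psi> x0) (\<psi> x)) powr (1 + \<alpha>') * k x powr (- \<alpha>) * norm (Jac \<psi> x) powr (2 * \<alpha> + 2)) * indicator U x \<partial>lborel)"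
    using nn_integral_weighted_vol_pullback[OF \<psi> cf _ U_borel order_refl] by (simp add: set_eq)
  finally have eq: "(\<integral>\<^sup>+ w. ennreal (norm (K (\<psi> x0) w) powr (1 + \<alpha>')) \<partial>weighted_vol U \<alpha>) =
     (\<integral>\<^sup>+x. ennreal (norm (K (\<psi> x0) (\<psi> x)) powr (1 + \<alpha>') * k x powr (- \<alpha>) * norm (Jac \<psi> x) powr (2 * \<alpha> + 2)) * indicator U x \<partial>lborel)" .
  \<comment> \<open>The kernel transforms with the Jacobians at \<open>x0\<close> and
    \<open>x\<close> to the power \<open>1 + \<alpha>'\<close>. The quotient to the power
    \<open>\<alpha>' - 1 - 2 * \<alpha>\<close> corrects this to \<open>2 * \<alpha> + 2\<close> at
    \<open>x\<close>, the exponent of the measure, and to \<open>2 * (\<alpha>' - \<alpha>)\<close>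
    at \<open>x0\<close>, which is \<open>C\<close>.\<close>
  have pt: "norm (K x0 x) powr (1 + \<alpha>') * k x powr (- \<alpha>) * norm (Jac \<psi> x0 / Jac \<psi> x) powr (\<alpha>' - 1 - 2 * \<alpha>) =
      C * (norm (K (\<psi> x0) (\<psi> x)) powr (1 + \<alpha>') * k x powr (- \<alpha>) * norm (Jac \<psi> x) powr (2 * \<alpha> + 2))" if x: "x \<in> U" for x
  proof -
    define Kn where "Kn = norm (K (\<psi> x0) (\<psi> x))"
    have 1: "norm (K x0 x) powr (1 + \<alpha>') = J x0 powr (1 + \<alpha>') * Kn powr (1 + \<alpha>') * J x powr (1 + \<alpha>')"
      unfolding norm_kernel_transform[OF \<psi> x0 x] by (simp add: powr_mult Kn_def J_def)
    have 2: "norm (Jac \<psi> x0 / Jac \<psi> x) powr (\<alpha>' - 1 - 2 * \<alpha>) = J x0 powr (\<alpha>' - 1 - 2 * \<alpha>) * J x powr (- (\<alpha>' - 1 - 2 * \<alpha>))"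
    proof -
      have "norm (Jac \<psi> x0 / Jac \<psi> x) = J x0 / J x" by (simp add: norm_divide J_def)
      then show ?thesis by (simp only: powr_divide powr_minus) (simp only: divide_inverse)
    qed
    have 3: "J x0 powr (1 + \<alpha>') * J x0 powr (\<alpha>' - 1 - 2 * \<alpha>) = C" unfolding C_def powr_add[symmetric] by (rule arg_cong) simp
    have 4: "J x powr (1 + \<alpha>') * J x powr (- (\<alpha>' - 1 - 2 * \<alpha>)) = J x powr (2 * \<alpha> + 2)" unfolding powr_add[symmetric] by (rule arg_cong) simp
    have "norm (K x0 x) powr (1 + \<alpha>') * k x powr (- \<alpha>) * norm (Jac \<psi> x0 / Jac \<psi> x) powr (\<alpha>' - 1 - 2 * \<alpha>) =
      (J x0 powr (1 + \<alpha>') * J x0 powr (\<alpha>' - 1 - 2 * \<alpha>)) * (Kn powr (1 + \<alpha>') * k x powr (- \<alpha>) * (J x powr (1 + \<alpha>') * J x powr (- (\<alpha>' - 1 - 2 * \<alpha>))))"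
      unfolding 1 2 by (simp only: mult_ac)
    then show ?thesis unfolding 3 4 by (simp add: Kn_def J_def)
  qed
  define B where "B = (\<lambda>x. norm (K (\<psi> x0) (\<psi> x)) powr (1 + \<alpha>') * k x powr (- \<alpha>) * norm (Jac \<psi> x) powr (2 * \<alpha> + 2))"
  have Bm: "(\<lambda>x. ennreal (B x) * indicator U x) \<in> borel_measurable lborel"
  proof -
    have "continuous_on U (\<lambda>x. norm (K (\<psi> x0) (\<psi> x)) powr (1 + \<alpha>'))"
      by (rule continuous_on_compose2[OF cf holo_map_on_continuous[OF bh(1)]]) (use bh in auto)
    moreover have "continuous_on U (\<lambda>x. k x powr (- \<alpha>))"
      by (intro continuous_intros continuous_kernel_diag) (use kernel_diag_pos in fastforce)
    moreover have "continuous_on U (\<lambda>x. norm (Jac \<psi> x) powr (2 * \<alpha> + 2))"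
      by (intro continuous_intros holo_on_continuous[OF holo_on_Jac[OF bh(1) open_U]]) (use Jac_nonzero[OF \<psi> open_U] in auto)
    ultimately have "continuous_on U B" unfolding B_def by (intro continuous_on_mult)
    from borel_measurable_ennreal_indicator[OF this U_borel order_refl] show ?thesis by simp
  qed
  have "(\<integral>\<^sup>+ x. ennreal (norm (K x0 x) powr (1 + \<alpha>') * k x powr (- \<alpha>) * norm (Jac \<psi> x0 / Jac \<psi> x) powr (\<alpha>' - 1 - 2 * \<alpha>)) * indicator U x \<partial>lborel)
     = (\<integral>\<^sup>+ x. ennreal C * (ennreal (B x) * indicator U x) \<partial>lborel)"
  proof (intro nn_integral_cong)
    fix x
    show "ennreal (norm (K x0 x) powr (1 + \<alpha>') * k x powr (- \<alpha>) * norm (Jac \<psi> x0 / Jac \<psi> x) powr (\<alpha>' - 1 - 2 * \<alpha>)) * indicator U x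
      = ennreal C * (ennreal (B x) * indicator U x)"
    proof (cases "x \<in> U")
      case True
      have e: "norm (K x0 x) powr (1 + \<alpha>') * k x powr (- \<alpha>) * norm (Jac \<psi> x0 / Jac \<psi> x) powr (\<alpha>' - 1 - 2 * \<alpha>) = C * B x"
        unfolding B_def by (rule pt[OF True])
      show ?thesis unfolding e using C by (simp add: ennreal_mult' mult.assoc)
    qed simp
  qed
  also have "\<dots> = ennreal C * (\<integral>\<^sup>+ x. ennreal (B x) * indicator U x \<partial>lborel)" by (rule nn_integral_cmult[OF Bm])
  also have "\<dots> \<le> ennreal C * ennreal (c * k (\<psi> x0) powr (\<alpha>' - \<alpha>))"
    using c y0 eq by (intro mult_left_mono) (auto simp: B_def)
  also have "\<dots> = ennreal (c * (C * k (\<psi> x0) powr (\<alpha>' - \<alpha>)))" using C by (simp add: ennreal_mult'[symmetric] mult_ac)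
  also have "C * k (\<psi> x0) powr (\<alpha>' - \<alpha>) = k x0 powr (\<alpha>' - \<alpha>)"
  proof -
    have "C = ((J x0)^2) powr (\<alpha>' - \<alpha>)" using J[OF x0] by (simp add: C_def powr_powr flip: powr_numeral)
    then show ?thesis using kernel_diag_pos[OF y0] by (simp add: kernel_diag_transform[OF \<psi> x0] J_def powr_mult)
  qed
  finally show ?thesis .
qed

text \<open>The holomorphic quotient \<open>F\<close> of \<open>Jac \<psi> x0\<close> by
  \<open>Jac \<psi>\<close> has a weighted integral bounded independently of \<psi> by
  \<open>FR_pullback\<close>. Near \<open>y0\<close> the kernel and the weight are bounded below, so
  the sub-mean value property bounds \<open>F x1\<close>.\<close>

lemma Jac_compare_local:
  assumes y0: "y0 \<in> U"
  obtains \<delta> C where "\<delta> > 0" "C > 0" "ball y0 \<delta> \<subseteq> U"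
    "\<And>\<psi> x0 x1. aut \<psi> \<Longrightarrow> x0 \<in> ball y0 \<delta> \<Longrightarrow> x1 \<in> ball y0 \<delta> \<Longrightarrow> norm (Jac \<psi> x0) \<le> C * norm (Jac \<psi> x1)"
proof -
  \<comment> \<open>Beyond the threshold \<open>a\<close>, and so large that \<open>s > 1\<close>,
    as the sub-mean value property requires.\<close>
  define \<alpha>' where "\<alpha>' = max a (max 0 (2 * \<alpha> + 2)) + 1"
  define s where "s = \<alpha>' - 1 - 2 * \<alpha>"
  have \<alpha>': "\<alpha>' > a" "1 + \<alpha>' > 0" and s: "s > 1" by (auto simp: \<alpha>'_def s_def)
  obtain c where c: "\<forall>z\<in>U. (\<integral>\<^sup>+ w. ennreal (norm (K z w) powr (1 + \<alpha>')) \<partial>weighted_vol U \<alpha>) \<le> ennreal (c * k z powr (\<alpha>' - \<alpha>))"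
    using FR[OF \<alpha>'(1)] by blast
  define \<kappa> where "\<kappa> = k y0 / 2"
  have \<kappa>: "\<kappa> > 0" using kernel_diag_pos[OF y0] by (simp add: \<kappa>_def)
  obtain \<eta> where \<eta>: "\<eta> > 0" "cball y0 \<eta> \<subseteq> U" "\<And>x x'. x \<in> ball y0 \<eta> \<Longrightarrow> x' \<in> ball y0 \<eta> \<Longrightarrow> norm (K x x') \<ge> \<kappa>"
  proof -
    have op: "open (U \<times> U)" by (intro open_Times open_U)
    have "continuous_on (U \<times> U) (\<lambda>p. norm ((\<lambda>(z, w). K z w) p))" by (intro continuous_on_norm continuous_kernel)
    from continuous_open_preimage[OF this op open_greaterThan, of \<kappa>]
    have "open ((U \<times> U) \<inter> (\<lambda>p. norm ((\<lambda>(z, w). K z w) p)) -` {\<kappa><..})" .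
    moreover have "(y0, y0) \<in> (U \<times> U) \<inter> (\<lambda>p. norm ((\<lambda>(z, w). K z w) p)) -` {\<kappa><..}"
      using y0 kernel_diag_pos[OF y0] by (simp add: kernel_diag \<kappa>_def)
    ultimately obtain A B where AB: "open A" "open B" "(y0, y0) \<in> A \<times> B" "A \<times> B \<subseteq> (U \<times> U) \<inter> (\<lambda>p. norm ((\<lambda>(z, w). K z w) p)) -` {\<kappa><..}"
      by (rule open_prod_elim)
    have "open (A \<inter> B \<inter> U)" "y0 \<in> A \<inter> B \<inter> U" using AB y0 open_U by auto
    then obtain e where e: "e > 0" "cball y0 e \<subseteq> A \<inter> B \<inter> U" using open_contains_cball by blast
    have "norm (K x x') \<ge> \<kappa>" if "x \<in> ball y0 e" "x' \<in> ball y0 e" for x x'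
    proof -
      have "(x, x') \<in> A \<times> B" using that e(2) ball_subset_cball by blast
      then show ?thesis using AB(4) by fastforce
    qed
    then show ?thesis using that e by blast
  qed
  have kcont: "continuous_on (cball y0 \<eta>) k" by (rule continuous_on_subset[OF continuous_kernel_diag \<eta>(2)])
  have kpos: "k x > 0" if "x \<in> cball y0 \<eta>" for x using kernel_diag_pos \<eta>(2) that by blast
  obtain m where m: "m > 0" "\<And>x. x \<in> cball y0 \<eta> \<Longrightarrow> k x powr (- \<alpha>) \<ge> m"
  proof -
    have "continuous_on (cball y0 \<eta>) (\<lambda>x. k x powr (- \<alpha>))" by (intro continuous_intros kcont) (use kpos in fastforce)
    then obtain x where "x \<in> cball y0 \<eta>" "\<And>y. y \<in> cball y0 \<eta> \<Longrightarrow> k x powr (- \<alpha>) \<le> k y powr (- \<alpha>)"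
      using continuous_attains_inf[of "cball y0 \<eta>" "\<lambda>x. k x powr (- \<alpha>)"] \<eta>(1) by auto
    then show ?thesis using that[of "k x powr (- \<alpha>)"] kpos[of x] by auto
  qed
  obtain M where M: "M > 0" "\<And>x. x \<in> cball y0 \<eta> \<Longrightarrow> k x powr (\<alpha>' - \<alpha>) \<le> M"
  proof -
    have "continuous_on (cball y0 \<eta>) (\<lambda>x. k x powr (\<alpha>' - \<alpha>))" by (intro continuous_intros kcont) (use kpos in fastforce)
    then obtain x where "x \<in> cball y0 \<eta>" "\<And>y. y \<in> cball y0 \<eta> \<Longrightarrow> k y powr (\<alpha>' - \<alpha>) \<le> k x powr (\<alpha>' - \<alpha>)"
      using continuous_attains_sup[of "cball y0 \<eta>" "\<lambda>x. k x powr (\<alpha>' - \<alpha>)"] \<eta>(1) by auto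
    then show ?thesis using that[of "k x powr (\<alpha>' - \<alpha>)"] kpos[of x] by auto
  qed
  \<comment> \<open>Half of \<eta>, so that \<open>ball x1 \<delta>\<close> stays where the lower
    bounds hold.\<close>
  define \<delta> where "\<delta> = \<eta> / 2"
  have \<delta>: "\<delta> > 0" using \<eta> by (simp add: \<delta>_def)
  define v where "v = measure lborel (ball (0::complex^'n) \<delta>)"
  have v: "v > 0" unfolding v_def by (rule measure_ball_pos[OF \<delta>])
  define q where "q = \<kappa> powr (1 + \<alpha>') * m"
  have q: "q > 0" using \<kappa> m by (simp add: q_def)
  \<comment> \<open>Obtained by solving the final inequality for \<open>norm (F x1)\<close>. The
    summand 1 keeps \<open>C\<close> positive, and the absolute value is taken because the sign of
    \<open>c\<close> is not prescribed.\<close>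
  define C where "C = (\<bar>c\<bar> * M / (q * v)) powr (1 / s) + 1"
  have C: "C > 0" by (simp add: C_def add_nonneg_pos)
  have main: "norm (Jac \<psi> x0) \<le> C * norm (Jac \<psi> x1)" if \<psi>: "aut \<psi>" and x0: "x0 \<in> ball y0 \<delta>" and x1: "x1 \<in> ball y0 \<delta>" for \<psi> x0 x1
  proof -
    note bh = biholomorphismD[OF \<psi>]
    have sub: "ball x1 \<delta> \<subseteq> ball y0 \<eta>"
    proof
      fix y assume "y \<in> ball x1 \<delta>" then show "y \<in> ball y0 \<eta>" using x1 dist_triangle[of y0 y x1] by (simp add: \<delta>_def)
    qed
    have subU: "ball y0 \<eta> \<subseteq> U" using \<eta>(2) ball_subset_cball by blast
    have x0': "x0 \<in> ball y0 \<eta>" "x0 \<in> cball y0 \<eta>" "x0 \<in> U" using x0 \<delta> \<eta> by (auto simp: \<delta>_def)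
    have x1U: "x1 \<in> U" using sub subU \<delta> by (meson centre_in_ball subsetD)
    define F where "F = (\<lambda>x. Jac \<psi> x0 / Jac \<psi> x)"
    have F: "holo_on U F" unfolding F_def
      by (intro holo_on_divide holo_on_const holo_on_Jac[OF bh(1) open_U]) (rule Jac_nonzero[OF \<psi> open_U])
    have "ennreal (q * norm (F x1) powr s) * emeasure lborel (ball x1 \<delta>) = ennreal q * (ennreal (norm (F x1) powr s) * emeasure lborel (ball x1 \<delta>))"
      using q by (simp add: ennreal_mult mult.assoc)
    also have "\<dots> \<le> ennreal q * (\<integral>\<^sup>+x. ennreal (norm (F x) powr s) * indicator (ball x1 \<delta>) x \<partial>lborel)"
      by (intro mult_left_mono holo_mean_value_powr[OF holo_on_subset[OF F] s]) (use sub subU in auto)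
    also have "\<dots> = (\<integral>\<^sup>+x. ennreal q * (ennreal (norm (F x) powr s) * indicator (ball x1 \<delta>) x) \<partial>lborel)"
    proof (rule nn_integral_cmult[symmetric])
      have "continuous_on U (\<lambda>x. norm (F x) powr s)" using continuous_holo_powr[OF F] s by simp
      from borel_measurable_ennreal_indicator[OF this, of "ball x1 \<delta>"] sub subU
      show "(\<lambda>x. ennreal (norm (F x) powr s) * indicator (ball x1 \<delta>) x) \<in> borel_measurable lborel" by auto
    qed
    also have "\<dots> \<le> (\<integral>\<^sup>+ x. ennreal (norm (K x0 x) powr (1 + \<alpha>') * k x powr (- \<alpha>) * norm (F x) powr s) * indicator U x \<partial>lborel)"
    proof (intro nn_integral_mono)
      fix x
      show "ennreal q * (ennreal (norm (F x) powr s) * indicator (ball x1 \<delta>) x) \<le>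
         ennreal (norm (K x0 x) powr (1 + \<alpha>') * k x powr (- \<alpha>) * norm (F x) powr s) * indicator U x"
      proof (cases "x \<in> ball x1 \<delta>")
        case True
        then have x: "x \<in> ball y0 \<eta>" "x \<in> U" using sub subU by auto
        have "q \<le> norm (K x0 x) powr (1 + \<alpha>') * k x powr (- \<alpha>)"
          unfolding q_def using \<eta>(3)[OF x0'(1) x(1)] \<kappa> \<alpha>'(2) m x(1) by (intro mult_mono powr_mono2) auto
        then have "q * norm (F x) powr s \<le> norm (K x0 x) powr (1 + \<alpha>') * k x powr (- \<alpha>) * norm (F x) powr s"
          by (rule mult_right_mono) simp
        then show ?thesis using True x q by (auto simp: ennreal_mult'[symmetric] indicator_def intro!: ennreal_leI)
      qed simp
    qed
    also have "\<dots> \<le> ennreal (c * k x0 powr (\<alpha>' - \<alpha>))"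
      unfolding F_def s_def by (rule FR_pullback[OF c \<alpha>'(2) \<psi> x0'(3)])
    also have "\<dots> \<le> ennreal (\<bar>c\<bar> * M)"
      using M(2)[OF x0'(2)] M(1) by (intro ennreal_leI mult_mono) auto
    also have "emeasure lborel (ball x1 \<delta>) = ennreal v"
    proof -
      have "emeasure lborel (ball x1 \<delta>) = ennreal (measure lborel (ball x1 \<delta>))"
        by (intro emeasure_eq_ennreal_measure emeasure_bounded_finite[THEN less_imp_neq, simplified]) auto
      then show ?thesis by (simp only: v_def measure_ball_eq[of x1])
    qed
    finally have "ennreal (q * norm (F x1) powr s * v) \<le> ennreal (\<bar>c\<bar> * M)"
      using q v by (simp add: ennreal_mult)
    then have "q * norm (F x1) powr s * v \<le> \<bar>c\<bar> * M" using M(1) by (subst (asm) ennreal_le_iff) auto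
    then have "norm (F x1) powr s \<le> \<bar>c\<bar> * M / (q * v)" using q v by (simp add: pos_le_divide_eq mult_ac)
    then have "(norm (F x1) powr s) powr (1 / s) \<le> (\<bar>c\<bar> * M / (q * v)) powr (1 / s)"
      using s by (intro powr_mono2) auto
    then have "norm (F x1) \<le> C" using s by (simp add: powr_powr C_def)
    then show ?thesis using Jac_nonzero[OF \<psi> open_U x1U] by (simp add: F_def norm_divide pos_divide_le_eq)
  qed
  have "ball y0 \<delta> \<subseteq> U" using \<eta>(1,2) by (auto simp: \<delta>_def)
  then show ?thesis using that[OF \<delta> C _ main] by blast
qed

text \<open>Local comparisons propagate through the connected domain; at this stage the constant may
  depend on \<open>x\<close>, but not on \<psi>.\<close>

lemma Jac_compare_point:
  assumes z0: "z0 \<in> U" and x: "x \<in> U"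
  shows "\<exists>C>0. \<forall>\<psi>. aut \<psi> \<longrightarrow> norm (Jac \<psi> z0) \<le> C * norm (Jac \<psi> x) \<and> norm (Jac \<psi> x) \<le> C * norm (Jac \<psi> z0)"
proof (rule connected_induction_simple[OF connected_U z0 x])
  show "\<exists>C>0. \<forall>\<psi>. aut \<psi> \<longrightarrow> norm (Jac \<psi> z0) \<le> C * norm (Jac \<psi> z0) \<and> norm (Jac \<psi> z0) \<le> C * norm (Jac \<psi> z0)"
    by (intro exI[of _ 1]) simp
  fix y assume y: "y \<in> U"
  obtain \<delta> C where \<delta>: "\<delta> > 0" "C > 0" "ball y \<delta> \<subseteq> U"
    "\<And>\<psi> x0 x1. aut \<psi> \<Longrightarrow> x0 \<in> ball y \<delta> \<Longrightarrow> x1 \<in> ball y \<delta> \<Longrightarrow> norm (Jac \<psi> x0) \<le> C * norm (Jac \<psi> x1)"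
    by (rule Jac_compare_local[OF y]) blast
  show "\<exists>T. openin (top_of_set U) T \<and> y \<in> T \<and> (\<forall>x\<in>T. \<forall>y\<in>T.
      (\<exists>C>0. \<forall>\<psi>. aut \<psi> \<longrightarrow> norm (Jac \<psi> z0) \<le> C * norm (Jac \<psi> x) \<and> norm (Jac \<psi> x) \<le> C * norm (Jac \<psi> z0)) \<longrightarrow>
      (\<exists>C>0. \<forall>\<psi>. aut \<psi> \<longrightarrow> norm (Jac \<psi> z0) \<le> C * norm (Jac \<psi> y) \<and> norm (Jac \<psi> y) \<le> C * norm (Jac \<psi> z0)))"
  proof (intro exI[of _ "ball y \<delta>"] conjI ballI impI)
    show "openin (top_of_set U) (ball y \<delta>)" using \<delta>(3) by (simp add: openin_open_eq open_U)
    show "y \<in> ball y \<delta>" using \<delta>(1) by simp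
    fix x0 x1 assume x: "x0 \<in> ball y \<delta>" "x1 \<in> ball y \<delta>"
    assume "\<exists>C>0. \<forall>\<psi>. aut \<psi> \<longrightarrow> norm (Jac \<psi> z0) \<le> C * norm (Jac \<psi> x0) \<and> norm (Jac \<psi> x0) \<le> C * norm (Jac \<psi> z0)"
    then obtain D where D: "D > 0" "\<And>\<psi>. aut \<psi> \<Longrightarrow> norm (Jac \<psi> z0) \<le> D * norm (Jac \<psi> x0) \<and> norm (Jac \<psi> x0) \<le> D * norm (Jac \<psi> z0)" by blast
    have "norm (Jac \<psi> z0) \<le> (D * C) * norm (Jac \<psi> x1) \<and> norm (Jac \<psi> x1) \<le> (D * C) * norm (Jac \<psi> z0)" if \<psi>: "aut \<psi>" for \<psi>
    proof
      have "norm (Jac \<psi> z0) \<le> D * norm (Jac \<psi> x0)" using D \<psi> by blast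
      also have "\<dots> \<le> D * (C * norm (Jac \<psi> x1))" using D \<delta>(4)[OF \<psi> x] by (intro mult_left_mono) auto
      finally show "norm (Jac \<psi> z0) \<le> (D * C) * norm (Jac \<psi> x1)" by (simp add: mult.assoc)
      have "norm (Jac \<psi> x1) \<le> C * norm (Jac \<psi> x0)" by (rule \<delta>(4)[OF \<psi> x(2,1)])
      also have "\<dots> \<le> C * (D * norm (Jac \<psi> z0))" using D(2)[OF \<psi>] \<delta>(2) by (intro mult_left_mono) auto
      finally show "norm (Jac \<psi> x1) \<le> (D * C) * norm (Jac \<psi> z0)" by (simp add: mult_ac)
    qed
    then show "\<exists>C>0. \<forall>\<psi>. aut \<psi> \<longrightarrow> norm (Jac \<psi> z0) \<le> C * norm (Jac \<psi> x1) \<and> norm (Jac \<psi> x1) \<le> C * norm (Jac \<psi> z0)"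
      using D(1) \<delta>(2) by (intro exI[of _ "D * C"]) auto
  qed
qed

text \<open>Finitely many of the local balls cover \<open>Q\<close>, and the sum of their constants
  plus 1 serves for all of them.\<close>

lemma Jac_compare:
  assumes z0: "z0 \<in> U" and Q: "compact Q" "Q \<subseteq> U"
  obtains C where "C > 0" "\<And>\<psi> x. aut \<psi> \<Longrightarrow> x \<in> Q \<Longrightarrow> norm (Jac \<psi> z0) \<le> C * norm (Jac \<psi> x) \<and> norm (Jac \<psi> x) \<le> C * norm (Jac \<psi> z0)"
proof -
  have "\<exists>\<delta>>0. \<exists>C>0. \<forall>\<psi> y. aut \<psi> \<longrightarrow> y \<in> ball x \<delta> \<longrightarrow> norm (Jac \<psi> z0) \<le> C * norm (Jac \<psi> y) \<and> norm (Jac \<psi> y) \<le> C * norm (Jac \<psi> z0)"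
    if x: "x \<in> U" for x
  proof -
    obtain \<delta> C where \<delta>: "\<delta> > 0" "C > 0" "ball x \<delta> \<subseteq> U"
      "\<And>\<psi> x0 x1. aut \<psi> \<Longrightarrow> x0 \<in> ball x \<delta> \<Longrightarrow> x1 \<in> ball x \<delta> \<Longrightarrow> norm (Jac \<psi> x0) \<le> C * norm (Jac \<psi> x1)"
      by (rule Jac_compare_local[OF x]) blast
    obtain D where D: "D > 0" "\<And>\<psi>. aut \<psi> \<Longrightarrow> norm (Jac \<psi> z0) \<le> D * norm (Jac \<psi> x) \<and> norm (Jac \<psi> x) \<le> D * norm (Jac \<psi> z0)"
      using Jac_compare_point[OF z0 x] by blast
    have xb: "x \<in> ball x \<delta>" using \<delta> by simp
    have "norm (Jac \<psi> z0) \<le> (D * C) * norm (Jac \<psi> y) \<and> norm (Jac \<psi> y) \<le> (D * C) * norm (Jac \<psi> z0)" if \<psi>: "aut \<psi>" and y: "y \<in> ball x \<delta>" for \<psi> y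
    proof
      have "norm (Jac \<psi> z0) \<le> D * norm (Jac \<psi> x)" using D \<psi> by blast
      also have "\<dots> \<le> D * (C * norm (Jac \<psi> y))" using D \<delta>(4)[OF \<psi> xb y] by (intro mult_left_mono) auto
      finally show "norm (Jac \<psi> z0) \<le> (D * C) * norm (Jac \<psi> y)" by (simp add: mult.assoc)
      have "norm (Jac \<psi> y) \<le> C * norm (Jac \<psi> x)" by (rule \<delta>(4)[OF \<psi> y xb])
      also have "\<dots> \<le> C * (D * norm (Jac \<psi> z0))" using D(2)[OF \<psi>] \<delta>(2) by (intro mult_left_mono) auto
      finally show "norm (Jac \<psi> y) \<le> (D * C) * norm (Jac \<psi> z0)" by (simp add: mult_ac)
    qed
    then show ?thesis using D(1) \<delta>(1,2) by (intro exI[of _ \<delta>] conjI exI[of _ "D * C"]) auto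
  qed
  then obtain \<delta> C where \<delta>: "\<And>x. x \<in> U \<Longrightarrow> \<delta> x > 0" "\<And>x. x \<in> U \<Longrightarrow> C x > 0"
    "\<And>x \<psi> y. x \<in> U \<Longrightarrow> aut \<psi> \<Longrightarrow> y \<in> ball x (\<delta> x) \<Longrightarrow> norm (Jac \<psi> z0) \<le> C x * norm (Jac \<psi> y) \<and> norm (Jac \<psi> y) \<le> C x * norm (Jac \<psi> z0)"
    by metis
  have "Q \<subseteq> (\<Union>x\<in>Q. ball x (\<delta> x))" using \<delta>(1) Q(2) by force
  then obtain Q' where Q': "Q' \<subseteq> Q" "finite Q'" "Q \<subseteq> (\<Union>x\<in>Q'. ball x (\<delta> x))"
    using compactE_image[OF Q(1), of Q "\<lambda>x. ball x (\<delta> x)"] by (metis open_ball)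
  define D where "D = (\<Sum>x\<in>Q'. C x) + 1"
  have Cn: "C x \<ge> 0" if "x \<in> Q'" for x using \<delta>(2)[of x] Q' Q that by (auto simp: less_imp_le subset_iff)
  have D: "D > 0" unfolding D_def by (intro add_nonneg_pos sum_nonneg Cn) auto
  have "norm (Jac \<psi> z0) \<le> D * norm (Jac \<psi> x) \<and> norm (Jac \<psi> x) \<le> D * norm (Jac \<psi> z0)" if \<psi>: "aut \<psi>" and x: "x \<in> Q" for \<psi> x
  proof -
    obtain y where y: "y \<in> Q'" "x \<in> ball y (\<delta> y)" using Q'(3) x by auto
    have "C y \<le> (\<Sum>x\<in>Q'. C x)" using y Q' Cn by (intro member_le_sum) auto
    then have CD: "C y \<le> D" by (simp add: D_def)
    have yU: "y \<in> U" using y Q' Q by auto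
    show ?thesis using \<delta>(3)[OF yU \<psi> y(2)] mult_right_mono[OF CD norm_ge_zero[of "Jac \<psi> x"]] mult_right_mono[OF CD norm_ge_zero[of "Jac \<psi> z0"]]
      by linarith
  qed
  then show ?thesis using that D by blast
qed

end

section \<open>Carleson measures\<close>

text \<open>After division by the weighted mean \<open>a\<close>, each factor is at most
  \<open>exp (w i * (y i / a - 1))\<close>, and these exponents add up to 0.\<close>

lemma weighted_am_gm:
  fixes w y :: "'i \<Rightarrow> real"
  assumes A: "finite A" and w: "\<And>i. i \<in> A \<Longrightarrow> w i > 0" "(\<Sum>i\<in>A. w i) = 1" and y: "\<And>i. i \<in> A \<Longrightarrow> y i \<ge> 0"
  shows "(\<Prod>i\<in>A. y i powr w i) \<le> (\<Sum>i\<in>A. w i * y i)"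
proof -
  define a where "a = (\<Sum>i\<in>A. w i * y i)"
  have a0: "a \<ge> 0" unfolding a_def by (intro sum_nonneg mult_nonneg_nonneg y) (auto simp: w less_imp_le)
  have ne: "A \<noteq> {}" using w(2) by auto
  show ?thesis
  proof (cases "a = 0")
    case True
    obtain i where i: "i \<in> A" using ne by blast
    have "\<forall>i\<in>A. w i * y i = 0"
      using True A y w unfolding a_def by (subst (asm) sum_nonneg_eq_0_iff) (auto simp: less_imp_le)
    then have "y i = 0" using w(1)[OF i] i by auto
    then have "(\<Prod>i\<in>A. y i powr w i) = 0" using A i by (intro prod_zero) auto
    then show ?thesis using a0 by (simp add: a_def)
  next
    case False
    then have a: "a > 0" using a0 by simp
    have "(\<Prod>i\<in>A. (y i / a) powr w i) \<le> (\<Prod>i\<in>A. exp (w i * (y i / a - 1)))"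
    proof (intro prod_mono conjI)
      fix i assume i: "i \<in> A"
      have "y i / a \<le> exp (y i / a - 1)" using exp_ge_add_one_self[of "y i / a - 1"] by simp
      then have "(y i / a) powr w i \<le> exp (y i / a - 1) powr w i" using y[OF i] a w(1)[OF i] by (intro powr_mono2) auto
      then show "(y i / a) powr w i \<le> exp (w i * (y i / a - 1))" by (simp add: powr_def)
    qed auto
    also have "\<dots> = exp (\<Sum>i\<in>A. w i * (y i / a - 1))" using A by (simp add: exp_sum)
    also have "(\<Sum>i\<in>A. w i * (y i / a - 1)) = (\<Sum>i\<in>A. w i * y i) / a - (\<Sum>i\<in>A. w i)"
      by (simp add: right_diff_distrib sum_subtractf sum_divide_distrib)
    also have "\<dots> = 0" using a w(2) by (simp add: a_def[symmetric])
    finally have 1: "(\<Prod>i\<in>A. (y i / a) powr w i) \<le> 1" by simp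
    have "(\<Prod>i\<in>A. y i powr w i) = (\<Prod>i\<in>A. (y i / a) powr w i * a powr w i)"
      using a by (intro prod.cong refl) (simp add: powr_mult[symmetric])
    also have "\<dots> = (\<Prod>i\<in>A. (y i / a) powr w i) * (\<Prod>i\<in>A. a powr w i)" by (rule prod.distrib)
    also have "(\<Prod>i\<in>A. a powr w i) = a" using a w(2) powr_sum[of a w A] by simp
    also have "(\<Prod>i\<in>A. (y i / a) powr w i) * a \<le> 1 * a" using 1 a by (intro mult_right_mono) auto
    finally show ?thesis by (simp add: a_def)
  qed
qed

lemma prod_mono_ennreal:
  fixes f g :: "'i \<Rightarrow> ennreal"
  shows "(\<And>i. i \<in> A \<Longrightarrow> f i \<le> g i) \<Longrightarrow> (\<Prod>i\<in>A. f i) \<le> (\<Prod>i\<in>A. g i)"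
  by (induction A rule: infinite_finite_induct) (auto intro!: mult_mono)

lemma prod_eq_0_ennreal:
  fixes f :: "'i \<Rightarrow> ennreal"
  shows "finite A \<Longrightarrow> (\<Prod>i\<in>A. f i) = 0 \<longleftrightarrow> (\<exists>i\<in>A. f i = 0)"
  by (induction A rule: finite_induct) auto

lemma ennpowr_eq_0_iff: "a > 0 \<Longrightarrow> ennpowr x a = 0 \<longleftrightarrow> x = 0"
  by (auto simp: ennpowr_def ennreal_eq_0_iff enn2real_eq_0_iff)

text \<open>Once the terms are normalised by the sums \<open>S i\<close>, weighted AM-GM applies
  termwise. A vanishing sum makes every product vanish; an infinite sum with no vanishing one makes
  the right side infinite. The order of these cases reflects the convention that 0 times infinity is
  0.\<close>

lemma holder_series_ennreal:
  fixes I :: "nat \<Rightarrow> 'i \<Rightarrow> ennreal"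
  assumes A: "finite A" and q: "\<And>i. i \<in> A \<Longrightarrow> q i > 0" and q1: "(\<Sum>i\<in>A. 1 / q i) = 1"
  shows "(\<Sum>n. \<Prod>i\<in>A. I n i) \<le> (\<Prod>i\<in>A. ennpowr (\<Sum>n. ennpowr (I n i) (q i)) (1 / q i))"
proof -
  define S where "S = (\<lambda>i. \<Sum>n. ennpowr (I n i) (q i))"
  have le_S: "ennpowr (I n i) (q i) \<le> S i" for n i
    unfolding S_def using sum_le_suminf[of "\<lambda>n. ennpowr (I n i) (q i)" "{n}"] by (simp add: summableI)
  show ?thesis
  proof (cases "\<exists>i\<in>A. S i = 0")
    case True
    then obtain i where i: "i \<in> A" "S i = 0" by blast
    have "I n i = 0" for n using le_S[of n i] i ennpowr_eq_0_iff[OF q[OF i(1)]] by simp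
    then have "(\<Prod>i\<in>A. I n i) = 0" for n using prod_eq_0_ennreal[OF A] i by blast
    then show ?thesis by (simp only: suminf_zero zero_le)
  next
    case nz: False
    show ?thesis
    proof (cases "\<exists>i\<in>A. S i = \<infinity>")
      case True
      then obtain i where i: "i \<in> A" "S i = \<infinity>" by blast
      have "(\<Prod>j\<in>A - {i}. ennpowr (S j) (1 / q j)) \<noteq> 0"
        using A nz ennpowr_eq_0_iff q by (subst prod_eq_0_ennreal) auto
      then have "(\<Prod>j\<in>A. ennpowr (S j) (1 / q j)) = \<infinity>"
        using A i by (subst prod.remove[of A i]) (auto simp: ennpowr_def ennreal_top_mult)
      then show ?thesis by (simp add: S_def)
    next
      case False
      define s where "s = (\<lambda>i. enn2real (S i))"
      have Ss: "S i = ennreal (s i)" if "i \<in> A" for i using False that by (simp add: s_def less_top)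
      have s: "s i > 0" if "i \<in> A" for i using nz that Ss[OF that] by (metis ennreal_eq_0_iff not_le_imp_less)
      define x where "x = (\<lambda>n i. enn2real (I n i))"
      have fin: "I n i \<noteq> \<infinity>" if "i \<in> A" for n i
      proof
        assume "I n i = \<infinity>"
        then have "ennpowr (I n i) (q i) = \<infinity>" by (simp add: ennpowr_def)
        then show False using le_S[of n i] False that by (simp add: top.extremum_unique)
      qed
      have Ix: "I n i = ennreal (x n i)" if "i \<in> A" for n i using fin[OF that] by (simp add: x_def less_top)
      have x0: "x n i \<ge> 0" for n i by (simp add: x_def)
      have px: "ennpowr (I n i) (q i) = ennreal (x n i powr q i)" if "i \<in> A" for n i using fin[OF that] by (simp add: ennpowr_def x_def)
      define P where "P = (\<Prod>i\<in>A. s i powr (1 / q i))"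
      have P: "P \<ge> 0" unfolding P_def by (intro prod_nonneg) auto
      have pt: "(\<Prod>i\<in>A. x n i) \<le> P * (\<Sum>i\<in>A. (1 / q i) * (x n i powr q i / s i))" for n
      proof -
        have "(\<Prod>i\<in>A. x n i) = (\<Prod>i\<in>A. s i powr (1 / q i) * (x n i powr q i / s i) powr (1 / q i))"
        proof (intro prod.cong refl)
          fix i assume i: "i \<in> A"
          have "s i powr (1 / q i) * (x n i powr q i / s i) powr (1 / q i) = (x n i powr q i) powr (1 / q i)"
            using s[OF i] by (subst powr_mult[symmetric]) auto
          then show "x n i = s i powr (1 / q i) * (x n i powr q i / s i) powr (1 / q i)"
            using q[OF i] x0[of n i] by (simp add: powr_powr)
        qed
        also have "\<dots> = P * (\<Prod>i\<in>A. (x n i powr q i / s i) powr (1 / q i))" by (simp add: prod.distrib P_def)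
        also have "\<dots> \<le> P * (\<Sum>i\<in>A. (1 / q i) * (x n i powr q i / s i))"
        proof (intro mult_left_mono P weighted_am_gm[OF A _ q1])
          fix i assume i: "i \<in> A"
          show "0 < 1 / q i" using q[OF i] by simp
          show "0 \<le> x n i powr q i / s i" using s[OF i] by simp
        qed
        finally show ?thesis .
      qed
      have "(\<Prod>i\<in>A. I n i) \<le> ennreal P * (\<Sum>i\<in>A. ennreal (1 / (q i * s i)) * ennpowr (I n i) (q i))" for n
      proof -
        have "(\<Prod>i\<in>A. I n i) = ennreal (\<Prod>i\<in>A. x n i)" by (simp add: prod_ennreal x0 Ix cong: prod.cong)
        also have "\<dots> \<le> ennreal (P * (\<Sum>i\<in>A. (1 / q i) * (x n i powr q i / s i)))" by (intro ennreal_leI pt)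
        also have "\<dots> = ennreal P * ennreal (\<Sum>i\<in>A. (1 / q i) * (x n i powr q i / s i))" using P by (simp add: ennreal_mult')
        also have "ennreal (\<Sum>i\<in>A. (1 / q i) * (x n i powr q i / s i)) = (\<Sum>i\<in>A. ennreal ((1 / q i) * (x n i powr q i / s i)))"
          using q s by (intro sum_ennreal[symmetric]) (auto simp: less_imp_le)
        also have "\<dots> = (\<Sum>i\<in>A. ennreal (1 / (q i * s i)) * ennpowr (I n i) (q i))"
        proof (intro sum.cong refl)
          fix i assume i: "i \<in> A"
          have "(1 / q i) * (x n i powr q i / s i) = (1 / (q i * s i)) * x n i powr q i" by simp
          then show "ennreal ((1 / q i) * (x n i powr q i / s i)) = ennreal (1 / (q i * s i)) * ennpowr (I n i) (q i)"
            using px[OF i] q[OF i] s[OF i] by (simp add: ennreal_mult'[symmetric])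
        qed
        finally show ?thesis .
      qed
      then have "(\<Sum>n. \<Prod>i\<in>A. I n i) \<le> (\<Sum>n. ennreal P * (\<Sum>i\<in>A. ennreal (1 / (q i * s i)) * ennpowr (I n i) (q i)))"
        by (intro suminf_le summableI)
      also have "\<dots> = ennreal P * (\<Sum>i\<in>A. ennreal (1 / (q i * s i)) * S i)"
        unfolding S_def by (simp only: ennreal_suminf_cmult suminf_sum[OF summableI])
      also have "(\<Sum>i\<in>A. ennreal (1 / (q i * s i)) * S i) = (\<Sum>i\<in>A. ennreal (1 / q i))"
      proof (intro sum.cong refl)
        fix i assume i: "i \<in> A"
        have "ennreal (1 / (q i * s i)) * S i = ennreal (1 / (q i * s i) * s i)" using q[OF i] s[OF i] by (simp add: Ss[OF i] ennreal_mult'[symmetric])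
        then show "ennreal (1 / (q i * s i)) * S i = ennreal (1 / q i)" using s[OF i] by simp
      qed
      also have "\<dots> = ennreal (\<Sum>i\<in>A. 1 / q i)" using q by (intro sum_ennreal) (auto simp: less_imp_le)
      also have "\<dots> = 1" by (simp add: q1)
      also have "ennreal P * 1 = (\<Prod>i\<in>A. ennpowr (S i) (1 / q i))"
      proof -
        have "ennpowr (S i) (1 / q i) = ennreal (s i powr (1 / q i))" if "i \<in> A" for i using False that by (simp add: ennpowr_def s_def)
        then show ?thesis by (simp add: P_def prod_ennreal cong: prod.cong)
      qed
      finally show ?thesis by (simp add: S_def)
    qed
  qed
qed

text \<open>The l1 norm dominates the lq norm: each term is at most the total \<open>t\<close>, so
  \<open>x n powr q\<close> is at most \<open>t powr (q - 1) * x n\<close>.\<close>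

lemma ennpowr_suminf_le:
  fixes I :: "nat \<Rightarrow> ennreal"
  assumes q: "q \<ge> 1"
  shows "ennpowr (\<Sum>n. ennpowr (I n) q) (1 / q) \<le> (\<Sum>n. I n)"
proof (cases "(\<Sum>n. I n) = \<infinity>")
  case False
  define t where "t = enn2real (\<Sum>n. I n)"
  have T: "(\<Sum>n. I n) = ennreal t" "t \<ge> 0" using False by (simp_all add: t_def less_top)
  have le: "I n \<le> ennreal t" for n
    unfolding T(1)[symmetric] using sum_le_suminf[of I "{n}"] by (simp add: summableI)
  define x where "x = (\<lambda>n. enn2real (I n))"
  have fin: "I n \<noteq> \<infinity>" for n using le[of n] by (auto simp: top.extremum_unique)
  have Ix: "I n = ennreal (x n)" for n using fin by (simp add: x_def less_top)
  have x: "x n \<ge> 0" "x n \<le> t" for n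
  proof -
    show "x n \<ge> 0" by (simp add: x_def)
    show "x n \<le> t" using le[of n] T(2) unfolding Ix[of n] by simp
  qed
  have "ennpowr (I n) q \<le> ennreal (t powr (q - 1)) * I n" for n
  proof -
    have "x n powr q = x n powr (q - 1) * x n" using x(1)[of n] powr_mult_base[of "x n" "q - 1"] by (simp add: mult.commute)
    also have "\<dots> \<le> t powr (q - 1) * x n" using x[of n] q by (intro mult_right_mono powr_mono2) auto
    finally have 1: "ennreal (x n powr q) \<le> ennreal (t powr (q - 1)) * ennreal (x n)" using x by (simp add: ennreal_mult'[symmetric] ennreal_leI)
    have 2: "ennpowr (I n) q = ennreal (x n powr q)" using fin[of n] by (simp add: ennpowr_def x_def)
    show ?thesis unfolding 2 by (subst Ix) (rule 1)
  qed
  then have "(\<Sum>n. ennpowr (I n) q) \<le> (\<Sum>n. ennreal (t powr (q - 1)) * I n)" by (intro suminf_le summableI)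
  also have "\<dots> = ennreal (t powr (q - 1) * t)" using T by (simp add: ennreal_suminf_cmult ennreal_mult'[symmetric])
  also have "t powr (q - 1) * t = t powr q" using T(2) powr_mult_base[of t "q - 1"] by (simp add: mult.commute)
  finally have *: "(\<Sum>n. ennpowr (I n) q) \<le> ennreal (t powr q)" .
  then have f: "(\<Sum>n. ennpowr (I n) q) \<noteq> \<infinity>" by (auto simp: top.extremum_unique)
  have "enn2real (\<Sum>n. ennpowr (I n) q) \<le> t powr q" using * by (simp add: enn2real_leI)
  then have "enn2real (\<Sum>n. ennpowr (I n) q) powr (1 / q) \<le> (t powr q) powr (1 / q)" using q by (intro powr_mono2) auto
  also have "\<dots> = t" using q T(2) by (simp add: powr_powr)
  finally show ?thesis using f T by (simp add: ennpowr_def ennreal_leI)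
qed simp

lemma compact_pos_bounds:
  fixes g :: "'a::topological_space \<Rightarrow> real"
  assumes "compact Q" "continuous_on Q g" "\<And>x. x \<in> Q \<Longrightarrow> g x > 0"
  obtains m M where "m > 0" "M > 0" "\<And>x. x \<in> Q \<Longrightarrow> m \<le> g x \<and> g x \<le> M"
proof (cases "Q = {}")
  case True
  then show ?thesis using that[of 1 1] by auto
next
  case False
  obtain a where a: "a \<in> Q" "\<And>y. y \<in> Q \<Longrightarrow> g a \<le> g y" using continuous_attains_inf[OF assms(1) False assms(2)] by blast
  obtain b where b: "b \<in> Q" "\<And>y. y \<in> Q \<Longrightarrow> g y \<le> g b" using continuous_attains_sup[OF assms(1) False assms(2)] by blast
  show ?thesis using that[of "g a" "g b"] a b assms(3) by blast
qed

section \<open>Volumes and sub-mean values on Bergman balls\<close>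

context bounded_domain
begin

lemma bergman_ball_subset: "bergman_ball U z r \<subseteq> U" by (auto simp: bergman_ball_def)

lemma emeasure_bergman_ball: "emeasure lborel (bergman_ball U z r) = ennreal (measure lborel (bergman_ball U z r))"
proof -
  have "bounded (bergman_ball U z r)" using bounded_subset[OF bounded_U bergman_ball_subset] .
  then show ?thesis using emeasure_bounded_finite by (intro emeasure_eq_ennreal_measure) (simp add: less_top)
qed

lemma aut_bergman_ball:
  assumes "aut \<psi>" "z0 \<in> U"
  shows "{x\<in>U. \<psi> x \<in> bergman_ball U (\<psi> z0) r} = bergman_ball U z0 r"
  using biholomorphismD(5)[OF assms(1)] d_invariant[OF assms] by (auto simp: bergman_ball_def)

lemma aut_bergman_ball_image:
  assumes "aut \<psi>" "z0 \<in> U" "w \<in> bergman_ball U (\<psi> z0) r"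
  obtains x where "x \<in> bergman_ball U z0 r" "\<psi> x = w"
proof -
  note bh = biholomorphismD[OF assms(1)]
  have w: "w \<in> U" using assms(3) bergman_ball_subset by blast
  then have "inv_into U \<psi> w \<in> {x\<in>U. \<psi> x \<in> bergman_ball U (\<psi> z0) r}" using bh assms(3) by simp
  then show ?thesis using that bh(8)[OF w] aut_bergman_ball[OF assms(1,2)] by blast
qed

end

context forelli_rudin_domain
begin

text \<open>By change of variables the volume is the integral of the squared Jacobian over the fixed
  ball about \<open>z0\<close>, where \<open>Jac \<psi>\<close> is comparable with its value at
  \<open>z0\<close>. The fixed ball has positive volume because it contains a Euclidean one.\<close>

lemma volume_compare:
  assumes z0: "z0 \<in> U" and r: "r > 0"
  obtains c where "c > 0" "\<And>\<psi>. aut \<psi> \<Longrightarrow> measure lborel (bergman_ball U (\<psi> z0) r) \<le> c * (norm (Jac \<psi> z0))^2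
     \<and> (norm (Jac \<psi> z0))^2 \<le> c * measure lborel (bergman_ball U (\<psi> z0) r)"
proof -
  obtain Q where Q: "compact Q" "Q \<subseteq> U" "bergman_ball U z0 r \<subseteq> Q" by (rule bergman_ball_relatively_compact[OF z0])
  obtain C where C: "C > 0" "\<And>\<psi> x. aut \<psi> \<Longrightarrow> x \<in> Q \<Longrightarrow> norm (Jac \<psi> z0) \<le> C * norm (Jac \<psi> x) \<and> norm (Jac \<psi> x) \<le> C * norm (Jac \<psi> z0)"
    by (rule Jac_compare[OF z0 Q(1,2)]) blast
  define A where "A = bergman_ball U z0 r"
  have Am: "A \<in> sets borel" unfolding A_def by (rule bergman_ball_borel[OF z0])
  define V where "V = measure lborel A"
  have eV: "emeasure lborel A = ennreal V" unfolding A_def V_def by (rule emeasure_bergman_ball)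
  have V: "V > 0"
  proof -
    obtain \<delta> M where \<delta>: "\<delta> > 0" "M > 0" "cball z0 \<delta> \<subseteq> U" "\<And>x y. x \<in> cball z0 \<delta> \<Longrightarrow> y \<in> cball z0 \<delta> \<Longrightarrow> d x y \<le> M * norm (y - x)"
      using d_local[OF z0] by metis
    define e where "e = min \<delta> (r / M)"
    have e: "e > 0" using \<delta> r by (simp add: e_def)
    have "ball z0 e \<subseteq> A"
    proof
      fix y assume y: "y \<in> ball z0 e"
      then have yc: "y \<in> cball z0 \<delta>" "z0 \<in> cball z0 \<delta>" using \<delta>(1) by (auto simp: e_def)
      have "d z0 y \<le> M * norm (y - z0)" by (rule \<delta>(4)[OF yc(2,1)])
      also have "\<dots> \<le> M * (r / M)" using y \<delta>(2) by (intro mult_left_mono) (auto simp: e_def dist_norm norm_minus_commute)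
      finally show "y \<in> A" using yc \<delta> by (auto simp: A_def bergman_ball_def)
    qed
    then have "emeasure lborel (ball z0 e) \<le> ennreal V" using emeasure_mono[of "ball z0 e" A lborel] Am eV by simp
    moreover have "emeasure lborel (ball z0 e) = ennreal (measure lborel (ball z0 e))"
      by (intro emeasure_eq_ennreal_measure emeasure_bounded_finite[THEN less_imp_neq, simplified]) auto
    ultimately have "ennreal (measure lborel (ball z0 e)) \<le> ennreal V" by simp
    then show ?thesis using measure_ball_pos[OF e, of z0] by (metis ennreal_le_iff2 less_le_trans not_le)
  qed
  \<comment> \<open>The two summands serve the two inequalities.\<close>
  define c where "c = C^2 * V + C^2 / V"
  have c: "c > 0" using C V by (simp add: c_def add_pos_pos)
  have "measure lborel (bergman_ball U (\<psi> z0) r) \<le> c * (norm (Jac \<psi> z0))^2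
     \<and> (norm (Jac \<psi> z0))^2 \<le> c * measure lborel (bergman_ball U (\<psi> z0) r)" if \<psi>: "aut \<psi>" for \<psi>
  proof -
    note bh = biholomorphismD[OF \<psi>]
    define j where "j = norm (Jac \<psi> z0)"
    define V' where "V' = measure lborel (bergman_ball U (\<psi> z0) r)"
    have V'0: "V' \<ge> 0" by (simp add: V'_def)
    have "(\<integral>\<^sup>+x. ennreal ((norm (det (complex_jacobi \<psi> x)))^2) * indicator {x\<in>U. \<psi> x \<in> bergman_ball U (\<psi> z0) r} x \<partial>lborel) = emeasure lborel (bergman_ball U (\<psi> z0) r)"
      by (rule emeasure_biholo_image[OF \<psi> open_U bounded_U bergman_ball_borel bergman_ball_subset]) (rule bh(5)[OF z0])
    then have eq: "(\<integral>\<^sup>+x. ennreal ((norm (Jac \<psi> x))^2) * indicator A x \<partial>lborel) = ennreal V'"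
      unfolding aut_bergman_ball[OF \<psi> z0] by (simp add: Jac_def A_def emeasure_bergman_ball V'_def)
    have cmp: "norm (Jac \<psi> x) \<le> C * j" "j \<le> C * norm (Jac \<psi> x)" if "x \<in> A" for x using C(2)[OF \<psi>] Q that by (auto simp: A_def j_def)
    have "ennreal V' \<le> (\<integral>\<^sup>+x. ennreal ((C * j)^2) * indicator A x \<partial>lborel)"
      unfolding eq[symmetric] using cmp(1) by (intro nn_integral_mono) (auto simp: indicator_def intro!: ennreal_leI power_mono)
    also have "\<dots> = ennreal ((C * j)^2 * V)" using Am V by (simp add: nn_integral_cmult_indicator eV ennreal_mult)
    finally have 1: "V' \<le> C^2 * V * j^2" using V by (simp add: power_mult_distrib mult_ac)
    have "ennreal ((j / C)^2 * V) = (\<integral>\<^sup>+x. ennreal ((j / C)^2) * indicator A x \<partial>lborel)"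
      using Am V by (simp add: nn_integral_cmult_indicator eV ennreal_mult)
    also have "\<dots> \<le> ennreal V'"
      unfolding eq[symmetric]
    proof (intro nn_integral_mono)
      fix x
      show "ennreal ((j / C)^2) * indicator A x \<le> ennreal ((norm (Jac \<psi> x))^2) * indicator A x"
      proof (cases "x \<in> A")
        case True
        have "j / C \<le> norm (Jac \<psi> x)" using cmp(2)[OF True] C(1) by (simp add: pos_divide_le_eq mult.commute)
        then have "(j / C)^2 \<le> (norm (Jac \<psi> x))^2" using C(1) by (intro power_mono) (auto simp: j_def)
        then show ?thesis using True by (simp add: ennreal_leI)
      qed simp
    qed
    finally have "(j / C)^2 * V \<le> V'" using V'0 by simp
    then have 2: "j^2 \<le> C^2 / V * V'" using C(1) V by (simp add: field_simps)
    have "C^2 * V \<le> c" "C^2 / V \<le> c" using C V by (simp_all add: c_def)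
    then have "C^2 * V * j^2 \<le> c * j^2" "C^2 / V * V' \<le> c * V'"
      using V'0 by (simp_all only: mult_right_mono zero_le_power2)
    then show ?thesis using 1 2 unfolding j_def V'_def by linarith
  qed
  then show ?thesis using that c by blast
qed

text \<open>The sub-mean value property is applied to \<open>f\<close> composed with \<psi> on a
  Euclidean ball about \<open>x\<close>, for which the doubled radius makes room. The pulled-back
  weighted measure has density of size \<open>norm (Jac \<psi> z0) powr (2 * \<alpha> + 2)\<close>,
  whence the factor.\<close>

lemma submean_bergman_ball:
  assumes z0: "z0 \<in> U" and r: "r > 0" and p: "p > 1"
  obtains C where "C > 0" "\<And>\<psi> f x. aut \<psi> \<Longrightarrow> holo_on U f \<Longrightarrow> x \<in> bergman_ball U z0 r \<Longrightarrow>
     ennreal (norm (f (\<psi> x)) powr p) \<le> ennreal (C * norm (Jac \<psi> z0) powr (- (2 * \<alpha> + 2))) *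
       (\<integral>\<^sup>+ w\<in>bergman_ball U (\<psi> z0) (2 * r). ennreal (norm (f w) powr p) \<partial>weighted_vol U \<alpha>)"
proof -
  obtain Q where Q: "compact Q" "Q \<subseteq> U" "bergman_ball U z0 (2 * r) \<subseteq> Q" by (rule bergman_ball_relatively_compact[OF z0])
  obtain C where C: "C > 0" "\<And>\<psi> x. aut \<psi> \<Longrightarrow> x \<in> Q \<Longrightarrow> norm (Jac \<psi> z0) \<le> C * norm (Jac \<psi> x) \<and> norm (Jac \<psi> x) \<le> C * norm (Jac \<psi> z0)"
    by (rule Jac_compare[OF z0 Q(1,2)]) blast
  \<comment> \<open>Neighbourhoods of Bergman diameter at most \<open>r\<close>; a Lebesgue number
    \<open>e\<close> of the resulting cover of \<open>Q\<close> then gives Euclidean balls of one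
    radius.\<close>
  have "\<exists>\<eta>>0. ball x \<eta> \<subseteq> U \<and> (\<forall>y\<in>ball x \<eta>. \<forall>y'\<in>ball x \<eta>. d y y' \<le> r)" if x: "x \<in> U" for x
  proof -
    obtain \<delta> M where \<delta>: "\<delta> > 0" "M > 0" "cball x \<delta> \<subseteq> U" "\<And>x' y. x' \<in> cball x \<delta> \<Longrightarrow> y \<in> cball x \<delta> \<Longrightarrow> d x' y \<le> M * norm (y - x')"
      using d_local[OF x] by metis
    define \<eta> where "\<eta> = min \<delta> (r / (2 * M))"
    have \<eta>: "\<eta> > 0" using \<delta> r by (simp add: \<eta>_def)
    have sub: "ball x \<eta> \<subseteq> cball x \<delta>" by (auto simp: \<eta>_def)
    have "d y y' \<le> r" if "y \<in> ball x \<eta>" "y' \<in> ball x \<eta>" for y y'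
    proof -
      have "d y y' \<le> M * norm (y' - y)" using \<delta>(4) sub that by blast
      also have "\<dots> \<le> M * (r / (2 * M) + r / (2 * M))"
      proof (intro mult_left_mono)
        have "norm (y' - y) = dist y y'" by (simp add: dist_norm norm_minus_commute)
        then have "norm (y' - y) \<le> dist y x + dist x y'" using dist_triangle[of y y' x] by simp
        also have "\<dots> \<le> r / (2 * M) + r / (2 * M)" using that by (intro add_mono) (auto simp: \<eta>_def dist_commute)
        finally show "norm (y' - y) \<le> r / (2 * M) + r / (2 * M)" .
      qed (use \<delta> in simp)
      also have "\<dots> = r" using \<delta>(2) by (simp add: field_simps)
      finally show ?thesis .
    qed
    then show ?thesis using \<eta> sub \<delta>(3) by blast
  qed
  then obtain \<eta> where \<eta>: "\<And>x. x \<in> U \<Longrightarrow> \<eta> x > 0" "\<And>x. x \<in> U \<Longrightarrow> ball x (\<eta> x) \<subseteq> U"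
    "\<And>x y y'. x \<in> U \<Longrightarrow> y \<in> ball x (\<eta> x) \<Longrightarrow> y' \<in> ball x (\<eta> x) \<Longrightarrow> d y y' \<le> r" by metis
  have cover: "Q \<subseteq> \<Union>((\<lambda>x. ball x (\<eta> x)) ` Q)" using \<eta>(1) Q(2) by force
  obtain e where e: "e > 0" "\<And>x. x \<in> Q \<Longrightarrow> \<exists>B\<in>(\<lambda>x. ball x (\<eta> x)) ` Q. ball x e \<subseteq> B"
    using Heine_Borel_lemma[OF Q(1) cover] by auto
  have sub: "ball x e \<subseteq> bergman_ball U z0 (2 * r)" if x: "x \<in> bergman_ball U z0 r" for x
  proof -
    have "x \<in> bergman_ball U z0 (2 * r)" using x r by (auto simp: bergman_ball_def)
    then have "x \<in> Q" using Q by blast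
    then obtain y where y: "y \<in> Q" "ball x e \<subseteq> ball y (\<eta> y)" using e(2) by blast
    have yU: "y \<in> U" using y Q by blast
    have xy: "x \<in> ball y (\<eta> y)" using y(2) e(1) by (meson centre_in_ball subsetD)
    show ?thesis
    proof
      fix w assume "w \<in> ball x e"
      then have w: "w \<in> ball y (\<eta> y)" using y by blast
      then have wU: "w \<in> U" using \<eta>(2)[OF yU] by blast
      have xU: "x \<in> U" "d z0 x \<le> r" using x by (auto simp: bergman_ball_def)
      have "d z0 w \<le> d z0 x + d x w" by (rule d_triangle[OF z0 xU(1) wU])
      also have "\<dots> \<le> r + r" using xU(2) \<eta>(3)[OF yU xy w] by simp
      finally show "w \<in> bergman_ball U z0 (2 * r)" using wU by (simp add: bergman_ball_def)
    qed
  qed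
  have "continuous_on Q (\<lambda>x. k x powr (- \<alpha>))"
    by (intro continuous_intros continuous_on_subset[OF continuous_kernel_diag Q(2)]) (use kernel_diag_pos Q(2) in fastforce)
  then obtain m where m: "m > 0" "\<And>x. x \<in> Q \<Longrightarrow> m \<le> k x powr (- \<alpha>)"
    using compact_pos_bounds[OF Q(1), of "\<lambda>x. k x powr (- \<alpha>)"] kernel_diag_pos Q(2)
    by (metis powr_gt_zero less_irrefl subsetD)
  define v where "v = measure lborel (ball (0::complex^'n) e)"
  have v: "v > 0" unfolding v_def by (rule measure_ball_pos[OF e(1)])
  define b where "b = \<bar>2 * \<alpha> + 2\<bar>"
  \<comment> \<open>The reciprocal of \<open>t * v\<close> below, apart from the power of
    \<open>j\<close>.\<close>
  define D where "D = C powr b / (m * v)"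
  have D: "D > 0" using C m v by (simp add: D_def)
  have "ennreal (norm (f (\<psi> x)) powr p) \<le> ennreal (D * norm (Jac \<psi> z0) powr (- (2 * \<alpha> + 2))) *
       (\<integral>\<^sup>+ w\<in>bergman_ball U (\<psi> z0) (2 * r). ennreal (norm (f w) powr p) \<partial>weighted_vol U \<alpha>)"
    if \<psi>: "aut \<psi>" and f: "holo_on U f" and x: "x \<in> bergman_ball U z0 r" for \<psi> f x
  proof -
    note bh = biholomorphismD[OF \<psi>]
    define j where "j = norm (Jac \<psi> z0)"
    have j: "j > 0" using Jac_nonzero[OF \<psi> open_U z0] by (simp add: j_def)
    define g where "g = (\<lambda>x. f (\<psi> x))"
    have g: "holo_on U g" unfolding g_def by (rule holo_on_compose[OF bh(1) f]) (use bh in auto)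
    have subU: "ball x e \<subseteq> U" using sub[OF x] bergman_ball_subset by blast
    define A where "A = bergman_ball U z0 (2 * r)"
    \<comment> \<open>A lower bound for the density on the doubled ball, from
      \<open>Jac_compare\<close> and \<open>powr_compare\<close>.\<close>
    define t where "t = m * C powr (- b) * j powr (2 * \<alpha> + 2)"
    have t: "t > 0" using m C j by (simp add: t_def)
    have tle: "t \<le> k y powr (- \<alpha>) * norm (Jac \<psi> y) powr (2 * \<alpha> + 2)" if y: "y \<in> A" for y
    proof -
      have yQ: "y \<in> Q" "y \<in> U" using y Q by (auto simp: A_def)
      have Jy: "norm (Jac \<psi> y) > 0" using Jac_nonzero[OF \<psi> open_U yQ(2)] by simp
      have "j powr (2 * \<alpha> + 2) \<le> C powr b * norm (Jac \<psi> y) powr (2 * \<alpha> + 2)"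
        unfolding b_def by (rule powr_compare[OF j Jy C(1)]) (use C(2)[OF \<psi> yQ(1)] in \<open>auto simp: j_def\<close>)
      then have "C powr (- b) * j powr (2 * \<alpha> + 2) \<le> norm (Jac \<psi> y) powr (2 * \<alpha> + 2)"
        using C(1) by (simp add: powr_minus field_simps)
      then show ?thesis unfolding t_def mult.assoc using m yQ by (intro mult_mono) auto
    qed
    have "ennreal (norm (g x) powr p) * ennreal v = ennreal (norm (g x) powr p) * emeasure lborel (ball x e)"
    proof -
      have "emeasure lborel (ball x e) = ennreal (measure lborel (ball x e))"
        by (intro emeasure_eq_ennreal_measure emeasure_bounded_finite[THEN less_imp_neq, simplified]) auto
      then show ?thesis by (simp only: v_def measure_ball_eq[of x])
    qed
    also have "\<dots> \<le> (\<integral>\<^sup>+y. ennreal (norm (g y) powr p) * indicator (ball x e) y \<partial>lborel)"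
      by (rule holo_mean_value_powr[OF holo_on_subset[OF g subU] p])
    finally have 1: "ennreal t * (ennreal (norm (g x) powr p) * ennreal v) \<le> ennreal t * (\<integral>\<^sup>+y. ennreal (norm (g y) powr p) * indicator (ball x e) y \<partial>lborel)"
      by (rule mult_left_mono) simp
    have "ennreal t * (\<integral>\<^sup>+y. ennreal (norm (g y) powr p) * indicator (ball x e) y \<partial>lborel) =
       (\<integral>\<^sup>+y. ennreal t * (ennreal (norm (g y) powr p) * indicator (ball x e) y) \<partial>lborel)"
    proof (rule nn_integral_cmult[symmetric])
      have "continuous_on U (\<lambda>x. norm (g x) powr p)" using continuous_holo_powr[OF g] p by simp
      from borel_measurable_ennreal_indicator[OF this _ subU]
      show "(\<lambda>y. ennreal (norm (g y) powr p) * indicator (ball x e) y) \<in> borel_measurable lborel" by simp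
    qed
    also have "\<dots> \<le> (\<integral>\<^sup>+y. ennreal (norm (f (\<psi> y)) powr p * k y powr (- \<alpha>) * norm (Jac \<psi> y) powr (2 * \<alpha> + 2)) * indicator A y \<partial>lborel)"
    proof (intro nn_integral_mono)
      fix y
      show "ennreal t * (ennreal (norm (g y) powr p) * indicator (ball x e) y) \<le>
        ennreal (norm (f (\<psi> y)) powr p * k y powr (- \<alpha>) * norm (Jac \<psi> y) powr (2 * \<alpha> + 2)) * indicator A y"
      proof (cases "y \<in> ball x e")
        case True
        then have y: "y \<in> A" using sub[OF x] by (auto simp: A_def)
        have "t * norm (g y) powr p \<le> (k y powr (- \<alpha>) * norm (Jac \<psi> y) powr (2 * \<alpha> + 2)) * norm (g y) powr p"
          using tle[OF y] by (rule mult_right_mono) simp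
        then have "t * norm (g y) powr p \<le> norm (f (\<psi> y)) powr p * k y powr (- \<alpha>) * norm (Jac \<psi> y) powr (2 * \<alpha> + 2)"
          by (simp add: g_def mult_ac)
        then show ?thesis using True y t by (auto simp: ennreal_mult'[symmetric] indicator_def intro!: ennreal_leI)
      qed simp
    qed
    also have "\<dots> = (\<integral>\<^sup>+ w\<in>bergman_ball U (\<psi> z0) (2 * r). ennreal (norm (f w) powr p) \<partial>weighted_vol U \<alpha>)" (is "_ = ?I")
    proof -
      have cf: "continuous_on U (\<lambda>x. norm (f x) powr p)" using continuous_holo_powr[OF f] p by simp
      have bb: "bergman_ball U (\<psi> z0) (2 * r) \<in> sets borel" by (rule bergman_ball_borel) (use bh(5) z0 in auto)
      from nn_integral_weighted_vol_pullback[OF \<psi> cf _ bb bergman_ball_subset]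
      show ?thesis unfolding aut_bergman_ball[OF \<psi> z0] A_def by simp
    qed
    finally have 2: "ennreal t * (ennreal (norm (g x) powr p) * ennreal v) \<le> ?I" using 1 by simp
    have "1 / (t * v) = D * j powr (- (2 * \<alpha> + 2))"
      using C(1) j by (simp only: t_def D_def powr_minus) (simp add: field_simps)
    then have "D * j powr (- (2 * \<alpha> + 2)) * (t * (norm (g x) powr p * v)) = (1 / (t * v)) * (t * v) * norm (g x) powr p"
      by (simp only: mult_ac)
    also have "\<dots> = norm (g x) powr p" using t v by simp
    finally have "ennreal (D * j powr (- (2 * \<alpha> + 2))) * (ennreal t * (ennreal (norm (g x) powr p) * ennreal v)) = ennreal (norm (g x) powr p)"
      using D t v by (simp only: ennreal_mult'[symmetric] ennreal_mult''[symmetric] less_imp_le powr_ge_zero mult_nonneg_nonneg)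
    moreover have "ennreal (D * j powr (- (2 * \<alpha> + 2))) * (ennreal t * (ennreal (norm (g x) powr p) * ennreal v)) \<le> ennreal (D * j powr (- (2 * \<alpha> + 2))) * ?I"
      using 2 by (rule mult_left_mono) simp
    ultimately show ?thesis by (simp add: g_def j_def)
  qed
  then show ?thesis using that D by blast
qed

end

lemma bergman_samplingD:
  assumes "bergman_sampling U r z"
  shows "r > 0" "z n \<in> U" "x \<in> U \<Longrightarrow> \<exists>n. x \<in> bergman_ball U (z n) r"
    "\<exists>N::nat. \<forall>x\<in>U. finite {n. x \<in> bergman_ball U (z n) (2 * r)} \<and> card {n. x \<in> bergman_ball U (z n) (2 * r)} \<le> N"
  using assms unfolding bergman_sampling_def by blast+

lemma norm_power_powr:
  fixes z :: complex
  assumes "n > 0" shows "norm (z ^ n) powr p = norm z powr (real n * p)"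
proof (cases "z = 0")
  case False
  then have "norm z ^ n = norm z powr real n" by (simp add: powr_realpow)
  then show ?thesis by (simp add: norm_power powr_powr)
qed (use assms in simp)

lemma nn_integral_cover_le:
  fixes F :: "'a \<Rightarrow> ennreal"
  assumes F: "F \<in> borel_measurable M" and B: "\<And>n::nat. B n \<in> sets M" and cover: "\<And>x. x \<in> space M \<Longrightarrow> \<exists>n. x \<in> B n"
  shows "(\<integral>\<^sup>+x. F x \<partial>M) \<le> (\<Sum>n. \<integral>\<^sup>+x\<in>B n. F x \<partial>M)"
proof -
  have "(\<integral>\<^sup>+x. F x \<partial>M) \<le> (\<integral>\<^sup>+x. (\<Sum>n. F x * indicator (B n) x) \<partial>M)"
  proof (rule nn_integral_mono)
    fix x assume "x \<in> space M"
    then obtain n where n: "x \<in> B n" using cover by blast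
    have "F x = (\<Sum>n\<in>{n}. F x * indicator (B n) x)" using n by simp
    also have "\<dots> \<le> (\<Sum>n. F x * indicator (B n) x)" by (rule sum_le_suminf) (auto intro: summableI)
    finally show "F x \<le> (\<Sum>n. F x * indicator (B n) x)" .
  qed
  also have "\<dots> = (\<Sum>n. \<integral>\<^sup>+x\<in>B n. F x \<partial>M)"
    by (intro nn_integral_suminf borel_measurable_times_ennreal F borel_measurable_indicator B)
  finally show ?thesis .
qed

lemma nn_integral_overlap_le:
  fixes F :: "'a \<Rightarrow> ennreal" and N :: nat
  assumes F: "F \<in> borel_measurable M" and B: "\<And>n::nat. B n \<in> sets M"
    and N: "\<And>x. x \<in> space M \<Longrightarrow> finite {n. x \<in> B n} \<and> card {n. x \<in> B n} \<le> N"
  shows "(\<Sum>n. \<integral>\<^sup>+x\<in>B n. F x \<partial>M) \<le> of_nat N * (\<integral>\<^sup>+x. F x \<partial>M)"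
proof -
  have "(\<Sum>n. \<integral>\<^sup>+x\<in>B n. F x \<partial>M) = (\<integral>\<^sup>+x. (\<Sum>n. F x * indicator (B n) x) \<partial>M)"
    by (intro nn_integral_suminf[symmetric] borel_measurable_times_ennreal F borel_measurable_indicator B)
  also have "\<dots> \<le> (\<integral>\<^sup>+x. of_nat N * F x \<partial>M)"
  proof (rule nn_integral_mono)
    fix x assume x: "x \<in> space M"
    have "(\<Sum>n. F x * indicator (B n) x) = F x * (\<Sum>n. indicator (B n) x)" by (rule ennreal_suminf_cmult)
    also have "(\<Sum>n. indicator (B n) x) = (\<Sum>n\<in>{n. x \<in> B n}. indicator (B n) x :: ennreal)"
      using N[OF x] by (intro suminf_finite) auto
    also have "\<dots> = of_nat (card {n. x \<in> B n})" by simp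
    also have "F x * of_nat (card {n. x \<in> B n}) \<le> F x * of_nat N"
      using N[OF x] by (intro mult_left_mono) auto
    finally show "(\<Sum>n. F x * indicator (B n) x) \<le> of_nat N * F x" by (simp add: mult.commute)
  qed
  also have "\<dots> = of_nat N * (\<integral>\<^sup>+x. F x \<partial>M)" by (rule nn_integral_cmult[OF F])
  finally show ?thesis .
qed

lemma ennreal_le_divide:
  assumes "a > 0" "ennreal a * x \<le> ennreal (b * a)" "b \<ge> 0"
  shows "x \<le> ennreal b"
proof -
  have "ennreal (1 / a) * (ennreal a * x) \<le> ennreal (1 / a) * ennreal (b * a)" by (rule mult_left_mono[OF assms(2)]) simp
  moreover have "ennreal (1 / a) * (ennreal a * x) = x" using assms(1) by (simp add: mult.assoc[symmetric] ennreal_mult'[symmetric])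
  moreover have "ennreal (1 / a) * ennreal (b * a) = ennreal b" using assms(1) by (simp add: ennreal_mult'[symmetric])
  ultimately show ?thesis by simp
qed

section \<open>The two implications for a sampling sequence\<close>

context forelli_rudin_domain
begin

lemma volume_powr_compare:
  assumes z0: "z0 \<in> U" and r: "r > 0"
  obtains c where "c > 0" "\<And>\<psi>. aut \<psi> \<Longrightarrow> measure lborel (bergman_ball U (\<psi> z0) r) powr e \<le> c * norm (Jac \<psi> z0) powr (2 * e)
     \<and> norm (Jac \<psi> z0) powr (2 * e) \<le> c * measure lborel (bergman_ball U (\<psi> z0) r) powr e"
proof -
  obtain c where c: "c > 0" "\<And>\<psi>. aut \<psi> \<Longrightarrow> measure lborel (bergman_ball U (\<psi> z0) r) \<le> c * (norm (Jac \<psi> z0))^2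
     \<and> (norm (Jac \<psi> z0))^2 \<le> c * measure lborel (bergman_ball U (\<psi> z0) r)"
    by (rule volume_compare[OF z0 r]) blast
  have "measure lborel (bergman_ball U (\<psi> z0) r) powr e \<le> c powr \<bar>e\<bar> * norm (Jac \<psi> z0) powr (2 * e)
     \<and> norm (Jac \<psi> z0) powr (2 * e) \<le> c powr \<bar>e\<bar> * measure lborel (bergman_ball U (\<psi> z0) r) powr e" if \<psi>: "aut \<psi>" for \<psi>
  proof -
    define j where "j = norm (Jac \<psi> z0)"
    define V where "V = measure lborel (bergman_ball U (\<psi> z0) r)"
    have j: "j > 0" using Jac_nonzero[OF \<psi> open_U z0] by (simp add: j_def)
    have *: "V \<le> c * j^2" "j^2 \<le> c * V" using c(2)[OF \<psi>] by (auto simp: j_def V_def)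
    have "0 < j^2" using j by simp
    then have "0 < c * V" using *(2) by (rule less_le_trans)
    then have V: "V > 0" using c(1) by (simp add: zero_less_mult_iff)
    have e: "j powr (2 * e) = (j^2) powr e" using j by (simp add: powr_powr flip: powr_numeral)
    have j2: "j^2 > 0" using j by simp
    show ?thesis
      unfolding j_def[symmetric] V_def[symmetric] e
      using powr_compare[OF V j2 c(1) *] powr_compare[OF j2 V c(1) *(2,1)] by blast
  qed
  then show ?thesis using that[of "c powr \<bar>e\<bar>"] c(1) by simp
qed

text \<open>The point \<open>z 0\<close> becomes the base point. The constants may then depend on
  the sequence, as the quantifiers of the theorem allow, while the exponent does not.\<close>

lemma sampling_automorphisms:
  assumes "bergman_sampling U r z"
  obtains \<psi> where "\<And>n::nat. aut (\<psi> n)" "\<And>n. \<psi> n (z 0) = z n"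
proof -
  note zU = bergman_samplingD(2)[OF assms]
  have "\<exists>\<phi>. aut \<phi> \<and> \<phi> (z 0) = z n" for n using obtain_aut[OF zU[of 0] zU[of n]] by metis
  then show ?thesis using that by metis
qed

text \<open>On the \<open>n\<close>-th ball each of the \<open>m\<close> factors costs
  \<open>j n powr (- \<beta>)\<close>, and the measure of the ball contributes at most a multiple of
  \<open>j n powr (2 * \<alpha>0)\<close>. With \<open>\<alpha>0 = real m * (1 + \<alpha>)\<close>
  these powers cancel and leave a constant independent of \<open>n\<close>.\<close>

lemma carleson_sufficient:
  fixes m :: nat and p q :: "nat \<Rightarrow> real" and z :: "nat \<Rightarrow> complex^'n"
  assumes samp: "bergman_sampling U r z" and mu: "sets \<mu> = sets (restrict_space borel U)"
    and pq: "\<forall>i\<in>{1..m}. 1 < p i \<and> 1 < q i" and q1: "(\<Sum>i=1..m. 1 / q i) = 1"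
    and C0: "C0 > 0" "\<And>n. emeasure \<mu> (bergman_ball U (z n) r) \<le> ennreal (C0 * measure lborel (bergman_ball U (z n) r) powr (real m * (1 + \<alpha>)))"
  shows "\<exists>C::real. C > 0 \<and> (\<forall>f::nat \<Rightarrow> complex^'n \<Rightarrow> complex. (\<forall>i\<in>{1..m}. holo_on U (f i)) \<longrightarrow>
        (\<integral>\<^sup>+ x. ennreal (\<Prod>i=1..m. norm (f i x) powr p i) \<partial>\<mu>)
          \<le> ennreal C * (\<Prod>i=1..m. ennpowr (\<Sum>n. ennpowr
                   (\<integral>\<^sup>+ x\<in>bergman_ball U (z n) (2 * r). ennreal (norm (f i x) powr p i) \<partial>weighted_vol U \<alpha>) (q i)) (1 / q i)))"
proof -
  note r = bergman_samplingD(1)[OF samp] and zU = bergman_samplingD(2)[OF samp] and cover = bergman_samplingD(3)[OF samp]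
  obtain \<psi> where \<psi>: "\<And>n::nat. aut (\<psi> n)" "\<And>n. \<psi> n (z 0) = z n" by (rule sampling_automorphisms[OF samp]) blast
  define j where "j = (\<lambda>n. norm (Jac (\<psi> n) (z 0)))"
  have j: "j n > 0" for n using Jac_nonzero[OF \<psi>(1) open_U zU] by (simp add: j_def)
  define \<beta> where "\<beta> = 2 * \<alpha> + 2"
  define I where "I = (\<lambda>(f :: complex^'n \<Rightarrow> complex) i n. \<integral>\<^sup>+ x\<in>bergman_ball U (z n) (2 * r). ennreal (norm (f x) powr p i) \<partial>weighted_vol U \<alpha>)"
  have "\<exists>C>0. \<forall>f x n. holo_on U f \<longrightarrow> x \<in> bergman_ball U (z n) r \<longrightarrow> ennreal (norm (f x) powr p i) \<le> ennreal (C * j n powr (- \<beta>)) * I f i n"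
    if i: "i \<in> {1..m}" for i
  proof -
    have pi: "p i > 1" using pq i by blast
    obtain C where C: "C > 0" "\<And>\<phi> f x. aut \<phi> \<Longrightarrow> holo_on U f \<Longrightarrow> x \<in> bergman_ball U (z 0) r \<Longrightarrow>
     ennreal (norm (f (\<phi> x)) powr p i) \<le> ennreal (C * norm (Jac \<phi> (z 0)) powr (- (2 * \<alpha> + 2))) *
       (\<integral>\<^sup>+ w\<in>bergman_ball U (\<phi> (z 0)) (2 * r). ennreal (norm (f w) powr p i) \<partial>weighted_vol U \<alpha>)"
      by (rule submean_bergman_ball[OF zU[of 0] r pi]) blast
    have "ennreal (norm (f x) powr p i) \<le> ennreal (C * j n powr (- \<beta>)) * I f i n" if f: "holo_on U f" and x: "x \<in> bergman_ball U (z n) r" for f x n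
    proof -
      obtain y where y: "y \<in> bergman_ball U (z 0) r" "\<psi> n y = x"
        using aut_bergman_ball_image[OF \<psi>(1) zU[of 0], of x n r] x \<psi>(2) by metis
      show ?thesis using C(2)[OF \<psi>(1)[of n] f y(1)] y(2) by (simp add: I_def j_def \<beta>_def \<psi>(2))
    qed
    with C(1) show ?thesis by blast
  qed
  then obtain Cs where Cs: "\<And>i. i \<in> {1..m} \<Longrightarrow> Cs i > 0" "\<And>i f x n. i \<in> {1..m} \<Longrightarrow> holo_on U f \<Longrightarrow> x \<in> bergman_ball U (z n) r \<Longrightarrow>
      ennreal (norm (f x) powr p i) \<le> ennreal (Cs i * j n powr (- \<beta>)) * I f i n" by metis
  define \<alpha>0 where "\<alpha>0 = real m * (1 + \<alpha>)"
  obtain c where c: "c > 0" "\<And>\<phi>. aut \<phi> \<Longrightarrow> measure lborel (bergman_ball U (\<phi> (z 0)) r) powr \<alpha>0 \<le> c * norm (Jac \<phi> (z 0)) powr (2 * \<alpha>0)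
     \<and> norm (Jac \<phi> (z 0)) powr (2 * \<alpha>0) \<le> c * measure lborel (bergman_ball U (\<phi> (z 0)) r) powr \<alpha>0"
    by (rule volume_powr_compare[OF zU[of 0] r, of \<alpha>0]) blast
  have mu_le: "emeasure \<mu> (bergman_ball U (z n) r) \<le> ennreal (C0 * c * j n powr (2 * \<alpha>0))" for n
  proof -
    have "measure lborel (bergman_ball U (z n) r) powr \<alpha>0 \<le> c * j n powr (2 * \<alpha>0)" using c(2)[OF \<psi>(1)[of n]] by (simp add: \<psi>(2) j_def)
    then have "C0 * measure lborel (bergman_ball U (z n) r) powr \<alpha>0 \<le> C0 * (c * j n powr (2 * \<alpha>0))" using C0(1) by (intro mult_left_mono) auto
    then have "ennreal (C0 * measure lborel (bergman_ball U (z n) r) powr \<alpha>0) \<le> ennreal (C0 * c * j n powr (2 * \<alpha>0))" by (intro ennreal_leI) (simp add: mult.assoc)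
    with C0(2)[of n] show ?thesis by (simp add: \<alpha>0_def)
  qed
  have spaceM: "space \<mu> = U" using sets_eq_imp_space_eq[OF mu] by (simp add: space_restrict_space)
  have ballM: "bergman_ball U (z n) r \<in> sets \<mu>" for n
    unfolding mu using bergman_ball_borel[OF zU] bergman_ball_subset by (auto simp: sets_restrict_space_iff)
  define D where "D = C0 * c * (\<Prod>i=1..m. Cs i)"
  have D: "D > 0" using C0 c Cs unfolding D_def by (intro mult_pos_pos prod_pos) auto
  have "(\<integral>\<^sup>+ x. ennreal (\<Prod>i=1..m. norm (f i x) powr p i) \<partial>\<mu>) \<le> ennreal D * (\<Prod>i=1..m. ennpowr (\<Sum>n. ennpowr (I (f i) i n) (q i)) (1 / q i))"
    if f: "\<forall>i\<in>{1..m}. holo_on U (f i)" for f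
  proof -
    define F where "F = (\<lambda>x. ennreal (\<Prod>i=1..m. norm (f i x) powr p i))"
    have Fm: "F \<in> borel_measurable \<mu>"
    proof -
      have "continuous_on U (\<lambda>x. norm (f i x) powr p i)" if "i \<in> {1..m}" for i
        using f that pq[rule_format, OF that] by (intro continuous_holo_powr) auto
      then have "continuous_on U (\<lambda>x. \<Prod>i=1..m. norm (f i x) powr p i)" by (intro continuous_on_prod) auto
      from borel_measurable_continuous_on_restrict[OF this]
      have "(\<lambda>x. \<Prod>i=1..m. norm (f i x) powr p i) \<in> borel_measurable \<mu>" by (simp cong: measurable_cong_sets add: mu)
      then show ?thesis unfolding F_def by measurable
    qed
    have loc: "(\<integral>\<^sup>+x\<in>bergman_ball U (z n) r. F x \<partial>\<mu>) \<le> ennreal D * (\<Prod>i=1..m. I (f i) i n)" for n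
    proof -
      have Fx: "F x \<le> ennreal ((\<Prod>i=1..m. Cs i) * j n powr (- (real m * \<beta>))) * (\<Prod>i=1..m. I (f i) i n)" if x: "x \<in> bergman_ball U (z n) r" for x
      proof -
        have "F x = (\<Prod>i=1..m. ennreal (norm (f i x) powr p i))" unfolding F_def by (intro prod_ennreal[symmetric]) auto
        also have "\<dots> \<le> (\<Prod>i=1..m. ennreal (Cs i * j n powr (- \<beta>)) * I (f i) i n)" by (intro prod_mono_ennreal Cs(2) x) (use f in auto)
        also have "\<dots> = (\<Prod>i=1..m. ennreal (Cs i * j n powr (- \<beta>))) * (\<Prod>i=1..m. I (f i) i n)" by (rule prod.distrib)
        also have "(\<Prod>i=1..m. ennreal (Cs i * j n powr (- \<beta>))) = ennreal (\<Prod>i=1..m. Cs i * j n powr (- \<beta>))"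
          using Cs(1) by (intro prod_ennreal) (auto simp: less_imp_le)
        also have "(\<Prod>i=1..m. Cs i * j n powr (- \<beta>)) = (\<Prod>i=1..m. Cs i) * j n powr (- (real m * \<beta>))"
          using j[of n] by (simp add: prod.distrib powr_realpow[symmetric] powr_powr mult.commute)
        finally show ?thesis .
      qed
      have "(\<integral>\<^sup>+x\<in>bergman_ball U (z n) r. F x \<partial>\<mu>) \<le>
         (\<integral>\<^sup>+x. (ennreal ((\<Prod>i=1..m. Cs i) * j n powr (- (real m * \<beta>))) * (\<Prod>i=1..m. I (f i) i n)) * indicator (bergman_ball U (z n) r) x \<partial>\<mu>)"
        using Fx by (intro nn_integral_mono) (auto simp: indicator_def)
      also have "\<dots> = (ennreal ((\<Prod>i=1..m. Cs i) * j n powr (- (real m * \<beta>))) * (\<Prod>i=1..m. I (f i) i n)) * emeasure \<mu> (bergman_ball U (z n) r)"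
        by (rule nn_integral_cmult_indicator[OF ballM])
      also have "\<dots> \<le> (ennreal ((\<Prod>i=1..m. Cs i) * j n powr (- (real m * \<beta>))) * (\<Prod>i=1..m. I (f i) i n)) * ennreal (C0 * c * j n powr (2 * \<alpha>0))"
        by (rule mult_left_mono[OF mu_le]) simp
      also have "\<dots> = ennreal ((\<Prod>i=1..m. Cs i) * j n powr (- (real m * \<beta>)) * (C0 * c * j n powr (2 * \<alpha>0))) * (\<Prod>i=1..m. I (f i) i n)"
      proof -
        have "0 \<le> (\<Prod>i=1..m. Cs i) * j n powr (- (real m * \<beta>))" using Cs(1) by (intro mult_nonneg_nonneg prod_nonneg) (auto simp: less_imp_le)
        then show ?thesis unfolding ennreal_mult'[OF \<open>0 \<le> (\<Prod>i=1..m. Cs i) * j n powr (- (real m * \<beta>))\<close>] by (simp only: mult_ac)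
      qed
      also have "(\<Prod>i=1..m. Cs i) * j n powr (- (real m * \<beta>)) * (C0 * c * j n powr (2 * \<alpha>0)) = D * (j n powr (- (real m * \<beta>)) * j n powr (2 * \<alpha>0))"
        by (simp add: D_def mult_ac)
      also have "j n powr (- (real m * \<beta>)) * j n powr (2 * \<alpha>0) = j n powr 0"
        unfolding powr_add[symmetric] by (rule arg_cong) (simp add: \<beta>_def \<alpha>0_def algebra_simps)
      also have "\<dots> = 1" using j[of n] by simp
      finally show ?thesis by simp
    qed
    have "(\<integral>\<^sup>+x. F x \<partial>\<mu>) \<le> (\<Sum>n. \<integral>\<^sup>+x\<in>bergman_ball U (z n) r. F x \<partial>\<mu>)"
      by (rule nn_integral_cover_le[OF Fm ballM]) (use cover spaceM in auto)
    also have "\<dots> \<le> (\<Sum>n. ennreal D * (\<Prod>i=1..m. I (f i) i n))" by (intro suminf_le summableI loc)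
    also have "\<dots> = ennreal D * (\<Sum>n. \<Prod>i=1..m. I (f i) i n)" by (rule ennreal_suminf_cmult)
    also have "\<dots> \<le> ennreal D * (\<Prod>i=1..m. ennpowr (\<Sum>n. ennpowr (I (f i) i n) (q i)) (1 / q i))"
    proof (intro mult_left_mono holder_series_ennreal[OF _ _ q1])
      show "q i > 0" if "i \<in> {1..m}" for i using pq[rule_format, OF that] by simp
    qed auto
    finally show ?thesis by (simp add: F_def)
  qed
  then show ?thesis using D unfolding I_def by blast
qed

text \<open>The kernel function at \<open>\<psi> n y\<close> is bounded below on the piece
  \<open>E y n\<close> of the ball, and its global norm is controlled by the Forelli-Rudin estimate.
  The right side of the hypothesis reduces to global norms by \<open>ennpowr_suminf_le\<close> and
  the bounded overlap of the doubled balls.\<close>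

lemma carleson_necessary:
  fixes m :: nat and p q :: "nat \<Rightarrow> real" and z :: "nat \<Rightarrow> complex^'n"
  assumes samp: "bergman_sampling U r z" and mu: "sets \<mu> = sets (restrict_space borel U)"
    and pq: "\<forall>i\<in>{1..m}. 1 < p i \<and> 1 < q i"
    and C0: "C0 > 0" "\<And>f::nat \<Rightarrow> complex^'n \<Rightarrow> complex. (\<forall>i\<in>{1..m}. holo_on U (f i)) \<Longrightarrow>
        (\<integral>\<^sup>+ x. ennreal (\<Prod>i=1..m. norm (f i x) powr p i) \<partial>\<mu>)
          \<le> ennreal C0 * (\<Prod>i=1..m. ennpowr (\<Sum>n. ennpowr
                   (\<integral>\<^sup>+ x\<in>bergman_ball U (z n) (2 * r). ennreal (norm (f i x) powr p i) \<partial>weighted_vol U \<alpha>) (q i)) (1 / q i))"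
  shows "\<exists>C::real. C > 0 \<and> (\<forall>n. emeasure \<mu> (bergman_ball U (z n) r) \<le> ennreal (C * measure lborel (bergman_ball U (z n) r) powr (real m * (1 + \<alpha>))))"
proof -
  note r = bergman_samplingD(1)[OF samp] and zU = bergman_samplingD(2)[OF samp]
  obtain N :: nat where N: "\<And>x. x \<in> U \<Longrightarrow> finite {n. x \<in> bergman_ball U (z n) (2 * r)} \<and> card {n. x \<in> bergman_ball U (z n) (2 * r)} \<le> N"
    using bergman_samplingD(4)[OF samp] by blast
  obtain \<psi> where \<psi>: "\<And>n::nat. aut (\<psi> n)" "\<And>n. \<psi> n (z 0) = z n" by (rule sampling_automorphisms[OF samp]) blast
  note bh = biholomorphismD[OF \<psi>(1)]
  define j where "j = (\<lambda>n. norm (Jac (\<psi> n) (z 0)))"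
  have j: "j n > 0" for n using Jac_nonzero[OF \<psi>(1) open_U zU] by (simp add: j_def)
  obtain Q where Q: "compact Q" "Q \<subseteq> U" "bergman_ball U (z 0) r \<subseteq> Q" by (rule bergman_ball_relatively_compact[OF zU])
  obtain C where C: "C > 0" "\<And>\<phi> x. aut \<phi> \<Longrightarrow> x \<in> Q \<Longrightarrow> norm (Jac \<phi> (z 0)) \<le> C * norm (Jac \<phi> x) \<and> norm (Jac \<phi> x) \<le> C * norm (Jac \<phi> (z 0))"
    by (rule Jac_compare[OF zU Q(1,2)]) blast
  define \<alpha>0 where "\<alpha>0 = real m * (1 + \<alpha>)"
  have spaceM: "space \<mu> = U" using sets_eq_imp_space_eq[OF mu] by (simp add: space_restrict_space)
  \<comment> \<open>Integer powers of the kernel keep the test functions holomorphic; the exponents only have to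
    exceed the Forelli-Rudin threshold.\<close>
  have "\<exists>l::nat. l > 0 \<and> real l * p i - 1 > a" if "i \<in> {1..m}" for i
  proof -
    obtain l :: nat where l: "max (a + 1) 1 < real l" using reals_Archimedean2 by blast
    have "real l \<le> real l * p i" using pq[rule_format, OF that] by (simp add: mult_le_cancel_left1)
    moreover have "a + 1 < real l" "0 < real l" using l by auto
    ultimately have "l > 0 \<and> real l * p i - 1 > a" by linarith
    then show ?thesis by blast
  qed
  then obtain l :: "nat \<Rightarrow> nat" where l: "\<And>i. i \<in> {1..m} \<Longrightarrow> l i > 0" "\<And>i. i \<in> {1..m} \<Longrightarrow> real (l i) * p i - 1 > a" by metis
  define s where "s = (\<lambda>i. real (l i) * p i)"
  \<comment> \<open>The exponent \<open>\<alpha>' - \<alpha>\<close> of the Forelli-Rudin bound when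
    \<open>1 + \<alpha>' = s i\<close>.\<close>
  define e where "e = (\<lambda>i. s i - 1 - \<alpha>)"
  have s: "s i > 0" if "i \<in> {1..m}" for i using l(1)[OF that] pq[rule_format, OF that] by (simp add: s_def)
  have "\<exists>c. \<forall>z\<in>U. (\<integral>\<^sup>+ w. ennreal (norm (K z w) powr s i) \<partial>weighted_vol U \<alpha>) \<le> ennreal (c * k z powr e i)" if "i \<in> {1..m}" for i
    using FR[OF l(2)[OF that]] by (simp add: s_def e_def)
  then obtain c where c: "\<And>i z. i \<in> {1..m} \<Longrightarrow> z \<in> U \<Longrightarrow> (\<integral>\<^sup>+ w. ennreal (norm (K z w) powr s i) \<partial>weighted_vol U \<alpha>) \<le> ennreal (c i * k z powr e i)"
    by metis
  \<comment> \<open>A lower bound for the kernel is available only near the diagonal, so a single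
    test point would not serve the whole ball.\<close>
  have "\<exists>\<eta>>0. \<forall>x\<in>ball y \<eta>. norm (K x y) \<ge> k y / 2" if y: "y \<in> U" for y
  proof -
    have "continuous_on U (\<lambda>x. norm (K x y))" by (intro continuous_on_norm holo_on_continuous[OF A2_holo[OF kernel_A2[OF y]]])
    from continuous_open_preimage[OF this open_U open_greaterThan, of "k y / 2"]
    have "open (U \<inter> (\<lambda>x. norm (K x y)) -` {k y / 2<..})" .
    moreover have "y \<in> U \<inter> (\<lambda>x. norm (K x y)) -` {k y / 2<..}" using y kernel_diag_pos[OF y] by (simp add: kernel_diag)
    ultimately obtain \<eta> where "\<eta> > 0" "ball y \<eta> \<subseteq> U \<inter> (\<lambda>x. norm (K x y)) -` {k y / 2<..}" using open_contains_ball by blast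
    then show ?thesis by (intro exI[of _ \<eta>]) (auto simp: less_imp_le subset_iff)
  qed
  then obtain \<eta> where \<eta>: "\<And>y. y \<in> U \<Longrightarrow> \<eta> y > 0" "\<And>x y. y \<in> U \<Longrightarrow> x \<in> ball y (\<eta> y) \<Longrightarrow> norm (K x y) \<ge> k y / 2" by metis
  have "Q \<subseteq> (\<Union>y\<in>Q. ball y (\<eta> y))" using \<eta>(1) Q(2) by force
  then obtain Y where Y: "Y \<subseteq> Q" "finite Y" "Q \<subseteq> (\<Union>y\<in>Y. ball y (\<eta> y))"
    using compactE_image[OF Q(1), of Q "\<lambda>y. ball y (\<eta> y)"] by (metis open_ball)
  \<comment> \<open>The image under \<open>\<psi> n\<close> of the part of the fixed ball near
    \<open>y\<close>.\<close>
  define E where "E = (\<lambda>y n. {w\<in>U. inv_into U (\<psi> n) w \<in> ball y (\<eta> y)} \<inter> bergman_ball U (z n) r)"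
  have EM: "E y n \<in> sets \<mu>" for y n
  proof -
    have "{w\<in>U. inv_into U (\<psi> n) w \<in> ball y (\<eta> y)} \<in> sets borel"
      by (rule borel_vimage_open[OF holo_map_on_continuous[OF bh(2)] open_U]) simp
    then have "E y n \<in> sets borel" unfolding E_def using bergman_ball_borel[OF zU] by (intro sets.Int) auto
    then show ?thesis unfolding mu by (auto simp: sets_restrict_space_iff E_def)
  qed
  have main: "\<exists>D\<ge>0. \<forall>n. emeasure \<mu> (E y n) \<le> ennreal (D * j n powr (2 * \<alpha>0))" if y: "y \<in> Q" for y
  proof -
    have yU: "y \<in> U" using y Q by blast
    \<comment> \<open>The lower bound \<open>k y / 2\<close> divided by \<open>C^2\<close>, to pay
      for the two Jacobian factors in the transformation of the kernel.\<close>
    define \<kappa> where "\<kappa> = k y / 2 / C^2"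
    have \<kappa>: "\<kappa> > 0" using kernel_diag_pos[OF yU] C(1) by (simp add: \<kappa>_def)
    \<comment> \<open>Collects the overlap number, the Forelli-Rudin constant and the comparison of
      Jacobians. Division by \<open>\<kappa> powr s i\<close> anticipates that a factor
      \<open>lo i\<close> will be split off.\<close>
    define Di where "Di = (\<lambda>i. real N * \<bar>c i\<bar> * k y powr e i * C powr \<bar>- 2 * e i\<bar> / \<kappa> powr s i)"
    have Di: "Di i \<ge> 0" for i by (simp add: Di_def)
    define D where "D = C0 * (\<Prod>i=1..m. Di i)"
    have D: "D \<ge> 0" unfolding D_def using C0(1) Di by (intro mult_nonneg_nonneg prod_nonneg) auto
    have "emeasure \<mu> (E y n) \<le> ennreal (D * j n powr (2 * \<alpha>0))" for n
    proof -
      define y' where "y' = \<psi> n y"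
      have y'U: "y' \<in> U" using bh(5)[OF yU] by (simp add: y'_def)
      define f where "f = (\<lambda>i w. K w y' ^ l i)"
      have fh: "holo_on U (f i)" for i unfolding f_def by (rule holo_on_power[OF A2_holo[OF kernel_A2[OF y'U]]])
      have fp: "norm (f i w) powr p i = norm (K y' w) powr s i" if "i \<in> {1..m}" for i w
        unfolding f_def norm_power_powr[OF l(1)[OF that]] s_def by (simp add: norm_kernel_sym[of w y'])
      have Jy: "norm (Jac (\<psi> n) y) > 0" using Jac_nonzero[OF \<psi>(1) open_U yU] by simp
      have Jyj: "norm (Jac (\<psi> n) y) \<le> C * j n" "j n \<le> C * norm (Jac (\<psi> n) y)" using C(2)[OF \<psi>(1) y] by (auto simp: j_def)
      define lo where "lo = (\<lambda>i. \<kappa> powr s i * j n powr (- 2 * s i))"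
      have lo: "lo i > 0" for i using \<kappa> j[of n] by (simp add: lo_def)
      have low: "lo i \<le> norm (K y' w) powr s i" if i: "i \<in> {1..m}" and w: "w \<in> E y n" for i w
      proof -
        define x where "x = inv_into U (\<psi> n) w"
        have wU: "w \<in> U" and xb: "x \<in> ball y (\<eta> y)" and wb: "w \<in> bergman_ball U (\<psi> n (z 0)) r" using w by (auto simp: E_def x_def \<psi>(2))
        have xU: "x \<in> U" "\<psi> n x = w" using bh(6,8)[OF wU] by (auto simp: x_def)
        have "x \<in> {x\<in>U. \<psi> n x \<in> bergman_ball U (\<psi> n (z 0)) r}" using xU wb by simp
        then have xQ: "x \<in> Q" using aut_bergman_ball[OF \<psi>(1)[of n] zU[of 0]] Q(3) by blast
        have Jx: "norm (Jac (\<psi> n) x) > 0" using Jac_nonzero[OF \<psi>(1) open_U xU(1)] by simp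
        have Jxj: "norm (Jac (\<psi> n) x) \<le> C * j n" using C(2)[OF \<psi>(1) xQ] by (auto simp: j_def)
        have "k y / 2 \<le> norm (K x y)" by (rule \<eta>(2)[OF yU xb])
        also have "\<dots> = norm (K w y') * (norm (Jac (\<psi> n) x) * norm (Jac (\<psi> n) y))"
          using norm_kernel_transform[OF \<psi>(1) xU(1) yU, of n] xU(2) by (simp add: y'_def)
        also have "\<dots> \<le> norm (K w y') * ((C * j n) * (C * j n))"
          using Jx Jxj Jyj(1) C(1) j[of n] by (intro mult_left_mono mult_mono) auto
        finally have "\<kappa> * j n powr (- 2) \<le> norm (K w y')"
          using C(1) j[of n] by (simp add: \<kappa>_def powr_minus powr_numeral field_simps power2_eq_square)
        then have "(\<kappa> * j n powr (- 2)) powr s i \<le> norm (K y' w) powr s i"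
          using \<kappa> s[OF i] by (intro powr_mono2) (auto simp: norm_kernel_sym[of w y'])
        then show ?thesis using \<kappa> by (simp add: lo_def powr_mult powr_powr)
      qed
      have "ennreal (\<Prod>i=1..m. lo i) * emeasure \<mu> (E y n) = (\<integral>\<^sup>+x. ennreal (\<Prod>i=1..m. lo i) * indicator (E y n) x \<partial>\<mu>)"
        by (rule nn_integral_cmult_indicator[OF EM, symmetric])
      also have "\<dots> \<le> (\<integral>\<^sup>+ x. ennreal (\<Prod>i=1..m. norm (f i x) powr p i) \<partial>\<mu>)"
      proof (rule nn_integral_mono)
        fix x
        show "ennreal (\<Prod>i=1..m. lo i) * indicator (E y n) x \<le> ennreal (\<Prod>i=1..m. norm (f i x) powr p i)"
        proof (cases "x \<in> E y n")
          case True
          have "(\<Prod>i=1..m. lo i) \<le> (\<Prod>i=1..m. norm (f i x) powr p i)"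
            using low[OF _ True] lo fp by (intro prod_mono) (auto simp: less_imp_le)
          then show ?thesis using True by (simp add: ennreal_leI)
        qed simp
      qed
      also have "\<dots> \<le> ennreal C0 * (\<Prod>i=1..m. ennpowr (\<Sum>n. ennpowr
                   (\<integral>\<^sup>+ x\<in>bergman_ball U (z n) (2 * r). ennreal (norm (f i x) powr p i) \<partial>weighted_vol U \<alpha>) (q i)) (1 / q i))"
        by (rule C0(2)) (use fh in blast)
      also have "\<dots> \<le> ennreal C0 * (\<Prod>i=1..m. ennreal (Di i * j n powr (2 + 2 * \<alpha>) * lo i))"
      proof (intro mult_left_mono prod_mono_ennreal)
        fix i assume i: "i \<in> {1..m}"
        have cf: "continuous_on U (\<lambda>x. norm (f i x) powr p i)" using pq[rule_format, OF i] by (intro continuous_holo_powr fh) simp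
        have "ennpowr (\<Sum>n. ennpowr (\<integral>\<^sup>+ x\<in>bergman_ball U (z n) (2 * r). ennreal (norm (f i x) powr p i) \<partial>weighted_vol U \<alpha>) (q i)) (1 / q i)
          \<le> (\<Sum>n. \<integral>\<^sup>+ x\<in>bergman_ball U (z n) (2 * r). ennreal (norm (f i x) powr p i) \<partial>weighted_vol U \<alpha>)"
          using pq[rule_format, OF i] by (intro ennpowr_suminf_le) simp
        also have "\<dots> \<le> of_nat N * (\<integral>\<^sup>+ x. ennreal (norm (f i x) powr p i) \<partial>weighted_vol U \<alpha>)"
        proof (rule nn_integral_overlap_le)
          have "(\<lambda>x. ennreal (norm (f i x) powr p i)) \<in> borel_measurable (restrict_space lborel U)"
            using measurable_restrict_U[OF cf] by measurable
          then show "(\<lambda>x. ennreal (norm (f i x) powr p i)) \<in> borel_measurable (weighted_vol U \<alpha>)"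
            by (simp add: weighted_vol_def cong: measurable_cong_sets)
          show "bergman_ball U (z n) (2 * r) \<in> sets (weighted_vol U \<alpha>)" for n
            using bergman_ball_borel[OF zU] bergman_ball_subset by (auto simp: weighted_vol_def sets_restrict_space_iff)
        qed (use N in \<open>simp add: space_weighted_vol\<close>)
        also have "\<dots> = of_nat N * (\<integral>\<^sup>+ x. ennreal (norm (K y' x) powr s i) \<partial>weighted_vol U \<alpha>)" by (simp add: fp[OF i])
        also have "\<dots> \<le> of_nat N * ennreal (c i * k y' powr e i)" by (intro mult_left_mono c[OF i y'U]) simp
        also have "\<dots> \<le> of_nat N * ennreal (\<bar>c i\<bar> * (k y powr e i * (C powr \<bar>- 2 * e i\<bar> * j n powr (- 2 * e i))))"
        proof (intro mult_left_mono ennreal_leI)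
          have ky: "k y' > 0" by (rule kernel_diag_pos[OF y'U])
          define J where "J = norm (Jac (\<psi> n) y)"
          have J: "J > 0" using Jy by (simp add: J_def)
          have "k y' = k y * J powr (- 2)"
            using kernel_diag_transform[OF \<psi>(1) yU, of n] J by (simp add: y'_def J_def powr_minus powr_numeral field_simps)
          then have "k y' powr e i = k y powr e i * J powr (- 2 * e i)"
            by (simp add: powr_mult powr_powr)
          also have "\<dots> \<le> k y powr e i * (C powr \<bar>- 2 * e i\<bar> * j n powr (- 2 * e i))"
            by (intro mult_left_mono powr_compare[OF J j[of n] C(1)]) (use Jyj in \<open>auto simp: J_def\<close>)
          finally have "\<bar>c i\<bar> * k y' powr e i \<le> \<bar>c i\<bar> * (k y powr e i * (C powr \<bar>- 2 * e i\<bar> * j n powr (- 2 * e i)))"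
            by (rule mult_left_mono) simp
          moreover have "c i * k y' powr e i \<le> \<bar>c i\<bar> * k y' powr e i" by (intro mult_right_mono) auto
          ultimately show "c i * k y' powr e i \<le> \<bar>c i\<bar> * (k y powr e i * (C powr \<bar>- 2 * e i\<bar> * j n powr (- 2 * e i)))" by linarith
        qed simp
        also have "\<dots> = ennreal (real N * (\<bar>c i\<bar> * (k y powr e i * (C powr \<bar>- 2 * e i\<bar> * j n powr (- 2 * e i)))))"
          by (simp add: ennreal_mult' ennreal_of_nat_eq_real_of_nat)
        also have "real N * (\<bar>c i\<bar> * (k y powr e i * (C powr \<bar>- 2 * e i\<bar> * j n powr (- 2 * e i)))) = Di i * \<kappa> powr s i * j n powr (- 2 * e i)"
          using \<kappa> by (simp add: Di_def)
        \<comment> \<open>Because \<open>- 2 * e i = 2 + 2 * \<alpha> - 2 * s i\<close>, the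
          dependence of this power on \<open>s i\<close> goes into \<open>lo i\<close>, which
          cancels against the lower bound. The remaining power of \<open>j n\<close> does not depend
          on the test functions.\<close>
        also have "j n powr (- 2 * e i) = j n powr (2 + 2 * \<alpha>) * j n powr (- 2 * s i)"
          unfolding powr_add[symmetric] by (rule arg_cong) (simp add: e_def)
        also have "Di i * \<kappa> powr s i * (j n powr (2 + 2 * \<alpha>) * j n powr (- 2 * s i)) = Di i * j n powr (2 + 2 * \<alpha>) * lo i"
          by (simp add: lo_def)
        finally show "ennpowr (\<Sum>n. ennpowr (\<integral>\<^sup>+ x\<in>bergman_ball U (z n) (2 * r). ennreal (norm (f i x) powr p i) \<partial>weighted_vol U \<alpha>) (q i)) (1 / q i)
          \<le> ennreal (Di i * j n powr (2 + 2 * \<alpha>) * lo i)" .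
      qed simp
      also have "(\<Prod>i=1..m. ennreal (Di i * j n powr (2 + 2 * \<alpha>) * lo i)) = ennreal (\<Prod>i=1..m. Di i * j n powr (2 + 2 * \<alpha>) * lo i)"
        using Di lo by (intro prod_ennreal) (auto simp: less_imp_le)
      also have "(\<Prod>i=1..m. Di i * j n powr (2 + 2 * \<alpha>) * lo i) = (\<Prod>i=1..m. Di i) * j n powr (2 * \<alpha>0) * (\<Prod>i=1..m. lo i)"
      proof -
        have "(j n powr (2 + 2 * \<alpha>)) ^ m = j n powr (2 * \<alpha>0)"
          using j[of n] by (simp add: powr_realpow[symmetric] powr_powr \<alpha>0_def algebra_simps)
        then show ?thesis by (simp add: prod.distrib)
      qed
      also have "ennreal C0 * ennreal ((\<Prod>i=1..m. Di i) * j n powr (2 * \<alpha>0) * (\<Prod>i=1..m. lo i)) = ennreal (D * j n powr (2 * \<alpha>0) * (\<Prod>i=1..m. lo i))"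
        using C0(1) by (simp add: ennreal_mult'[symmetric] D_def mult.assoc)
      finally show ?thesis by (rule ennreal_le_divide[rotated]) (use lo D in \<open>auto intro!: prod_pos\<close>)
    qed
    with D show ?thesis by blast
  qed
  then obtain D where D: "\<And>y. y \<in> Q \<Longrightarrow> D y \<ge> 0" "\<And>y n. y \<in> Q \<Longrightarrow> emeasure \<mu> (E y n) \<le> ennreal (D y * j n powr (2 * \<alpha>0))" by metis
  obtain cv where cv: "cv > 0" "\<And>\<phi>. aut \<phi> \<Longrightarrow> measure lborel (bergman_ball U (\<phi> (z 0)) r) powr \<alpha>0 \<le> cv * norm (Jac \<phi> (z 0)) powr (2 * \<alpha>0)
     \<and> norm (Jac \<phi> (z 0)) powr (2 * \<alpha>0) \<le> cv * measure lborel (bergman_ball U (\<phi> (z 0)) r) powr \<alpha>0"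
    by (rule volume_powr_compare[OF zU[of 0] r, of \<alpha>0]) blast
  define F where "F = (\<Sum>y\<in>Y. D y) + 1"
  have DY: "D y \<ge> 0" if "y \<in> Y" for y using D(1) Y that by auto
  have F: "F > 0" unfolding F_def by (intro add_nonneg_pos sum_nonneg DY) auto
  have "emeasure \<mu> (bergman_ball U (z n) r) \<le> ennreal (F * cv * measure lborel (bergman_ball U (z n) r) powr \<alpha>0)" for n
  proof -
    have sub: "bergman_ball U (z n) r \<subseteq> (\<Union>y\<in>Y. E y n)"
    proof
      fix w assume w: "w \<in> bergman_ball U (z n) r"
      then have wU: "w \<in> U" using bergman_ball_subset by blast
      have "inv_into U (\<psi> n) w \<in> {x\<in>U. \<psi> n x \<in> bergman_ball U (\<psi> n (z 0)) r}"
        using bh(6,8)[OF wU] w by (simp add: \<psi>(2))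
      then have "inv_into U (\<psi> n) w \<in> Q" using aut_bergman_ball[OF \<psi>(1)[of n] zU[of 0]] Q(3) by blast
      then obtain y where "y \<in> Y" "inv_into U (\<psi> n) w \<in> ball y (\<eta> y)" using Y(3) by blast
      then show "w \<in> (\<Union>y\<in>Y. E y n)" using w wU by (auto simp: E_def)
    qed
    have "emeasure \<mu> (bergman_ball U (z n) r) \<le> emeasure \<mu> (\<Union>y\<in>Y. E y n)"
      using Y(2) EM by (intro emeasure_mono[OF sub]) auto
    also have "\<dots> \<le> (\<Sum>y\<in>Y. emeasure \<mu> (E y n))" by (rule emeasure_subadditive_finite) (use Y EM in auto)
    also have "\<dots> \<le> (\<Sum>y\<in>Y. ennreal (D y * j n powr (2 * \<alpha>0)))" by (intro sum_mono D(2)) (use Y in auto)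
    also have "\<dots> = ennreal ((\<Sum>y\<in>Y. D y) * j n powr (2 * \<alpha>0))"
      unfolding sum_distrib_right by (intro sum_ennreal mult_nonneg_nonneg DY) auto
    also have "\<dots> \<le> ennreal (F * (cv * measure lborel (bergman_ball U (z n) r) powr \<alpha>0))"
    proof (intro ennreal_leI mult_mono)
      show "j n powr (2 * \<alpha>0) \<le> cv * measure lborel (bergman_ball U (z n) r) powr \<alpha>0" using cv(2)[OF \<psi>(1)[of n]] by (simp add: \<psi>(2) j_def)
    qed (use F in \<open>auto simp: F_def\<close>)
    finally show ?thesis by (simp add: mult.assoc)
  qed
  then show ?thesis using F cv(1) by (intro exI[of _ "F * cv"]) (simp add: \<alpha>0_def)
qed

end

theorem theorem3:
  fixes U :: "(complex^'n) set" and t :: "complex^'n"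
    and m :: nat and \<alpha> :: real and p q :: "nat \<Rightarrow> real"
  assumes "minimal_domain_center U t"
    and "homogeneous_domain U"
    and "forelli_rudin U"
    and "m \<ge> 1"
    and "\<alpha> > alpha_min U"
    and "\<forall>i\<in>{1..m}. 1 < p i \<and> 1 < q i"
    and "(\<Sum>i=1..m. 1 / q i) = 1"
  shows "\<exists>\<alpha>\<^sub>0::real. \<forall>r>0. \<forall>z::nat \<Rightarrow> complex^'n. \<forall>\<mu>::(complex^'n) measure.
    bergman_sampling U r z \<longrightarrow> sets \<mu> = sets (restrict_space borel U) \<longrightarrow>
    ((\<exists>C::real. C > 0 \<and> (\<forall>f::nat \<Rightarrow> complex^'n \<Rightarrow> complex. (\<forall>i\<in>{1..m}. holo_on U (f i)) \<longrightarrow>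
        (\<integral>\<^sup>+ x. ennreal (\<Prod>i=1..m. norm (f i x) powr p i) \<partial>\<mu>)
          \<le> ennreal C *
             (\<Prod>i=1..m. ennpowr
                (\<Sum>k. ennpowr
                   (\<integral>\<^sup>+ x\<in>bergman_ball U (z k) (2 * r). ennreal (norm (f i x) powr p i)
                      \<partial>weighted_vol U \<alpha>)
                   (q i))
                (1 / q i))))
     \<longleftrightarrow>
     (\<exists>C::real. C > 0 \<and> (\<forall>k. emeasure \<mu> (bergman_ball U (z k) r)
        \<le> ennreal (C * measure lborel (bergman_ball U (z k) r) powr \<alpha>\<^sub>0))))"
proof -
  \<comment> \<open>The hypothesis \<open>\<alpha> > alpha_min U\<close> admits (FR) with
    \<open>\<beta> = \<alpha>\<close>.\<close>
  obtain a where a: "\<forall>\<alpha>'>a. \<exists>c::real. \<forall>z\<in>U.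
        (\<integral>\<^sup>+ w. ennreal (norm (bergman_kernel U z w) powr (1 + \<alpha>')) \<partial>weighted_vol U \<alpha>)
          \<le> ennreal (c * bergman_diag U z powr (\<alpha>' - \<alpha>))"
    using assms(3,5) unfolding forelli_rudin_def by blast
  interpret forelli_rudin_domain U \<alpha> a
    using assms(1,2) a by unfold_locales (auto simp: minimal_domain_center_def cdomain_def)
  show ?thesis
  \<comment> \<open>The witness is fixed before \<open>r\<close>, the sequence and the measure, and
    involves only \<open>m\<close> and \<alpha>.\<close>
  proof (rule exI[of _ "real m * (1 + \<alpha>)"], intro allI impI iffI, goal_cases)
    case (1 r z \<mu>)
    from 1(4) obtain C where C: "C > 0 \<and> (\<forall>f::nat \<Rightarrow> complex^'n \<Rightarrow> complex. (\<forall>i\<in>{1..m}. holo_on U (f i)) \<longrightarrow>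
        (\<integral>\<^sup>+ x. ennreal (\<Prod>i=1..m. norm (f i x) powr p i) \<partial>\<mu>)
          \<le> ennreal C * (\<Prod>i=1..m. ennpowr (\<Sum>k. ennpowr
             (\<integral>\<^sup>+ x\<in>bergman_ball U (z k) (2 * r). ennreal (norm (f i x) powr p i) \<partial>weighted_vol U \<alpha>)
             (q i)) (1 / q i)))" ..
    show ?case
      by (rule carleson_necessary[OF 1(2,3) assms(6) conjunct1[OF C] mp[OF spec[OF conjunct2[OF C]]]])
  next
    case (2 r z \<mu>)
    from 2(4) obtain C where C: "C > 0 \<and> (\<forall>k. emeasure \<mu> (bergman_ball U (z k) r)
        \<le> ennreal (C * measure lborel (bergman_ball U (z k) r) powr (real m * (1 + \<alpha>))))" ..
    show ?case
      by (rule carleson_sufficient[OF 2(2,3) assms(6,7) conjunct1[OF C] spec[OF conjunct2[OF C]]])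
  qed
qed

end
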